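(* Let $G\curvearrowright X$ and $H\curvearrowright Y$ be topologically free continuous actions of countable sofic groups on compact metrizable spaces, and suppose that they are continuously orbit equivalent. If $G$ contains a w-normal amenable subgroup which is neither locally finite nor virtually cyclic, then $$h(H\curvearrowright Y)\ge h(G\curvearrowright X),$$ while if $G$ is a product of two countably infinite groups at least one of which is not locally finite, then $$h(H\curvearrowright Y)\ge \underline{h}(G\curvearrowright X).$$ Here $h$ denotes maximum sofic topological entropy and $\underline{h}$ infimum sofic topological entropy.
   Context: All groups are countable and discrete. A group is locally finite if each of its finitely generated subgroups is finite, and virtually cyclic if it has a cyclic subgroup of finite index. w-normality. A subgroup $G_0$ of $G$ is w-normal in $G$ if there are a countable ordinal $\gamma$ and subgroups $G_\lambda$ of $G$ for ordinals $0\le\lambda\le\gamma$ (the subgroup at $\lambda=0$ being $G_0$) such that $G_\lambda\subseteq G_{\lambda'}$ for $\lambda<\lambda'\le\gamma$; $G=G_\gamma$; $G_\lambda$ is normal in $G_{\lambda+1}$ for each $\lambda<\gamma$; and $G_{\lambda'}=\bigcup_{\lambda<\lambda'}G_\lambda$ for each limit ordinal $\lambda'\le\gamma$. A continuous action $G\curvearrowright X$ on a compact metrizable space is topologically free if the set of $x\in X$ with $sx\ne x$ for all $s\in G\setminus\{e_G\}$ is dense. Continuous actions $G\curvearrowright X$ and $H\curvearrowright Y$ on compact metrizable spaces are continuously orbit equivalent if there are a homeomorphism $\Phi:X\to Y$ and continuous maps $\kappa:G\times X\to H$ and $\lambda:H\times Y\to G$ with $\Phi(gx)=\kappa(g,x)\Phi(x)$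 and $\Phi^{-1}(ty)=\lambda(t,y)\Phi^{-1}(y)$ for all $g\in G,x\in X,t\in H,y\in Y$. Sofic approximations. For a nonempty finite set $V$, $\mathrm{Sym}(V)$ is its permutation group and $\rho_{\mathrm{Hamm}}(T,S)=|\{v\in V:Tv\ne Sv\}|/|V|$ for $T,S\in V^V$. A sofic approximation for $G$ is a (not necessarily multiplicative) map $\sigma:G\to\mathrm{Sym}(V)$ for some nonempty finite set $V$. It is an $(F,\delta)$-approximation ($F\subseteq G$ finite, $\delta>0$) if $\rho_{\mathrm{Hamm}}(\sigma_{st},\sigma_s\sigma_t)\le\delta$ for all $s,t\in F$ and $\rho_{\mathrm{Hamm}}(\sigma_s,\sigma_t)\ge 1-\delta$ for all distinct $s,t\in F$. A sofic approximation sequence for $G$ is a sequence $\Sigma=\{\sigma_k:G\to\mathrm{Sym}(V_k)\}_{k=1}^\infty$ such that for every finite $F\subseteq G$ and $\delta>0$, $\sigma_k$ is an $(F,\delta)$-approximation for all sufficiently large $k$. $G$ is sofic if it admits a sofic approximation sequence. Sofic topological entropy. Let $d$ be a compatible metric on $X$. For maps $\varphi,\psi:V\to X$ set $d_2(\varphi,\psi)=\big(\frac1{|V|}\sum_{v\in V}d(\varphi(v),\psi(v))^2\big)^{1/2}$ and $d_\infty(\varphi,\psi)=\max_{v\in V}d(\varphi(v),\psi(v))$. For finite $F\subseteq G$, $\delta>0$ and a sofic approximation $\sigma:G\to\mathrm{Sym}(V)$, $\mathrm{Map}_d(F,\delta,\sigma)$ is the set of all maps $\varphi:V\to X$ with $d_2(\varphi\sigma_g,g\varphi)\le\delta$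 for all $g\in F$. $N_\varepsilon(\Omega,\rho)$ is the maximum cardinality of a subset $\Omega_0$ of $\Omega$ with $\rho(\omega_1,\omega_2)\ge\varepsilon$ for all distinct $\omega_1,\omega_2\in\Omega_0$. Then $$h_\Sigma(G\curvearrowright X)=\sup_{\varepsilon>0}\inf_F\inf_{\delta>0}\limsup_{k\to\infty}\frac1{|V_k|}\log N_\varepsilon(\mathrm{Map}_d(F,\delta,\sigma_k),d_\infty),$$ with $F$ ranging over finite subsets of $G$ and $\log 0=-\infty$; this does not depend on $d$. The maximum and infimum sofic topological entropies are $h(G\curvearrowright X)=\max_\Sigma h_\Sigma(G\curvearrowright X)$ (the maximum exists) and $\underline{h}(G\curvearrowright X)=\inf_\Sigma h_\Sigma(G\curvearrowright X)$, over all sofic approximation sequences $\Sigma$ for $G$. *)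

theory Defs
  imports
    "HOL-Analysis.Analysis"
    "HOL-Algebra.Elementary_Groups"
    "HOL-Algebra.Group_Action"
    "HOL-Combinatorics.Permutations"
begin

section \<open>Groups\<close>

definition locally_finite_group :: "('a, 'm) monoid_scheme \<Rightarrow> bool" where
  "locally_finite_group G \<longleftrightarrow>
     (\<forall>F. finite F \<and> F \<subseteq> carrier G \<longrightarrow> finite (generate G F))"

definition virtually_cyclic_group :: "('a, 'm) monoid_scheme \<Rightarrow> bool" where
  "virtually_cyclic_group G \<longleftrightarrow>
     (\<exists>C. subgroup C G \<and> cyclic_group (G\<lparr>carrier := C\<rparr>) \<and> finite (rcosets\<^bsub>G\<^esub> C))"

text \<open>Real-valued functions on the group are represented by functions on the whole type that
  are bounded on the carrier. Positivity refers to the carrier only, so by linearity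
  \<open>m f\<close> depends only on the restriction of \<open>f\<close> to the carrier.\<close>

definition invariant_mean :: "('a, 'm) monoid_scheme \<Rightarrow> (('a \<Rightarrow> real) \<Rightarrow> real) \<Rightarrow> bool" where
  "invariant_mean G m \<longleftrightarrow>
     m (\<lambda>x. 1) = 1 \<and>
     (\<forall>f. bounded (f ` carrier G) \<and> (\<forall>x\<in>carrier G. 0 \<le> f x) \<longrightarrow> 0 \<le> m f) \<and>
     (\<forall>f g a b. bounded (f ` carrier G) \<and> bounded (g ` carrier G) \<longrightarrow>
        m (\<lambda>x. a * f x + b * g x) = a * m f + b * m g) \<and>
     (\<forall>f. \<forall>s\<in>carrier G. bounded (f ` carrier G) \<longrightarrow> m (\<lambda>x. f (s \<otimes>\<^bsub>G\<^esub> x)) = m f)"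

definition amenable_group :: "('a, 'm) monoid_scheme \<Rightarrow> bool" where
  "amenable_group G \<longleftrightarrow> (\<exists>m. invariant_mean G m)"

text \<open>The countable ordinals \<open>\<lambda>\<close> with \<open>0 \<le> \<lambda> \<le> \<gamma>\<close> are encoded by a well-order \<open>r\<close> on a set of
  natural numbers with least element \<open>z\<close> and greatest element \<open>c\<close> (so \<open>c\<close> plays the role of
  \<open>\<gamma>\<close>); these are, up to isomorphism, exactly the intervals \<open>[0, \<gamma>]\<close> with \<open>\<gamma>\<close> a countable
  ordinal. \<open>wo_rel.suc r {a}\<close> is the immediate successor of \<open>a\<close>.\<close>

definition w_normal :: "'a set \<Rightarrow> ('a, 'm) monoid_scheme \<Rightarrow> bool" where
  "w_normal N G \<longleftrightarrow>
     (\<exists>(r :: nat rel) z c (S :: nat \<Rightarrow> 'a set).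
        Well_order r \<and> z \<in> Field r \<and> c \<in> Field r \<and>
        (\<forall>a\<in>Field r. (z, a) \<in> r \<and> (a, c) \<in> r) \<and>
        (\<forall>a\<in>Field r. subgroup (S a) G) \<and>
        S z = N \<and> S c = carrier G \<and>
        (\<forall>a b. (a, b) \<in> r \<longrightarrow> S a \<subseteq> S b) \<and>
        (\<forall>a\<in>Field r - {c}. S a \<lhd> G\<lparr>carrier := S (wo_rel.suc r {a})\<rparr>) \<and>
        (\<forall>a\<in>Field r - {z}. (\<forall>b\<in>Field r - {c}. a \<noteq> wo_rel.suc r {b}) \<longrightarrow>
           S a = (\<Union>b\<in>underS r a. S b)))"

section \<open>Continuous actions\<close>

definition continuous_action ::
  "('a, 'm) monoid_scheme \<Rightarrow> 'x topology \<Rightarrow> ('a \<Rightarrow> 'x \<Rightarrow> 'x) \<Rightarrow> bool" where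
  "continuous_action G X \<alpha> \<longleftrightarrow>
     group_action G (topspace X) \<alpha> \<and> (\<forall>g\<in>carrier G. continuous_map X X (\<alpha> g))"

definition topologically_free ::
  "('a, 'm) monoid_scheme \<Rightarrow> 'x topology \<Rightarrow> ('a \<Rightarrow> 'x \<Rightarrow> 'x) \<Rightarrow> bool" where
  "topologically_free G X \<alpha> \<longleftrightarrow>
     X closure_of {x \<in> topspace X. \<forall>s\<in>carrier G - {\<one>\<^bsub>G\<^esub>}. \<alpha> s x \<noteq> x} = topspace X"

definition continuously_orbit_equivalent ::
  "('a, 'm) monoid_scheme \<Rightarrow> 'x topology \<Rightarrow> ('a \<Rightarrow> 'x \<Rightarrow> 'x) \<Rightarrow>
   ('b, 'n) monoid_scheme \<Rightarrow> 'y topology \<Rightarrow> ('b \<Rightarrow> 'y \<Rightarrow> 'y) \<Rightarrow> bool" where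
  "continuously_orbit_equivalent G X \<alpha> H Y \<beta> \<longleftrightarrow>
     (\<exists>\<Phi> \<Psi> \<kappa> l. homeomorphic_maps X Y \<Phi> \<Psi> \<and>
        continuous_map (prod_topology (discrete_topology (carrier G)) X)
          (discrete_topology (carrier H)) \<kappa> \<and>
        continuous_map (prod_topology (discrete_topology (carrier H)) Y)
          (discrete_topology (carrier G)) l \<and>
        (\<forall>g\<in>carrier G. \<forall>x\<in>topspace X. \<Phi> (\<alpha> g x) = \<beta> (\<kappa> (g, x)) (\<Phi> x)) \<and>
        (\<forall>t\<in>carrier H. \<forall>y\<in>topspace Y. \<Psi> (\<beta> t y) = \<alpha> (l (t, y)) (\<Psi> y)))"

definition compatible_metric :: "'x topology \<Rightarrow> ('x \<Rightarrow> 'x \<Rightarrow> real) \<Rightarrow> bool" where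
  "compatible_metric X d \<longleftrightarrow>
     Metric_space (topspace X) d \<and> Metric_space.mtopology (topspace X) d = X"

section \<open>Sofic approximations\<close>

definition hamming_dist :: "'v set \<Rightarrow> ('v \<Rightarrow> 'v) \<Rightarrow> ('v \<Rightarrow> 'v) \<Rightarrow> real" where
  "hamming_dist V T S = real (card {v \<in> V. T v \<noteq> S v}) / real (card V)"

definition sofic_approximation ::
  "('a, 'm) monoid_scheme \<Rightarrow> 'v set \<Rightarrow> ('a \<Rightarrow> 'v \<Rightarrow> 'v) \<Rightarrow> bool" where
  "sofic_approximation G V \<sigma> \<longleftrightarrow>
     finite V \<and> V \<noteq> {} \<and> (\<forall>s\<in>carrier G. \<sigma> s permutes V)"

definition good_approximation ::
  "('a, 'm) monoid_scheme \<Rightarrow> 'a set \<Rightarrow> real \<Rightarrow> 'v set \<Rightarrow> ('a \<Rightarrow> 'v \<Rightarrow> 'v) \<Rightarrow> bool" where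
  "good_approximation G F \<delta> V \<sigma> \<longleftrightarrow>
     (\<forall>s\<in>F. \<forall>t\<in>F. hamming_dist V (\<sigma> (s \<otimes>\<^bsub>G\<^esub> t)) (\<sigma> s \<circ> \<sigma> t) \<le> \<delta>) \<and>
     (\<forall>s\<in>F. \<forall>t\<in>F. s \<noteq> t \<longrightarrow> hamming_dist V (\<sigma> s) (\<sigma> t) \<ge> 1 - \<delta>)"

text \<open>The finite sets \<open>V\<^sub>k\<close> are taken to be sets of natural numbers, so that all sofic
  approximation sequences of a group live in one type; every finite set is in bijection with
  such a set, and all notions below are invariant under bijections.\<close>

type_synonym 'a sofic_seq = "nat \<Rightarrow> nat set \<times> ('a \<Rightarrow> nat \<Rightarrow> nat)"

definition sofic_approximation_sequence ::
  "('a, 'm) monoid_scheme \<Rightarrow> 'a sofic_seq \<Rightarrow> bool" where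
  "sofic_approximation_sequence G \<Sigma> \<longleftrightarrow>
     (\<forall>k. sofic_approximation G (fst (\<Sigma> k)) (snd (\<Sigma> k))) \<and>
     (\<forall>F \<delta>. finite F \<and> F \<subseteq> carrier G \<and> 0 < \<delta> \<longrightarrow>
        (\<forall>\<^sub>F k in sequentially. good_approximation G F \<delta> (fst (\<Sigma> k)) (snd (\<Sigma> k))))"

definition sofic_group :: "('a, 'm) monoid_scheme \<Rightarrow> bool" where
  "sofic_group G \<longleftrightarrow> (\<exists>\<Sigma>. sofic_approximation_sequence G \<Sigma>)"

section \<open>Sofic topological entropy\<close>

definition dist_2 :: "'v set \<Rightarrow> ('x \<Rightarrow> 'x \<Rightarrow> real) \<Rightarrow> ('v \<Rightarrow> 'x) \<Rightarrow> ('v \<Rightarrow> 'x) \<Rightarrow> real" where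
  "dist_2 V d \<phi> \<psi> = sqrt (1 / real (card V) * (\<Sum>v\<in>V. (d (\<phi> v) (\<psi> v))\<^sup>2))"

definition dist_inf :: "'v set \<Rightarrow> ('x \<Rightarrow> 'x \<Rightarrow> real) \<Rightarrow> ('v \<Rightarrow> 'x) \<Rightarrow> ('v \<Rightarrow> 'x) \<Rightarrow> real" where
  "dist_inf V d \<phi> \<psi> = (MAX v\<in>V. d (\<phi> v) (\<psi> v))"

definition sofic_maps ::
  "'x topology \<Rightarrow> ('x \<Rightarrow> 'x \<Rightarrow> real) \<Rightarrow> ('a \<Rightarrow> 'x \<Rightarrow> 'x) \<Rightarrow> 'a set \<Rightarrow> real \<Rightarrow>
   'v set \<Rightarrow> ('a \<Rightarrow> 'v \<Rightarrow> 'v) \<Rightarrow> ('v \<Rightarrow> 'x) set" where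
  "sofic_maps X d \<alpha> F \<delta> V \<sigma> =
     {\<phi> \<in> V \<rightarrow>\<^sub>E topspace X. \<forall>g\<in>F. dist_2 V d (\<phi> \<circ> \<sigma> g) (\<alpha> g \<circ> \<phi>) \<le> \<delta>}"

text \<open>\<open>Max\<close> is meaningful where this is used: for a compatible metric on a compact space, the
  cardinalities of \<open>\<epsilon>\<close>-separated sets of maps from a finite set are bounded, in particular
  such sets are finite.\<close>

definition separation_number :: "real \<Rightarrow> 'w set \<Rightarrow> ('w \<Rightarrow> 'w \<Rightarrow> real) \<Rightarrow> nat" where
  "separation_number \<epsilon> \<Omega> \<rho> =
     Max {card W |W. W \<subseteq> \<Omega> \<and> finite W \<and> (\<forall>x\<in>W. \<forall>y\<in>W. x \<noteq> y \<longrightarrow> \<rho> x y \<ge> \<epsilon>)}"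

definition log_card :: "nat \<Rightarrow> ereal" where
  "log_card n = (if n = 0 then -\<infinity> else ereal (ln (real n)))"

definition sofic_entropy ::
  "('a, 'm) monoid_scheme \<Rightarrow> 'x topology \<Rightarrow> ('x \<Rightarrow> 'x \<Rightarrow> real) \<Rightarrow> ('a \<Rightarrow> 'x \<Rightarrow> 'x) \<Rightarrow>
   'a sofic_seq \<Rightarrow> ereal" where
  "sofic_entropy G X d \<alpha> \<Sigma> =
     (SUP \<epsilon>\<in>{0<..}. INF F\<in>{F. finite F \<and> F \<subseteq> carrier G}. INF \<delta>\<in>{0<..}.
        limsup (\<lambda>k. ereal (1 / real (card (fst (\<Sigma> k)))) *
          log_card (separation_number \<epsilon>
            (sofic_maps X d \<alpha> F \<delta> (fst (\<Sigma> k)) (snd (\<Sigma> k)))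
            (dist_inf (fst (\<Sigma> k)) d))))"

text \<open>The supremum is attained, whence the name.\<close>

definition max_sofic_entropy ::
  "('a, 'm) monoid_scheme \<Rightarrow> 'x topology \<Rightarrow> ('x \<Rightarrow> 'x \<Rightarrow> real) \<Rightarrow> ('a \<Rightarrow> 'x \<Rightarrow> 'x) \<Rightarrow> ereal" where
  "max_sofic_entropy G X d \<alpha> =
     (SUP \<Sigma>\<in>{\<Sigma>. sofic_approximation_sequence G \<Sigma>}. sofic_entropy G X d \<alpha> \<Sigma>)"

definition inf_sofic_entropy ::
  "('a, 'm) monoid_scheme \<Rightarrow> 'x topology \<Rightarrow> ('x \<Rightarrow> 'x \<Rightarrow> real) \<Rightarrow> ('a \<Rightarrow> 'x \<Rightarrow> 'x) \<Rightarrow> ereal" where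
  "inf_sofic_entropy G X d \<alpha> =
     (INF \<Sigma>\<in>{\<Sigma>. sofic_approximation_sequence G \<Sigma>}. sofic_entropy G X d \<alpha> \<Sigma>)"

end

theory Submission imports Defs begin

text \<open>Fix a sofic approximation of \<open>G\<close> on \<open>V\<close>. An almost equivariant map \<open>\<phi>: V \<rightarrow> X\<close> determines, through
  \<open>\<Phi> \<circ> \<phi>\<close> and the cocycle \<open>\<lambda>\<close>, a sofic approximation of \<open>H\<close> on the same set \<open>V\<close>, but a different one for
  each \<open>\<phi>\<close>, and only the pair is almost equivariant. To have exponentially many maps share one
  approximation, restrict to a class of maps \<open>\<phi>\<close> whose cocycles \<open>\<kappa>(g, \<phi>(v))\<close> agree on a set \<open>E\<close> of edges
  \<open>(g, v)\<close> so small that the pigeonhole loses only a factor \<open>exp (\<tau> |V|)\<close>. This suffices if \<open>E\<close>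
  connects a set of base points whose translates by a fixed finite set \<open>S\<close> cover \<open>V\<close> up to few
  points, since the cocycle identity propagates agreement along paths.

  Such sets exist within a fixed budget for any prescribed weights of the edges, because both kinds of
  groups contain sparse but well connected nets. For an amenable subgroup, tile \<open>V\<close> by Folner sets and
  join a sparse net inside each tile by a spanning forest; if the group has superlinear growth the net is a
  maximal separated set, and otherwise it is made of cosets of an infinite cyclic subgroup of infinite index.
  Through a normal extension \<open>N \<subseteq> M\<close> with \<open>N\<close> infinite, edges for the new generators are needed only on
  a sparse set, as conjugation carries connections along \<open>N\<close> to their translates. In a product the sequence
  \<open>\<sigma> \<times> \<sigma>\<close> makes the two factors commute exactly, and the base points can be taken sparse in the
  direction of one factor and full in the direction of the other, which is not locally finite.\<close>

section \<open>Sofic sequences and sparse connectivity\<close>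

text \<open>The order of quantifiers shapes the proof. In the entropy of \<open>H\<close> the scale
  \<epsilon>' stands outside the finite set \<open>L\<close> and the tolerance \<delta>. The scale
  at which rebuilt maps stay separated is governed by the moduli of continuity of the elements of
  \<open>S\<close>, while the moves to be connected are the elements s'^-1 r s with s, s' in
  \<open>S\<close> and r a cocycle value belonging to \<open>L\<close>. Hence \<open>S\<close> has
  to be fixed before \<open>T\<close>. The loss exp (\<tau> |V|) has two halves: the cocycle values
  recorded along \<open>E\<close>, and a coarse record of the map on the few points where it is far
  from equivariant, without which two maps might differ only there. The approximations of
  \<open>H\<close> obtained for various \<open>L\<close> are unrelated to each other and can only be
  assembled into some sequence, which is why \<open>H\<close> enters with its maximum. On the side
  of \<open>G\<close>, a w-normal amenable subgroup gives connectivity along every sequence, hence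
  the maximum; for products it is obtained only along a constructed sequence, hence the infimum.
  Topological freeness enters only through identities between cocycles.\<close>

lemma (in group) mult_inv_cancel [simp]:
  assumes "x \<in> carrier G" "y \<in> carrier G"
  shows "x \<otimes> (inv x \<otimes> y) = y" "inv x \<otimes> (x \<otimes> y) = y"
  using m_assoc[of x "inv x" y] m_assoc[of "inv x" x y] assms by auto

definition edge_rel :: "('a \<Rightarrow> 'v \<Rightarrow> 'v) \<Rightarrow> ('a \<times> 'v) set \<Rightarrow> ('v \<times> 'v) set" where
  "edge_rel s E = {(v, s g v) |g v. (g, v) \<in> E}"

text \<open>Symmetric because the cocycle identity can be solved backwards along an edge; reflexive
  so that \<open>link s E ^^ n\<close> consists of all paths of length at most n.\<close>

definition link :: "('a \<Rightarrow> 'v \<Rightarrow> 'v) \<Rightarrow> ('a \<times> 'v) set \<Rightarrow> ('v \<times> 'v) set" where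
  "link s E = (edge_rel s E \<union> (edge_rel s E)\<inverse>)\<^sup>="

lemma link_refl: "(v, v) \<in> link s E"
  by (simp add: link_def)

lemma link_edge: "(g, v) \<in> E \<Longrightarrow> (v, s g v) \<in> link s E"
  by (auto simp: link_def edge_rel_def)

lemma link_edge': "(g, v) \<in> E \<Longrightarrow> (s g v, v) \<in> link s E"
  by (auto simp: link_def edge_rel_def)

lemma link_mono: "E \<subseteq> E' \<Longrightarrow> link s E \<subseteq> link s E'"
  by (auto simp: link_def edge_rel_def)

lemma link_sym: "(u, v) \<in> link s E \<Longrightarrow> (v, u) \<in> link s E"
  by (auto simp: link_def)

lemma link_pow_sym: "(u, v) \<in> link s E ^^ n \<Longrightarrow> (v, u) \<in> link s E ^^ n"
proof (induction n arbitrary: v)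
  case (Suc n)
  then show ?case
    by (metis link_sym relpow_Suc_E relpow_Suc_I2)
qed simp

lemma relpow_subset_mono: "(R :: ('v \<times> 'v) set) \<subseteq> R' \<Longrightarrow> R ^^ n \<subseteq> R' ^^ n"
  by (induction n) (auto intro: relcomp_mono[THEN subsetD])

lemma link_pow_le: "(u, v) \<in> link s E ^^ m \<Longrightarrow> m \<le> n \<Longrightarrow> (u, v) \<in> link s E ^^ n"
proof (induction n)
  case (Suc n)
  then show ?case
    by (metis le_Suc_eq link_refl relpow_Suc_I)
qed simp

lemma link_pow_mono:
  assumes "(u, v) \<in> link s E ^^ m" "m \<le> n" "E \<subseteq> E'"
  shows "(u, v) \<in> link s E' ^^ n"
  using link_pow_le[OF assms(1,2)] relpow_subset_mono[OF link_mono[OF assms(3)]] by blast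

locale sofic_sequence = group G for G (structure) +
  fixes \<Sigma> :: "'a sofic_seq"
  assumes countable_carrier: "countable (carrier G)"
    and sofic: "sofic_approximation_sequence G \<Sigma>"
begin

abbreviation V :: "nat \<Rightarrow> nat set" where "V k \<equiv> fst (\<Sigma> k)"
abbreviation \<sigma> :: "nat \<Rightarrow> 'a \<Rightarrow> nat \<Rightarrow> nat" where "\<sigma> k \<equiv> snd (\<Sigma> k)"
abbreviation sz :: "nat \<Rightarrow> real" where "sz k \<equiv> real (card (V k))"

lemma finite_V [simp]: "finite (V k)" and V_nonempty [simp]: "V k \<noteq> {}"
  and \<sigma>_permutes: "g \<in> carrier G \<Longrightarrow> \<sigma> k g permutes V k"
  using sofic by (auto simp: sofic_approximation_sequence_def sofic_approximation_def)

lemma sz_pos [simp]: "0 < sz k"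
  by (simp add: card_gt_0_iff)

lemma \<sigma>_in [simp]: "g \<in> carrier G \<Longrightarrow> \<sigma> k g v \<in> V k \<longleftrightarrow> v \<in> V k"
  using \<sigma>_permutes permutes_in_image by metis

lemma \<sigma>_inj: "g \<in> carrier G \<Longrightarrow> \<sigma> k g u = \<sigma> k g v \<longleftrightarrow> u = v"
  using \<sigma>_permutes by (metis injD permutes_inj)

text \<open>At such a point the asymptotic axioms of a sofic sequence hold exactly on
  \<open>Z\<close>, and one can compute as in the group. Every later argument takes place at
  faithful points, and the others are counted.\<close>

definition faithful_at :: "nat \<Rightarrow> 'a set \<Rightarrow> nat \<Rightarrow> bool" where
  "faithful_at k Z v \<longleftrightarrow>
     (\<forall>s\<in>Z. \<forall>t\<in>Z. \<sigma> k s (\<sigma> k t v) = \<sigma> k (s \<otimes> t) v \<and> (s \<noteq> t \<longrightarrow> \<sigma> k s v \<noteq> \<sigma> k t v))"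

lemma faithful_mult: "faithful_at k Z v \<Longrightarrow> s \<in> Z \<Longrightarrow> t \<in> Z \<Longrightarrow> \<sigma> k s (\<sigma> k t v) = \<sigma> k (s \<otimes> t) v"
  and faithful_inj: "faithful_at k Z v \<Longrightarrow> s \<in> Z \<Longrightarrow> t \<in> Z \<Longrightarrow> \<sigma> k s v = \<sigma> k t v \<Longrightarrow> s = t"
  by (auto simp: faithful_at_def)

text \<open>The permutation of the unit need not be the identity, but it is idempotent at a faithful
  point, and it is injective.\<close>

lemma faithful_one:
  assumes "faithful_at k Z v" "\<one> \<in> Z"
  shows "\<sigma> k \<one> v = v"
  using faithful_mult[OF assms(1) assms(2) assms(2)] \<sigma>_inj[of \<one>] by simp

lemma faithful_inv:
  assumes "faithful_at k Z v" "\<one> \<in> Z" "g \<in> Z" "inv g \<in> Z" "g \<in> carrier G"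
  shows "\<sigma> k g (\<sigma> k (inv g) v) = v" "\<sigma> k (inv g) (\<sigma> k g v) = v"
  using faithful_mult[OF assms(1)] assms faithful_one[OF assms(1,2)] by auto

definition unfaithful :: "nat \<Rightarrow> 'a set \<Rightarrow> nat set" where
  "unfaithful k Z = {v \<in> V k. \<not> faithful_at k Z v}"

lemma unfaithful_subset: "unfaithful k Z \<subseteq> V k" and finite_unfaithful [simp]: "finite (unfaithful k Z)"
  by (auto simp: unfaithful_def)

lemma faithfulI: "v \<in> V k \<Longrightarrow> v \<notin> unfaithful k Z \<Longrightarrow> faithful_at k Z v"
  by (auto simp: unfaithful_def)

lemma eventually_unfaithful_small:
  assumes Z: "finite Z" "Z \<subseteq> carrier G" and \<delta>: "0 < \<delta>"
  shows "\<forall>\<^sub>F k in sequentially. real (card (unfaithful k Z)) \<le> \<delta> * sz k"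
proof -
  define N where "N = real (card (Z \<times> Z))"
  \<comment> \<open>There are 2 N failure sets, each with at most e |V| points; the added 1 covers
    an empty \<open>Z\<close>.\<close>
  define e where "e = \<delta> / (2 * (N + 1))"
  have N0: "N \<ge> 0" by (simp add: N_def)
  have e: "0 < e" using \<delta> N0 by (simp add: e_def)
  have "\<forall>\<^sub>F k in sequentially. good_approximation G Z e (V k) (\<sigma> k)"
    using sofic Z e by (simp add: sofic_approximation_sequence_def)
  then show ?thesis
  proof eventually_elim
    case (elim k)
    define A where "A = (\<lambda>(s,t). {v \<in> V k. \<sigma> k (s \<otimes> t) v \<noteq> (\<sigma> k s \<circ> \<sigma> k t) v})"
    define B where "B = (\<lambda>(s,t). {v \<in> V k. s \<noteq> t \<and> \<sigma> k s v = \<sigma> k t v})"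
    have A: "real (card (A p)) \<le> e * sz k" if p: "p \<in> Z \<times> Z" for p
    proof -
      obtain s t where st: "p = (s,t)" "s \<in> Z" "t \<in> Z" using p by blast
      have "hamming_dist (V k) (\<sigma> k (s \<otimes> t)) (\<sigma> k s \<circ> \<sigma> k t) \<le> e"
        using elim st by (auto simp: good_approximation_def)
      then show ?thesis using st
        by (simp add: hamming_dist_def A_def divide_le_eq card_gt_0_iff)
    qed
    have B: "real (card (B p)) \<le> e * sz k" if p: "p \<in> Z \<times> Z" for p
    proof (cases "fst p = snd p")
      case True
      then have "B p = {}" by (auto simp: B_def)
      then show ?thesis using e by simp
    next
      case False
      obtain s t where st: "p = (s,t)" "s \<in> Z" "t \<in> Z" using p by blast
      have neq: "s \<noteq> t" using False st by simp
      have *: "hamming_dist (V k) (\<sigma> k s) (\<sigma> k t) \<ge> 1 - e"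
        using elim st neq by (auto simp: good_approximation_def)
      have "{v \<in> V k. \<sigma> k s v \<noteq> \<sigma> k t v} = V k - B p"
        using st neq by (auto simp: B_def)
      then have "real (card {v \<in> V k. \<sigma> k s v \<noteq> \<sigma> k t v}) = sz k - real (card (B p))"
        by (simp add: B_def card_Diff_subset card_mono st of_nat_diff)
      with * show ?thesis
        by (simp add: hamming_dist_def le_divide_eq card_gt_0_iff algebra_simps)
    qed
    have "unfaithful k Z \<subseteq> (\<Union>p\<in>Z\<times>Z. A p \<union> B p)"
    proof
      fix v assume "v \<in> unfaithful k Z"
      then obtain s t where "v \<in> V k" "s \<in> Z" "t \<in> Z"
        "\<sigma> k s (\<sigma> k t v) \<noteq> \<sigma> k (s \<otimes> t) v \<or> (s \<noteq> t \<and> \<sigma> k s v = \<sigma> k t v)"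
        unfolding unfaithful_def faithful_at_def by blast
      then have "(s, t) \<in> Z \<times> Z" "v \<in> A (s, t) \<union> B (s, t)"
        by (auto simp: A_def B_def)
      then show "v \<in> (\<Union>p\<in>Z\<times>Z. A p \<union> B p)" by blast
    qed
    then have "card (unfaithful k Z) \<le> card (\<Union>p\<in>Z\<times>Z. A p \<union> B p)"
      using Z by (intro card_mono) (auto simp: A_def B_def)
    also have "\<dots> \<le> (\<Sum>p\<in>Z\<times>Z. card (A p \<union> B p))"
      using Z by (intro card_UN_le) auto
    also have "\<dots> \<le> (\<Sum>p\<in>Z\<times>Z. card (A p) + card (B p))"
      by (intro sum_mono card_Un_le)
    finally have "real (card (unfaithful k Z)) \<le> (\<Sum>p\<in>Z\<times>Z. real (card (A p)) + real (card (B p)))"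
      by (metis (mono_tags, lifting) of_nat_add of_nat_le_iff of_nat_sum sum.cong)
    also have "\<dots> \<le> (\<Sum>p\<in>Z\<times>Z. e * sz k + e * sz k)"
      using A B by (intro sum_mono add_mono) auto
    also have "\<dots> = N * 2 * e * sz k" by (simp add: N_def)
    also have "\<dots> \<le> \<delta> * sz k"
    proof (rule mult_right_mono)
      show "N * 2 * e \<le> \<delta>" using N0 \<delta> by (simp add: e_def field_simps)
    qed simp
    finally show ?case .
  qed
qed

text \<open>The points to discard, besides those of \<open>B\<close>, when an argument is also
  applied at their translates by \<open>A\<close>.\<close>

definition touch :: "nat \<Rightarrow> 'a set \<Rightarrow> nat set \<Rightarrow> nat set" where
  "touch k A B = {v \<in> V k. \<exists>a\<in>A. \<sigma> k a v \<in> B}"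

lemma touch_subset: "touch k A B \<subseteq> V k" and finite_touch [simp]: "finite (touch k A B)"
  by (auto simp: touch_def)

lemma card_touch:
  assumes "finite A" "A \<subseteq> carrier G" "finite B"
  shows "card (touch k A B) \<le> card A * card B"
proof -
  have *: "card {v \<in> V k. \<sigma> k a v \<in> B} \<le> card B" if "a \<in> A" for a
    by (rule card_inj_on_le[of "\<sigma> k a"]) (use that assms \<sigma>_inj in \<open>auto intro!: inj_onI\<close>)
  have "touch k A B \<subseteq> (\<Union>a\<in>A. {v \<in> V k. \<sigma> k a v \<in> B})"
    by (auto simp: touch_def)
  then have "card (touch k A B) \<le> card (\<Union>a\<in>A. {v \<in> V k. \<sigma> k a v \<in> B})"
    using assms by (intro card_mono) auto
  also have "\<dots> \<le> (\<Sum>a\<in>A. card {v \<in> V k. \<sigma> k a v \<in> B})"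
    using assms by (intro card_UN_le) auto
  also have "\<dots> \<le> (\<Sum>a\<in>A. card B)"
    by (intro sum_mono) (rule *)
  finally show ?thesis by simp
qed

lemma card_touch_le:
  assumes "finite A" "A \<subseteq> carrier G" "finite B" "real (card B) \<le> e * sz k"
  shows "real (card (touch k A B)) \<le> real (card A) * e * sz k"
proof -
  have "real (card (touch k A B)) \<le> real (card A) * real (card B)"
    using card_touch[OF assms(1-3), of k] by (metis of_nat_le_iff of_nat_mult)
  also have "\<dots> \<le> real (card A) * (e * sz k)"
    using assms(4) by (intro mult_left_mono) auto
  finally show ?thesis by (simp add: mult.assoc)
qed

text \<open>\<open>U\<close> is a maximal set of faithful points of \<open>W\<close> whose
  translates D u are pairwise disjoint. Disjointness bounds its density by 1/|D|; maximality makes D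
  w meet some D u, so that w and u differ by an element of D^-1 D. The way back from w to u is
  stated as well because inverses are not exact in a sofic model.\<close>

lemma ex_separated_net:
  assumes D: "finite D" "D \<noteq> {}" "D \<subseteq> carrier G" and W: "W \<subseteq> V k"
    and Z: "D \<union> (\<lambda>(d, d'). inv d \<otimes> d') ` (D \<times> D) \<subseteq> Z"
  obtains U where "U \<subseteq> W" "card U * card D \<le> card (V k)"
    "\<And>w. w \<in> W \<Longrightarrow> w \<notin> unfaithful k Z \<Longrightarrow>
       \<exists>u\<in>U. \<exists>x \<in> (\<lambda>(d, d'). inv d \<otimes> d') ` (D \<times> D). w = \<sigma> k x u \<and> u = \<sigma> k (inv x) w"
proof -
  define sep where "sep U \<longleftrightarrow> U \<subseteq> W - unfaithful k Z \<and>
    (\<forall>u\<in>U. \<forall>u'\<in>U. u \<noteq> u' \<longrightarrow> (\<forall>d\<in>D. \<forall>d'\<in>D. \<sigma> k d u \<noteq> \<sigma> k d' u'))" for U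
  have fW: "finite W" by (rule finite_subset[OF W finite_V])
  have "finite {U. sep U}"
  proof (rule finite_subset)
    show "{U. sep U} \<subseteq> Pow W" unfolding sep_def by blast
  qed (simp add: fW)
  moreover have "{} \<in> {U. sep U}" by (simp add: sep_def)
  ultimately obtain U where "U \<in> {U. sep U}" "\<forall>U'\<in>{U. sep U}. U \<subseteq> U' \<longrightarrow> U = U'"
    by (metis finite_has_maximal2)
  then have U: "sep U" and max: "\<And>U'. sep U' \<Longrightarrow> U \<subseteq> U' \<Longrightarrow> U' = U" by blast+
  have U1: "U \<subseteq> W - unfaithful k Z"
    and U2: "\<forall>u\<in>U. \<forall>u'\<in>U. u \<noteq> u' \<longrightarrow> (\<forall>d\<in>D. \<forall>d'\<in>D. \<sigma> k d u \<noteq> \<sigma> k d' u')"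
    using U[unfolded sep_def] by (rule conjunct1, rule conjunct2)
  have UW: "U \<subseteq> W" using U1 by blast
  have UF: "faithful_at k Z u" if "u \<in> U" for u
    by (rule faithfulI) (use that U1 W in blast)+
  have DZ: "D \<subseteq> Z" and PZ: "(\<lambda>(d, d'). inv d \<otimes> d') ` (D \<times> D) \<subseteq> Z"
    using Z[unfolded Un_subset_iff] by (rule conjunct1, rule conjunct2)
  have inj: "inj_on (\<lambda>(d, u). \<sigma> k d u) (D \<times> U)"
  proof (rule inj_onI, clarify)
    fix d u d' u' assume *: "d \<in> D" "u \<in> U" "d' \<in> D" "u' \<in> U" "\<sigma> k d u = \<sigma> k d' u'"
    have "u = u'" using U2 * by metis
    moreover have "d = d'"
      using faithful_inj[OF UF[OF *(2)], of d d'] DZ *(1,3,5) calculation by blast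
    ultimately show "d = d' \<and> u = u'" by simp
  qed
  have "card (D \<times> U) \<le> card (V k)"
  proof (rule card_inj_on_le[OF inj])
    show "(\<lambda>(d, u). \<sigma> k d u) ` (D \<times> U) \<subseteq> V k"
    proof (clarsimp)
      fix d u assume "d \<in> D" "u \<in> U"
      then have "d \<in> carrier G" "u \<in> V k" using D UW W by blast+
      then show "\<sigma> k d u \<in> V k" by simp
    qed
  qed simp
  then have card: "card U * card D \<le> card (V k)" by (simp add: card_cartesian_product mult.commute)
  have fin: "\<exists>u\<in>U. \<exists>x \<in> (\<lambda>(d, d'). inv d \<otimes> d') ` (D \<times> D). w = \<sigma> k x u \<and> u = \<sigma> k (inv x) w"
    if w: "w \<in> W" "w \<notin> unfaithful k Z" for w
  proof -
    have "\<exists>u\<in>U. \<exists>d\<in>D. \<exists>d'\<in>D. \<sigma> k d w = \<sigma> k d' u"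
    proof (cases "w \<in> U")
      case True
      then show ?thesis using D by blast
    next
      case False
      have 1: "\<not> sep (insert w U)" using max[of "insert w U"] False by blast
      have 2: "insert w U \<subseteq> W - unfaithful k Z" using U1 w by blast
      obtain u u' d d' where *: "u \<in> insert w U" "u' \<in> insert w U" "u \<noteq> u'" "d \<in> D" "d' \<in> D"
        "\<sigma> k d u = \<sigma> k d' u'"
        using 1 2 unfolding sep_def by blast
      have 3: "\<not> (u \<in> U \<and> u' \<in> U)" using U2 * by metis
      show ?thesis
      proof (cases "u = w")
        case True
        then have u': "u' \<in> U" using * by auto
        show ?thesis
          by (rule bexI[OF _ u'], rule bexI[OF _ *(4)], rule bexI[OF _ *(5)]) (use *(6) True in simp)
      next
        case False
        then have u': "u' = w" "u \<in> U" using * 3 by auto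
        show ?thesis
          by (rule bexI[OF _ u'(2)], rule bexI[OF _ *(5)], rule bexI[OF _ *(4)]) (use *(6) u' in simp)
      qed
    qed
    then obtain u d d' where *: "u \<in> U" "d \<in> D" "d' \<in> D" "\<sigma> k d w = \<sigma> k d' u" by blast
    have dc: "d \<in> carrier G" "d' \<in> carrier G" using *(2,3) D(3) by blast+
    have Fw: "faithful_at k Z w" using w W faithfulI by blast
    have P: "inv a \<otimes> b \<in> (\<lambda>(d, d'). inv d \<otimes> d') ` (D \<times> D)" if "a \<in> D" "b \<in> D" for a b
      by (rule image_eqI[of _ _ "(a, b)"]) (simp_all add: that)
    have zz: "inv d \<otimes> d' \<in> Z" "inv d' \<otimes> d \<in> Z"
      by (rule subsetD[OF PZ P[OF *(2,3)]], rule subsetD[OF PZ P[OF *(3,2)]])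
    have e1: "d \<otimes> (inv d \<otimes> d') = d'" and e2: "d' \<otimes> (inv d' \<otimes> d) = d"
      using dc by auto
    have "\<sigma> k d (\<sigma> k (inv d \<otimes> d') u) = \<sigma> k d' u"
      using faithful_mult[OF UF[OF *(1)], of d "inv d \<otimes> d'"] zz DZ *(2,3) e1 by (simp add: subset_iff)
    then have 1: "w = \<sigma> k (inv d \<otimes> d') u" using * \<sigma>_inj[OF dc(1)] by metis
    have "\<sigma> k d' (\<sigma> k (inv d' \<otimes> d) w) = \<sigma> k d w"
      using faithful_mult[OF Fw, of d' "inv d' \<otimes> d"] zz DZ *(2,3) e2 by (simp add: subset_iff)
    then have 2: "u = \<sigma> k (inv d' \<otimes> d) w" using * \<sigma>_inj[OF dc(2)] by metis
    have 3: "inv (inv d \<otimes> d') = inv d' \<otimes> d" using dc by (simp add: inv_mult_group)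
    show ?thesis
      by (rule bexI[OF _ *(1)], rule bexI[OF _ P[OF *(2,3)]]) (simp add: 1[symmetric] 2[symmetric] 3)
  qed
  show thesis by (rule that[OF UW card]) (rule fin)
qed

text \<open>The points of \<open>W\<close> are base points, every good point is the translate of a base point by an
  element of \<open>S\<close>, and nearby base points are joined by short paths of edges in \<open>E\<close>. With \<open>\<Upsilon> g\<close> a large
  multiple of the information needed to record the cocycle at \<open>g\<close>, the cost bound makes recording it
  along all edges cheap. It matters that \<open>S\<close> is chosen before \<open>T\<close> and \<open>\<delta>\<close>.\<close>

definition sparsely_connected :: "('a \<Rightarrow> real) \<Rightarrow> 'a set \<Rightarrow> 'a set \<Rightarrow> bool" where
  "sparsely_connected \<Upsilon> S L \<longleftrightarrow>
     (\<forall>T \<delta>. finite T \<and> T \<subseteq> L \<and> 0 < \<delta> \<longrightarrow>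
        (\<exists>C R. finite R \<and> R \<subseteq> carrier G \<and>
           (\<forall>\<^sub>F k in sequentially. \<exists>W E B. W \<subseteq> V k \<and> E \<subseteq> R \<times> V k \<and> B \<subseteq> V k \<and>
              real (card B) \<le> \<delta> * sz k \<and> (\<Sum>(g, v)\<in>E. \<Upsilon> g) \<le> (1 + \<delta>) * sz k \<and>
              (\<forall>v\<in>V k - B. \<exists>s\<in>S. \<exists>w\<in>W. v = \<sigma> k s w) \<and>
              (\<forall>w\<in>W - B. \<forall>t\<in>T. \<sigma> k t w \<in> W \<longrightarrow> (w, \<sigma> k t w) \<in> link (\<sigma> k) E ^^ C))))"

end

section \<open>Spanning forests\<close>

definition conn_rel :: "'v set \<Rightarrow> ('v \<times> 'v) set \<Rightarrow> ('v \<times> 'v) set" where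
  "conn_rel A r = {(a, b). a \<in> A \<and> b \<in> A \<and> (a, b) \<in> (r \<union> r\<inverse>)\<^sup>*}"

lemma equiv_conn_rel: "equiv A (conn_rel A r)"
proof (rule equivI)
  show "refl_on A (conn_rel A r)" by (auto simp: refl_on_def conn_rel_def)
  have "sym ((r \<union> r\<inverse>)\<^sup>*)" by (rule sym_rtrancl[OF sym_Un_converse])
  then show "sym (conn_rel A r)" unfolding conn_rel_def sym_def by blast
  show "trans (conn_rel A r)" unfolding conn_rel_def trans_def by (auto intro: rtrancl_trans)
qed (auto simp: conn_rel_def)

lemma conn_rel_mono: "r \<subseteq> r' \<Longrightarrow> conn_rel A r \<subseteq> conn_rel A r'"
proof -
  assume "r \<subseteq> r'"
  then have "(r \<union> r\<inverse>)\<^sup>* \<subseteq> (r' \<union> r'\<inverse>)\<^sup>*" by (intro rtrancl_mono) blast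
  then show ?thesis by (auto simp: conn_rel_def)
qed

text \<open>Sending a class of \<open>e1\<close> to the class of \<open>e2\<close> around it is
  onto, and it identifies the classes of \<open>a\<close> and \<open>b\<close>.\<close>

lemma card_quotient_less:
  assumes A: "finite A" and e1: "equiv A e1" and e2: "equiv A e2" and sub: "e1 \<subseteq> e2"
    and ab: "(a, b) \<in> e2" "(a, b) \<notin> e1"
  shows "card (A // e2) < card (A // e1)"
proof -
  have abA: "a \<in> A" "b \<in> A" using ab(1) equiv_type[OF e2] by auto
  have comp: "e2 `` (e1 `` {x}) = e2 `` {x}" if x: "x \<in> A" for x
  proof
    show "e2 `` (e1 `` {x}) \<subseteq> e2 `` {x}"
      using sub equivE[OF e2] unfolding trans_def by blast
    show "e2 `` {x} \<subseteq> e2 `` (e1 `` {x})" using equiv_class_self[OF e1 x] by auto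
  qed
  have img: "A // e2 = (\<lambda>X. e2 `` X) ` (A // e1)"
    unfolding quotient_def using comp by (auto simp: image_iff)
  have fin: "finite (A // e1)" by (rule finite_quotient[OF A equiv_type[OF e1]])
  have "card (A // e2) \<noteq> card (A // e1)"
  proof
    assume "card (A // e2) = card (A // e1)"
    then have inj: "inj_on (\<lambda>X. e2 `` X) (A // e1)"
      using img fin by (intro eq_card_imp_inj_on) auto
    have "e2 `` (e1 `` {a}) = e2 `` (e1 `` {b})"
      using comp[OF abA(1)] comp[OF abA(2)] equiv_class_eq[OF e2 ab(1)] by simp
    then have "e1 `` {a} = e1 `` {b}"
      by (rule inj_onD[OF inj]) (use abA in \<open>auto intro: quotientI\<close>)
    then have "(a, b) \<in> e1" by (rule eq_equiv_class[OF _ e1 abA(2)])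
    then show False using ab(2) by simp
  qed
  moreover have "card (A // e2) \<le> card (A // e1)" unfolding img by (rule card_image_le[OF fin])
  ultimately show ?thesis by simp
qed

text \<open>Kruskal's greedy choice on top of the edges \<open>r0\<close> that are already
  available: an edge is kept only if it merges two components, so each kept edge is paid for by a
  drop in the number of components. The sum form avoids subtraction of natural numbers.\<close>

lemma ex_spanning_forest:
  assumes A: "finite A" and r: "finite r" "r \<subseteq> A \<times> A"
  shows "\<exists>r'\<subseteq>r. card r' + card (A // conn_rel A (r0 \<union> r')) \<le> card (A // conn_rel A r0) \<and>
    r \<subseteq> conn_rel A (r0 \<union> r')"
  using r
proof (induction r rule: finite_induct)
  case empty
  then show ?case by (intro exI[of _ "{}"]) simp
next
  case (insert p r)
  then obtain r' where r': "r' \<subseteq> r" "card r' + card (A // conn_rel A (r0 \<union> r')) \<le> card (A // conn_rel A r0)"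
    "r \<subseteq> conn_rel A (r0 \<union> r')" by auto
  show ?case
  proof (cases "p \<in> conn_rel A (r0 \<union> r')")
    case True
    then show ?thesis using r' by (intro exI[of _ r']) auto
  next
    case False
    obtain a b where p: "p = (a, b)" "a \<in> A" "b \<in> A" using insert.prems by auto
    let ?r = "insert p r'"
    have pin: "p \<in> conn_rel A (r0 \<union> ?r)" using p by (auto simp: conn_rel_def)
    have sub: "conn_rel A (r0 \<union> r') \<subseteq> conn_rel A (r0 \<union> ?r)" by (rule conn_rel_mono) auto
    have "card (A // conn_rel A (r0 \<union> ?r)) < card (A // conn_rel A (r0 \<union> r'))"
      by (rule card_quotient_less[OF A equiv_conn_rel equiv_conn_rel sub, of a b]) (use pin False p in auto)
    moreover have "finite r'" using r'(1) insert.hyps finite_subset by auto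
    then have "card ?r \<le> Suc (card r')" by (simp add: card_insert_if)
    ultimately have "card ?r + card (A // conn_rel A (r0 \<union> ?r)) \<le> card (A // conn_rel A r0)" using r'(2) by linarith
    then show ?thesis using r' sub pin by (intro exI[of _ ?r]) auto
  qed
qed

text \<open>There are at most |A|/M classes with M or more points, and every other class consists of
  points of \<open>B\<close>, so it can be charged to one of them.\<close>

lemma card_quotient_le_large_classes:
  assumes A: "finite A" and e: "equiv A e" and B: "finite B" and M: "0 < M"
    and large: "\<And>a. a \<in> A \<Longrightarrow> a \<notin> B \<Longrightarrow> M \<le> card (e `` {a})"
  shows "real (card (A // e)) \<le> real (card A) / real M + real (card B)"
proof -
  define L where "L = {X \<in> A // e. M \<le> card X}"
  define S where "S = {X \<in> A // e. \<not> M \<le> card X}"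
  have fin: "finite (A // e)" by (rule finite_quotient[OF A equiv_type[OF e]])
  have "card (A // e) \<le> card L + card S"
  proof -
    have "A // e = L \<union> S" by (auto simp: L_def S_def)
    then show ?thesis using card_Un_le[of L S] by simp
  qed
  moreover have "M * card L \<le> card A"
  proof -
    have "M * card L = (\<Sum>X\<in>L. M)" by simp
    also have "\<dots> \<le> (\<Sum>X\<in>L. card X)" by (rule sum_mono) (simp add: L_def)
    also have "\<dots> = card (\<Union>L)"
    proof (rule card_Union_disjoint[symmetric])
      show "pairwise disjnt L" using quotient_disj[OF e] by (auto simp: pairwise_def disjnt_def L_def)
      show "finite X" if "X \<in> L" for X
        using that finite_equiv_class[OF A equiv_type[OF e]] by (auto simp: L_def)
    qed
    also have "\<dots> \<le> card A"
      by (rule card_mono[OF A]) (use Union_quotient[OF e] in \<open>auto simp: L_def\<close>)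
    finally show ?thesis .
  qed
  moreover have "card S \<le> card B"
  proof (rule card_inj_on_le)
    have meet: "\<exists>x. x \<in> X \<and> x \<in> B" if X: "X \<in> S" for X
    proof -
      obtain a where a: "a \<in> A" "X = e `` {a}" using X by (auto simp: S_def quotient_def)
      then have "a \<in> B" using X large[of a] by (auto simp: S_def)
      then show ?thesis using a equiv_class_self[OF e a(1)] by auto
    qed
    have some: "(SOME x. x \<in> X \<and> x \<in> B) \<in> X \<and> (SOME x. x \<in> X \<and> x \<in> B) \<in> B" if "X \<in> S" for X
      by (rule someI_ex[OF meet[OF that]])
    show "inj_on (\<lambda>X. SOME x. x \<in> X \<and> x \<in> B) S"
    proof (rule inj_onI)
      fix X X' assume X: "X \<in> S" "X' \<in> S" "(SOME x. x \<in> X \<and> x \<in> B) = (SOME x. x \<in> X' \<and> x \<in> B)"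
      then have "(SOME x. x \<in> X \<and> x \<in> B) \<in> X \<inter> X'" using some[OF X(1)] some[OF X(2)] by simp
      moreover have "X \<in> A // e" "X' \<in> A // e" using X by (auto simp: S_def)
      ultimately show "X = X'" using quotient_disj[OF e] by blast
    qed
    show "(\<lambda>X. SOME x. x \<in> X \<and> x \<in> B) ` S \<subseteq> B" using some by blast
  qed (rule B)
  ultimately have 1: "card (A // e) \<le> card L + card B" and 2: "M * card L \<le> card A" by auto
  have "real (card L) * real M \<le> real (card A)" using 2 by (metis mult.commute of_nat_le_iff of_nat_mult)
  then have "real (card L) \<le> real (card A) / real M" using M by (simp add: le_divide_eq)
  then show ?thesis using 1 by linarith
qed

lemma card_quotient_le: "finite A \<Longrightarrow> card (A // e) \<le> card A"
  unfolding quotient_def by (simp add: UNION_singleton_eq_range card_image_le)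

text \<open>A shortest path uses at most as many steps as there are pairs in the symmetrised
  relation. The crude square suffices: only a bound that does not depend on the sofic model is
  wanted.\<close>

lemma conn_rel_bounded_path:
  assumes r: "r \<subseteq> P \<times> P" "finite P" "card P \<le> m" and ab: "(a, b) \<in> (r \<union> r\<inverse>)\<^sup>*"
  shows "\<exists>j\<le>m * m. (a, b) \<in> (r \<union> r\<inverse>) ^^ j"
proof -
  have sub: "r \<union> r\<inverse> \<subseteq> P \<times> P" using r by blast
  have fin: "finite (r \<union> r\<inverse>)" by (rule finite_subset[OF sub]) (simp add: r)
  have "card (r \<union> r\<inverse>) \<le> card (P \<times> P)" by (rule card_mono[OF _ sub]) (simp add: r)
  also have "\<dots> \<le> m * m" using r(3) by (simp add: card_cartesian_product mult_le_mono)
  finally have le: "card (r \<union> r\<inverse>) \<le> m * m" .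
  obtain j where "j \<le> card (r \<union> r\<inverse>)" "(a, b) \<in> (r \<union> r\<inverse>) ^^ j"
    using ab unfolding rtrancl_finite_eq_relpow[OF fin] by auto
  then show ?thesis using le by (intro exI[of _ j]) simp
qed

section \<open>Folner sets from invariant means\<close>

definition hall_condition :: "'i set \<Rightarrow> ('i \<times> 'y) set \<Rightarrow> bool" where
  "hall_condition I r \<longleftrightarrow> (\<forall>E. finite E \<and> E \<subseteq> I \<longrightarrow> card E \<le> card (r `` E))"

text \<open>Submodularity. Deleting either of two neighbours of \<open>i\<close> breaks the Hall
  condition on some set containing \<open>i\<close>; call the rest of these sets E1 and E2, and A1
  and A2 the reduced neighbourhoods. Then A1 \<union> A2 is the neighbourhood of
  \<open>insert i (E1 \<union> E2)\<close> and A1 \<inter> A2 contains that of E1 \<inter> E2, so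
  |A1| + |A2| exceeds |E1| + |E2|, against the choice of the two sets.\<close>

lemma minimal_hall_condition_single_valued:
  assumes hall: "hall_condition I r" and fin: "\<And>i. i \<in> I \<Longrightarrow> finite (r `` {i})"
    and min: "\<And>p. p \<in> r \<Longrightarrow> \<not> hall_condition I (r - {p})"
    and ix: "i \<in> I" "(i, x1) \<in> r" "(i, x2) \<in> r"
  shows "x1 = x2"
proof (rule ccontr)
  assume neq: "x1 \<noteq> x2"
  have finE: "finite (r `` E)" if "finite E" "E \<subseteq> I" for E
  proof -
    have "r `` E = (\<Union>i\<in>E. r `` {i})" by blast
    then show ?thesis using that fin by auto
  qed
  have half: "\<exists>E. finite E \<and> E \<subseteq> I \<and> i \<notin> E \<and> card (r `` E \<union> (r `` {i} - {x})) \<le> card E"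
    if x: "(i, x) \<in> r" for x
  proof -
    obtain F where F: "finite F" "F \<subseteq> I" "card ((r - {(i, x)}) `` F) < card F"
      using min[OF x] unfolding hall_condition_def by (meson not_le)
    have iF: "i \<in> F"
    proof (rule ccontr)
      assume "i \<notin> F"
      then have "(r - {(i, x)}) `` F = r `` F" by auto
      then show False using F hall unfolding hall_condition_def by (metis not_le)
    qed
    have "r `` (F - {i}) \<union> (r `` {i} - {x}) \<subseteq> (r - {(i, x)}) `` F" using iF by auto
    then have "card (r `` (F - {i}) \<union> (r `` {i} - {x})) \<le> card ((r - {(i, x)}) `` F)"
      by (rule card_mono[rotated]) (rule finite_subset[OF _ finE[OF F(1,2)]], auto)
    also have "\<dots> \<le> card (F - {i})" using F iF by simp
    finally show ?thesis using F by (intro exI[of _ "F - {i}"]) auto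
  qed
  obtain E1 where E1: "finite E1" "E1 \<subseteq> I" "i \<notin> E1" "card (r `` E1 \<union> (r `` {i} - {x1})) \<le> card E1"
    using half[OF ix(2)] by blast
  obtain E2 where E2: "finite E2" "E2 \<subseteq> I" "i \<notin> E2" "card (r `` E2 \<union> (r `` {i} - {x2})) \<le> card E2"
    using half[OF ix(3)] by blast
  define A1 where "A1 = r `` E1 \<union> (r `` {i} - {x1})"
  define A2 where "A2 = r `` E2 \<union> (r `` {i} - {x2})"
  have fA: "finite A1" "finite A2" using finE E1 E2 fin[OF ix(1)] by (auto simp: A1_def A2_def)
  have "A1 \<union> A2 = r `` (insert i (E1 \<union> E2))" using neq ix by (auto simp: A1_def A2_def)
  then have 1: "card (E1 \<union> E2) + 1 \<le> card (A1 \<union> A2)"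
    using hall[unfolded hall_condition_def, rule_format, of "insert i (E1 \<union> E2)"] E1 E2 ix by auto
  have "card (E1 \<inter> E2) \<le> card (r `` (E1 \<inter> E2))"
    using hall[unfolded hall_condition_def, rule_format, of "E1 \<inter> E2"] E1 E2 by auto
  also have "\<dots> \<le> card (A1 \<inter> A2)"
    by (rule card_mono) (use fA in \<open>auto simp: A1_def A2_def\<close>)
  finally have 2: "card (E1 \<inter> E2) \<le> card (A1 \<inter> A2)" .
  have "card A1 + card A2 = card (A1 \<union> A2) + card (A1 \<inter> A2)" by (rule card_Un_Int[OF fA])
  moreover have "card E1 + card E2 = card (E1 \<union> E2) + card (E1 \<inter> E2)"
    by (rule card_Un_Int[OF E1(1) E2(1)])
  ultimately show False using 1 2 E1(4) E2(4) unfolding A1_def[symmetric] A2_def[symmetric] by linarith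
qed

text \<open>Rado's proof of Hall's theorem: a minimal relation with the Hall property is a matching.\<close>

lemma hall_matching:
  assumes hall: "hall_condition I r0" and fin: "\<And>i. i \<in> I \<Longrightarrow> finite (r0 `` {i})"
  obtains f where "inj_on f I" "\<And>i. i \<in> I \<Longrightarrow> (i, f i) \<in> r0"
proof -
  \<comment> \<open>Zorn's lemma is applied to the set of deleted pairs, whose maximal members leave
    a minimal relation.\<close>
  define \<A> where "\<A> = {D. D \<subseteq> r0 \<and> hall_condition I (r0 - D)}"
  have "\<exists>M\<in>\<A>. \<forall>X\<in>\<A>. M \<subseteq> X \<longrightarrow> X = M"
  proof (rule subset_Zorn')
    fix \<C> assume chain: "subset.chain \<A> \<C>"
    show "\<Union>\<C> \<in> \<A>"
    proof (cases "\<C> = {}")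
      case True
      then show ?thesis using hall by (simp add: \<A>_def)
    next
      case False
      have sub: "\<C> \<subseteq> \<A>" using chain by (simp add: subset.chain_def)
      have "card E \<le> card ((r0 - \<Union>\<C>) `` E)" if E: "finite E" "E \<subseteq> I" for E
      proof -
        \<comment> \<open>Only finitely many pairs start in \<open>E\<close>, so one member of the
          chain already deletes all those among them that the union deletes.\<close>
        define P where "P = \<Union>\<C> \<inter> (SIGMA i:E. r0 `` {i})"
        have "finite P" unfolding P_def using E fin by (intro finite_Int disjI2 finite_SigmaI) auto
        then obtain D where D: "D \<in> \<C>" "P \<subseteq> D"
          using finite_subset_Union_chain[of P \<C> \<A>] False chain unfolding P_def by blast
        have "(r0 - \<Union>\<C>) `` E = (r0 - D) `` E" using D unfolding P_def by blast
        moreover have "hall_condition I (r0 - D)" using D sub by (auto simp: \<A>_def)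
        ultimately show ?thesis using E by (simp add: hall_condition_def)
      qed
      moreover have "\<Union>\<C> \<subseteq> r0" using sub by (auto simp: \<A>_def)
      ultimately show ?thesis by (simp add: \<A>_def hall_condition_def)
    qed
  qed
  then obtain D where D: "D \<in> \<A>" and max: "\<And>X. X \<in> \<A> \<Longrightarrow> D \<subseteq> X \<Longrightarrow> X = D" by blast
  define r where "r = r0 - D"
  have hr: "hall_condition I r" using D by (simp add: r_def \<A>_def)
  have fr: "finite (r `` {i})" if "i \<in> I" for i
    by (rule finite_subset[OF _ fin[OF that]]) (auto simp: r_def)
  have min: "\<not> hall_condition I (r - {p})" if p: "p \<in> r" for p
  proof
    assume h: "hall_condition I (r - {p})"
    have "r - {p} = r0 - insert p D" by (auto simp: r_def)
    then have "insert p D \<in> \<A>" using h D p by (simp add: \<A>_def r_def)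
    then show False using max[of "insert p D"] p by (auto simp: r_def)
  qed
  have ex: "\<exists>x. (i, x) \<in> r" if "i \<in> I" for i
  proof -
    have "card {i} \<le> card (r `` {i})"
      using hr[unfolded hall_condition_def, rule_format, of "{i}"] that by simp
    then have "r `` {i} \<noteq> {}" by (intro notI) simp
    then show ?thesis by blast
  qed
  define f where "f i = (SOME x. (i, x) \<in> r)" for i
  have f: "(i, f i) \<in> r" if "i \<in> I" for i unfolding f_def by (rule someI_ex[OF ex[OF that]])
  have f_unique: "x = f i" if "i \<in> I" "(i, x) \<in> r" for i x
    by (rule minimal_hall_condition_single_valued[OF hr fr min that(1,2) f[OF that(1)]])
  have "inj_on f I"
  proof (rule inj_onI, rule ccontr)
    fix i j assume ij: "i \<in> I" "j \<in> I" "f i = f j" "i \<noteq> j"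
    have "r `` {i, j} \<subseteq> {f i}"
    proof
      fix x assume "x \<in> r `` {i, j}"
      then have "(i, x) \<in> r \<or> (j, x) \<in> r" by auto
      then show "x \<in> {f i}" using f_unique[of i x] f_unique[of j x] ij(1-3) by auto
    qed
    then have "card (r `` {i, j}) \<le> 1" using card_mono[of "{f i}" "r `` {i, j}"] by simp
    moreover have "card {i, j} \<le> card (r `` {i, j})"
      using hr[unfolded hall_condition_def, rule_format, of "{i, j}"] ij by simp
    ultimately show False using ij(4) by simp
  qed
  moreover have "(i, f i) \<in> r0" if "i \<in> I" for i using f[OF that] by (simp add: r_def)
  ultimately show thesis by (rule that)
qed

lemma invariant_mean_mono:
  assumes m: "invariant_mean G m" and f: "bounded (f ` carrier G)" and g: "bounded (g ` carrier G)"
    and le: "\<And>x. x \<in> carrier G \<Longrightarrow> f x \<le> g x"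
  shows "m f \<le> m g"
proof -
  have lin: "m (\<lambda>x. a * f x + b * g x) = a * m f + b * m g"
    if "bounded (f ` carrier G)" "bounded (g ` carrier G)" for f g a b
    using m that unfolding invariant_mean_def by blast
  have b: "bounded ((\<lambda>x. 1 * g x + (-1) * f x) ` carrier G)"
    using bounded_minus_comp[OF g f] by simp
  then have "0 \<le> m (\<lambda>x. 1 * g x + (-1) * f x)"
    using m le unfolding invariant_mean_def by simp
  then show ?thesis using lin[OF g f, of 1 "-1"] by simp
qed

lemma invariant_mean_sum:
  assumes m: "invariant_mean G m" and "finite J" and b: "\<And>j. j \<in> J \<Longrightarrow> bounded (f j ` carrier G)"
  shows "m (\<lambda>x. \<Sum>j\<in>J. f j x) = (\<Sum>j\<in>J. m (f j))" "bounded ((\<lambda>x. \<Sum>j\<in>J. f j x) ` carrier G)"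
proof -
  have lin: "m (\<lambda>x. a * f x + b * g x) = a * m f + b * m g"
    if "bounded (f ` carrier G)" "bounded (g ` carrier G)" for f g a b
    using m that unfolding invariant_mean_def by blast
  have "m (\<lambda>x. \<Sum>j\<in>J. f j x) = (\<Sum>j\<in>J. m (f j)) \<and> bounded ((\<lambda>x. \<Sum>j\<in>J. f j x) ` carrier G)"
    using assms(2) b
  proof (induction J)
    case empty
    have z: "bounded ((\<lambda>x. 0::real) ` carrier G)" by (metis bounded_empty bounded_insert bounded_subset image_subsetI insertI1)
    have "m (\<lambda>x. 0 * 0 + 0 * 0) = 0" using lin[OF z z, of 0 0] by simp
    then show ?case using z by simp
  next
    case (insert j J)
    then have 1: "bounded (f j ` carrier G)" "bounded ((\<lambda>x. \<Sum>j\<in>J. f j x) ` carrier G)"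
      "m (\<lambda>x. \<Sum>j\<in>J. f j x) = (\<Sum>j\<in>J. m (f j))" by auto
    have "m (\<lambda>x. 1 * f j x + 1 * (\<Sum>j\<in>J. f j x)) = 1 * m (f j) + 1 * (\<Sum>j\<in>J. m (f j))"
      using lin[OF 1(1,2), of 1 1] 1(3) by simp
    then show ?case using insert(1,2) bounded_plus_comp[OF 1(1,2)] by simp
  qed
  then show "m (\<lambda>x. \<Sum>j\<in>J. f j x) = (\<Sum>j\<in>J. m (f j))" "bounded ((\<lambda>x. \<Sum>j\<in>J. f j x) ` carrier G)" by auto
qed

lemma bounded_indicator_image: "bounded ((indicator A :: 'a \<Rightarrow> real) ` S)"
  by (rule boundedI[of _ 1]) (auto simp: indicator_def)

text \<open>The pieces A (b, p) cover two copies of the group, while their translates B (b, p) are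
  disjoint inside one copy because \<open>f\<close> is injective. An invariant mean would give 2 <=
  1.\<close>

lemma (in group) no_invariant_mean_if_doubling:
  assumes m: "invariant_mean G m" and P: "finite P" "P \<subseteq> carrier G"
    and inj: "inj_on f (carrier G \<times> (UNIV :: bool set))"
    and f: "\<And>x b. x \<in> carrier G \<Longrightarrow> \<exists>p\<in>P. f (x, b) = p \<otimes> x"
  shows False
proof -
  define A where "A = (\<lambda>(b :: bool, p). {x \<in> carrier G. f (x, b) = p \<otimes> x})"
  define B where "B = (\<lambda>(b, p). (\<lambda>x. p \<otimes> x) ` A (b, p))"
  let ?J = "(UNIV :: bool set) \<times> P"
  have fJ: "finite ?J" using P by simp
  have AB: "m (indicator (A j)) = m (indicator (B j))" if j: "j \<in> ?J" for j
  proof -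
    obtain b p where bp: "j = (b, p)" "p \<in> P" using j by blast
    have pc: "p \<in> carrier G" using bp P by blast
    have eq: "indicator (B j) (p \<otimes> x) = (indicator (A j) x :: real)" if x: "x \<in> carrier G" for x
    proof -
      have "p \<otimes> x \<in> B j \<longleftrightarrow> x \<in> A j"
      proof
        assume "p \<otimes> x \<in> B j"
        then obtain y where "y \<in> A j" "p \<otimes> x = p \<otimes> y" by (auto simp: B_def bp)
        moreover have "y \<in> carrier G" using calculation by (auto simp: A_def bp)
        ultimately show "x \<in> A j" using x pc by simp
      qed (auto simp: B_def bp)
      then show ?thesis by (simp add: indicator_def)
    qed
    have bd: "bounded ((\<lambda>x. indicator (B j) (p \<otimes> x) :: real) ` carrier G)"
      by (rule boundedI[of _ 1]) (auto simp: indicator_def)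
    have "m (indicator (B j)) = m (\<lambda>x. indicator (B j) (p \<otimes> x))"
      using m pc bounded_indicator_image[of "B j" "carrier G"] unfolding invariant_mean_def by metis
    also have "\<dots> = m (indicator (A j))"
      by (intro antisym invariant_mean_mono[OF m] bd bounded_indicator_image) (simp_all add: eq)
    finally show ?thesis by simp
  qed
  have one: "bounded ((\<lambda>x. 1 :: real) ` carrier G)" "bounded ((\<lambda>x. 2 :: real) ` carrier G)"
    by (rule boundedI[of _ 1], fastforce) (rule boundedI[of _ 2], fastforce)
  have "2 = m (\<lambda>x. 2)"
  proof -
    have "m (\<lambda>x. 1 * 1 + 1 * 1) = 1 * m (\<lambda>x. 1) + 1 * m (\<lambda>x. 1)"
      using m one unfolding invariant_mean_def by blast
    then show ?thesis using m unfolding invariant_mean_def by simp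
  qed
  also have "\<dots> \<le> m (\<lambda>x. \<Sum>j\<in>?J. indicator (A j) x)"
  proof (rule invariant_mean_mono[OF m one(2)])
    show "bounded ((\<lambda>x. \<Sum>j\<in>?J. indicator (A j) x :: real) ` carrier G)"
      by (rule invariant_mean_sum(2)[OF m fJ bounded_indicator_image])
    fix x assume x: "x \<in> carrier G"
    obtain p where p: "\<And>b. p b \<in> P" "\<And>b. f (x, b) = p b \<otimes> x" using f[OF x] by metis
    have "2 = (\<Sum>j\<in>(\<lambda>b. (b, p b)) ` UNIV. indicator (A j) x :: real)"
      using x p by (subst sum.reindex) (auto simp: inj_on_def A_def UNIV_bool)
    also have "\<dots> \<le> (\<Sum>j\<in>?J. indicator (A j) x)"
      by (rule sum_mono2[OF fJ]) (use p in auto)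
    finally show "2 \<le> (\<Sum>j\<in>?J. indicator (A j) x :: real)" .
  qed
  also have "\<dots> = (\<Sum>j\<in>?J. m (indicator (A j)))"
    by (rule invariant_mean_sum(1)[OF m fJ bounded_indicator_image])
  also have "\<dots> = (\<Sum>j\<in>?J. m (indicator (B j)))" by (rule sum.cong[OF refl AB])
  also have "\<dots> = m (\<lambda>x. \<Sum>j\<in>?J. indicator (B j) x)"
    by (rule invariant_mean_sum(1)[OF m fJ bounded_indicator_image, symmetric])
  also have "\<dots> \<le> m (\<lambda>x. 1)"
  proof (rule invariant_mean_mono[OF m _ one(1)])
    show "bounded ((\<lambda>x. \<Sum>j\<in>?J. indicator (B j) x :: real) ` carrier G)"
      by (rule invariant_mean_sum(2)[OF m fJ bounded_indicator_image])
    fix y assume y: "y \<in> carrier G"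
    have uniq: "j = j'" if jj: "j \<in> ?J" "j' \<in> ?J" "y \<in> B j" "y \<in> B j'" for j j'
    proof -
      obtain b p b' p' where bp: "j = (b, p)" "p \<in> P" "j' = (b', p')" "p' \<in> P" using jj by blast
      obtain x x' where x: "x \<in> A j" "y = p \<otimes> x" "x' \<in> A j'" "y = p' \<otimes> x'" using jj bp by (auto simp: B_def)
      then have "x \<in> carrier G" "x' \<in> carrier G" "f (x, b) = f (x', b')" using bp by (auto simp: A_def)
      then have "x = x'" "b = b'" using inj by (auto dest: inj_onD)
      moreover have "p \<otimes> x = p' \<otimes> x" using x calculation by simp
      then have "p = p'" using right_cancel[of x p p'] bp P \<open>x \<in> carrier G\<close> by blast
      ultimately show ?thesis using bp by simp
    qed
    have "(\<Sum>j\<in>?J. indicator (B j) y :: real) = (\<Sum>j\<in>{j \<in> ?J. y \<in> B j}. 1)"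
      by (rule sum.mono_neutral_cong_right[OF fJ]) (auto simp: indicator_def)
    also have "\<dots> \<le> 1"
    proof -
      have "card {j \<in> ?J. y \<in> B j} \<le> 1" using uniq fJ by (subst card_le_Suc0_iff_eq[folded One_nat_def]) auto
      then show ?thesis by simp
    qed
    finally show "(\<Sum>j\<in>?J. indicator (B j) y :: real) \<le> 1" .
  qed
  also have "m (\<lambda>x. 1) = 1" using m unfolding invariant_mean_def by blast
  finally show False by simp
qed

text \<open>If there are no Folner sets, some \<open>P\<close> doubles all finite sets, and Hall's theorem turns this
  into a paradoxical decomposition.\<close>

lemma (in group) amenable_folner:
  assumes am: "amenable_group G" and T: "finite T" "T \<subseteq> carrier G" and \<epsilon>: "0 < (\<epsilon> :: real)"
  obtains F where "finite F" "F \<noteq> {}" "F \<subseteq> carrier G"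
    "\<And>t. t \<in> T \<Longrightarrow> real (card ((\<lambda>x. t \<otimes> x) ` F - F)) \<le> \<epsilon> * real (card F)"
proof (rule ccontr)
  assume not_thesis: "\<not> thesis"
  note folner = that
  have no: "\<exists>t\<in>T. real (card ((\<lambda>x. t \<otimes> x) ` F - F)) > \<epsilon> * real (card F)"
    if "finite F" "F \<noteq> {}" "F \<subseteq> carrier G" for F
  proof (rule ccontr)
    assume *: "\<not> ?thesis"
    have thesis
    proof (rule folner[OF that])
      fix t assume "t \<in> T"
      then show "real (card ((\<lambda>x. t \<otimes> x) ` F - F)) \<le> \<epsilon> * real (card F)" using * by (auto simp: not_less)
    qed
    then show False using not_thesis by simp
  qed
  obtain m where m: "invariant_mean G m" using am by (auto simp: amenable_group_def)
  \<comment> \<open>With the unit added, \<open>A <#> F\<close> contains \<open>F\<close> together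
    with the new points of some translate, so each application gains the factor 1 +
    \<epsilon>.\<close>
  define A where "A = insert \<one> T"
  have A: "finite A" "A \<subseteq> carrier G" using T by (auto simp: A_def)
  have step: "finite (A <#> F) \<and> A <#> F \<subseteq> carrier G \<and> (1 + \<epsilon>) * real (card F) \<le> real (card (A <#> F))"
    if F: "finite F" "F \<subseteq> carrier G" for F
  proof (intro conjI)
    have "A <#> F = (\<lambda>(p, x). p \<otimes> x) ` (A \<times> F)" by (auto simp: set_mult_def)
    then show 1: "finite (A <#> F)" using A(1) F(1) by simp
    show "A <#> F \<subseteq> carrier G" by (rule set_mult_closed[OF A(2) F(2)])
    show "(1 + \<epsilon>) * real (card F) \<le> real (card (A <#> F))"
    proof (cases "F = {}")
      case False
      then obtain t where t: "t \<in> T" "real (card ((\<lambda>x. t \<otimes> x) ` F - F)) > \<epsilon> * real (card F)"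
        using no F by blast
      have "F \<subseteq> A <#> F"
      proof
        fix x assume x: "x \<in> F"
        then have "x = \<one> \<otimes> x" using F by auto
        then show "x \<in> A <#> F" using x unfolding set_mult_def A_def by blast
      qed
      then have sub: "F \<union> ((\<lambda>x. t \<otimes> x) ` F - F) \<subseteq> A <#> F" using t by (auto simp: set_mult_def A_def)
      have "real (card F) + real (card ((\<lambda>x. t \<otimes> x) ` F - F)) = real (card (F \<union> ((\<lambda>x. t \<otimes> x) ` F - F)))"
        using F by (subst card_Un_disjoint) auto
      also have "\<dots> \<le> real (card (A <#> F))" using card_mono[OF 1 sub] by simp
      finally show ?thesis using t by (simp add: algebra_simps)
    qed simp
  qed
  have iter: "\<exists>P. finite P \<and> P \<subseteq> carrier G \<and>
      (\<forall>F. finite F \<and> F \<subseteq> carrier G \<longrightarrow> (1 + \<epsilon>) ^ k * real (card F) \<le> real (card (P <#> F)))" for k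
  proof (induction k)
    case 0
    have "{\<one>} <#> F = F" if "F \<subseteq> carrier G" for F using that by (force simp: set_mult_def)
    then show ?case by (intro exI[of _ "{\<one>}"]) simp
  next
    case (Suc k)
    then obtain P where "finite P \<and> P \<subseteq> carrier G \<and>
      (\<forall>F. finite F \<and> F \<subseteq> carrier G \<longrightarrow> (1 + \<epsilon>) ^ k * real (card F) \<le> real (card (P <#> F)))"
      by (rule exE)
    then have P: "finite P" "P \<subseteq> carrier G"
      "\<And>F. finite F \<Longrightarrow> F \<subseteq> carrier G \<Longrightarrow> (1 + \<epsilon>) ^ k * real (card F) \<le> real (card (P <#> F))"
      by simp_all
    have "(1 + \<epsilon>) ^ Suc k * real (card F) \<le> real (card ((A <#> P) <#> F))"
      if F: "finite F" "F \<subseteq> carrier G" for F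
    proof -
      have "P <#> F = (\<lambda>(p, x). p \<otimes> x) ` (P \<times> F)" by (auto simp: set_mult_def)
      then have PF: "finite (P <#> F)" "P <#> F \<subseteq> carrier G"
        using P(1) F(1) set_mult_closed[OF P(2) F(2)] by simp_all
      have "(1 + \<epsilon>) ^ Suc k * real (card F) = (1 + \<epsilon>) * ((1 + \<epsilon>) ^ k * real (card F))" by simp
      also have "\<dots> \<le> (1 + \<epsilon>) * real (card (P <#> F))"
        using P(3)[OF F] \<epsilon> by (intro mult_left_mono) auto
      also have "\<dots> \<le> real (card (A <#> (P <#> F)))" using step[OF PF] by blast
      also have "A <#> (P <#> F) = (A <#> P) <#> F" using set_mult_assoc[OF A(2) P(2) F(2)] by simp
      finally show ?thesis .
    qed
    moreover have "finite (A <#> P)" "A <#> P \<subseteq> carrier G" using step[OF P(1,2)] by auto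
    ultimately show ?case by (intro exI[of _ "A <#> P"]) simp
  qed
  have "1 < 1 + \<epsilon>" using \<epsilon> by simp
  \<comment> \<open>Growth by more than 2 is exactly what the Hall condition for two copies of the
    group requires.\<close>
  then obtain k where k: "2 < (1 + \<epsilon>) ^ k" by (meson real_arch_pow)
  obtain P where P: "finite P" "P \<subseteq> carrier G" and
    grow: "\<And>F. finite F \<Longrightarrow> F \<subseteq> carrier G \<Longrightarrow> (1 + \<epsilon>) ^ k * real (card F) \<le> real (card (P <#> F))"
    using iter[of k] by metis
  define r0 where "r0 = {((x, b :: bool), y). x \<in> carrier G \<and> (\<exists>p\<in>P. y = p \<otimes> x)}"
  have hall: "hall_condition (carrier G \<times> UNIV) r0"
    unfolding hall_condition_def
  proof (intro allI impI)
    fix E :: "('a \<times> bool) set" assume E: "finite E \<and> E \<subseteq> carrier G \<times> UNIV"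
    let ?F = "fst ` E"
    have F: "finite ?F" "?F \<subseteq> carrier G" using E by auto
    have im: "r0 `` E = P <#> ?F" using E by (force simp: r0_def set_mult_def)
    have "E \<subseteq> ?F \<times> UNIV" by force
    then have "card E \<le> card (?F \<times> (UNIV :: bool set))" using F by (intro card_mono) auto
    then have "real (card E) \<le> 2 * real (card ?F)" by (simp add: card_cartesian_product)
    also have "\<dots> \<le> (1 + \<epsilon>) ^ k * real (card ?F)" using k by (intro mult_right_mono) auto
    also have "\<dots> \<le> real (card (r0 `` E))" using grow[OF F] im by simp
    finally show "card E \<le> card (r0 `` E)" by simp
  qed
  have fin: "finite (r0 `` {i})" if "i \<in> carrier G \<times> UNIV" for i
  proof -
    have "r0 `` {i} \<subseteq> (\<lambda>p. p \<otimes> fst i) ` P" by (auto simp: r0_def)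
    then show ?thesis using P finite_surj by blast
  qed
  obtain f where f: "inj_on f (carrier G \<times> (UNIV :: bool set))" "\<And>i. i \<in> carrier G \<times> UNIV \<Longrightarrow> (i, f i) \<in> r0"
    using hall_matching[OF hall fin] by blast
  show False
    by (rule no_invariant_mean_if_doubling[OF m P f(1)]) (use f(2) in \<open>auto simp: r0_def\<close>)
qed

section \<open>Growth and sparse nets\<close>

context group
begin

definition wprod :: "'a list \<Rightarrow> 'a" where
  "wprod w = foldr (\<otimes>) w \<one>"

definition word_ball :: "'a set \<Rightarrow> nat \<Rightarrow> 'a set" where
  "word_ball Q m = wprod ` {w. set w \<subseteq> Q \<and> length w \<le> m}"

lemma wprod_Nil [simp]: "wprod [] = \<one>" and wprod_Cons [simp]: "wprod (q # w) = q \<otimes> wprod w"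
  by (simp_all add: wprod_def)

lemma wprod_closed [simp]: "set w \<subseteq> carrier G \<Longrightarrow> wprod w \<in> carrier G"
  by (induction w) auto

lemma wprod_append: "set v \<subseteq> carrier G \<Longrightarrow> set w \<subseteq> carrier G \<Longrightarrow> wprod (v @ w) = wprod v \<otimes> wprod w"
  by (induction v) (auto simp: m_assoc)

lemma word_ballE:
  assumes "x \<in> word_ball Q m"
  obtains w where "set w \<subseteq> Q" "length w \<le> m" "x = wprod w"
  using assms by (auto simp: word_ball_def)

lemma word_ballI: "set w \<subseteq> Q \<Longrightarrow> length w \<le> m \<Longrightarrow> wprod w \<in> word_ball Q m"
  by (auto simp: word_ball_def)

lemma finite_word_ball: "finite Q \<Longrightarrow> finite (word_ball Q m)"
  unfolding word_ball_def by (intro finite_imageI finite_lists_length_le)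

lemma word_ball_closed: "Q \<subseteq> carrier G \<Longrightarrow> word_ball Q m \<subseteq> carrier G"
  by (auto elim!: word_ballE)

lemma one_in_word_ball: "\<one> \<in> word_ball Q m"
  using word_ballI[of "[]"] by simp

lemma word_ball_mono: "m \<le> l \<Longrightarrow> word_ball Q m \<subseteq> word_ball Q l"
  by (auto simp: word_ball_def)

lemma word_ball_mult:
  assumes "Q \<subseteq> carrier G" "x \<in> word_ball Q m" "y \<in> word_ball Q l"
  shows "x \<otimes> y \<in> word_ball Q (m + l)"
proof -
  obtain v where v: "set v \<subseteq> Q" "length v \<le> m" "x = wprod v" using assms(2) by (rule word_ballE)
  obtain w where w: "set w \<subseteq> Q" "length w \<le> l" "y = wprod w" using assms(3) by (rule word_ballE)
  have "x \<otimes> y = wprod (v @ w)" using v w assms(1) by (subst wprod_append) auto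
  then show ?thesis using v w by (auto intro!: word_ballI)
qed

lemma generator_in_word_ball: "Q \<subseteq> carrier G \<Longrightarrow> q \<in> Q \<Longrightarrow> q \<in> word_ball Q 1"
  using word_ballI[of "[q]" Q 1] by auto

lemma wprod_inv:
  assumes "Q \<subseteq> carrier G" "m_inv G ` Q \<subseteq> Q" "set w \<subseteq> Q"
  shows "inv (wprod w) = wprod (rev (map (m_inv G) w))"
  using assms(3)
proof (induction w)
  case (Cons q w)
  have c: "q \<in> carrier G" "set w \<subseteq> carrier G" "set (rev (map (m_inv G) w)) \<subseteq> carrier G"
    using Cons.prems assms by auto
  then have "inv (wprod (q # w)) = inv (wprod w) \<otimes> inv q" by (simp add: inv_mult_group)
  also have "\<dots> = wprod (rev (map (m_inv G) w) @ [inv q])"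
    using c Cons by (subst wprod_append) auto
  finally show ?case by simp
qed simp

lemma word_ball_inv:
  assumes "Q \<subseteq> carrier G" "m_inv G ` Q \<subseteq> Q" "x \<in> word_ball Q m"
  shows "inv x \<in> word_ball Q m"
proof -
  obtain w where w: "set w \<subseteq> Q" "length w \<le> m" "x = wprod w" using assms(3) by (rule word_ballE)
  have "set (rev (map (m_inv G) w)) \<subseteq> Q" using w assms(2) by auto
  then show ?thesis using wprod_inv[OF assms(1,2) w(1)] w word_ballI[of "rev (map (m_inv G) w)" Q m] by simp
qed

lemma generate_eq_word_balls:
  assumes "Q \<subseteq> carrier G" "m_inv G ` Q \<subseteq> Q"
  shows "generate G Q = (\<Union>m. word_ball Q m)"
proof (intro subset_antisym subsetI)
  fix x assume "x \<in> generate G Q"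
  then show "x \<in> (\<Union>m. word_ball Q m)"
  proof induction
    case one
    then show ?case using one_in_word_ball by blast
  next
    case (incl h)
    then show ?case using generator_in_word_ball[OF assms(1)] by blast
  next
    case (inv h)
    then show ?case using generator_in_word_ball[OF assms(1), of "inv h"] assms(2) by blast
  next
    case (eng h1 h2)
    then show ?case using word_ball_mult[OF assms(1)] by blast
  qed
next
  fix x assume "x \<in> (\<Union>m. word_ball Q m)"
  then obtain m where "x \<in> word_ball Q m" by blast
  then obtain w where w: "set w \<subseteq> Q" "x = wprod w" by (rule word_ballE)
  have "wprod w \<in> generate G Q" using w(1)
    by (induction w) (auto intro: generate.one generate.eng generate.incl)
  then show "x \<in> generate G Q" using w by simp
qed

text \<open>Steps multiply on the left, as the permutations of a sofic model do, so that this graph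
  can be copied into the tiles.\<close>

definition net_rel :: "'a set \<Rightarrow> nat \<Rightarrow> 'a set \<Rightarrow> ('a \<times> 'a) set" where
  "net_rel Q l Y = {(y, y'). y \<in> Y \<and> y' \<in> Y \<and> (\<exists>q\<in>word_ball Q l. y' = q \<otimes> y)}"

text \<open>Dense enough to be a net, yet with \<open>K\<close> times fewer points per unit of length, so that a spanning
  forest of paths of length \<open>l\<close> costs little; the components of \<open>net_rel\<close> are infinite, so
  few additional edges are needed to connect them to each other.\<close>

definition sparse_net :: "'a set \<Rightarrow> bool" where
  "sparse_net Q \<longleftrightarrow> (\<forall>K :: real. \<exists>S l Y D.
     finite S \<and> S \<subseteq> carrier G \<and> Y \<subseteq> carrier G \<and> finite D \<and> D \<subseteq> carrier G \<and>
     K * (real l + 1) \<le> real (card D) \<and> inj_on (\<lambda>(d, y). d \<otimes> y) (D \<times> Y) \<and>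
     (\<forall>x\<in>carrier G. \<exists>s\<in>S. \<exists>y\<in>Y. x = s \<otimes> y) \<and>
     (\<forall>M :: nat. \<exists>r. \<forall>y\<in>Y. M \<le> card {y'. (y, y') \<in> net_rel Q l Y ^^ r}))"

lemma net_rel_pow_subset:
  assumes "Q \<subseteq> carrier G" "Y \<subseteq> carrier G" "(y, y') \<in> net_rel Q l Y ^^ r" "y \<in> Y"
  shows "y' \<in> Y \<and> (\<exists>q\<in>word_ball Q (r * l). y' = q \<otimes> y)"
  using assms(3)
proof (induction r arbitrary: y')
  case 0
  then show ?case using assms one_in_word_ball by (intro conjI bexI[of _ \<one>]) auto
next
  case (Suc r)
  then obtain x where x: "(y, x) \<in> net_rel Q l Y ^^ r" "(x, y') \<in> net_rel Q l Y" by auto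
  obtain q where q: "q \<in> word_ball Q (r * l)" "x = q \<otimes> y" using Suc.IH[OF x(1)] by blast
  obtain q' where q': "q' \<in> word_ball Q l" "y' = q' \<otimes> x" "y' \<in> Y" using x(2) by (auto simp: net_rel_def)
  have "q \<in> carrier G" "q' \<in> carrier G" "y \<in> carrier G"
    using q q' word_ball_closed[OF assms(1)] assms by auto
  then have "y' = (q' \<otimes> q) \<otimes> y" using q q' by (simp add: m_assoc)
  moreover have "q' \<otimes> q \<in> word_ball Q (Suc r * l)"
    using word_ball_mult[OF assms(1) q'(1) q(1)] by simp
  ultimately show ?case using q'(3) by blast
qed

text \<open>A ball that does not grow in one step is already everything that can be reached; if
  infinitely many points can be reached, the ball of radius r therefore has at least r
  points.\<close>

lemma net_component_large:
  assumes Q: "finite Q" "Q \<subseteq> carrier G" and Y: "Y \<subseteq> carrier G" "y \<in> Y"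
    and inf: "infinite {y'. (y, y') \<in> (net_rel Q l Y)\<^sup>*}"
  shows "M \<le> card {y'. (y, y') \<in> net_rel Q l Y ^^ M}"
proof -
  define B where "B r = {y'. (y, y') \<in> net_rel Q l Y ^^ r}" for r
  have refl: "(x, x) \<in> net_rel Q l Y" if "x \<in> Y" for x
    using that Y one_in_word_ball[of Q l] by (auto simp: net_rel_def intro!: bexI[of _ \<one>])
  have BY: "B r \<subseteq> Y" for r using net_rel_pow_subset[OF Q(2) Y(1) _ Y(2)] by (auto simp: B_def)
  have fB: "finite (B r)" for r
  proof (rule finite_subset)
    show "B r \<subseteq> (\<lambda>q. q \<otimes> y) ` word_ball Q (r * l)"
      using net_rel_pow_subset[OF Q(2) Y(1) _ Y(2)] unfolding B_def by (intro subsetI) blast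
  qed (simp add: finite_word_ball Q)
  have B_Suc: "B (Suc r) = net_rel Q l Y `` B r" for r by (auto simp: B_def)
  have mono: "B r \<subseteq> B (Suc r)" for r
    using BY[of r] refl unfolding B_Suc by blast
  have strict: "B r \<noteq> B (Suc r)" for r
  proof
    assume eq: "B r = B (Suc r)"
    have "y' \<in> B r" if "(y, y') \<in> (net_rel Q l Y)\<^sup>*" for y'
      using that
    proof induction
      case base
      have "y \<in> B j" for j
      proof (induction j)
        case (Suc j)
        then show ?case using mono[of j] by blast
      qed (simp add: B_def)
      then show ?case .
    next
      case (step x z)
      then have "z \<in> B (Suc r)" unfolding B_Suc by blast
      then show ?case using eq by simp
    qed
    then have "{y'. (y, y') \<in> (net_rel Q l Y)\<^sup>*} \<subseteq> B r" by blast
    then show False using inf fB[of r] finite_subset by auto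
  qed
  have "r \<le> card (B r)" for r
  proof (induction r)
    case (Suc r)
    have "card (B r) < card (B (Suc r))"
      by (rule psubset_card_mono[OF fB]) (use mono strict in blast)
    then show ?case using Suc by simp
  qed simp
  then show ?thesis by (simp add: B_def)
qed

text \<open>The counterpart of \<open>ex_separated_net\<close> in the group itself, where the net
  may be infinite and Zorn's lemma replaces finiteness.\<close>

lemma ex_maximal_inj_mult:
  obtains Y where "Y \<subseteq> carrier G" "inj_on (\<lambda>(d, y). d \<otimes> y) (D \<times> Y)"
    "\<And>x. x \<in> carrier G \<Longrightarrow> x \<notin> Y \<Longrightarrow> \<not> inj_on (\<lambda>(d, y). d \<otimes> y) (D \<times> insert x Y)"
proof -
  let ?A = "{Y. Y \<subseteq> carrier G \<and> inj_on (\<lambda>(d, y). d \<otimes> y) (D \<times> Y)}"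
  have "\<exists>M\<in>?A. \<forall>X\<in>?A. M \<subseteq> X \<longrightarrow> X = M"
  proof (rule subset_Zorn')
    fix C assume chain: "subset.chain ?A C"
    then have sub: "C \<subseteq> ?A" by (simp add: subset.chain_def)
    have "inj_on (\<lambda>(d, y). d \<otimes> y) (D \<times> \<Union>C)"
    proof (rule inj_onI)
      fix p p' assume p: "p \<in> D \<times> \<Union>C" "p' \<in> D \<times> \<Union>C" and eq: "(case p of (d, y) \<Rightarrow> d \<otimes> y) = (case p' of (d, y) \<Rightarrow> d \<otimes> y)"
      obtain X X' where X: "X \<in> C" "snd p \<in> X" "X' \<in> C" "snd p' \<in> X'" using p by force
      have "X \<subseteq> X' \<or> X' \<subseteq> X" using chain X unfolding subset_chain_def by blast
      then obtain X'' where "X'' \<in> C" "snd p \<in> X''" "snd p' \<in> X''" using X by blast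
      then have "inj_on (\<lambda>(d, y). d \<otimes> y) (D \<times> X'')" "p \<in> D \<times> X''" "p' \<in> D \<times> X''" using sub p by auto
      then show "p = p'" using eq unfolding inj_on_def by blast
    qed
    then show "\<Union>C \<in> ?A" using sub by blast
  qed
  then obtain Y where Y: "Y \<in> ?A" and max: "\<forall>X\<in>?A. Y \<subseteq> X \<longrightarrow> X = Y" by (rule bexE)
  show thesis
  proof (rule that[of Y])
    show "Y \<subseteq> carrier G" "inj_on (\<lambda>(d, y). d \<otimes> y) (D \<times> Y)" using Y by simp_all
    fix x assume x: "x \<in> carrier G" "x \<notin> Y"
    show "\<not> inj_on (\<lambda>(d, y). d \<otimes> y) (D \<times> insert x Y)"
    proof
      assume "inj_on (\<lambda>(d, y). d \<otimes> y) (D \<times> insert x Y)"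
      then have "insert x Y \<in> ?A" using x Y by simp
      then have "insert x Y = Y" using max by blast
      then show False using x by blast
    qed
  qed
qed

text \<open>\<open>Y\<close> is a maximal set with disjoint balls of radius m, so balls of radius 2
  m around it cover the group. Net points whose covering balls contain neighbouring elements differ
  by a word of length l = 2 m + 1 + 2 m; the factor 4 m + 2 in the growth hypothesis is l +
  1.\<close>

lemma sparse_net_superlinear:
  assumes Q: "finite Q" "Q \<subseteq> carrier G" "m_inv G ` Q \<subseteq> Q"
    and growth: "\<And>K :: real. \<exists>m. K * (4 * real m + 2) \<le> real (card (word_ball Q m))"
  shows "sparse_net Q"
  unfolding sparse_net_def
proof
  fix K :: real
  obtain m where m: "K * (4 * real m + 2) \<le> real (card (word_ball Q m))" using growth by blast
  define D where "D = word_ball Q m"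
  define l where "l = 4 * m + 1"
  have Dc: "finite D" "D \<subseteq> carrier G" using finite_word_ball[OF Q(1)] word_ball_closed[OF Q(2)] by (auto simp: D_def)
  obtain Y where Y: "Y \<subseteq> carrier G" "inj_on (\<lambda>(d, y). d \<otimes> y) (D \<times> Y)"
    and max: "\<And>x. x \<in> carrier G \<Longrightarrow> x \<notin> Y \<Longrightarrow> \<not> inj_on (\<lambda>(d, y). d \<otimes> y) (D \<times> insert x Y)"
    using ex_maximal_inj_mult[of D] by blast
  define S where "S = word_ball Q (2 * m)"
  have Sc: "finite S" "S \<subseteq> carrier G" using finite_word_ball[OF Q(1)] word_ball_closed[OF Q(2)] by (auto simp: S_def)
  have cover: "\<exists>s\<in>S. \<exists>y\<in>Y. x = s \<otimes> y" if x: "x \<in> carrier G" for x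
  proof (cases "x \<in> Y")
    case True
    then show ?thesis using x one_in_word_ball[of Q "2 * m"] by (intro bexI[of _ \<one>] bexI[of _ x]) (auto simp: S_def)
  next
    case False
    obtain d y d' y' where *: "d \<in> D" "y \<in> insert x Y" "d' \<in> D" "y' \<in> insert x Y" "d \<otimes> y = d' \<otimes> y'" "(d, y) \<noteq> (d', y')"
      using max[OF x False] by (auto simp: inj_on_def)
    have main: "\<exists>s\<in>S. \<exists>y\<in>Y. x = s \<otimes> y" if "e \<in> D" "e' \<in> D" "z \<in> Y" "e \<otimes> x = e' \<otimes> z" for e e' z
    proof -
      have c: "e \<in> carrier G" "e' \<in> carrier G" "z \<in> carrier G" using that Dc Y by auto
      have "x = inv e \<otimes> (e \<otimes> x)" using c x by (simp add: m_assoc[symmetric])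
      also have "\<dots> = (inv e \<otimes> e') \<otimes> z" using that c by (simp add: m_assoc)
      finally have "x = (inv e \<otimes> e') \<otimes> z" .
      moreover have "inv e \<otimes> e' \<in> S"
        using word_ball_mult[OF Q(2) word_ball_inv[OF Q(2,3), of e m], of e' m] that by (simp add: S_def D_def mult_2)
      ultimately show ?thesis using that(3) by blast
    qed
    consider "y \<in> Y" "y' \<in> Y" | "y = x" "y' \<in> Y" | "y \<in> Y" "y' = x" | "y = x" "y' = x" using * by blast
    then show ?thesis
    proof cases
      case 1
      then show ?thesis using inj_onD[OF Y(2), of "(d, y)" "(d', y')"] * by auto
    next
      case 2
      then show ?thesis using main[of d d' y'] * by simp
    next
      case 3
      then show ?thesis using main[of d' d y] * by simp
    next
      case 4
      have "d \<in> carrier G" "d' \<in> carrier G" using * Dc by auto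
      then have "d = d'" using right_cancel[OF x, of d d'] *(5) 4 by simp
      then show ?thesis using *(6) 4 by simp
    qed
  qed
  \<comment> \<open>A walk along the letters of a word is shadowed by net points at distance at most
    2 m, each linked to the next. If the net points reachable from \<open>y\<close> were finitely
    many, all word balls would have bounded size.\<close>
  have inf: "infinite {y'. (y, y') \<in> (net_rel Q l Y)\<^sup>*}" if y: "y \<in> Y" for y
  proof
    let ?C = "{y'. (y, y') \<in> (net_rel Q l Y)\<^sup>*}"
    assume fC: "finite ?C"
    have reach: "\<exists>s\<in>S. \<exists>y'\<in>?C \<inter> Y. wprod w \<otimes> y = s \<otimes> y'" if "set w \<subseteq> Q" for w
      using that
    proof (induction w)
      case Nil
      then show ?case using y one_in_word_ball[of Q "2 * m"] by (intro bexI[of _ \<one>] bexI[of _ y]) (auto simp: S_def)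
    next
      case (Cons q w)
      then obtain s y' where s: "s \<in> S" "y' \<in> ?C" "y' \<in> Y" "wprod w \<otimes> y = s \<otimes> y'" by auto
      have c: "q \<in> carrier G" "wprod w \<in> carrier G" "s \<in> carrier G" "y' \<in> carrier G" "y \<in> carrier G"
        using Cons.prems Q s Sc Y y by (auto intro!: wprod_closed)
      obtain s2 y2 where s2: "s2 \<in> S" "y2 \<in> Y" "q \<otimes> (s \<otimes> y') = s2 \<otimes> y2"
        using cover[of "q \<otimes> (s \<otimes> y')"] c by auto
      have c2: "s2 \<in> carrier G" "y2 \<in> carrier G" using s2 Sc Y by auto
      have "y2 = inv s2 \<otimes> (s2 \<otimes> y2)" using c2 by (simp add: m_assoc[symmetric])
      also have "\<dots> = (inv s2 \<otimes> (q \<otimes> s)) \<otimes> y'" using s2(3)[symmetric] c c2 by (simp add: m_assoc)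
      finally have "y2 = (inv s2 \<otimes> (q \<otimes> s)) \<otimes> y'" .
      moreover have "inv s2 \<otimes> (q \<otimes> s) \<in> word_ball Q (2 * m + (1 + 2 * m))"
        using word_ball_inv[OF Q(2,3), of s2] generator_in_word_ball[OF Q(2), of q] s2 s Cons.prems
        unfolding S_def by (intro word_ball_mult[OF Q(2)]) auto
      moreover have "2 * m + (1 + 2 * m) = l" by (simp add: l_def)
      ultimately have "(y', y2) \<in> net_rel Q l Y" unfolding net_rel_def using s(3) s2(2) by auto
      then have "y2 \<in> ?C" using s(2) by (auto intro: rtrancl_into_rtrancl)
      moreover have "wprod (q # w) \<otimes> y = s2 \<otimes> y2" using s(4) s2(3) c by (simp add: m_assoc)
      ultimately show ?case using s2 by blast
    qed
    have bound: "card (word_ball Q j) \<le> card (S \<times> ?C)" for j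
    proof -
      have "(\<lambda>x. x \<otimes> y) ` word_ball Q j \<subseteq> (\<lambda>(s, z). s \<otimes> z) ` (S \<times> ?C)"
      proof (rule image_subsetI)
        fix x assume "x \<in> word_ball Q j"
        then obtain w where "set w \<subseteq> Q" "x = wprod w" by (rule word_ballE)
        then obtain s y' where "s \<in> S" "y' \<in> ?C" "x \<otimes> y = s \<otimes> y'" using reach by blast
        then show "x \<otimes> y \<in> (\<lambda>(s, z). s \<otimes> z) ` (S \<times> ?C)" by (intro image_eqI[of _ _ "(s, y')"]) auto
      qed
      then have "card ((\<lambda>x. x \<otimes> y) ` word_ball Q j) \<le> card ((\<lambda>(s, z). s \<otimes> z) ` (S \<times> ?C))"
        using Sc fC by (intro card_mono) auto
      also have "\<dots> \<le> card (S \<times> ?C)" using Sc fC by (intro card_image_le) auto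
      also have "card ((\<lambda>x. x \<otimes> y) ` word_ball Q j) = card (word_ball Q j)"
        by (rule card_image) (use y Y word_ball_closed[OF Q(2), of j] in \<open>auto intro!: inj_onI simp: subset_iff\<close>)
      finally show ?thesis .
    qed
    obtain j where j: "(real (card (S \<times> ?C)) + 1) * (4 * real j + 2) \<le> real (card (word_ball Q j))"
      using growth by blast
    have "real (card (S \<times> ?C)) + 1 \<le> (real (card (S \<times> ?C)) + 1) * (4 * real j + 2)"
      by (simp add: mult_le_cancel_left1)
    then show False using j bound[of j] by linarith
  qed
  have "\<exists>r. \<forall>y\<in>Y. M \<le> card {y'. (y, y') \<in> net_rel Q l Y ^^ r}" for M
    using net_component_large[OF Q(1,2) Y(1) _ inf] by blast
  moreover have "K * (real l + 1) \<le> real (card D)" using m by (simp add: l_def D_def algebra_simps)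
  ultimately show "\<exists>S l Y D. finite S \<and> S \<subseteq> carrier G \<and> Y \<subseteq> carrier G \<and> finite D \<and> D \<subseteq> carrier G \<and>
     K * (real l + 1) \<le> real (card D) \<and> inj_on (\<lambda>(d, y). d \<otimes> y) (D \<times> Y) \<and>
     (\<forall>x\<in>carrier G. \<exists>s\<in>S. \<exists>y\<in>Y. x = s \<otimes> y) \<and>
     (\<forall>M :: nat. \<exists>r. \<forall>y\<in>Y. M \<le> card {y'. (y, y') \<in> net_rel Q l Y ^^ r})"
    using Sc Y Dc cover by (intro exI[of _ S] exI[of _ l] exI[of _ Y] exI[of _ D]) simp
qed

end

text \<open>A finite Morse-Hedlund argument.\<close>

lemma few_factors_periodic:
  assumes len: "length w = M + r" and r: "r < M"
    and few: "card ((\<lambda>i. take r (drop i w)) ` {..<M}) \<le> r"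
  obtains i p where "1 \<le> p" "p \<le> r" "i \<le> 2 * r" "\<And>k. k + 2 * r < M \<Longrightarrow> w ! (i + k) = w ! (i + p + k)"
proof -
  define f where "f l i = take l (drop i w)" for l i
  have f_take: "f l i = take l (f l' i)" if "l \<le> l'" for l l' i using that by (simp add: f_def min_def)
  have f_Suc: "f (Suc l) i = f l i @ [w ! (i + l)]" if "l < r" "i < M" for l i
    using that len by (simp add: f_def take_Suc_conv_app_nth)
  have img: "f l ` {..<M} = take l ` f l' ` {..<M}" if "l \<le> l'" for l l'
    using f_take[OF that] by (simp add: image_image)
  \<comment> \<open>The number of factors is 1 for length 0 and at most r for length r, so it cannot
    increase at each of the r steps between.\<close>
  have "\<exists>l<r. card (f (Suc l) ` {..<M}) \<le> card (f l ` {..<M})"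
  proof (rule ccontr)
    assume *: "\<not> ?thesis"
    have "Suc l \<le> card (f l ` {..<M})" if "l \<le> r" for l
      using that
    proof (induction l)
      case 0
      have "f 0 ` {..<M} = {[]}" using r by (auto simp: f_def)
      then show ?case by simp
    next
      case (Suc l)
      then have "card (f l ` {..<M}) < card (f (Suc l) ` {..<M})" using * by (meson Suc_le_lessD not_le)
      then show ?case using Suc by simp
    qed
    from this[of r] show False using few by (simp add: f_def)
  qed
  then obtain l where l: "l < r" "card (f (Suc l) ` {..<M}) \<le> card (f l ` {..<M})" by blast
  have "card (take l ` f (Suc l) ` {..<M}) = card (f (Suc l) ` {..<M})"
    using l(2) img[of l "Suc l"] card_image_le[of "f (Suc l) ` {..<M}" "take l"] by simp
  then have inj: "inj_on (take l) (f (Suc l) ` {..<M})"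
    by (intro eq_card_imp_inj_on) simp_all
  \<comment> \<open>Where the number of factors does not increase, a factor of length l has only one
    continuation.\<close>
  have det: "f (Suc l) i = f (Suc l) j" if "i < M" "j < M" "f l i = f l j" for i j
  proof (rule inj_onD[OF inj])
    show "take l (f (Suc l) i) = take l (f (Suc l) j)"
      using that f_take[of l "Suc l" i] f_take[of l "Suc l" j] by simp
  qed (use that in auto)
  have det': "w ! (i + l) = w ! (j + l)" if "i < M" "j < M" "f l i = f l j" for i j
    using det[OF that] f_Suc[OF l(1) that(1)] f_Suc[OF l(1) that(2)] by simp
  have shift: "f l (Suc i) = f l (Suc j)" if "i < M" "j < M" "f l i = f l j" for i j
  proof -
    have "f l (Suc i) = tl (f (Suc l) i)" for i
      by (simp add: f_def tl_take tl_drop[symmetric] drop_Suc)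
    then show ?thesis using det[OF that] by simp
  qed
  \<comment> \<open>At the first r + 1 positions only r different factors are available, so one of
    them repeats.\<close>
  have "card (f l ` {..r}) < card {..r}"
  proof -
    have "card (f l ` {..r}) \<le> card (f l ` {..<M})" using r by (intro card_mono image_mono) auto
    also have "\<dots> \<le> card (f r ` {..<M})" using img[of l r] l(1) by (simp add: card_image_le)
    also have "\<dots> \<le> r" using few by (simp add: f_def)
    finally show ?thesis by simp
  qed
  then have "\<not> inj_on (f l) {..r}" by (rule pigeonhole)
  then obtain i j where ij: "i < j" "j \<le> r" "f l i = f l j"
    unfolding inj_on_def by (metis atMost_iff linorder_neqE_nat)
  have step: "f l (i + k) = f l (j + k)" if "k + r < M" for k
    using that
  proof (induction k)
    case 0
    then show ?case using ij by simp
  next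
    case (Suc k)
    then show ?case using shift[of "i + k" "j + k"] ij by simp
  qed
  show thesis
  \<comment> \<open>Equal factors at i < j stay equal under shifting both positions, so from
    position i + l on the letters repeat with period j - i. Both i and l are at most r, whence the
    bound 2 r.\<close>
  proof (rule that[of "j - i" "i + l"])
    fix k assume k: "k + 2 * r < M"
    have "w ! (i + k + l) = w ! (j + k + l)"
      by (rule det') (use k ij step[of k] in auto)
    moreover have "i + l + (j - i) + k = j + k + l" using ij by simp
    ultimately show "w ! (i + l + k) = w ! (i + l + (j - i) + k)" by (simp add: add_ac)
  qed (use ij l in auto)
qed

section \<open>Minimal words, and elements of infinite order under linear growth\<close>

context group
begin

text \<open>Shortlex normal forms, the letters being ordered through \<iota>. The order is
  well-founded, total and compatible with concatenation, which yields existence, uniqueness and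
  closure under factors.\<close>

definition min_word :: "('a \<Rightarrow> nat) \<Rightarrow> 'a set \<Rightarrow> 'a list \<Rightarrow> bool" where
  "min_word \<iota> Q w \<longleftrightarrow> set w \<subseteq> Q \<and>
     (\<forall>v. set v \<subseteq> Q \<and> wprod v = wprod w \<longrightarrow> (map \<iota> v, map \<iota> w) \<notin> lenlex less_than)"

lemma ex_min_word:
  assumes "x \<in> word_ball Q m"
  obtains w where "min_word \<iota> Q w" "wprod w = x"
proof -
  let ?W = "{w. set w \<subseteq> Q \<and> wprod w = x}"
  have "wf (inv_image (lenlex less_than) (map \<iota>))" by (intro wf_inv_image wf_lenlex wf_less_than)
  moreover obtain w0 where "w0 \<in> ?W" using assms by (auto elim: word_ballE)
  ultimately obtain w where w: "w \<in> ?W" "\<And>v. (v, w) \<in> inv_image (lenlex less_than) (map \<iota>) \<Longrightarrow> v \<notin> ?W"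
    by (rule wfE_min) blast
  have "min_word \<iota> Q w" using w unfolding min_word_def by (auto simp: in_inv_image)
  then show thesis using w(1) by (intro that) auto
qed

lemma min_word_unique:
  assumes "inj_on \<iota> Q" "min_word \<iota> Q v" "min_word \<iota> Q w" "wprod v = wprod w"
  shows "v = w"
proof -
  have "map \<iota> v = map \<iota> w"
  proof (rule ccontr)
    assume "map \<iota> v \<noteq> map \<iota> w"
    then have "(map \<iota> v, map \<iota> w) \<in> lenlex less_than \<or> (map \<iota> w, map \<iota> v) \<in> lenlex less_than"
      using total_lenlex[OF total_less_than] by (auto simp: total_on_def)
    then show False using assms(2-4) by (auto simp: min_word_def)
  qed
  then show ?thesis
    using assms(1-3) by (auto simp: min_word_def dest!: map_inj_on intro: inj_on_subset)
qed

lemma min_word_factor: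
  assumes Q: "Q \<subseteq> carrier G" and w: "min_word \<iota> Q (u @ v @ x)"
  shows "min_word \<iota> Q v"
proof -
  have sub: "set u \<subseteq> Q" "set v \<subseteq> Q" "set x \<subseteq> Q" using w by (auto simp: min_word_def)
  have "(map \<iota> v', map \<iota> v) \<notin> lenlex less_than" if v': "set v' \<subseteq> Q" "wprod v' = wprod v" for v'
  proof
    assume *: "(map \<iota> v', map \<iota> v) \<in> lenlex less_than"
    have c: "set u \<subseteq> carrier G" "set v \<subseteq> carrier G" "set x \<subseteq> carrier G" "set v' \<subseteq> carrier G"
      using sub v' Q by auto
    have "wprod (u @ v' @ x) = wprod (u @ v @ x)" using c v' by (simp add: wprod_append)
    moreover have "set (u @ v' @ x) \<subseteq> Q" using sub v' by auto
    moreover have "(map \<iota> v' @ map \<iota> x, map \<iota> v @ map \<iota> x) \<in> lenlex less_than"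
      by (rule lenlex_append1[OF *]) simp
    then have "(map \<iota> (u @ v' @ x), map \<iota> (u @ v @ x)) \<in> lenlex less_than"
      by (simp add: lenlex_append2 irrefl_less_than)
    ultimately show False using w unfolding min_word_def by blast
  qed
  then show ?thesis using sub by (auto simp: min_word_def)
qed

lemma min_word_trivial:
  assumes "min_word \<iota> Q w" "wprod w = \<one>"
  shows "w = []"
  using assms(1)[unfolded min_word_def, THEN conjunct2, rule_format, of "[]"] assms(2) by simp

text \<open>Otherwise there are more than r minimal words of each length r >= 1. They represent
  distinct elements, so the ball of radius m has at least m^2/2 elements, which exceeds a linear
  bound.\<close>

lemma min_word_sphere_small:
  assumes Q: "finite Q" "Q \<subseteq> carrier G" and \<iota>: "inj_on \<iota> Q"
    and linear: "\<And>m. real (card (word_ball Q m)) \<le> K * (4 * real m + 2)"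
  shows "\<exists>r. 1 \<le> r \<and> card {w. min_word \<iota> Q w \<and> length w = r} \<le> r"
proof (rule ccontr)
  define W where "W r = {w. min_word \<iota> Q w \<and> length w = r}" for r
  assume no: "\<not> ?thesis"
  have big: "r < card (W r)" if "1 \<le> r" for r using no that unfolding W_def by (meson not_le)
  have fW: "finite (W r)" for r
    by (rule finite_subset[OF _ finite_lists_length_eq[OF Q(1), of r]]) (auto simp: W_def min_word_def)
  have le: "(\<Sum>r\<in>{1..m}. card (W r)) \<le> card (word_ball Q m)" for m
  proof -
    have "(\<Sum>r\<in>{1..m}. card (W r)) = card (\<Union>r\<in>{1..m}. W r)"
      by (rule card_UN_disjoint[symmetric]) (auto simp: fW, auto simp: W_def)
    also have "\<dots> \<le> card (word_ball Q m)"
    proof (rule card_inj_on_le[of wprod])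
      show "inj_on wprod (\<Union>r\<in>{1..m}. W r)"
        by (auto simp: W_def intro!: inj_onI min_word_unique[OF \<iota>])
      show "wprod ` (\<Union>r\<in>{1..m}. W r) \<subseteq> word_ball Q m"
        by (auto simp: W_def min_word_def intro!: word_ballI)
    qed (rule finite_word_ball[OF Q(1)])
    finally show ?thesis .
  qed
  have sq: "real m ^ 2 / 2 \<le> K * (4 * real m + 2)" for m
  proof -
    have "real m ^ 2 / 2 \<le> (\<Sum>r\<in>{1..m}. real r)"
      by (induction m) (auto simp: power2_eq_square algebra_simps)
    also have "\<dots> \<le> (\<Sum>r\<in>{1..m}. real (card (W r)))"
      using big by (intro sum_mono) (simp add: less_imp_le)
    also have "\<dots> \<le> real (card (word_ball Q m))" using le[of m] by (metis of_nat_le_iff of_nat_sum)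
    finally show ?thesis using linear[of m] by linarith
  qed
  \<comment> \<open>Large enough for both 8 m + 4 <= 12 m and 12 |K| < m.\<close>
  obtain m :: nat where m: "12 * \<bar>K\<bar> + 1 < real m" using reals_Archimedean2 by blast
  have "real m ^ 2 \<le> K * (8 * real m + 4)" using sq[of m] by (simp add: algebra_simps)
  also have "\<dots> \<le> \<bar>K\<bar> * (8 * real m + 4)" by (intro mult_right_mono) auto
  also have "\<dots> \<le> \<bar>K\<bar> * (12 * real m)" using m by (intro mult_left_mono) auto
  also have "\<dots> = 12 * \<bar>K\<bar> * real m" by simp
  also have "\<dots> < real m * real m" using m by (intro mult_strict_right_mono) auto
  finally show False by (simp add: power2_eq_square)
qed

lemma wprod_periodic:
  assumes Q: "Q \<subseteq> carrier G" and w: "set w \<subseteq> Q" and p: "i + p * q \<le> length w"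
    and per: "\<And>k. k + p < p * q \<Longrightarrow> w ! (i + k) = w ! (i + p + k)"
  shows "wprod (take (p * q) (drop i w)) = wprod (take p (drop i w)) [^] q"
  using p per
proof (induction q)
  case (Suc q)
  have c: "set (take j (drop i' w)) \<subseteq> carrier G" for j i'
    using w Q set_take_subset set_drop_subset by (metis subset_trans)
  have "take (p * q) (drop (i + p) w) = take (p * q) (drop i w)"
  proof (rule nth_equalityI)
    fix k assume "k < length (take (p * q) (drop (i + p) w))"
    then show "take (p * q) (drop (i + p) w) ! k = take (p * q) (drop i w) ! k"
      using Suc.prems(1) Suc.prems(2)[of k] by (simp add: add_ac)
  qed (use Suc.prems in simp)
  then have "take (p * Suc q) (drop i w) = take p (drop i w) @ take (p * q) (drop i w)"
    by (simp add: take_add add.commute)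
  moreover have "wprod (take (p * q) (drop i w)) = wprod (take p (drop i w)) [^] q"
  proof (rule Suc.IH)
    show "i + p * q \<le> length w" using Suc.prems(1) by simp
  qed (use Suc.prems(2) in simp)
  ultimately have "wprod (take (p * Suc q) (drop i w)) = wprod (take p (drop i w)) \<otimes> wprod (take p (drop i w)) [^] q"
    using c by (simp add: wprod_append)
  then show ?case using nat_pow_Suc2[OF wprod_closed[OF c]] by simp
qed simp

text \<open>For some r there are at most r minimal words of length r, hence a long minimal word has
  at most r factors of that length and is periodic with a period p <= r. It contains high powers of
  the period word as factors; these are again minimal and nonempty, so they do not represent the
  unit. The period word depends on the length of the long word but always lies in one finite
  ball.\<close>

lemma linear_growth_ex_infinite_order:
  assumes Q: "finite Q" "Q \<subseteq> carrier G" "m_inv G ` Q \<subseteq> Q" and inf: "infinite (generate G Q)"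
    and linear: "\<And>m. real (card (word_ball Q m)) \<le> K * (4 * real m + 2)"
  obtains a where "a \<in> carrier G" "\<And>q :: nat. 1 \<le> q \<Longrightarrow> a [^] q \<noteq> \<one>"
proof -
  obtain \<iota> :: "'a \<Rightarrow> nat" where \<iota>: "inj_on \<iota> Q" using finite_imp_inj_to_nat_seg[OF Q(1)] by blast
  obtain r where r: "1 \<le> r" "card {w. min_word \<iota> Q w \<and> length w = r} \<le> r"
    using min_word_sphere_small[OF Q(1,2) \<iota> linear] by blast
  have long: "\<exists>w. min_word \<iota> Q w \<and> length w = L" for L
  proof -
    have "\<not> generate G Q \<subseteq> word_ball Q L" using inf finite_subset finite_word_ball[OF Q(1)] by blast
    then obtain x j where x: "x \<in> word_ball Q j" "x \<notin> word_ball Q L"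
      unfolding generate_eq_word_balls[OF Q(2,3)] by blast
    obtain w where w: "min_word \<iota> Q w" "wprod w = x" by (rule ex_min_word[OF x(1)])
    have "set w \<subseteq> Q" using w by (simp add: min_word_def)
    then have "L < length w" using x(2) w(2) word_ballI[of w Q L] by force
    moreover have "min_word \<iota> Q (take L w)"
      by (rule min_word_factor[OF Q(2), of \<iota> "[]" _ "drop L w"]) (simp add: w)
    ultimately show ?thesis by (intro exI[of _ "take L w"]) simp
  qed
  have main: "\<exists>a\<in>word_ball Q r. \<forall>q. 1 \<le> q \<and> r * q + 4 * r < M \<longrightarrow> a [^] q \<noteq> \<one>" if M: "4 * r < M" for M :: nat
  proof -
    obtain w where w: "min_word \<iota> Q w" "length w = M + r" using long by blast
    have sw: "set w \<subseteq> Q" using w by (simp add: min_word_def)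
    have factor: "min_word \<iota> Q (take l (drop i w))" for l i
      by (rule min_word_factor[OF Q(2), of \<iota> "take i w" _ "drop l (drop i w)"]) (simp add: w del: drop_drop)
    have "card ((\<lambda>i. take r (drop i w)) ` {..<M}) \<le> card {w. min_word \<iota> Q w \<and> length w = r}"
    proof (rule card_mono)
      show "finite {w. min_word \<iota> Q w \<and> length w = r}"
        by (rule finite_subset[OF _ finite_lists_length_eq[OF Q(1), of r]]) (auto simp: min_word_def)
    qed (use factor w in auto)
    then have "card ((\<lambda>i. take r (drop i w)) ` {..<M}) \<le> r" using r by simp
    moreover have rM: "r < M" using M by simp
    ultimately obtain i p where ip: "1 \<le> p" "p \<le> r" "i \<le> 2 * r"
      "\<And>k. k + 2 * r < M \<Longrightarrow> w ! (i + k) = w ! (i + p + k)"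
      using few_factors_periodic[OF w(2) rM] by metis
    define a where "a = wprod (take p (drop i w))"
    have st: "set (take l (drop i w)) \<subseteq> Q" for l using factor by (simp add: min_word_def)
    have "a \<in> word_ball Q r" unfolding a_def using st ip by (intro word_ballI) auto
    moreover have "a [^] q \<noteq> \<one>" if q: "1 \<le> q" "r * q + 4 * r < M" for q
    proof
      assume one: "a [^] q = \<one>"
      have "p * q \<le> r * q" using ip by simp
      have aq: "wprod (take (p * q) (drop i w)) = a [^] q" unfolding a_def
      proof (rule wprod_periodic[OF Q(2) sw])
        show "i + p * q \<le> length w" using ip q \<open>p * q \<le> r * q\<close> w(2) by linarith
        fix k assume "k + p < p * q"
        then have "k + 2 * r < M" using \<open>p * q \<le> r * q\<close> q by linarith
        then show "w ! (i + k) = w ! (i + p + k)" by (rule ip(4))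
      qed
      have "take (p * q) (drop i w) = []" by (rule min_word_trivial[OF factor]) (simp only: aq one)
      moreover have "0 < p * q" "i < length w" using ip q w(2) M by auto
      ultimately show False by simp
    qed
    ultimately show ?thesis by blast
  qed
  have "\<exists>a\<in>carrier G. \<forall>q :: nat. 1 \<le> q \<longrightarrow> a [^] q \<noteq> \<one>"
  proof (rule ccontr)
    assume nt: "\<not> ?thesis"
    have "\<exists>q :: nat. 1 \<le> q \<and> a [^] q = \<one>" if "a \<in> word_ball Q r" for a
      using nt word_ball_closed[OF Q(2), of r] that by blast
    then obtain e :: "'a \<Rightarrow> nat" where e: "\<And>a. a \<in> word_ball Q r \<Longrightarrow> 1 \<le> e a \<and> a [^] e a = \<one>" by metis
    \<comment> \<open>A common bound for the orders of the elements of the ball; a long word adapted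
      to it produces an element whose order would have to be larger.\<close>
    define E where "E = Max (e ` word_ball Q r)"
    have E: "e a \<le> E" if "a \<in> word_ball Q r" for a
      unfolding E_def using that finite_word_ball[OF Q(1), of r] by (intro Max_ge) auto
    obtain a where a: "a \<in> word_ball Q r" "\<forall>q. 1 \<le> q \<and> r * q + 4 * r < r * E + 4 * r + 1 \<longrightarrow> a [^] q \<noteq> \<one>"
      using main[of "r * E + 4 * r + 1"] by auto
    have "r * e a \<le> r * E" using E[OF a(1)] by simp
    then have "r * e a + 4 * r < r * E + 4 * r + 1" by linarith
    then show False using a(2) e[OF a(1)] by blast
  qed
  then show thesis using that by blast
qed

end

section \<open>Nets made of cosets of an infinite cyclic subgroup\<close>

context group
begin

text \<open>Along a coset of A = <a> the net is connected by steps of length 1. In the subgroup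
  \<Gamma> generated by \<open>a\<close> and many elements of different left cosets, linear growth
  forces \<open>A\<close> to have finite index. A left transversal \<open>E\<close> of
  \<open>A\<close> in \<Gamma> serves both as covering set and as \<open>D\<close>, and
  \<open>Y\<close> consists of \<open>A\<close> times representatives of the right cosets of
  \<Gamma>, so that every element is uniquely e y.\<close>

lemma sparse_net_infinite_order:
  assumes a: "a \<in> carrier G" and ord: "\<And>q :: nat. 1 \<le> q \<Longrightarrow> a [^] q \<noteq> \<one>"
    and linear: "\<And>Q. finite Q \<Longrightarrow> Q \<subseteq> carrier G \<Longrightarrow> m_inv G ` Q \<subseteq> Q \<Longrightarrow>
      \<exists>K :: real. \<forall>m. real (card (word_ball Q m)) \<le> K * (4 * real m + 2)"
    and index: "\<And>n. \<exists>D. finite D \<and> D \<subseteq> carrier G \<and> card D = n \<and>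
      (\<forall>d\<in>D. \<forall>d'\<in>D. d \<noteq> d' \<longrightarrow> inv d \<otimes> d' \<notin> generate G {a})"
  shows "sparse_net {a, inv a}"
  unfolding sparse_net_def
proof
  fix K :: real
  let ?Q = "{a, inv a}"
  define A where "A = generate G {a}"
  have A: "subgroup A G" unfolding A_def using a by (intro generate_is_subgroup) auto
  have Ac: "A \<subseteq> carrier G" using A by (rule subgroup.subset)
  \<comment> \<open>The factor 2 is l + 1 for l = 1.\<close>
  obtain D0 where D0: "finite D0" "D0 \<subseteq> carrier G" "card D0 = nat \<lceil>2 * K\<rceil>"
      "\<forall>d\<in>D0. \<forall>d'\<in>D0. d \<noteq> d' \<longrightarrow> inv d \<otimes> d' \<notin> A"
    using index[of "nat \<lceil>2 * K\<rceil>", folded A_def] by (elim exE conjE) (rule that, assumption+)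
  define R where "R = D0 \<union> m_inv G ` D0 \<union> ?Q"
  have R: "finite R" "R \<subseteq> carrier G" "m_inv G ` R \<subseteq> R"
    using D0 a by (auto simp: R_def)
  define \<Gamma> where "\<Gamma> = generate G R"
  have \<Gamma>: "subgroup \<Gamma> G" unfolding \<Gamma>_def using R by (intro generate_is_subgroup) auto
  have \<Gamma>c: "\<Gamma> \<subseteq> carrier G" using \<Gamma> by (rule subgroup.subset)
  have A\<Gamma>: "A \<subseteq> \<Gamma>" unfolding A_def \<Gamma>_def by (rule mono_generate) (simp add: R_def)
  have D0\<Gamma>: "D0 \<subseteq> \<Gamma>" unfolding \<Gamma>_def by (intro subsetI generate.incl) (simp add: R_def)
  have pow_inj: "i = j" if "a [^] i = a [^] j" for i j :: nat
  proof -
    have "a [^] (j' - i') = \<one>" if "i' < j'" "a [^] i' = a [^] j'" for i' j' :: nat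
    proof -
      have "a [^] i' \<otimes> a [^] (j' - i') = a [^] i' \<otimes> \<one>"
        using that a nat_pow_mult[OF a, of i' "j' - i'"] by simp
      then have "inv (a [^] i') \<otimes> (a [^] i' \<otimes> a [^] (j' - i')) = inv (a [^] i') \<otimes> (a [^] i' \<otimes> \<one>)" by simp
      then show ?thesis using a by (simp add: m_assoc[symmetric])
    qed
    from this[of i j] this[of j i] ord[of "j - i"] ord[of "i - j"] that show ?thesis
      by (cases i j rule: linorder_cases) auto
  qed
  have pow_A: "a [^] (i :: nat) \<in> A" for i
  proof (induction i)
    case 0
    then show ?case using subgroup.one_closed[OF A] by simp
  next
    case (Suc i)
    have "a \<in> A" unfolding A_def by (rule generate.incl) simp
    then show ?case using subgroup.m_closed[OF A Suc] by simp
  qed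
  obtain K' :: real where K': "\<And>m. real (card (word_ball R m)) \<le> K' * (4 * real m + 2)"
    using linear[OF R] by blast
  define sep where "sep E \<longleftrightarrow> finite E \<and> E \<subseteq> \<Gamma> \<and> (\<forall>d\<in>E. \<forall>d'\<in>E. d \<noteq> d' \<longrightarrow> inv d \<otimes> d' \<notin> A)" for E
  \<comment> \<open>If \<open>E\<close> lies in a ball of radius r, then \<open>E\<close> times the
    first m powers of \<open>a\<close> embeds in the ball of radius r + m. Letting m grow, |E| is at
    most the slope of the linear bound.\<close>
  have bound: "real (card E) \<le> 4 * \<bar>K'\<bar> + 1" if E: "sep E" for E
  proof (rule ccontr)
    assume big: "\<not> ?thesis"
    have fE: "finite E" "E \<subseteq> \<Gamma>" and E': "\<And>d d'. d \<in> E \<Longrightarrow> d' \<in> E \<Longrightarrow> d \<noteq> d' \<Longrightarrow> inv d \<otimes> d' \<notin> A"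
      using E unfolding sep_def by auto
    have "\<exists>r. E \<subseteq> word_ball R r" using fE
    proof (induction E)
      case (insert x E)
      then obtain r where r: "E \<subseteq> word_ball R r" by auto
      obtain r' where "x \<in> word_ball R r'" using insert.prems by (auto simp: \<Gamma>_def generate_eq_word_balls[OF R(2,3)])
      then have "insert x E \<subseteq> word_ball R (max r r')"
        using r word_ball_mono[of r "max r r'" R] word_ball_mono[of r' "max r r'" R] by auto
      then show ?case by blast
    qed simp
    then obtain r where r: "E \<subseteq> word_ball R r" by blast
    have pow_ball: "a [^] j \<in> word_ball R j" for j :: nat
    proof (induction j)
      case 0
      then show ?case by (simp add: one_in_word_ball)
    next
      case (Suc j)
      then show ?case
        using word_ball_mult[OF R(2) Suc generator_in_word_ball[OF R(2), of a]] by (simp add: R_def)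
    qed
    have grow: "real (card E) * real m \<le> K' * (4 * (real r + real m) + 2)" for m :: nat
    proof -
      have "card (E \<times> {..<m}) \<le> card (word_ball R (r + m))"
      proof (rule card_inj_on_le[of "\<lambda>(e, j). e \<otimes> a [^] j"])
        show "inj_on (\<lambda>(e, j). e \<otimes> a [^] j) (E \<times> {..<m})"
        proof (rule inj_onI, clarify)
          fix e j e' j' assume *: "e \<in> E" "j < m" "e' \<in> E" "j' < m" "e \<otimes> a [^] j = e' \<otimes> a [^] (j' :: nat)"
          have c: "e \<in> carrier G" "e' \<in> carrier G" "a [^] j \<in> carrier G" "a [^] j' \<in> carrier G"
            using * fE \<Gamma>c a by auto
          have "inv e \<otimes> e' = inv e \<otimes> (e' \<otimes> a [^] j') \<otimes> inv (a [^] j')" using c by (simp add: m_assoc)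
          also have "\<dots> = inv e \<otimes> (e \<otimes> a [^] j) \<otimes> inv (a [^] j')" using * by simp
          also have "\<dots> = a [^] j \<otimes> inv (a [^] j')" using c by (simp add: m_assoc[symmetric])
          also have "\<dots> \<in> A" using pow_A A by (simp add: subgroup.m_closed subgroup.m_inv_closed)
          finally have ee: "e = e'" using E' * by blast
          then have "a [^] j = a [^] j'" using * c by simp
          then show "e = e' \<and> j = j'" using ee pow_inj by simp
        qed
        show "(\<lambda>(e, j). e \<otimes> a [^] j) ` (E \<times> {..<m}) \<subseteq> word_ball R (r + m)"
        proof (rule image_subsetI)
          fix p assume "p \<in> E \<times> {..<m}"
          then obtain e j where p: "p = (e, j)" "e \<in> E" "j < m" by auto
          have "a [^] j \<in> word_ball R m" using pow_ball[of j] word_ball_mono[of j m R] p by auto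
          then show "(\<lambda>(e, j). e \<otimes> a [^] j) p \<in> word_ball R (r + m)"
            using word_ball_mult[OF R(2), of e r "a [^] j" m] p r by auto
        qed
      qed (rule finite_word_ball[OF R(1)])
      then have "real (card E) * real m \<le> real (card (word_ball R (r + m)))"
        by (simp add: card_cartesian_product of_nat_mult[symmetric] del: of_nat_mult)
      then show ?thesis using K'[of "r + m"] by simp
    qed
    obtain m :: nat where m: "\<bar>K'\<bar> * (4 * real r + 2) < real m" using reals_Archimedean2 by blast
    have "(4 * \<bar>K'\<bar> + 1) * real m \<le> real (card E) * real m" using big by (intro mult_right_mono) auto
    also have "\<dots> \<le> K' * (4 * (real r + real m) + 2)" by (rule grow)
    also have "\<dots> \<le> \<bar>K'\<bar> * (4 * (real r + real m) + 2)" by (intro mult_right_mono) auto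
    finally show False using m by (simp add: algebra_simps)
  qed
  have "sep D0" using D0 D0\<Gamma> by (simp add: sep_def)
  \<comment> \<open>Sizes are bounded, so a largest family exists; being largest it meets every left
    coset of \<open>A\<close> in \<Gamma>, and it is at least as large as \<open>D0\<close>.\<close>
  have "\<exists>E. sep E \<and> (\<forall>E'. sep E' \<longrightarrow> card E' \<le> card E)"
  proof -
    have "\<forall>E. sep E \<longrightarrow> card E < Suc (nat \<lfloor>4 * \<bar>K'\<bar> + 1\<rfloor>)"
      by (intro allI impI le_imp_less_Suc le_nat_floor bound)
    then show ?thesis by (rule ex_has_greatest_nat[where P = sep and f = card, OF \<open>sep D0\<close>])
  qed
  then obtain E where E: "sep E" and max: "\<And>E'. sep E' \<Longrightarrow> card E' \<le> card E" by blast
  have fE: "finite E" "E \<subseteq> \<Gamma>" and E': "\<And>d d'. d \<in> E \<Longrightarrow> d' \<in> E \<Longrightarrow> d \<noteq> d' \<Longrightarrow> inv d \<otimes> d' \<notin> A"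
    using E unfolding sep_def by auto
  have Ec: "E \<subseteq> carrier G" using fE \<Gamma>c by blast
  have coverE: "\<exists>e\<in>E. \<exists>x\<in>A. g = e \<otimes> x" if g: "g \<in> \<Gamma>" for g
  proof (cases "g \<in> E")
    case True
    then show ?thesis using Ec subgroup.one_closed[OF A] by (intro bexI[of _ g] bexI[of _ \<one>]) auto
  next
    case False
    have gc: "g \<in> carrier G" using g \<Gamma>c by auto
    have "\<not> sep (insert g E)" using max[of "insert g E"] False fE by auto
    then obtain d d' where dd: "d \<in> insert g E" "d' \<in> insert g E" "d \<noteq> d'" "inv d \<otimes> d' \<in> A"
      using fE g by (auto simp: sep_def)
    have key: "\<exists>e\<in>E. inv e \<otimes> g \<in> A"
    proof -
      consider "d \<in> E" "d' \<in> E" | "d = g" "d' \<in> E" | "d \<in> E" "d' = g" using dd by blast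
      then show ?thesis
      proof cases
        case 1
        then show ?thesis using E' dd by blast
      next
        case 2
        have "inv (inv d \<otimes> d') \<in> A" using dd(4) A by (simp add: subgroup.m_inv_closed)
        moreover have "inv (inv d \<otimes> d') = inv d' \<otimes> g" using 2 gc Ec by (simp add: inv_mult_group subset_iff)
        ultimately show ?thesis using 2 by auto
      next
        case 3
        then show ?thesis using dd by blast
      qed
    qed
    then obtain e where e: "e \<in> E" "inv e \<otimes> g \<in> A" by blast
    have "g = e \<otimes> (inv e \<otimes> g)" using e Ec gc by (simp add: m_assoc[symmetric] subset_iff)
    then show ?thesis using e by blast
  qed
  \<comment> \<open>The value depends only on the coset of \<open>x\<close>. This is why
    \<open>Y\<close> meets each right coset of \<Gamma> in a single right coset of
    \<open>A\<close>.\<close>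
  define \<rho> where "\<rho> x = (SOME z. z \<in> \<Gamma> #> x)" for x
  have \<rho>: "\<rho> x \<in> \<Gamma> #> x" "\<rho> x \<in> carrier G" "\<Gamma> #> \<rho> x = \<Gamma> #> x" if x: "x \<in> carrier G" for x
  proof -
    show 1: "\<rho> x \<in> \<Gamma> #> x" unfolding \<rho>_def using rcos_self[OF x \<Gamma>] by (rule someI)
    then show "\<rho> x \<in> carrier G" using r_coset_subset_G[OF \<Gamma>c x] by blast
    show "\<Gamma> #> \<rho> x = \<Gamma> #> x" using repr_independence[OF 1 x \<Gamma>] by simp
  qed
  define Y where "Y = {b \<otimes> \<rho> x |b x. b \<in> A \<and> x \<in> carrier G}"
  have Yc: "Y \<subseteq> carrier G" using Ac \<rho> by (auto simp: Y_def)
  have cover: "\<exists>s\<in>E. \<exists>y\<in>Y. x = s \<otimes> y" if x: "x \<in> carrier G" for x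
  proof -
    obtain g where g: "g \<in> \<Gamma>" "\<rho> x = g \<otimes> x" using \<rho>(1)[OF x] by (auto simp: r_coset_def)
    have "inv g \<in> \<Gamma>" using g \<Gamma> by (simp add: subgroup.m_inv_closed)
    then obtain e b where eb: "e \<in> E" "b \<in> A" "inv g = e \<otimes> b" using coverE by blast
    have c: "g \<in> carrier G" "e \<in> carrier G" "b \<in> carrier G" using g eb \<Gamma>c Ec Ac by auto
    have "x = inv g \<otimes> \<rho> x" using g c x by (simp add: m_assoc[symmetric])
    also have "\<dots> = e \<otimes> (b \<otimes> \<rho> x)" using eb c \<rho>(2)[OF x] by (simp add: m_assoc)
    finally show ?thesis using eb x unfolding Y_def by blast
  qed
  have inj: "inj_on (\<lambda>(d, y). d \<otimes> y) (E \<times> Y)"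
  proof (rule inj_onI, clarify)
    fix e y e' y' assume *: "e \<in> E" "y \<in> Y" "e' \<in> E" "y' \<in> Y" "e \<otimes> y = e' \<otimes> y'"
    obtain b x b' x' where bx: "b \<in> A" "x \<in> carrier G" "y = b \<otimes> \<rho> x" "b' \<in> A" "x' \<in> carrier G" "y' = b' \<otimes> \<rho> x'"
      using * by (auto simp: Y_def)
    have c: "e \<in> carrier G" "e' \<in> carrier G" "b \<in> carrier G" "b' \<in> carrier G" "\<rho> x \<in> carrier G" "\<rho> x' \<in> carrier G"
      using * bx Ec Ac \<rho> by auto
    have "e \<otimes> b \<in> \<Gamma>" "e' \<otimes> b' \<in> \<Gamma>" using * bx fE A\<Gamma> \<Gamma> by (auto intro!: subgroup.m_closed)
    then have eG: "e \<otimes> y \<in> \<Gamma> #> \<rho> x" "e' \<otimes> y' \<in> \<Gamma> #> \<rho> x'"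
      using rcosI[of "e \<otimes> b" \<Gamma> "\<rho> x"] rcosI[of "e' \<otimes> b'" \<Gamma> "\<rho> x'"] \<Gamma>c c bx by (auto simp: m_assoc)
    have "\<Gamma> #> \<rho> x = \<Gamma> #> \<rho> x'"
      using repr_independence[OF eG(1) c(5) \<Gamma>] repr_independence[OF eG(2) c(6) \<Gamma>] *(5) by simp
    then have "\<Gamma> #> x = \<Gamma> #> x'" using \<rho>(3) bx by simp
    then have zz: "\<rho> x = \<rho> x'" by (simp add: \<rho>_def)
    have "e \<otimes> b \<otimes> \<rho> x = e' \<otimes> b' \<otimes> \<rho> x" using * bx c zz by (simp add: m_assoc)
    then have eb: "e \<otimes> b = e' \<otimes> b'" using c by simp
    have "inv e \<otimes> e' = inv e \<otimes> (e' \<otimes> b') \<otimes> inv b'" using c by (simp add: m_assoc)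
    also have "\<dots> = inv e \<otimes> (e \<otimes> b) \<otimes> inv b'" using eb by simp
    also have "\<dots> = b \<otimes> inv b'" using c by (simp add: m_assoc[symmetric])
    also have "\<dots> \<in> A" using bx A by (simp add: subgroup.m_closed subgroup.m_inv_closed)
    finally have "e = e'" using E' * by blast
    moreover have "y = y'" using * c bx calculation Yc by auto
    ultimately show "e = e' \<and> y = y'" by simp
  qed
  have Q: "finite ?Q" "?Q \<subseteq> carrier G" using a by auto
  have inf: "infinite {y'. (y, y') \<in> (net_rel ?Q 1 Y)\<^sup>*}" if y: "y \<in> Y" for y
  proof -
    have yc: "y \<in> carrier G" using y Yc by auto
    have aY: "b \<otimes> z \<in> Y" if zb: "z \<in> Y" "b \<in> A" for z b
    proof -
      obtain b' x where bx: "b' \<in> A" "x \<in> carrier G" "z = b' \<otimes> \<rho> x" using zb(1) unfolding Y_def by blast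
      have "b \<otimes> z = (b \<otimes> b') \<otimes> \<rho> x" using m_assoc[OF subsetD[OF Ac zb(2)] subsetD[OF Ac bx(1)] \<rho>(2)[OF bx(2)]] bx(3) by simp
      moreover have "b \<otimes> b' \<in> A" using bx zb A by (simp add: subgroup.m_closed)
      ultimately show ?thesis using bx by (auto simp: Y_def)
    qed
    have "(y, a [^] j \<otimes> y) \<in> (net_rel ?Q 1 Y)\<^sup>*" for j :: nat
    proof (induction j)
      case (Suc j)
      have "a [^] Suc j \<otimes> y = a \<otimes> (a [^] j \<otimes> y)" using nat_pow_Suc2[OF a, of j] m_assoc[of a "a [^] j" y] a yc by simp
      then have "(a [^] j \<otimes> y, a [^] Suc j \<otimes> y) \<in> net_rel ?Q 1 Y"
        unfolding net_rel_def using aY[OF y pow_A, of j] aY[OF y pow_A, of "Suc j"] generator_in_word_ball[OF Q(2), of a] by auto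
      with Suc show ?case by (rule rtrancl_into_rtrancl)
    qed (use yc in simp)
    then have "range (\<lambda>j :: nat. a [^] j \<otimes> y) \<subseteq> {y'. (y, y') \<in> (net_rel ?Q 1 Y)\<^sup>*}" by blast
    moreover have "inj (\<lambda>j :: nat. a [^] j \<otimes> y)"
      using a yc pow_inj by (auto intro!: injI)
    then have "infinite (range (\<lambda>j :: nat. a [^] j \<otimes> y))" by (rule range_inj_infinite)
    ultimately show ?thesis by (rule infinite_super)
  qed
  have "\<exists>r. \<forall>y\<in>Y. M \<le> card {y'. (y, y') \<in> net_rel ?Q 1 Y ^^ r}" for M
    using net_component_large[OF Q Yc _ inf] by blast
  moreover have "K * (real 1 + 1) \<le> real (card E)"
  proof -
    have "2 * K \<le> real (nat \<lceil>2 * K\<rceil>)" by (rule real_nat_ceiling_ge)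
    also have "\<dots> \<le> real (card E)" using max[OF \<open>sep D0\<close>] D0 by simp
    finally show ?thesis by simp
  qed
  ultimately show "\<exists>S l Y D. finite S \<and> S \<subseteq> carrier G \<and> Y \<subseteq> carrier G \<and> finite D \<and> D \<subseteq> carrier G \<and>
     K * (real l + 1) \<le> real (card D) \<and> inj_on (\<lambda>(d, y). d \<otimes> y) (D \<times> Y) \<and>
     (\<forall>x\<in>carrier G. \<exists>s\<in>S. \<exists>y\<in>Y. x = s \<otimes> y) \<and>
     (\<forall>M :: nat. \<exists>r. \<forall>y\<in>Y. M \<le> card {y'. (y, y') \<in> net_rel ?Q l Y ^^ r})"
    using fE Ec Yc inj cover by (intro exI[of _ E] exI[of _ 1] exI[of _ Y] exI[of _ E]) simp
qed

text \<open>Taking inverses turns representatives of distinct right cosets, which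
  \<open>rcosets\<close> counts, into representatives of distinct left cosets.\<close>

lemma infinite_index_left_transversal:
  assumes A: "subgroup A G" and inf: "infinite (rcosets A)"
  shows "\<exists>D. finite D \<and> D \<subseteq> carrier G \<and> card D = n \<and>
      (\<forall>d\<in>D. \<forall>d'\<in>D. d \<noteq> d' \<longrightarrow> inv d \<otimes> d' \<notin> A)"
proof -
  obtain \<C> where C: "\<C> \<subseteq> rcosets A" "finite \<C>" "card \<C> = n" using infinite_arbitrarily_large[OF inf] by blast
  have "\<forall>c\<in>\<C>. \<exists>x. x \<in> carrier G \<and> c = A #> x" using C by (auto simp: RCOSETS_def)
  then obtain x where x: "\<And>c. c \<in> \<C> \<Longrightarrow> x c \<in> carrier G \<and> c = A #> x c" by metis
  have inj: "inj_on (\<lambda>c. inv (x c)) \<C>"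
  proof (rule inj_onI)
    fix c c' assume c: "c \<in> \<C>" "c' \<in> \<C>" "inv (x c) = inv (x c')"
    then have "x c = x c'" using x inj_onD[OF inv_inj c(3)] by blast
    then have "A #> x c = A #> x c'" by simp
    then show "c = c'" using x[OF c(1)] x[OF c(2)] by argo
  qed
  have "inv (inv (x c)) \<otimes> inv (x c') \<notin> A" if c: "c \<in> \<C>" "c' \<in> \<C>" "c \<noteq> c'" for c c'
  proof
    assume *: "inv (inv (x c)) \<otimes> inv (x c') \<in> A"
    have xc: "x c \<in> carrier G" "x c' \<in> carrier G" using x c by auto
    have "(x c \<otimes> inv (x c')) \<otimes> x c' \<in> A #> x c'"
      using * xc subgroup.subset[OF A] by (intro rcosI) auto
    then have "x c \<in> A #> x c'" using xc by (simp add: m_assoc)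
    then have "A #> x c' = A #> x c" by (rule repr_independence[OF _ xc(2) A])
    then show False using x[OF c(1)] x[OF c(2)] c(3) by argo
  qed
  then show ?thesis using C x inj
    by (intro exI[of _ "(\<lambda>c. inv (x c)) ` \<C>"]) (auto simp: card_image)
qed

text \<open>Either some finite symmetric set grows superlinearly, or all grow linearly. In the
  second case an infinite finitely generated subgroup supplies an element of infinite order, and its
  cyclic subgroup has infinite index because the group is not virtually cyclic.\<close>

theorem ex_sparse_net:
  assumes nlf: "\<not> locally_finite_group G" and nvc: "\<not> virtually_cyclic_group G"
  obtains Q where "finite Q" "Q \<subseteq> carrier G" "m_inv G ` Q \<subseteq> Q" "sparse_net Q"
proof (cases "\<exists>Q. finite Q \<and> Q \<subseteq> carrier G \<and> m_inv G ` Q \<subseteq> Q \<and>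
    (\<forall>K :: real. \<exists>m. K * (4 * real m + 2) \<le> real (card (word_ball Q m)))")
  case True
  then obtain Q where Q: "finite Q" "Q \<subseteq> carrier G" "m_inv G ` Q \<subseteq> Q"
    "\<And>K :: real. \<exists>m. K * (4 * real m + 2) \<le> real (card (word_ball Q m))" by blast
  show thesis by (rule that[OF Q(1-3) sparse_net_superlinear[OF Q]])
next
  case False
  have linear: "\<exists>K :: real. \<forall>m. real (card (word_ball Q m)) \<le> K * (4 * real m + 2)"
    if "finite Q" "Q \<subseteq> carrier G" "m_inv G ` Q \<subseteq> Q" for Q
  proof -
    have "\<not> (\<forall>K :: real. \<exists>m. K * (4 * real m + 2) \<le> real (card (word_ball Q m)))" using False that by blast
    then obtain K :: real where "\<not> (\<exists>m. K * (4 * real m + 2) \<le> real (card (word_ball Q m)))" by blast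
    then show ?thesis by (intro exI[of _ K]) (simp add: not_le less_imp_le)
  qed
  obtain F where F: "finite F" "F \<subseteq> carrier G" "infinite (generate G F)"
    using nlf by (auto simp: locally_finite_group_def)
  define Q where "Q = F \<union> m_inv G ` F"
  have Q: "finite Q" "Q \<subseteq> carrier G" "m_inv G ` Q \<subseteq> Q" using F by (auto simp: Q_def)
  have "infinite (generate G Q)"
    by (rule infinite_super[OF mono_generate F(3)]) (simp add: Q_def)
  moreover obtain K :: real where "\<And>m. real (card (word_ball Q m)) \<le> K * (4 * real m + 2)"
    using linear[OF Q] by blast
  ultimately obtain a where a: "a \<in> carrier G" "\<And>q :: nat. 1 \<le> q \<Longrightarrow> a [^] q \<noteq> \<one>"
    using linear_growth_ex_infinite_order[OF Q] by blast
  have A: "subgroup (generate G {a}) G" using a by (intro generate_is_subgroup) auto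
  have "cyclic_group (G\<lparr>carrier := generate G {a}\<rparr>)"
    using cyclic_group_generated[of a] a by (simp add: subgroup_generated_def)
  then have "infinite (rcosets (generate G {a}))" using nvc A by (auto simp: virtually_cyclic_group_def)
  note transversal = infinite_index_left_transversal[OF A this]
  have "sparse_net {a, inv a}" by (rule sparse_net_infinite_order[OF a linear transversal])
  then show thesis using a by (intro that[of "{a, inv a}"]) auto
qed

end

section \<open>Tilings of sofic models\<close>

definition min_point :: "('v \<Rightarrow> nat) \<Rightarrow> 'v set \<Rightarrow> 'v" where
  "min_point p A = (SOME c. c \<in> A \<and> (\<forall>a\<in>A. p c \<le> p a))"

lemma min_point:
  assumes "finite A" "A \<noteq> {}"
  shows "min_point p A \<in> A" "\<And>a. a \<in> A \<Longrightarrow> p (min_point p A) \<le> p a"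
proof -
  have "Min (p ` A) \<in> p ` A" using assms by simp
  then obtain c where "c \<in> A" "p c = Min (p ` A)" by force
  then have "\<exists>c. c \<in> A \<and> (\<forall>a\<in>A. p c \<le> p a)" using assms by (intro exI[of _ c]) simp
  then have "min_point p A \<in> A \<and> (\<forall>a\<in>A. p (min_point p A) \<le> p a)"
    unfolding min_point_def by (rule someI_ex)
  then show "min_point p A \<in> A" "\<And>a. a \<in> A \<Longrightarrow> p (min_point p A) \<le> p a" by auto
qed

lemma min_point_eqI:
  assumes "finite A" "inj p" "c \<in> A" "\<And>a. a \<in> A \<Longrightarrow> p c \<le> p a"
  shows "min_point p A = c"
proof -
  have "A \<noteq> {}" using assms(3) by auto
  then have "p (min_point p A) = p c"
    using min_point[OF assms(1), where p = p] assms(3,4) by (simp add: antisym)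
  then show ?thesis using assms(2) by (simp add: inj_eq)
qed

lemma min_point_transpose:
  assumes A: "finite A" "a \<in> A" "b \<in> A" and p: "inj p" and min: "min_point p A = a"
  shows "min_point (p \<circ> Transposition.transpose a b) A = b"
proof (rule min_point_eqI[OF A(1) _ A(3)])
  show "inj (p \<circ> Transposition.transpose a b)" using p by (intro inj_compose) auto
  fix x assume "x \<in> A"
  then have "Transposition.transpose a b x \<in> A" using A by (auto simp: Transposition.transpose_def)
  then have "p a \<le> p (Transposition.transpose a b x)"
    using min_point(2)[OF A(1), where p = p] min by auto
  then show "(p \<circ> Transposition.transpose a b) b \<le> (p \<circ> Transposition.transpose a b) x" by simp
qed

text \<open>Swapping the labels of two points of \<open>A\<close> carries the permutations with
  least label at one of them to those with least label at the other. Hence under a random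
  permutation the least label falls into \<open>B\<close> with probability |B|/|A|; denominators are
  cleared.\<close>

lemma card_min_point:
  assumes S: "finite S" "A \<subseteq> S" "B \<subseteq> A" "A \<noteq> {}"
  shows "card {p. p permutes S \<and> min_point p A \<in> B} * card A = card B * fact (card S)"
proof -
  define P where "P c = {p. p permutes S \<and> min_point p A = c}" for c
  have fA: "finite A" by (rule finite_subset[OF S(2,1)])
  have fP: "finite (P c)" for c unfolding P_def using finite_permutations[OF S(1)] by (rule rev_finite_subset) auto
  have le: "card (P a) \<le> card (P b)" if ab: "a \<in> A" "b \<in> A" for a b
  proof (rule card_inj_on_le[where f = "\<lambda>p. p \<circ> Transposition.transpose a b"])
    show "inj_on (\<lambda>p. p \<circ> Transposition.transpose a b) (P a)"
    proof (rule inj_onI)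
      fix p q :: "nat \<Rightarrow> nat" assume "p \<circ> Transposition.transpose a b = q \<circ> Transposition.transpose a b"
      then have "p \<circ> Transposition.transpose a b \<circ> Transposition.transpose a b = q \<circ> Transposition.transpose a b \<circ> Transposition.transpose a b" by simp
      then show "p = q" by (simp add: comp_assoc)
    qed
    show "(\<lambda>p. p \<circ> Transposition.transpose a b) ` P a \<subseteq> P b"
    proof (rule image_subsetI)
      fix p assume p: "p \<in> P a"
      have "Transposition.transpose a b permutes S" using ab S by (intro permutes_swap_id) auto
      moreover have "p permutes S" using p by (simp add: P_def)
      ultimately have "p \<circ> Transposition.transpose a b permutes S" by (rule permutes_compose)
      moreover have "min_point (p \<circ> Transposition.transpose a b) A = b"
        using p permutes_inj by (intro min_point_transpose[OF fA ab]) (auto simp: P_def)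
      ultimately show "p \<circ> Transposition.transpose a b \<in> P b" by (simp add: P_def)
    qed
  qed (rule fP)
  obtain a where a: "a \<in> A" using S by auto
  have eq: "card (P c) = card (P a)" if "c \<in> A" for c using le[OF that a] le[OF a that] by simp
  have count: "card {p. p permutes S \<and> min_point p A \<in> C} = card C * card (P a)" if C: "C \<subseteq> A" for C
  proof -
    have "{p. p permutes S \<and> min_point p A \<in> C} = (\<Union>c\<in>C. P c)" by (auto simp: P_def)
    also have "card \<dots> = (\<Sum>c\<in>C. card (P c))"
    proof (rule card_UN_disjoint)
      show "finite C" using C fA by (rule finite_subset)
      show "\<forall>i\<in>C. \<forall>j\<in>C. i \<noteq> j \<longrightarrow> P i \<inter> P j = {}" by (auto simp: P_def)
    qed (simp add: fP)
    also have "\<dots> = (\<Sum>c\<in>C. card (P a))" using C eq by (intro sum.cong) auto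
    finally show ?thesis by simp
  qed
  have "{p. p permutes S \<and> min_point p A \<in> A} = {p. p permutes S}"
    using min_point(1)[OF fA S(4)] by auto
  then have "fact (card S) = card A * card (P a)"
    using count[of A] card_permutations[OF refl S(1)] by simp
  then show ?thesis using count[OF S(3)] by simp
qed

lemma card_filter_eq_sum: "finite S \<Longrightarrow> real (card {x \<in> S. P x}) = (\<Sum>x\<in>S. of_bool (P x))"
proof -
  assume "finite S"
  have "{x \<in> S. P x} = S \<inter> {x. P x}" by auto
  then show ?thesis using \<open>finite S\<close> by (simp add: sum_of_bool_eq)
qed

text \<open>If the point of least label in A \<union> A' lies in the intersection, it is the minimum
  of both sets; so they can differ only if it falls into the symmetric difference.\<close>

lemma card_min_point_differ:
  assumes S: "finite S" "A \<subseteq> S" "A' \<subseteq> S" "A \<noteq> {}" "A' \<noteq> {}"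
  shows "card {p. p permutes S \<and> min_point p A \<noteq> min_point p A'} * card (A \<union> A')
    \<le> card ((A - A') \<union> (A' - A)) * fact (card S)"
proof -
  have fA: "finite A" "finite A'" using S by (auto intro: finite_subset)
  have sub: "{p. p permutes S \<and> min_point p A \<noteq> min_point p A'}
      \<subseteq> {p. p permutes S \<and> min_point p (A \<union> A') \<in> (A - A') \<union> (A' - A)}"
  proof (rule subsetI, rule ccontr)
    fix p assume "p \<in> {p. p permutes S \<and> min_point p A \<noteq> min_point p A'}"
      "p \<notin> {p. p permutes S \<and> min_point p (A \<union> A') \<in> (A - A') \<union> (A' - A)}"
    then have p: "p permutes S" "min_point p A \<noteq> min_point p A'"
      and no: "min_point p (A \<union> A') \<notin> (A - A') \<union> (A' - A)" by simp_all
    let ?c = "min_point p (A \<union> A')"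
    have c: "?c \<in> A \<union> A'" "\<And>a. a \<in> A \<union> A' \<Longrightarrow> p ?c \<le> p a"
      using min_point[of "A \<union> A'", where p = p] fA S(4) by auto
    then have "?c \<in> A" "?c \<in> A'" using no by blast+
    then have "min_point p A = ?c" "min_point p A' = ?c"
      using c(2) fA permutes_inj[OF p(1)] by (auto intro!: min_point_eqI)
    then show False using p(2) by simp
  qed
  have "card {p. p permutes S \<and> min_point p A \<noteq> min_point p A'}
      \<le> card {p. p permutes S \<and> min_point p (A \<union> A') \<in> (A - A') \<union> (A' - A)}"
    by (rule card_mono[OF _ sub]) (rule rev_finite_subset[OF finite_permutations[OF S(1)]], auto)
  then have "card {p. p permutes S \<and> min_point p A \<noteq> min_point p A'} * card (A \<union> A')
      \<le> card {p. p permutes S \<and> min_point p (A \<union> A') \<in> (A - A') \<union> (A' - A)} * card (A \<union> A')"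
    by (rule mult_le_mono1)
  also have "\<dots> = card ((A - A') \<union> (A' - A)) * fact (card S)"
    using S by (intro card_min_point) auto
  finally show ?thesis .
qed

text \<open>Each point joins the candidate centre of least random label; two neighbouring points have
  nearly the same candidates and so are unlikely to be separated.\<close>

lemma (in sofic_sequence) ex_tiling:
  assumes F: "finite F" "F \<noteq> {}" "F \<subseteq> carrier G" and Z: "finite Z" "Z \<subseteq> carrier G"
    and inv: "\<And>z. z \<in> Z \<Longrightarrow> real (card ((\<lambda>x. inv z \<otimes> x) ` F - F)) \<le> \<epsilon> * real (card F)"
    and Z': "Z \<union> m_inv G ` F \<union> (\<lambda>(h, z). inv h \<otimes> z) ` (F \<times> Z) \<subseteq> Z'"
  obtains c where "\<And>u. u \<in> V k \<Longrightarrow> \<exists>h\<in>F. c u = \<sigma> k (inv h) u"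
    "real (card {u \<in> V k - unfaithful k Z'. \<exists>z\<in>Z. c (\<sigma> k z u) \<noteq> c u}) \<le> 2 * \<epsilon> * real (card Z) * sz k"
proof -
  \<comment> \<open>The possible centres of \<open>u\<close>: the points from which elements of
    \<open>F\<close> lead to \<open>u\<close>, up to the inexactness of inverses.\<close>
  define cand where "cand u = (\<lambda>h. \<sigma> k (inv h) u) ` F" for u
  define U where "U = V k - unfaithful k Z'"
  define PP where "PP = {p. p permutes V k}"
  define bad where "bad p = {u \<in> U. \<exists>z\<in>Z. min_point p (cand (\<sigma> k z u)) \<noteq> min_point p (cand u)}" for p
  have cand: "finite (cand u)" "cand u \<noteq> {}" for u using F by (auto simp: cand_def)
  have cand_sub: "cand u \<subseteq> V k" if "u \<in> V k" for u using that F by (auto simp: cand_def)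
  have finPP: "finite PP" unfolding PP_def by (rule finite_permutations) simp
  have cardPP: "card PP = fact (card (V k))" unfolding PP_def by (rule card_permutations) simp_all
  have fU: "finite U" by (simp add: U_def)
  have F0: "0 < real (card F)" using F by (simp add: card_gt_0_iff)
  have prob: "real (card {p \<in> PP. min_point p (cand (\<sigma> k z u)) \<noteq> min_point p (cand u)}) \<le> 2 * \<epsilon> * real (card PP)"
    if u: "u \<in> U" and z: "z \<in> Z" for u z
  proof -
    have zc: "z \<in> carrier G" using z Z by auto
    have uV: "u \<in> V k" using u by (simp add: U_def)
    have fu: "faithful_at k Z' u" using u by (auto simp: U_def intro: faithfulI)
    have Z1: "z \<in> Z'" "\<And>h. h \<in> F \<Longrightarrow> inv h \<in> Z'" "\<And>h. h \<in> F \<Longrightarrow> inv h \<otimes> z \<in> Z'"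
      using Z' z by force+
    define J where "J = m_inv G ` F"
    define K where "K = (\<lambda>h. inv h \<otimes> z) ` F"
    have JK: "J \<subseteq> Z'" "K \<subseteq> Z'" using Z1 by (auto simp: J_def K_def)
    have inj: "inj_on (\<lambda>x. \<sigma> k x u) Z'" using faithful_inj[OF fu] by (auto intro: inj_onI)
    have c1: "cand u = (\<lambda>x. \<sigma> k x u) ` J" by (auto simp: cand_def J_def image_image)
    have c2: "cand (\<sigma> k z u) = (\<lambda>x. \<sigma> k x u) ` K"
      unfolding cand_def K_def image_image
      by (rule image_cong[OF refl]) (rule faithful_mult[OF fu Z1(2) Z1(1)])
    have invJ: "inj_on (m_inv G) F" using F(3) by (meson inj_on_subset inv_inj)
    have fJ: "finite J" "finite K" using F by (auto simp: J_def K_def)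
    have cJ: "card J = card F" unfolding J_def by (rule card_image[OF invJ])
    have "inj_on (\<lambda>h. inv h \<otimes> z) F"
    proof (rule inj_onI)
      fix h h' assume "h \<in> F" "h' \<in> F" "inv h \<otimes> z = inv h' \<otimes> z"
      then show "h = h'" using zc F(3) by (metis inv_closed inv_inv right_cancel subsetD)
    qed
    then have cK: "card K = card F" unfolding K_def by (rule card_image)
    \<comment> \<open>Seen from \<open>u\<close>, the candidates of \<open>u\<close> and of its
      translate by \<open>z\<close> are F^-1 and F^-1 z. Inversion turns their difference into z^-1
      F - F, which explains the form of the Folner hypothesis.\<close>
    have KJ: "card (K - J) = card ((\<lambda>x. inv z \<otimes> x) ` F - F)"
    proof -
      have "K = m_inv G ` ((\<lambda>x. inv z \<otimes> x) ` F)"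
        unfolding K_def image_image
        by (rule image_cong[OF refl]) (use F(3) zc in \<open>auto simp: inv_mult_group\<close>)
      moreover have "inj_on (m_inv G) ((\<lambda>x. inv z \<otimes> x) ` F \<union> F)"
        by (rule inj_on_subset[OF inv_inj]) (use F(3) zc in auto)
      ultimately have "K - J = m_inv G ` ((\<lambda>x. inv z \<otimes> x) ` F - F)" unfolding J_def
        by (subst inj_on_image_set_diff[of "m_inv G" "(\<lambda>x. inv z \<otimes> x) ` F \<union> F"]) auto
      moreover have "inj_on (m_inv G) ((\<lambda>x. inv z \<otimes> x) ` F - F)"
        by (rule inj_on_subset[OF inv_inj]) (use F(3) zc in auto)
      ultimately show ?thesis by (simp add: card_image)
    qed
    have "card (J - K) = card (K - J)"
    proof -
      have "card J = card (J \<inter> K) + card (J - K)" using card_Int_Diff[OF fJ(1)] by simp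
      moreover have "card K = card (J \<inter> K) + card (K - J)" using card_Int_Diff[OF fJ(2), of J] by (simp add: Int_commute)
      ultimately show ?thesis using cJ cK by simp
    qed
    then have sym: "real (card (J - K)) + real (card (K - J)) \<le> 2 * \<epsilon> * real (card F)"
      using inv[OF z] KJ by simp
    let ?A = "cand (\<sigma> k z u)" and ?B = "cand u"
    have "(?A - ?B) \<union> (?B - ?A) = (\<lambda>x. \<sigma> k x u) ` ((K - J) \<union> (J - K))"
      unfolding c1 c2 image_Un using inj_on_image_set_diff[OF inj, of K J] inj_on_image_set_diff[OF inj, of J K] JK by auto
    then have "card ((?A - ?B) \<union> (?B - ?A)) \<le> card ((K - J) \<union> (J - K))"
      using fJ by (simp add: card_image_le)
    also have "\<dots> \<le> card (K - J) + card (J - K)" by (rule card_Un_le)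
    finally have d: "real (card ((?A - ?B) \<union> (?B - ?A))) \<le> 2 * \<epsilon> * real (card F)" using sym by linarith
    have "card F \<le> card ?B"
      unfolding c1 using cJ card_image[OF inj_on_subset[OF inj JK(1)]] by simp
    also have "\<dots> \<le> card (?A \<union> ?B)" using cand by (intro card_mono) auto
    finally have "real (card F) \<le> real (card (?A \<union> ?B))" by simp
    have "card {p \<in> PP. min_point p ?A \<noteq> min_point p ?B} * card F
       \<le> card {p. p permutes V k \<and> min_point p ?A \<noteq> min_point p ?B} * card (?A \<union> ?B)"
      using \<open>real (card F) \<le> real (card (?A \<union> ?B))\<close> by (simp add: PP_def)
    also have "\<dots> \<le> card ((?A - ?B) \<union> (?B - ?A)) * fact (card (V k))"
      using cand cand_sub uV zc by (intro card_min_point_differ) auto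
    finally have "card {p \<in> PP. min_point p ?A \<noteq> min_point p ?B} * card F
        \<le> card ((?A - ?B) \<union> (?B - ?A)) * card PP" unfolding cardPP .
    then have "real (card {p \<in> PP. min_point p ?A \<noteq> min_point p ?B}) * real (card F)
        \<le> real (card ((?A - ?B) \<union> (?B - ?A))) * real (card PP)"
      unfolding of_nat_mult[symmetric] of_nat_le_iff .
    also have "\<dots> \<le> 2 * \<epsilon> * real (card F) * real (card PP)" using d by (intro mult_right_mono) auto
    finally have "real (card {p \<in> PP. min_point p ?A \<noteq> min_point p ?B}) * real (card F)
        \<le> (2 * \<epsilon> * real (card PP)) * real (card F)" by (simp add: mult_ac)
    then show ?thesis using F0 by simp
  qed
  \<comment> \<open>First moment argument: were every labelling bad, the sum over all labellings
    would exceed the sum of the individual probabilities of separation.\<close>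
  have "\<exists>p\<in>PP. real (card (bad p)) \<le> 2 * \<epsilon> * real (card Z) * sz k"
  proof (rule ccontr)
    assume "\<not> ?thesis"
    then have more: "2 * \<epsilon> * real (card Z) * sz k < real (card (bad p))" if "p \<in> PP" for p
      using that by force
    have "PP \<noteq> {}" using cardPP by auto
    then have "(\<Sum>p\<in>PP. 2 * \<epsilon> * real (card Z) * sz k) < (\<Sum>p\<in>PP. real (card (bad p)))"
      using finPP more by (intro sum_strict_mono) auto
    also have "\<dots> \<le> (\<Sum>p\<in>PP. \<Sum>u\<in>U. \<Sum>z\<in>Z. of_bool (min_point p (cand (\<sigma> k z u)) \<noteq> min_point p (cand u)))"
    proof (rule sum_mono)
      fix p assume "p \<in> PP"
      have "real (card (bad p)) = (\<Sum>u\<in>U. of_bool (\<exists>z\<in>Z. min_point p (cand (\<sigma> k z u)) \<noteq> min_point p (cand u)))"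
        unfolding bad_def by (rule card_filter_eq_sum[OF fU])
      also have "\<dots> \<le> (\<Sum>u\<in>U. \<Sum>z\<in>Z. of_bool (min_point p (cand (\<sigma> k z u)) \<noteq> min_point p (cand u)))"
      proof (rule sum_mono)
        fix u
        show "of_bool (\<exists>z\<in>Z. min_point p (cand (\<sigma> k z u)) \<noteq> min_point p (cand u))
          \<le> (\<Sum>z\<in>Z. of_bool (min_point p (cand (\<sigma> k z u)) \<noteq> min_point p (cand u)) :: real)"
        proof (cases "\<exists>z\<in>Z. min_point p (cand (\<sigma> k z u)) \<noteq> min_point p (cand u)")
          case True
          then obtain z where z: "z \<in> Z" "min_point p (cand (\<sigma> k z u)) \<noteq> min_point p (cand u)" by blast
          have "(1::real) = of_bool (min_point p (cand (\<sigma> k z u)) \<noteq> min_point p (cand u))" using z by simp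
          also have "\<dots> \<le> (\<Sum>z\<in>Z. of_bool (min_point p (cand (\<sigma> k z u)) \<noteq> min_point p (cand u)))"
            using Z z by (intro member_le_sum) auto
          finally show ?thesis using True by simp
        qed (simp add: sum_nonneg)
      qed
      finally show "real (card (bad p)) \<le> (\<Sum>u\<in>U. \<Sum>z\<in>Z. of_bool (min_point p (cand (\<sigma> k z u)) \<noteq> min_point p (cand u)))" .
    qed
    also have "\<dots> = (\<Sum>u\<in>U. \<Sum>z\<in>Z. \<Sum>p\<in>PP. of_bool (min_point p (cand (\<sigma> k z u)) \<noteq> min_point p (cand u)))"
      by (subst sum.swap, rule sum.cong[OF refl], rule sum.swap)
    also have "\<dots> = (\<Sum>u\<in>U. \<Sum>z\<in>Z. real (card {p \<in> PP. min_point p (cand (\<sigma> k z u)) \<noteq> min_point p (cand u)}))"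
      by (rule sum.cong[OF refl], rule sum.cong[OF refl], rule card_filter_eq_sum[OF finPP, symmetric])
    also have "\<dots> \<le> (\<Sum>u\<in>U. \<Sum>z\<in>Z. 2 * \<epsilon> * real (card PP))"
      by (intro sum_mono prob)
    also have "\<dots> = real (card U) * (real (card Z) * (2 * \<epsilon> * real (card PP)))" by simp
    also have "\<dots> \<le> sz k * (real (card Z) * (2 * \<epsilon> * real (card PP)))"
    proof (rule mult_right_mono)
      show "real (card U) \<le> sz k" by (simp add: U_def card_mono)
      have "0 \<le> \<epsilon>" if "z \<in> Z" for z
      proof (rule ccontr)
        assume "\<not> 0 \<le> \<epsilon>"
        then have "\<epsilon> * real (card F) < 0" using F0 by (simp add: mult_neg_pos)
        then show False using inv[OF that] by linarith
      qed
      then show "0 \<le> real (card Z) * (2 * \<epsilon> * real (card PP))"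
        by (cases "Z = {}") (auto intro!: mult_nonneg_nonneg)
    qed
    finally show False by (simp add: mult_ac)
  qed
  then obtain p where p: "p \<in> PP" "real (card (bad p)) \<le> 2 * \<epsilon> * real (card Z) * sz k" by blast
  show thesis
  proof (rule that[of "\<lambda>u. min_point p (cand u)"])
    show "\<exists>h\<in>F. min_point p (cand u) = \<sigma> k (inv h) u" for u
      using min_point(1)[OF cand, where p = p] by (auto simp: cand_def)
    show "real (card {u \<in> V k - unfaithful k Z'. \<exists>z\<in>Z. min_point p (cand (\<sigma> k z u)) \<noteq> min_point p (cand u)})
      \<le> 2 * \<epsilon> * real (card Z) * sz k" using p(2) by (simp add: bad_def U_def)
  qed
qed

section \<open>Amenable subgroups\<close>

lemma sum_edge_cost_le:
  fixes \<Upsilon> :: "'a \<Rightarrow> real"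
  assumes "finite E" "\<And>g v. (g, v) \<in> E \<Longrightarrow> \<Upsilon> g \<le> U"
  shows "(\<Sum>(g, v)\<in>E. \<Upsilon> g) \<le> real (card E) * U"
proof -
  have "(\<Sum>(g, v)\<in>E. \<Upsilon> g) \<le> (\<Sum>p\<in>E. U)" using assms(2) by (intro sum_mono) (auto split: prod.split)
  then show ?thesis by simp
qed

lemma link_UN_path:
  assumes "(u, v) \<in> rel ^^ j" and "\<And>a b. (a, b) \<in> rel \<Longrightarrow> (a, b) \<in> link s E ^^ m"
  shows "(u, v) \<in> link s E ^^ (j * m)"
  using assms(1)
proof (induction j arbitrary: v)
  case (Suc j)
  then obtain x where x: "(u, x) \<in> rel ^^ j" "(x, v) \<in> rel" by auto
  have "(u, v) \<in> link s E ^^ (j * m + m)" by (rule relpow_trans[OF Suc.IH[OF x(1)] assms(2)[OF x(2)]])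
  then show ?case by (simp add: add.commute)
qed simp

section \<open>Copying a net of the group into the tiles of a sofic model\<close>

context sofic_sequence
begin

text \<open>The last letter acts first, so the edge of the leading letter starts where the rest of
  the word has arrived.\<close>

primrec word_edges :: "nat \<Rightarrow> 'a list \<Rightarrow> nat \<Rightarrow> ('a \<times> nat) set" where
  "word_edges k [] w = {}"
| "word_edges k (q # v) w = insert (q, \<sigma> k (wprod v) w) (word_edges k v w)"

lemma word_edges:
  assumes Q: "Q \<subseteq> carrier G" and w: "w \<in> V k" "faithful_at k Z w" and Z: "Q \<subseteq> Z" "word_ball Q l \<subseteq> Z"
    and v: "set v \<subseteq> Q" "length v \<le> l"
  shows "(w, \<sigma> k (wprod v) w) \<in> link (\<sigma> k) (word_edges k v w) ^^ length v \<and>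
    finite (word_edges k v w) \<and> card (word_edges k v w) \<le> length v \<and> word_edges k v w \<subseteq> Q \<times> V k"
  using v
proof (induction v)
  case Nil
  have "\<one> \<in> Z" using one_in_word_ball Z by blast
  then show ?case using faithful_one[OF w(2)] by simp
next
  case (Cons q v)
  let ?E = "word_edges k (q # v) w"
  have IH: "(w, \<sigma> k (wprod v) w) \<in> link (\<sigma> k) (word_edges k v w) ^^ length v"
    "finite (word_edges k v w)" "card (word_edges k v w) \<le> length v" "word_edges k v w \<subseteq> Q \<times> V k"
    using Cons by auto
  have vQ: "q \<in> Q" "set v \<subseteq> Q" "length v \<le> l" using Cons.prems by auto
  have "wprod v \<in> word_ball Q l" using vQ by (intro word_ballI)
  then have eq: "\<sigma> k q (\<sigma> k (wprod v) w) = \<sigma> k (wprod (q # v)) w"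
    using faithful_mult[OF w(2), of q "wprod v"] Z vQ by auto
  have "(w, \<sigma> k (wprod v) w) \<in> link (\<sigma> k) ?E ^^ length v"
    by (rule link_pow_mono[OF IH(1)]) auto
  moreover have "(\<sigma> k (wprod v) w, \<sigma> k (wprod (q # v)) w) \<in> link (\<sigma> k) ?E"
    unfolding eq[symmetric] by (rule link_edge) simp
  ultimately have "(w, \<sigma> k (wprod (q # v)) w) \<in> link (\<sigma> k) ?E ^^ length (q # v)"
    by (simp del: wprod_Cons) (rule relcompI)
  moreover have "\<sigma> k (wprod v) w \<in> V k" using vQ Q w(1) by (subst \<sigma>_in) (auto intro!: wprod_closed)
  ultimately show ?case using IH vQ by (auto simp: card_insert_if simp del: wprod_Cons)
qed

text \<open>A good point has coordinates: the centre of its tile and its position in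
  \<open>F\<close>. Moves by \<open>Z\<close> keep the centre and multiply the position on the left,
  so pulling back \<open>Y\<close> along the position gives base points that inherit density,
  covering and net structure. A first forest joins net neighbours by words of length at most l, at
  most |V|/|D| of them; a second one joins the resulting components by single edges from
  \<open>T\<close>, few because most components have at least M points. These are the two terms of
  the cost. Connecting paths stay in one tile, whence a length bound in terms of |F|.\<close>

lemma tile_structure:
  assumes N: "subgroup N G" and Q: "finite Q" "Q \<subseteq> N" and F: "finite F" "F \<subseteq> N"
    and Y: "Y \<subseteq> N" and D: "finite D" "D \<noteq> {}" "D \<subseteq> N" and S: "finite S" "S \<subseteq> N" and T: "finite T" "T \<subseteq> N"
    and inj: "inj_on (\<lambda>(d, y). d \<otimes> y) (D \<times> Y)"
    and cover: "\<And>x. x \<in> N \<Longrightarrow> \<exists>s\<in>S. \<exists>y\<in>Y. x = s \<otimes> y"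
    and M: "0 < M" and comp: "\<And>y. y \<in> Y \<Longrightarrow> M \<le> card {y'. (y, y') \<in> net_rel Q l Y ^^ r}"
    and Z: "Z \<subseteq> N" "\<one> \<in> Z" "S \<subseteq> Z" "m_inv G ` S \<subseteq> Z" "D \<subseteq> Z" "T \<subseteq> Z" "Q \<subseteq> Z"
      "word_ball Q (r * l) \<subseteq> Z" "word_ball Q l \<subseteq> Z"
    and Z': "Z \<union> m_inv G ` F \<union> (\<lambda>(h, z). inv h \<otimes> z) ` (F \<times> Z) \<subseteq> Z'"
    and c: "\<And>u. u \<in> V k \<Longrightarrow> \<exists>h\<in>F. c u = \<sigma> k (inv h) u"
    and \<Upsilon>: "\<And>g. 0 \<le> \<Upsilon> g"
  defines "Bad \<equiv> unfaithful k Z' \<union> {u \<in> V k - unfaithful k Z'. \<exists>z\<in>Z. c (\<sigma> k z u) \<noteq> c u}"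
  shows "\<exists>W E. W \<subseteq> V k \<and> E \<subseteq> (Q \<union> T) \<times> V k \<and>
    (\<forall>v\<in>V k - Bad. \<exists>s\<in>S. \<exists>w\<in>W. v = \<sigma> k s w) \<and>
    (\<forall>w\<in>W - (Bad \<union> touch k T Bad). \<forall>t\<in>T. \<sigma> k t w \<in> W \<longrightarrow>
       (w, \<sigma> k t w) \<in> link (\<sigma> k) E ^^ (card F * card F * (l + 1))) \<and>
    (\<Sum>(g, v)\<in>E. \<Upsilon> g) \<le> sz k / real (card D) * (real l * sum \<Upsilon> Q) +
      (sz k / real M + real (card (Bad \<union> touch k (word_ball Q (r * l)) Bad))) * sum \<Upsilon> T"
proof -
  have Nc: "N \<subseteq> carrier G" using N by (rule subgroup.subset)
  have sub: "Q \<subseteq> carrier G" "F \<subseteq> carrier G" "Y \<subseteq> carrier G" "D \<subseteq> carrier G" "S \<subseteq> carrier G" "T \<subseteq> carrier G" "Z \<subseteq> carrier G"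
    by (rule subset_trans[OF Q(2) Nc], rule subset_trans[OF F(2) Nc], rule subset_trans[OF Y Nc],
        rule subset_trans[OF D(3) Nc], rule subset_trans[OF S(2) Nc], rule subset_trans[OF T(2) Nc],
        rule subset_trans[OF Z(1) Nc])
  have ZZ': "Z \<subseteq> Z'" and FZ': "\<And>h. h \<in> F \<Longrightarrow> inv h \<in> Z'" and FZZ': "\<And>h z. h \<in> F \<Longrightarrow> z \<in> Z \<Longrightarrow> inv h \<otimes> z \<in> Z'"
  proof -
    show "Z \<subseteq> Z'" using Z' unfolding Un_subset_iff by (elim conjE)
    fix h assume h: "h \<in> F"
    have "m_inv G ` F \<subseteq> Z'" using Z' unfolding Un_subset_iff by (elim conjE)
    then show "inv h \<in> Z'" using h by (rule subsetD[OF _ imageI])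
    fix z assume z: "z \<in> Z"
    have "(\<lambda>(h, z). inv h \<otimes> z) ` (F \<times> Z) \<subseteq> Z'" using Z' unfolding Un_subset_iff by (elim conjE)
    moreover have "inv h \<otimes> z \<in> (\<lambda>(h, z). inv h \<otimes> z) ` (F \<times> Z)"
      by (rule image_eqI[of _ _ "(h, z)"]) (simp_all add: h z)
    ultimately show "inv h \<otimes> z \<in> Z'" by (rule subsetD)
  qed
  \<comment> \<open>The position of \<open>u\<close> in its tile.\<close>
  define x where "x u = (SOME h. h \<in> F \<and> c u = \<sigma> k (inv h) u)" for u
  have x: "x u \<in> F" "c u = \<sigma> k (inv (x u)) u" if u: "u \<in> V k" for u
  proof -
    have "\<exists>h. h \<in> F \<and> c u = \<sigma> k (inv h) u" using c[OF u] by blast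
    then have "x u \<in> F \<and> c u = \<sigma> k (inv (x u)) u" unfolding x_def by (rule someI_ex)
    then show "x u \<in> F" "c u = \<sigma> k (inv (x u)) u" by auto
  qed
  have xc: "x u \<in> carrier G" "x u \<in> N" if u: "u \<in> V k" for u using x(1)[OF u] sub F by auto
  define Good where "Good = V k - Bad"
  have GV: "Good \<subseteq> V k" by (auto simp: Good_def)
  have faithful: "faithful_at k Z' u" if "u \<in> Good" for u
    using that faithfulI[of u k Z'] by (auto simp: Good_def Bad_def)
  have c_move: "c (\<sigma> k z u) = c u" if "u \<in> Good" "z \<in> Z" for z u
    using that by (auto simp: Good_def Bad_def)
  \<comment> \<open>\<open>Bad\<close> contains every point at which this could fail: where the
    model is not faithful or a move leaves the tile.\<close>
  have x_move: "x (\<sigma> k z u) = z \<otimes> x u" if u: "u \<in> Good" and z: "z \<in> Z" for z u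
  proof -
    have uV: "u \<in> V k" using u GV by auto
    have zc: "z \<in> carrier G" using z sub by auto
    have zu: "\<sigma> k z u \<in> V k" using uV zc by simp
    have h: "x (\<sigma> k z u) \<in> F" "x u \<in> F" using x(1)[OF zu] x(1)[OF uV] .
    have "\<sigma> k (inv (x (\<sigma> k z u)) \<otimes> z) u = \<sigma> k (inv (x (\<sigma> k z u))) (\<sigma> k z u)"
      using faithful_mult[OF faithful[OF u] FZ'[OF h(1)]] ZZ' z by auto
    also have "\<dots> = \<sigma> k (inv (x u)) u" using x(2)[OF zu] x(2)[OF uV] c_move[OF u z] by simp
    finally have "inv (x (\<sigma> k z u)) \<otimes> z = inv (x u)"
      by (rule faithful_inj[OF faithful[OF u] FZZ'[OF h(1) z] FZ'[OF h(2)]])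
    then have "x (\<sigma> k z u) \<otimes> (inv (x (\<sigma> k z u)) \<otimes> z) \<otimes> x u = x (\<sigma> k z u) \<otimes> inv (x u) \<otimes> x u" by simp
    then show ?thesis using xc[OF uV] xc[OF zu] zc by (simp add: m_assoc)
  qed
  have coord_inj: "u = u'" if u: "u \<in> V k" "u' \<in> V k" "c u = c u'" "x u = x u'" for u u'
  proof -
    have "\<sigma> k (inv (x u)) u = \<sigma> k (inv (x u)) u'" using x(2)[OF u(1)] x(2)[OF u(2)] u(3,4) by argo
    moreover have "inv (x u) \<in> carrier G" using xc(1)[OF u(1)] by simp
    ultimately show ?thesis using \<sigma>_inj by blast
  qed
  define W where "W = {u \<in> V k. x u \<in> Y}"
  define W1 where "W1 = W \<inter> Good"
  have W1V: "W1 \<subseteq> V k" "W1 \<subseteq> Good" "finite W1" by (auto simp: W1_def W_def Good_def)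
  have W1x: "x u \<in> Y" if "u \<in> W1" for u using that by (auto simp: W1_def W_def)
  have syndetic: "\<exists>s\<in>S. \<exists>w\<in>W. v = \<sigma> k s w" if v: "v \<in> V k - Bad" for v
  proof -
    have vG: "v \<in> Good" "v \<in> V k" using v by (auto simp: Good_def)
    obtain s y where sy: "s \<in> S" "y \<in> Y" "x v = s \<otimes> y" using cover[OF xc(2)[OF vG(2)]] by blast
    have sc: "s \<in> carrier G" "y \<in> carrier G" using sy sub by auto
    have sZ: "s \<in> Z" "inv s \<in> Z" using sy Z by auto
    have "x (\<sigma> k (inv s) v) = inv s \<otimes> x v" by (rule x_move[OF vG(1) sZ(2)])
    also have "\<dots> = y" using sy sc by simp
    finally have "\<sigma> k (inv s) v \<in> W" using sy vG sc by (simp add: W_def)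
    moreover have "v = \<sigma> k s (\<sigma> k (inv s) v)"
      using faithful_inv(1)[OF faithful[OF vG(1)] subsetD[OF ZZ' Z(2)] subsetD[OF ZZ' sZ(1)]
          subsetD[OF ZZ' sZ(2)] sc(1)] by simp
    ultimately show ?thesis using sy by blast
  qed
  \<comment> \<open>Translates of base points by \<open>D\<close> determine the tile and the product
    d y, so the injectivity assumed for D \<times> Y carries over tile by tile.\<close>
  have density: "card D * card W1 \<le> card (V k)"
  proof -
    have "inj_on (\<lambda>(d, w). \<sigma> k d w) (D \<times> W1)"
    proof (rule inj_onI, clarify)
      fix d w d' w' assume *: "d \<in> D" "w \<in> W1" "d' \<in> D" "w' \<in> W1" "\<sigma> k d w = \<sigma> k d' w'"
      have wG: "w \<in> Good" "w' \<in> Good" "d \<in> Z" "d' \<in> Z" using * W1V Z by auto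
      have "d \<otimes> x w = d' \<otimes> x w'" using x_move[OF wG(1,3)] x_move[OF wG(2,4)] *(5) by simp
      then have "(d, x w) = (d', x w')" using inj_onD[OF inj, of "(d, x w)" "(d', x w')"] * W1x by auto
      moreover have "c w = c w'" using c_move[OF wG(1,3)] c_move[OF wG(2,4)] *(5) by simp
      ultimately show "d = d' \<and> w = w'" using coord_inj[of w w'] wG GV by auto
    qed
    then have "card (D \<times> W1) \<le> card (V k)"
    proof (rule card_inj_on_le)
      show "(\<lambda>(d, w). \<sigma> k d w) ` (D \<times> W1) \<subseteq> V k" using sub W1V by (auto simp: subset_iff)
    qed simp
    then show ?thesis by (simp add: card_cartesian_product)
  qed
  define r1 where "r1 = {(w, w'). w \<in> W1 \<and> w' \<in> W1 \<and> (\<exists>q\<in>word_ball Q l. w' = \<sigma> k q w)}"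
  define r2 where "r2 = {(w, w'). w \<in> W1 \<and> w' \<in> W1 \<and> (\<exists>t\<in>T. w' = \<sigma> k t w)}"
  have fr: "finite r1" "r1 \<subseteq> W1 \<times> W1" "finite r2" "r2 \<subseteq> W1 \<times> W1"
  proof -
    show r: "r1 \<subseteq> W1 \<times> W1" "r2 \<subseteq> W1 \<times> W1" by (auto simp: r1_def r2_def)
    show "finite r1" "finite r2"
      by (rule finite_subset[OF r(1)], simp add: W1V(3)) (rule finite_subset[OF r(2)], simp add: W1V(3))
  qed
  have r_c: "c w = c w'" if "(w, w') \<in> r1 \<union> r2" for w w'
    using that c_move W1V(2) Z by (auto simp: r1_def r2_def subset_iff)
  obtain r1' where r1': "r1' \<subseteq> r1" "card r1' + card (W1 // conn_rel W1 ({} \<union> r1')) \<le> card (W1 // conn_rel W1 {})"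
      "r1 \<subseteq> conn_rel W1 ({} \<union> r1')"
    using ex_spanning_forest[OF W1V(3) fr(1,2), of "{}"] by blast
  have card_r1': "card r1' \<le> card W1" using r1'(2) card_quotient_le[OF W1V(3), of "conn_rel W1 {}"] by linarith
  \<comment> \<open>This forest is built on top of the first, so its size is bounded by the number
    of components that the first one leaves.\<close>
  obtain r2' where r2': "r2' \<subseteq> r2" "card r2' + card (W1 // conn_rel W1 (r1' \<union> r2')) \<le> card (W1 // conn_rel W1 r1')"
      "r2 \<subseteq> conn_rel W1 (r1' \<union> r2')"
    using ex_spanning_forest[OF W1V(3) fr(3,4), of r1'] by blast
  have fr': "finite r1'" "finite r2'" by (rule finite_subset[OF r1'(1) fr(1)], rule finite_subset[OF r2'(1) fr(3)])
  have conn1: "(w, w') \<in> (r1' \<union> r1'\<inverse>)\<^sup>*" if "(w, w') \<in> r1" for w w'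
    using r1'(3) that by (auto simp: conn_rel_def)
  let ?B = "Bad \<union> touch k (word_ball Q (r * l)) Bad"
  have fB: "finite ?B" by (auto simp: Bad_def)
  \<comment> \<open>If no move by the ball of radius r l meets \<open>Bad\<close>, the first r steps
    of the net from the position of w can be copied into the model, giving M base points joined to
    w.\<close>
  have large: "M \<le> card (conn_rel W1 r1' `` {w})" if w: "w \<in> W1" "w \<notin> ?B" for w
  proof -
    let ?C = "{y'. (x w, y') \<in> net_rel Q l Y ^^ r}"
    have wG: "w \<in> Good" "w \<in> V k" using w W1V by auto
    have xw: "x w \<in> carrier G" "x w \<in> Y" using xc[OF wG(2)] W1x[OF w(1)] by auto
    have near: "\<sigma> k b w \<in> Good" if "b \<in> word_ball Q (r * l)" for b
    proof -
      have "b \<in> carrier G" using that word_ball_closed[OF sub(1)] by blast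
      moreover have "\<sigma> k b w \<notin> Bad" using w(2) wG(2) that by (auto simp: touch_def)
      ultimately show ?thesis using wG by (simp add: Good_def)
    qed
    have reach: "y' \<otimes> inv (x w) \<in> word_ball Q (j * l) \<and> \<sigma> k (y' \<otimes> inv (x w)) w \<in> W1 \<and>
        (w, \<sigma> k (y' \<otimes> inv (x w)) w) \<in> (r1' \<union> r1'\<inverse>)\<^sup>*"
      if "(x w, y') \<in> net_rel Q l Y ^^ j" "j \<le> r" for y' j
      using that
    proof (induction j arbitrary: y')
      case 0
      have "\<sigma> k \<one> w = w" using faithful_one[OF faithful[OF wG(1)]] Z(2) ZZ' by blast
      then show ?case using 0 xw w one_in_word_ball by simp
    next
      case (Suc j)
      then obtain y1 where y1: "(x w, y1) \<in> net_rel Q l Y ^^ j" "(y1, y') \<in> net_rel Q l Y" by auto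
      let ?b = "y1 \<otimes> inv (x w)" and ?b' = "y' \<otimes> inv (x w)"
      have IH: "?b \<in> word_ball Q (j * l)" "\<sigma> k ?b w \<in> W1" "(w, \<sigma> k ?b w) \<in> (r1' \<union> r1'\<inverse>)\<^sup>*"
        using Suc.IH[OF y1(1)] Suc.prems by auto
      obtain q where q: "q \<in> word_ball Q l" "y' = q \<otimes> y1" "y1 \<in> Y" "y' \<in> Y" using y1(2) by (auto simp: net_rel_def)
      have qc: "q \<in> carrier G" "y1 \<in> carrier G" "y' \<in> carrier G" using subsetD[OF word_ball_closed[OF sub(1)] q(1)] subsetD[OF sub(3)] q(3,4) by auto
      have b': "?b' = q \<otimes> ?b" using q qc xw by (simp add: m_assoc)
      have "?b' \<in> word_ball Q (l + j * l)" unfolding b' by (rule word_ball_mult[OF sub(1) q(1) IH(1)])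
      then have b'1: "?b' \<in> word_ball Q (Suc j * l)" by simp
      have "Suc j * l \<le> r * l" "j * l \<le> r * l" using Suc.prems by (auto intro!: mult_le_mono1 simp del: mult_Suc)
      then have b'2: "?b' \<in> word_ball Q (r * l)" "?b \<in> word_ball Q (r * l)"
        using b'1 IH(1) word_ball_mono by blast+
      have xb': "x (\<sigma> k ?b' w) = y'"
        using x_move[OF wG(1), of ?b'] b'2 Z xw qc by (auto simp: m_assoc)
      have in1: "\<sigma> k ?b' w \<in> W1" using near[OF b'2(1)] xb' q GV by (auto simp: W1_def W_def)
      have "\<sigma> k q (\<sigma> k ?b w) = \<sigma> k ?b' w" unfolding b'
        by (rule faithful_mult[OF faithful[OF wG(1)]]) (use q b'2 Z ZZ' in blast)+
      then have "(\<sigma> k ?b w, \<sigma> k ?b' w) \<in> r1" using IH(2) in1 q(1) unfolding r1_def by (auto intro!: bexI[of _ q])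
      then have "(w, \<sigma> k ?b' w) \<in> (r1' \<union> r1'\<inverse>)\<^sup>*" using IH(3) conn1 by (meson rtrancl_trans)
      then show ?case using b'1 in1 by blast
    qed
    have Csub: "?C \<subseteq> Y" using net_rel_pow_subset[OF sub(1,3) _ xw(2)] by blast
    have inj': "inj_on (\<lambda>y'. \<sigma> k (y' \<otimes> inv (x w)) w) ?C"
    proof (rule inj_onI)
      fix y1 y2 assume y: "y1 \<in> ?C" "y2 \<in> ?C" "\<sigma> k (y1 \<otimes> inv (x w)) w = \<sigma> k (y2 \<otimes> inv (x w)) w"
      have "y1 \<otimes> inv (x w) \<in> word_ball Q (r * l)" "y2 \<otimes> inv (x w) \<in> word_ball Q (r * l)"
        using reach[of y1 r] reach[of y2 r] y by auto
      then have "y1 \<otimes> inv (x w) = y2 \<otimes> inv (x w)"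
        using faithful_inj[OF faithful[OF wG(1)] _ _ y(3)] Z ZZ' by blast
      moreover have "y1 \<in> carrier G" "y2 \<in> carrier G" using y Csub sub by auto
      ultimately show "y1 = y2" using xw by simp
    qed
    have img: "(\<lambda>y'. \<sigma> k (y' \<otimes> inv (x w)) w) ` ?C \<subseteq> conn_rel W1 r1' `` {w}"
      using reach w(1) by (auto simp: conn_rel_def)
    have "finite (conn_rel W1 r1' `` {w})" by (rule finite_subset[OF _ W1V(3)]) (auto simp: conn_rel_def)
    then have "card ?C \<le> card (conn_rel W1 r1' `` {w})" by (rule card_inj_on_le[OF inj' img])
    then show ?thesis using comp[OF xw(2)] by simp
  qed
  have card_r2': "real (card r2') \<le> sz k / real M + real (card ?B)"
  proof -
    have "real (card r2') \<le> real (card (W1 // conn_rel W1 r1'))" using r2'(2) by simp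
    also have "\<dots> \<le> real (card W1) / real M + real (card ?B)"
      by (rule card_quotient_le_large_classes[OF W1V(3) equiv_conn_rel fB M large])
    also have "real (card W1) / real M \<le> sz k / real M"
      using W1V(1) by (intro divide_right_mono) (auto intro: card_mono)
    finally show ?thesis by simp
  qed
  have "\<forall>e\<in>r1'. \<exists>v. set v \<subseteq> Q \<and> length v \<le> l \<and> snd e = \<sigma> k (wprod v) (fst e)"
  proof
    fix e assume "e \<in> r1'"
    then have "e \<in> r1" by (rule subsetD[OF r1'(1)])
    then obtain q where q: "q \<in> word_ball Q l" "snd e = \<sigma> k q (fst e)" by (auto simp: r1_def)
    obtain v where "set v \<subseteq> Q" "length v \<le> l" "q = wprod v" using q(1) by (rule word_ballE)
    then show "\<exists>v. set v \<subseteq> Q \<and> length v \<le> l \<and> snd e = \<sigma> k (wprod v) (fst e)"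
      using q(2) by (intro exI[of _ v]) simp
  qed
  then obtain v where v: "\<And>e. e \<in> r1' \<Longrightarrow> set (v e) \<subseteq> Q \<and> length (v e) \<le> l \<and> snd e = \<sigma> k (wprod (v e)) (fst e)" by metis
  have "\<forall>e\<in>r2'. \<exists>t. t \<in> T \<and> snd e = \<sigma> k t (fst e)" 
  proof
    fix e assume "e \<in> r2'"
    then have "e \<in> r2" by (rule subsetD[OF r2'(1)])
    then show "\<exists>t. t \<in> T \<and> snd e = \<sigma> k t (fst e)" by (auto simp: r2_def)
  qed
  then obtain t where t: "\<And>e. e \<in> r2' \<Longrightarrow> t e \<in> T \<and> snd e = \<sigma> k (t e) (fst e)" by metis
  define E1 where "E1 = (\<Union>e\<in>r1'. word_edges k (v e) (fst e))"
  define E2 where "E2 = (\<lambda>e. (t e, fst e)) ` r2'"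
  have edges1: "e \<in> r1' \<Longrightarrow> (fst e, snd e) \<in> link (\<sigma> k) (word_edges k (v e) (fst e)) ^^ length (v e) \<and>
      finite (word_edges k (v e) (fst e)) \<and> card (word_edges k (v e) (fst e)) \<le> length (v e) \<and>
      word_edges k (v e) (fst e) \<subseteq> Q \<times> V k" for e
  proof -
    assume e: "e \<in> r1'"
    then have "fst e \<in> W1" using r1'(1) by (auto simp: r1_def)
    then have "fst e \<in> V k" "faithful_at k Z' (fst e)" using W1V faithful by auto
    then show ?thesis using word_edges[OF sub(1), of "fst e" k Z' l "v e"] v[OF e] Z ZZ' by auto
  qed
  have E1: "E1 \<subseteq> Q \<times> V k" "finite E1" using edges1 fr' by (auto simp: E1_def)
  have E2: "E2 \<subseteq> T \<times> V k" "finite E2"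
  proof -
    show "finite E2" using fr'(2) by (simp add: E2_def)
    show "E2 \<subseteq> T \<times> V k"
    proof
      fix p assume "p \<in> E2"
      then obtain e where e: "e \<in> r2'" "p = (t e, fst e)" by (auto simp: E2_def)
      then have "fst e \<in> W1" using subsetD[OF r2'(1) e(1)] by (auto simp: r2_def)
      then show "p \<in> T \<times> V k" using e t[OF e(1)] W1V(1) by auto
    qed
  qed
  have "card E1 \<le> (\<Sum>e\<in>r1'. card (word_edges k (v e) (fst e)))" unfolding E1_def by (rule card_UN_le[OF fr'(1)])
  also have "\<dots> \<le> (\<Sum>e\<in>r1'. l)" 
  proof (rule sum_mono)
    fix e assume e: "e \<in> r1'"
    show "card (word_edges k (v e) (fst e)) \<le> l" using edges1[OF e] v[OF e] by linarith
  qed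
  finally have "card E1 \<le> card r1' * l" by simp
  then have cE1: "real (card E1) \<le> real (card r1') * real l" unfolding of_nat_mult[symmetric] of_nat_le_iff .
  have "real (card r1') \<le> sz k / real (card D)"
  proof -
    have "card r1' * card D \<le> card (V k)" by (rule order_trans[OF mult_le_mono1[OF card_r1']]) (simp only: mult.commute density)
    then show ?thesis using D by (simp add: le_divide_eq card_gt_0_iff of_nat_mult[symmetric] del: of_nat_mult)
  qed
  then have cE1': "real (card E1) \<le> sz k / real (card D) * real l" by (rule order_trans[OF cE1 mult_right_mono]) simp
  have cE2: "real (card E2) \<le> sz k / real M + real (card ?B)"
    using card_image_le[OF fr'(2), of "\<lambda>e. (t e, fst e)"] card_r2' unfolding E2_def by linarith
  define E where "E = E1 \<union> E2"
  have \<Upsilon>le: "\<Upsilon> g \<le> sum \<Upsilon> A" if "finite A" "g \<in> A" for g A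
    using that \<Upsilon> by (intro member_le_sum) auto
  have cost: "(\<Sum>(g, v)\<in>E. \<Upsilon> g) \<le> sz k / real (card D) * (real l * sum \<Upsilon> Q) + (sz k / real M + real (card ?B)) * sum \<Upsilon> T"
  proof -
    have "(\<Sum>(g, v)\<in>E. \<Upsilon> g) \<le> (\<Sum>(g, v)\<in>E1. \<Upsilon> g) + (\<Sum>(g, v)\<in>E2. \<Upsilon> g)"
    proof -
      have "0 \<le> (\<Sum>(g, v)\<in>E1 \<inter> E2. \<Upsilon> g)" using \<Upsilon> by (intro sum_nonneg) auto
      then show ?thesis unfolding E_def using sum.union_inter[OF E1(2) E2(2), of "\<lambda>(g, v). \<Upsilon> g"] by linarith
    qed
    also have "(\<Sum>(g, v)\<in>E1. \<Upsilon> g) \<le> real (card E1) * sum \<Upsilon> Q"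
      using E1 \<Upsilon>le[OF Q(1)] by (intro sum_edge_cost_le) auto
    also have "\<dots> \<le> sz k / real (card D) * real l * sum \<Upsilon> Q"
      using cE1' \<Upsilon> by (intro mult_right_mono sum_nonneg) auto
    also have "(\<Sum>(g, v)\<in>E2. \<Upsilon> g) \<le> real (card E2) * sum \<Upsilon> T"
      using E2 \<Upsilon>le[OF T(1)] by (intro sum_edge_cost_le) auto
    also have "\<dots> \<le> (sz k / real M + real (card ?B)) * sum \<Upsilon> T"
      using cE2 \<Upsilon> by (intro mult_right_mono sum_nonneg) auto
    finally show ?thesis by (simp add: mult.assoc)
  qed
  have connected: "(w, \<sigma> k s w) \<in> link (\<sigma> k) E ^^ (card F * card F * (l + 1))"
    if w: "w \<in> W" "w \<notin> Bad \<union> touch k T Bad" "s \<in> T" "\<sigma> k s w \<in> W" for w s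
  proof -
    have wV: "w \<in> V k" using w by (auto simp: W_def)
    have sw: "\<sigma> k s w \<notin> Bad" using w wV by (auto simp: touch_def)
    have W1: "w \<in> W1" "\<sigma> k s w \<in> W1" using w wV sw by (auto simp: W1_def W_def Good_def)
    then have "(w, \<sigma> k s w) \<in> r2" using w by (auto simp: r2_def)
    then have path: "(w, \<sigma> k s w) \<in> ((r1' \<union> r2') \<union> (r1' \<union> r2')\<inverse>)\<^sup>*" using r2'(3) by (auto simp: conn_rel_def)
    \<comment> \<open>The base points of the tile of w. No step changes the centre, so the path
      never leaves this set, and the position embeds it in \<open>F\<close>.\<close>
    define P where "P = {u \<in> W1. c u = c w}"
    define r0 where "r0 = (r1' \<union> r2') \<inter> (P \<times> P)"
    have inP: "(w, u) \<in> (r0 \<union> r0\<inverse>)\<^sup>* \<and> u \<in> P"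
      if "(w, u) \<in> ((r1' \<union> r2') \<union> (r1' \<union> r2')\<inverse>)\<^sup>*" for u
      using that
    proof induction
      case base
      then show ?case using W1 by (simp add: P_def)
    next
      case (step u u')
      have "(u, u') \<in> r1 \<union> r2 \<or> (u', u) \<in> r1 \<union> r2" using step.hyps(2) r1'(1) r2'(1) by blast
      then have "c u = c u'" "u' \<in> W1" using r_c[of u u'] r_c[of u' u] fr(2,4) by auto
      then have "u' \<in> P" using step.IH by (simp add: P_def)
      then have "(u, u') \<in> r0 \<union> r0\<inverse>" using step.hyps(2) step.IH by (auto simp: r0_def)
      then have "(w, u') \<in> (r0 \<union> r0\<inverse>)\<^sup>*" by (rule rtrancl_into_rtrancl[OF conjunct1[OF step.IH]])
      then show ?case using \<open>u' \<in> P\<close> by simp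
    qed
    have cardP: "card P \<le> card F"
    proof (rule card_inj_on_le[of x])
      show "inj_on x P" using coord_inj W1V(1) by (auto intro!: inj_onI simp: P_def subset_iff)
      show "x ` P \<subseteq> F" using x(1) W1V(1) by (auto simp: P_def subset_iff)
    qed (rule F)
    have r0P: "r0 \<subseteq> P \<times> P" and fP: "finite P" using W1V(3) by (auto simp: r0_def P_def)
    obtain j where j: "j \<le> card F * card F" "(w, \<sigma> k s w) \<in> (r0 \<union> r0\<inverse>) ^^ j"
      using conn_rel_bounded_path[OF r0P fP cardP conjunct1[OF inP[OF path]]] by (elim exE conjE)
    have one: "(a, b) \<in> link (\<sigma> k) E ^^ (l + 1)" if "(a, b) \<in> r1' \<union> r2'" for a b
    proof (cases "(a, b) \<in> r1'")
      case True
      have "(a, b) \<in> link (\<sigma> k) (word_edges k (v (a, b)) a) ^^ length (v (a, b))" using edges1[OF True] by simp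
      then show ?thesis by (rule link_pow_mono) (use v[OF True] True in \<open>auto simp: E_def E1_def intro!: bexI[of _ "(a, b)"]\<close>)
    next
      case False
      then have ab: "(a, b) \<in> r2'" using that by simp
      then have "(t (a, b), a) \<in> E" by (force simp: E_def E2_def)
      then have "(a, \<sigma> k (t (a, b)) a) \<in> link (\<sigma> k) E" by (rule link_edge)
      then have "(a, b) \<in> link (\<sigma> k) E ^^ 1" using t[OF ab] by simp
      then show ?thesis by (rule link_pow_le) simp
    qed
    have "(w, \<sigma> k s w) \<in> link (\<sigma> k) E ^^ (j * (l + 1))"
    proof (rule link_UN_path[OF j(2)])
      fix a b assume "(a, b) \<in> r0 \<union> r0\<inverse>"
      then have "(a, b) \<in> r1' \<union> r2' \<or> (b, a) \<in> r1' \<union> r2'" by (auto simp: r0_def)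
      then show "(a, b) \<in> link (\<sigma> k) E ^^ (l + 1)"
        using one[of a b] link_pow_sym[OF one[of b a]] by argo
    qed
    then show ?thesis using j(1) by (rule link_pow_le[OF _ mult_le_mono1])
  qed
  have "W \<subseteq> V k" "E \<subseteq> (Q \<union> T) \<times> V k" using E1 E2 by (auto simp: W_def E_def)
  then show ?thesis using syndetic connected cost by (intro exI[of _ W] exI[of _ E]) blast
qed

text \<open>The net is taken for K above the total weight of \<open>Q\<close>, before
  \<open>T\<close> and \<delta> are known; this fixes \<open>S\<close> and bounds the first forest
  by |V|. Everything chosen afterwards (M, r, the tolerance \<theta>, the Folner set) only has to
  fit the remaining \<delta> |V|.\<close>

lemma folner_sparsely_connected:
  assumes N: "subgroup N G" and Q: "finite Q" "Q \<subseteq> N"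
    and folner: "\<And>T \<epsilon>. finite T \<Longrightarrow> T \<subseteq> N \<Longrightarrow> 0 < (\<epsilon> :: real) \<Longrightarrow>
      \<exists>F. finite F \<and> F \<noteq> {} \<and> F \<subseteq> N \<and> (\<forall>t\<in>T. real (card ((\<lambda>x. t \<otimes> x) ` F - F)) \<le> \<epsilon> * real (card F))"
    and net: "\<And>K :: real. \<exists>S l Y D.
     finite S \<and> S \<subseteq> N \<and> Y \<subseteq> N \<and> finite D \<and> D \<subseteq> N \<and>
     K * (real l + 1) \<le> real (card D) \<and> inj_on (\<lambda>(d, y). d \<otimes> y) (D \<times> Y) \<and>
     (\<forall>x\<in>N. \<exists>s\<in>S. \<exists>y\<in>Y. x = s \<otimes> y) \<and>
     (\<forall>M :: nat. \<exists>r. \<forall>y\<in>Y. M \<le> card {y'. (y, y') \<in> net_rel Q l Y ^^ r})"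
    and \<Upsilon>: "\<And>g. 0 \<le> \<Upsilon> g"
  shows "\<exists>S. finite S \<and> S \<subseteq> N \<and> sparsely_connected \<Upsilon> S N"
proof -
  have Nc: "N \<subseteq> carrier G" using N by (rule subgroup.subset)
  have \<Upsilon>sum: "0 \<le> sum \<Upsilon> A" for A using \<Upsilon> by (simp add: sum_nonneg)
  obtain S l Y D where S: "finite S" "S \<subseteq> N" and Y: "Y \<subseteq> N" and D: "finite D" "D \<subseteq> N"
    and K: "(sum \<Upsilon> Q + 1) * (real l + 1) \<le> real (card D)"
    and inj: "inj_on (\<lambda>(d, y). d \<otimes> y) (D \<times> Y)"
    and cover': "\<forall>x\<in>N. \<exists>s\<in>S. \<exists>y\<in>Y. x = s \<otimes> y"
    and comp: "\<forall>M :: nat. \<exists>r. \<forall>y\<in>Y. M \<le> card {y'. (y, y') \<in> net_rel Q l Y ^^ r}"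
    using net[of "sum \<Upsilon> Q + 1"] by (elim exE conjE) (rule that, assumption+)
  have cover: "\<exists>s\<in>S. \<exists>y\<in>Y. x = s \<otimes> y" if "x \<in> N" for x using cover' that by (rule bspec)
  have Dpos: "0 < real (card D)"
  proof -
    have "0 < (sum \<Upsilon> Q + 1) * (real l + 1)" using \<Upsilon>sum[of Q] by (intro mult_pos_pos) auto
    then show ?thesis using K by linarith
  qed
  have "real l * sum \<Upsilon> Q \<le> (sum \<Upsilon> Q + 1) * (real l + 1)"
    using \<Upsilon>sum[of Q] by (simp add: algebra_simps)
  then have cost1: "sz k / real (card D) * (real l * sum \<Upsilon> Q) \<le> sz k" for k
    using K Dpos mult_left_mono[of "real l * sum \<Upsilon> Q" "real (card D)" "sz k / real (card D)"] by simp
  have "sparsely_connected \<Upsilon> S N"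
    unfolding sparsely_connected_def
  proof (intro allI impI)
    fix T \<delta> assume T\<delta>: "finite T \<and> T \<subseteq> N \<and> (0 :: real) < \<delta>"
    then have T: "finite T" "T \<subseteq> N" and \<delta>: "0 < \<delta>" by auto
    \<comment> \<open>Components this large make the edges from \<open>T\<close> that join them cost
      at most half of \<delta> |V|.\<close>
    define M where "M = nat \<lceil>2 * sum \<Upsilon> T / \<delta>\<rceil> + 1"
    have M: "0 < M" "sum \<Upsilon> T / real M \<le> \<delta> / 2"
    proof -
      show "0 < M" by (simp add: M_def)
      have "2 * sum \<Upsilon> T / \<delta> \<le> real M" unfolding M_def using real_nat_ceiling_ge[of "2 * sum \<Upsilon> T / \<delta>"] by simp
      then show "sum \<Upsilon> T / real M \<le> \<delta> / 2" using \<delta> \<open>0 < M\<close> by (simp add: field_simps)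
    qed
    obtain r where "\<forall>y\<in>Y. M \<le> card {y'. (y, y') \<in> net_rel Q l Y ^^ r}" using comp[rule_format, of M] by (rule exE)
    then have r: "M \<le> card {y'. (y, y') \<in> net_rel Q l Y ^^ r}" if "y \<in> Y" for y using that by (rule bspec)
    define \<beta> where "\<beta> = real (card (word_ball Q (r * l)))"
    \<comment> \<open>With \<theta> = \<delta>/X there is room for the exceptional set and its
      preimages under \<open>T\<close>, and also for the cost of joining the components near bad
      points, which lie within the ball of radius r l.\<close>
    define X where "X = 2 * (1 + \<beta> + real (card T)) * (1 + sum \<Upsilon> T)"
    define \<theta> where "\<theta> = \<delta> / X"
    have den: "0 < 1 + \<beta> + real (card T)" "0 < 1 + sum \<Upsilon> T" using \<Upsilon>sum[of T] by (auto simp: \<beta>_def intro: add_pos_nonneg)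
    have X: "0 < X" unfolding X_def using den by simp
    have \<theta>: "0 < \<theta>" unfolding \<theta>_def using \<delta> X by simp
    have \<theta>X: "\<theta> * X = \<delta>" using X by (simp add: \<theta>_def)
    have \<theta>1: "\<theta> * (1 + real (card T)) \<le> \<delta>"
    proof -
      have "\<theta> * (1 + real (card T)) \<le> \<theta> * (2 * (1 + \<beta> + real (card T)) * (1 + sum \<Upsilon> T))"
      proof (rule mult_left_mono)
        have "1 + real (card T) \<le> 2 * (1 + \<beta> + real (card T)) * 1" by (simp add: \<beta>_def)
        also have "\<dots> \<le> 2 * (1 + \<beta> + real (card T)) * (1 + sum \<Upsilon> T)"
          using \<Upsilon>sum[of T] den by (intro mult_left_mono) auto
        finally show "1 + real (card T) \<le> 2 * (1 + \<beta> + real (card T)) * (1 + sum \<Upsilon> T)" .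
      qed (use \<theta> in simp)
      also have "\<dots> = \<delta>" using \<theta>X by (simp only: X_def)
      finally show ?thesis .
    qed
    have \<theta>2: "\<theta> * (1 + \<beta>) * sum \<Upsilon> T \<le> \<delta> / 2"
    proof -
      have "(1 + \<beta>) * sum \<Upsilon> T \<le> (1 + \<beta> + real (card T)) * (1 + sum \<Upsilon> T)"
        using \<Upsilon>sum[of T] by (intro mult_mono) (auto simp: \<beta>_def)
      then have "\<theta> * ((1 + \<beta>) * sum \<Upsilon> T) \<le> \<theta> * ((1 + \<beta> + real (card T)) * (1 + sum \<Upsilon> T))"
        using \<theta> by (intro mult_left_mono) auto
      also have "\<dots> = \<theta> * X / 2" by (simp add: X_def field_simps)
      also have "\<dots> = \<delta> / 2" by (simp only: \<theta>X)
      finally show ?thesis by (simp add: mult.assoc)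
    qed
    define Z where "Z = insert \<one> (S \<union> m_inv G ` S \<union> D \<union> T \<union> Q \<union> word_ball Q (r * l) \<union> word_ball Q l)"
    have ballN: "word_ball Q m \<subseteq> N" for m
    proof
      fix x assume "x \<in> word_ball Q m"
      then obtain w where "set w \<subseteq> Q" "x = wprod w" by (rule word_ballE)
      then have "set w \<subseteq> N" "x = wprod w" using Q by auto
      then show "x \<in> N" using subgroup.one_closed[OF N] subgroup.m_closed[OF N] by (induction w arbitrary: x) auto
    qed
    have invS: "m_inv G ` S \<subseteq> N" using S subgroup.m_inv_closed[OF N] by auto
    have Z: "finite Z" "Z \<subseteq> N" "\<one> \<in> Z" "S \<subseteq> Z" "m_inv G ` S \<subseteq> Z" "D \<subseteq> Z" "T \<subseteq> Z" "Q \<subseteq> Z"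
      "word_ball Q (r * l) \<subseteq> Z" "word_ball Q l \<subseteq> Z"
      using S D T Q finite_word_ball[OF Q(1)] ballN invS subgroup.one_closed[OF N] unfolding Z_def by (simp_all, blast+)
    have Zc: "Z \<subseteq> carrier G" by (rule subset_trans[OF Z(2) Nc])
    \<comment> \<open>Tile boundaries then take \<theta>/2, which leaves the other half for
      unfaithful points.\<close>
    define \<epsilon> where "\<epsilon> = \<theta> / (4 * (real (card Z) + 1))"
    have \<epsilon>: "0 < \<epsilon>" "2 * \<epsilon> * real (card Z) \<le> \<theta> / 2"
    proof -
      show "0 < \<epsilon>" using \<theta> by (simp add: \<epsilon>_def)
      have "2 * \<epsilon> * real (card Z) \<le> 2 * \<epsilon> * (real (card Z) + 1)" using \<open>0 < \<epsilon>\<close> by simp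
      also have "\<dots> = \<theta> / 2" by (simp add: \<epsilon>_def field_simps)
      finally show "2 * \<epsilon> * real (card Z) \<le> \<theta> / 2" .
    qed
    have "finite (m_inv G ` Z)" "m_inv G ` Z \<subseteq> N" using Z(1,2) subgroup.m_inv_closed[OF N] by auto
    then obtain F where F: "finite F" "F \<noteq> {}" "F \<subseteq> N"
      and Fz: "\<And>t. t \<in> m_inv G ` Z \<Longrightarrow> real (card ((\<lambda>x. t \<otimes> x) ` F - F)) \<le> \<epsilon> * real (card F)"
      using folner[OF _ _ \<epsilon>(1)] by metis
    have Fc: "F \<subseteq> carrier G" by (rule subset_trans[OF F(3) Nc])
    define Z' where "Z' = Z \<union> m_inv G ` F \<union> (\<lambda>(h, z). inv h \<otimes> z) ` (F \<times> Z)"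
    have Z': "finite Z'" "Z' \<subseteq> carrier G" 
    proof -
      show "finite Z'" using F(1) Z(1) by (simp add: Z'_def)
      show "Z' \<subseteq> carrier G" unfolding Z'_def
        using Zc by (auto intro!: m_closed inv_closed dest: subsetD[OF Fc] subsetD[OF Zc])
    qed
    have "0 < \<theta> / 2" using \<theta> by simp
    note ev = eventually_unfaithful_small[OF Z' this]
    show "\<exists>C R. finite R \<and> R \<subseteq> carrier G \<and>
           (\<forall>\<^sub>F k in sequentially. \<exists>W E B. W \<subseteq> V k \<and> E \<subseteq> R \<times> V k \<and> B \<subseteq> V k \<and>
              real (card B) \<le> \<delta> * sz k \<and> (\<Sum>(g, v)\<in>E. \<Upsilon> g) \<le> (1 + \<delta>) * sz k \<and>
              (\<forall>v\<in>V k - B. \<exists>s\<in>S. \<exists>w\<in>W. v = \<sigma> k s w) \<and>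
              (\<forall>w\<in>W - B. \<forall>t\<in>T. \<sigma> k t w \<in> W \<longrightarrow> (w, \<sigma> k t w) \<in> link (\<sigma> k) E ^^ C))"
    proof (rule exI[of _ "card F * card F * (l + 1)"], rule exI[of _ "Q \<union> T"], intro conjI)
      show "finite (Q \<union> T)" using Q T by simp
      show "Q \<union> T \<subseteq> carrier G" using Q T Nc by blast
      show "\<forall>\<^sub>F k in sequentially. \<exists>W E B. W \<subseteq> V k \<and> E \<subseteq> (Q \<union> T) \<times> V k \<and> B \<subseteq> V k \<and>
              real (card B) \<le> \<delta> * sz k \<and> (\<Sum>(g, v)\<in>E. \<Upsilon> g) \<le> (1 + \<delta>) * sz k \<and>
              (\<forall>v\<in>V k - B. \<exists>s\<in>S. \<exists>w\<in>W. v = \<sigma> k s w) \<and>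
              (\<forall>w\<in>W - B. \<forall>t\<in>T. \<sigma> k t w \<in> W \<longrightarrow> (w, \<sigma> k t w) \<in> link (\<sigma> k) E ^^ (card F * card F * (l + 1)))"
        using ev
      proof eventually_elim
        case (elim k)
        obtain c where c: "\<And>u. u \<in> V k \<Longrightarrow> \<exists>h\<in>F. c u = \<sigma> k (inv h) u"
          "real (card {u \<in> V k - unfaithful k Z'. \<exists>z\<in>Z. c (\<sigma> k z u) \<noteq> c u}) \<le> 2 * \<epsilon> * real (card Z) * sz k"
        proof (rule ex_tiling[OF F(1,2) Fc Z(1) Zc])
          show "real (card ((\<lambda>x. inv z \<otimes> x) ` F - F)) \<le> \<epsilon> * real (card F)" if "z \<in> Z" for z
            by (rule Fz[OF imageI[OF that]])
          show "Z \<union> m_inv G ` F \<union> (\<lambda>(h, z). inv h \<otimes> z) ` (F \<times> Z) \<subseteq> Z'" by (simp add: Z'_def)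
        qed (rule that)
        define Bad where "Bad = unfaithful k Z' \<union> {u \<in> V k - unfaithful k Z'. \<exists>z\<in>Z. c (\<sigma> k z u) \<noteq> c u}"
        have fBad: "finite Bad" "Bad \<subseteq> V k" using unfaithful_subset by (auto simp: Bad_def)
        have "real (card Bad) \<le> \<theta> / 2 * sz k + 2 * \<epsilon> * real (card Z) * sz k"
          unfolding Bad_def by (rule order_trans[OF of_nat_mono[OF card_Un_le]]) (use elim c(2) in simp)
        also have "\<dots> \<le> \<theta> / 2 * sz k + \<theta> / 2 * sz k" using \<epsilon>(2) by (intro add_mono mult_right_mono) auto
        finally have cBad: "real (card Bad) \<le> \<theta> * sz k" by simp
        have touchB: "real (card (Bad \<union> touch k A Bad)) \<le> \<theta> * (1 + real (card A)) * sz k"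
          if "finite A" "A \<subseteq> carrier G" for A
        proof -
          have "real (card (Bad \<union> touch k A Bad)) \<le> real (card Bad) + real (card (touch k A Bad))"
            using card_Un_le[of Bad "touch k A Bad"] by linarith
          also have "\<dots> \<le> \<theta> * sz k + real (card A) * \<theta> * sz k"
            using cBad card_touch_le[OF that fBad(1) cBad] by linarith
          finally show ?thesis by (simp add: algebra_simps)
        qed
        obtain W E where WE: "W \<subseteq> V k" "E \<subseteq> (Q \<union> T) \<times> V k"
          "\<forall>v\<in>V k - Bad. \<exists>s\<in>S. \<exists>w\<in>W. v = \<sigma> k s w"
          "\<forall>w\<in>W - (Bad \<union> touch k T Bad). \<forall>t\<in>T. \<sigma> k t w \<in> W \<longrightarrow>
             (w, \<sigma> k t w) \<in> link (\<sigma> k) E ^^ (card F * card F * (l + 1))"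
          "(\<Sum>(g, v)\<in>E. \<Upsilon> g) \<le> sz k / real (card D) * (real l * sum \<Upsilon> Q) +
            (sz k / real M + real (card (Bad \<union> touch k (word_ball Q (r * l)) Bad))) * sum \<Upsilon> T"
        proof -
          have D0: "D \<noteq> {}" using Dpos by auto
          have sub: "Z \<union> m_inv G ` F \<union> (\<lambda>(h, z). inv h \<otimes> z) ` (F \<times> Z) \<subseteq> Z'" by (simp add: Z'_def)
          note tiles = tile_structure[where c = c and \<Upsilon> = \<Upsilon> and k = k,
              OF N Q F(1,3) Y D(1) D0 D(2) S T inj _ M(1) _ Z(2-10) sub, folded Bad_def]
          show thesis
            by (rule exE[OF tiles], rule cover, assumption, rule r, assumption, rule c(1), assumption, rule \<Upsilon>)
              (elim exE conjE, rule that, assumption+)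
        qed
        have ballc: "finite (word_ball Q (r * l))" "word_ball Q (r * l) \<subseteq> carrier G"
          using finite_word_ball[OF Q(1)] subset_trans[OF ballN Nc] by auto
        have "(\<Sum>(g, v)\<in>E. \<Upsilon> g) \<le> sz k + (sz k / real M + \<theta> * (1 + \<beta>) * sz k) * sum \<Upsilon> T"
          using WE(5) cost1[of k] mult_right_mono[OF add_left_mono[OF touchB[OF ballc]], of "sum \<Upsilon> T" "sz k / real M"] \<Upsilon>sum[of T]
          unfolding \<beta>_def by linarith
        also have "\<dots> = sz k + (sum \<Upsilon> T / real M + \<theta> * (1 + \<beta>) * sum \<Upsilon> T) * sz k" by (simp add: field_simps)
        also have "\<dots> \<le> sz k + (\<delta> / 2 + \<delta> / 2) * sz k"
          using M(2) \<theta>2 by (intro add_left_mono mult_right_mono add_mono) auto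
        finally have cost: "(\<Sum>(g, v)\<in>E. \<Upsilon> g) \<le> (1 + \<delta>) * sz k" by (simp add: algebra_simps)
        define B where "B = Bad \<union> touch k T Bad"
        have "real (card B) \<le> \<theta> * (1 + real (card T)) * sz k" unfolding B_def using T Nc by (intro touchB) auto
        also have "\<dots> \<le> \<delta> * sz k" using \<theta>1 by (intro mult_right_mono) auto
        finally have cB: "real (card B) \<le> \<delta> * sz k" .
        have BV: "B \<subseteq> V k" using fBad touch_subset by (auto simp: B_def)
        have "\<forall>v\<in>V k - B. \<exists>s\<in>S. \<exists>w\<in>W. v = \<sigma> k s w" using WE(3) by (auto simp: B_def)
        then show ?case using WE(1,2) BV cB cost WE(4)[folded B_def]
          by (intro exI[of _ W] exI[of _ E] exI[of _ B]) simp
      qed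
    qed
  qed
  then show ?thesis using S by blast
qed

end

section \<open>Normal and w-normal extensions\<close>

lemma sum_edge_image_le:
  fixes \<Upsilon> :: "'a \<Rightarrow> real"
  assumes "finite U" "\<And>u. u \<in> U \<Longrightarrow> \<Upsilon> (fst (f u)) \<le> c u" "\<And>g. 0 \<le> \<Upsilon> g"
  shows "(\<Sum>(g, v)\<in>f ` U. \<Upsilon> g) \<le> (\<Sum>u\<in>U. c u)"
proof -
  have "(\<Sum>(g, v)\<in>f ` U. \<Upsilon> g) \<le> (\<Sum>u\<in>U. \<Upsilon> (fst (f u)))"
    using sum_image_le[OF assms(1), of "\<lambda>(g, v). \<Upsilon> g" f] assms(3) by (simp add: case_prod_beta o_def)
  also have "\<dots> \<le> (\<Sum>u\<in>U. c u)" using assms(2) by (rule sum_mono)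
  finally show ?thesis .
qed

lemma sum_edge_Un_le:
  fixes \<Upsilon> :: "'a \<Rightarrow> real"
  assumes "finite E" "finite E'" "\<And>g. 0 \<le> \<Upsilon> g"
  shows "(\<Sum>(g, v)\<in>E \<union> E'. \<Upsilon> g) \<le> (\<Sum>(g, v)\<in>E. \<Upsilon> g) + (\<Sum>(g, v)\<in>E'. \<Upsilon> g)"
proof -
  have "0 \<le> (\<Sum>(g, v)\<in>E \<inter> E'. \<Upsilon> g)" using assms(3) by (intro sum_nonneg) auto
  then show ?thesis using sum.union_inter[OF assms(1,2), of "\<lambda>(g, v). \<Upsilon> g"] by linarith
qed

context sofic_sequence
begin

text \<open>Let v = x^-1 w be a net point near w, with x in \<open>N\<close>. Then t v = (t x^-1
  t^-1) (t w), and t x^-1 t^-1 lies in \<open>N\<close> by normality. So w is joined inside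
  \<open>N\<close> to a base point next to v, then v to t v by one new edge, and a base point next
  to t v inside \<open>N\<close> to t w. New edges are needed only at the net, whose density 1/|D|
  is arbitrarily small since \<open>N\<close> is infinite; \<open>S\<close> and the main term of the
  budget do not change.\<close>

lemma sparsely_connected_normal_extension:
  assumes N: "subgroup N G" "infinite N" and S: "finite S" "S \<subseteq> N"
    and L: "L \<subseteq> carrier G" "\<And>t x. t \<in> L \<Longrightarrow> x \<in> N \<Longrightarrow> t \<otimes> x \<otimes> inv t \<in> N"
    and conn: "sparsely_connected \<Upsilon> S N" and \<Upsilon>: "\<And>g. 0 \<le> \<Upsilon> g"
  shows "sparsely_connected \<Upsilon> S L"
  unfolding sparsely_connected_def
proof (intro allI impI)
  fix T \<delta> assume T\<delta>: "finite T \<and> T \<subseteq> L \<and> (0 :: real) < \<delta>"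
  then have T: "finite T" "T \<subseteq> L" and \<delta>: "0 < \<delta>" by auto
  have Nc: "N \<subseteq> carrier G" using N(1) by (rule subgroup.subset)
  have Sc: "S \<subseteq> carrier G" and Tc: "T \<subseteq> carrier G"
    by (rule subset_trans[OF S(2) Nc], rule subset_trans[OF T(2) L(1)])
  have \<Upsilon>sum: "0 \<le> sum \<Upsilon> A" for A using \<Upsilon> by (simp add: sum_nonneg)
  \<comment> \<open>The weight added per net point v: an edge from v to its base point, an edge for
    each t in \<open>T\<close>, and an edge from each t v to its base point.\<close>
  define c0 where "c0 = sum \<Upsilon> S + sum \<Upsilon> T + real (card T) * sum \<Upsilon> S"
  have c0: "0 \<le> c0" unfolding c0_def using \<Upsilon>sum by (intro add_nonneg_nonneg mult_nonneg_nonneg) auto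
  obtain D where D: "D \<subseteq> N" "finite D" "card D = nat \<lceil>2 * c0 / \<delta>\<rceil> + 1"
    using infinite_arbitrarily_large[OF N(2)] by blast
  have Dc: "D \<subseteq> carrier G" by (rule subset_trans[OF D(1) Nc])
  have D0: "D \<noteq> {}" using D by auto
  have cD: "c0 \<le> \<delta> / 2 * real (card D)"
  proof -
    have "2 * c0 / \<delta> \<le> real (card D)" using real_nat_ceiling_ge[of "2 * c0 / \<delta>"] D(3) by simp
    then show ?thesis using \<delta> by (simp add: field_simps)
  qed
  define P where "P = (\<lambda>(d, d'). inv d \<otimes> d') ` (D \<times> D)"
  have P: "finite P" "P \<subseteq> N"
    using D(2) by (auto simp: P_def intro!: subgroup.m_closed[OF N(1)] subgroup.m_inv_closed[OF N(1)] dest: subsetD[OF D(1)])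
  have Pc: "P \<subseteq> carrier G" by (rule subset_trans[OF P(2) Nc])
  \<comment> \<open>The elements of \<open>N\<close> that lead from w to the base point next to v,
    and from t w to the base point next to t v.\<close>
  define T0 where "T0 = (\<lambda>(s, x). inv s \<otimes> inv x) ` (S \<times> P) \<union> (\<lambda>(s, t, x). inv s \<otimes> (t \<otimes> inv x \<otimes> inv t)) ` (S \<times> T \<times> P)"
  have T0: "finite T0" "T0 \<subseteq> N"
  proof -
    show "finite T0" unfolding T0_def using S T P by simp
    have "inv s \<otimes> inv x \<in> N" if "s \<in> S" "x \<in> P" for s x
      using that S(2) P(2) by (intro subgroup.m_closed[OF N(1)] subgroup.m_inv_closed[OF N(1)]) auto
    moreover have "inv s \<otimes> (t \<otimes> inv x \<otimes> inv t) \<in> N" if "s \<in> S" "t \<in> T" "x \<in> P" for s t x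
      using that S(2) P(2) T(2)
      by (intro subgroup.m_closed[OF N(1)] L(2) subgroup.m_inv_closed[OF N(1)]) auto
    ultimately show "T0 \<subseteq> N" unfolding T0_def by auto
  qed
  \<comment> \<open>The moves from w to v, t v and t w, all of which have to avoid the exceptional
    set of \<open>N\<close>.\<close>
  define A where "A = m_inv G ` P \<union> (\<lambda>(t, x). t \<otimes> inv x) ` (T \<times> P) \<union> T"
  have Ac: "finite A" "A \<subseteq> carrier G"
    using P T Pc Tc by (auto simp: A_def intro!: m_closed dest: subsetD[OF Pc] subsetD[OF Tc])
  define Z where "Z = D \<union> P \<union> S \<union> A \<union> T0 \<union> (\<lambda>(s, t, x). inv s \<otimes> (t \<otimes> inv x)) ` (S \<times> T \<times> P)"
  have T0c: "T0 \<subseteq> carrier G" by (rule subset_trans[OF T0(2) Nc])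
  have Z: "finite Z" "Z \<subseteq> carrier G"
  proof -
    show "finite Z" unfolding Z_def using D P S Ac T0 T by simp
    have "(\<lambda>(s, t, x). inv s \<otimes> (t \<otimes> inv x)) ` (S \<times> T \<times> P) \<subseteq> carrier G"
      by (auto intro!: m_closed inv_closed dest: subsetD[OF Pc] subsetD[OF Tc] subsetD[OF Sc])
    then show "Z \<subseteq> carrier G" unfolding Z_def using Dc Pc Sc Ac(2) T0c by simp
  qed
  define \<delta>1 where "\<delta>1 = \<delta> / (2 * (1 + real (card A)))"
  have \<delta>1: "0 < \<delta>1" "(1 + real (card A)) * \<delta>1 = \<delta> / 2" "\<delta>1 \<le> \<delta> / 2"
  proof -
    have a: "0 < 1 + real (card A)" by linarith
    show "0 < \<delta>1" unfolding \<delta>1_def using \<delta> a by simp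
    show eq: "(1 + real (card A)) * \<delta>1 = \<delta> / 2" unfolding \<delta>1_def using a by (simp add: field_simps)
    have "\<delta>1 \<le> (1 + real (card A)) * \<delta>1" using \<open>0 < \<delta>1\<close> by (simp add: algebra_simps)
    then show "\<delta>1 \<le> \<delta> / 2" using eq by simp
  qed
  obtain C0 R0 where R0: "finite R0" "R0 \<subseteq> carrier G" and ev: "\<forall>\<^sub>F k in sequentially. \<exists>W E B. W \<subseteq> V k \<and> E \<subseteq> R0 \<times> V k \<and> B \<subseteq> V k \<and>
              real (card B) \<le> \<delta>1 * sz k \<and> (\<Sum>(g, v)\<in>E. \<Upsilon> g) \<le> (1 + \<delta>1) * sz k \<and>
              (\<forall>v\<in>V k - B. \<exists>s\<in>S. \<exists>w\<in>W. v = \<sigma> k s w) \<and>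
              (\<forall>w\<in>W - B. \<forall>t\<in>T0. \<sigma> k t w \<in> W \<longrightarrow> (w, \<sigma> k t w) \<in> link (\<sigma> k) E ^^ C0)"
    using conn[unfolded sparsely_connected_def, rule_format, OF conjI[OF T0(1) conjI[OF T0(2) \<delta>1(1)]]]
    by (elim exE conjE) (rule that, assumption+)
  have "0 < \<delta> / 2" using \<delta> by simp
  note ev2 = eventually_unfaithful_small[OF Z this]
  show "\<exists>C R. finite R \<and> R \<subseteq> carrier G \<and>
           (\<forall>\<^sub>F k in sequentially. \<exists>W E B. W \<subseteq> V k \<and> E \<subseteq> R \<times> V k \<and> B \<subseteq> V k \<and>
              real (card B) \<le> \<delta> * sz k \<and> (\<Sum>(g, v)\<in>E. \<Upsilon> g) \<le> (1 + \<delta>) * sz k \<and>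
              (\<forall>v\<in>V k - B. \<exists>s\<in>S. \<exists>w\<in>W. v = \<sigma> k s w) \<and>
              (\<forall>w\<in>W - B. \<forall>t\<in>T. \<sigma> k t w \<in> W \<longrightarrow> (w, \<sigma> k t w) \<in> link (\<sigma> k) E ^^ C))"
  proof (rule exI[of _ "C0 + 1 + 1 + 1 + C0"], rule exI[of _ "R0 \<union> S \<union> T"], intro conjI)
    show "finite (R0 \<union> S \<union> T)" using R0 S T by simp
    show "R0 \<union> S \<union> T \<subseteq> carrier G" using R0 Sc Tc by simp
    show "\<forall>\<^sub>F k in sequentially. \<exists>W E B. W \<subseteq> V k \<and> E \<subseteq> (R0 \<union> S \<union> T) \<times> V k \<and> B \<subseteq> V k \<and>
              real (card B) \<le> \<delta> * sz k \<and> (\<Sum>(g, v)\<in>E. \<Upsilon> g) \<le> (1 + \<delta>) * sz k \<and>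
              (\<forall>v\<in>V k - B. \<exists>s\<in>S. \<exists>w\<in>W. v = \<sigma> k s w) \<and>
              (\<forall>w\<in>W - B. \<forall>t\<in>T. \<sigma> k t w \<in> W \<longrightarrow> (w, \<sigma> k t w) \<in> link (\<sigma> k) E ^^ (C0 + 1 + 1 + 1 + C0))"
      using ev ev2
    proof eventually_elim
      case (elim k)
      then obtain W E0 B0 where W: "W \<subseteq> V k" and E0: "E0 \<subseteq> R0 \<times> V k" "(\<Sum>(g, v)\<in>E0. \<Upsilon> g) \<le> (1 + \<delta>1) * sz k"
        and B0: "B0 \<subseteq> V k" "real (card B0) \<le> \<delta>1 * sz k"
        and cov: "\<forall>v\<in>V k - B0. \<exists>s\<in>S. \<exists>w\<in>W. v = \<sigma> k s w"
        and path: "\<forall>w\<in>W - B0. \<forall>t\<in>T0. \<sigma> k t w \<in> W \<longrightarrow> (w, \<sigma> k t w) \<in> link (\<sigma> k) E0 ^^ C0"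
        by (elim exE conjE) (rule that, assumption+)
      have unf: "real (card (unfaithful k Z)) \<le> \<delta> / 2 * sz k" using elim by simp
      have DZ: "D \<union> (\<lambda>(d, d'). inv d \<otimes> d') ` (D \<times> D) \<subseteq> Z" by (auto simp: Z_def P_def)
      obtain U where U: "U \<subseteq> V k" "card U * card D \<le> card (V k)"
        and net: "\<And>w. w \<in> V k \<Longrightarrow> w \<notin> unfaithful k Z \<Longrightarrow>
           \<exists>u\<in>U. \<exists>x\<in>(\<lambda>(d, d'). inv d \<otimes> d') ` (D \<times> D). w = \<sigma> k x u \<and> u = \<sigma> k (inv x) w"
        using ex_separated_net[OF D(2) D0 Dc subset_refl DZ] by metis
      have fU: "finite U" by (rule finite_subset[OF U(1) finite_V])
      have "\<forall>v\<in>V k - B0. \<exists>p. fst p \<in> S \<and> snd p \<in> W \<and> v = \<sigma> k (fst p) (snd p)"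
      proof
        fix v assume "v \<in> V k - B0"
        then obtain s w where "s \<in> S" "w \<in> W" "v = \<sigma> k s w" using cov by blast
        then show "\<exists>p. fst p \<in> S \<and> snd p \<in> W \<and> v = \<sigma> k (fst p) (snd p)" by (intro exI[of _ "(s, w)"]) simp
      qed
      then obtain pick where pick: "\<forall>v\<in>V k - B0. fst (pick v) \<in> S \<and> snd (pick v) \<in> W \<and> v = \<sigma> k (fst (pick v)) (snd (pick v))"
        by (rule bchoice[THEN exE])
      define U' where "U' = U - B0"
      define E1 where "E1 = pick ` U'"
      define E2 where "E2 = (\<lambda>(t, v). (t, v)) ` (T \<times> U)"
      define E3 where "E3 = (\<lambda>(t, v). pick (\<sigma> k t v)) ` {p \<in> T \<times> U. \<sigma> k (fst p) (snd p) \<notin> B0}"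
      define E where "E = E0 \<union> (E1 \<union> (E2 \<union> E3))"
      have fE0: "finite E0" by (rule finite_subset[OF E0(1)]) (simp add: R0)
      have fE: "finite E1" "finite E2" "finite E3" using fU T by (auto simp: E1_def E2_def E3_def U'_def)
      have \<Upsilon>le: "\<Upsilon> g \<le> sum \<Upsilon> A" if "finite A" "g \<in> A" for g A using that \<Upsilon> by (intro member_le_sum) auto
      have tv: "\<sigma> k t v \<in> V k" if "t \<in> T" "v \<in> U" for t v using that Tc U(1) by (simp add: subset_iff)
      have s1: "(\<Sum>(g, v)\<in>E1. \<Upsilon> g) \<le> (\<Sum>u\<in>U. sum \<Upsilon> S)"
      proof -
        have "(\<Sum>(g, v)\<in>E1. \<Upsilon> g) \<le> (\<Sum>u\<in>U'. sum \<Upsilon> S)" unfolding E1_def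
          by (rule sum_edge_image_le) (use fU U(1) pick \<Upsilon> \<Upsilon>le[OF S(1)] in \<open>auto simp: U'_def\<close>)
        also have "\<dots> \<le> (\<Sum>u\<in>U. sum \<Upsilon> S)" by (rule sum_mono2[OF fU]) (auto simp: U'_def \<Upsilon>sum)
        finally show ?thesis .
      qed
      have s2: "(\<Sum>(g, v)\<in>E2. \<Upsilon> g) \<le> real (card U) * sum \<Upsilon> T"
      proof -
        have "(\<Sum>(g, v)\<in>E2. \<Upsilon> g) \<le> (\<Sum>p\<in>T \<times> U. \<Upsilon> (fst p))" unfolding E2_def
          by (rule sum_edge_image_le) (use fU T \<Upsilon> in auto)
        also have "\<dots> = (\<Sum>t\<in>T. \<Sum>u\<in>U. \<Upsilon> t)" unfolding sum.cartesian_product by (simp add: case_prod_beta)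
        also have "\<dots> = real (card U) * sum \<Upsilon> T" by (simp add: sum_distrib_left)
        finally show ?thesis .
      qed
      have s3: "(\<Sum>(g, v)\<in>E3. \<Upsilon> g) \<le> real (card U) * (real (card T) * sum \<Upsilon> S)"
      proof -
        let ?J = "{p \<in> T \<times> U. \<sigma> k (fst p) (snd p) \<notin> B0}"
        have "(\<Sum>(g, v)\<in>E3. \<Upsilon> g) \<le> (\<Sum>p\<in>?J. sum \<Upsilon> S)" unfolding E3_def
        proof (rule sum_edge_image_le)
          show "finite ?J" using fU T by simp
          fix p assume p: "p \<in> ?J"
          then have "\<sigma> k (fst p) (snd p) \<in> V k - B0" using tv by auto
          then show "\<Upsilon> (fst ((\<lambda>(t, v). pick (\<sigma> k t v)) p)) \<le> sum \<Upsilon> S"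
            using pick \<Upsilon>le[OF S(1)] by (simp add: case_prod_beta)
        qed (rule \<Upsilon>)
        also have "\<dots> \<le> (\<Sum>p\<in>T \<times> U. sum \<Upsilon> S)" by (rule sum_mono2) (use fU T \<Upsilon>sum in auto)
        also have "\<dots> = real (card U) * (real (card T) * sum \<Upsilon> S)" by (simp add: card_cartesian_product)
        finally show ?thesis .
      qed
      have "(\<Sum>(g, v)\<in>E. \<Upsilon> g) \<le> (\<Sum>(g, v)\<in>E0. \<Upsilon> g) + ((\<Sum>(g, v)\<in>E1. \<Upsilon> g) + ((\<Sum>(g, v)\<in>E2. \<Upsilon> g) + (\<Sum>(g, v)\<in>E3. \<Upsilon> g)))"
        unfolding E_def using fE0 fE \<Upsilon>
        by (intro order_trans[OF sum_edge_Un_le] add_left_mono) auto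
      also have "\<dots> \<le> (1 + \<delta>1) * sz k + real (card U) * c0"
        using E0(2) s1 s2 s3 unfolding c0_def by (simp add: algebra_simps)
      also have "real (card U) * c0 \<le> \<delta> / 2 * sz k"
      proof -
        have "real (card U) * c0 \<le> real (card U) * (\<delta> / 2 * real (card D))" using cD by (intro mult_left_mono) auto
        also have "\<dots> = \<delta> / 2 * real (card U * card D)" by simp
        also have "\<dots> \<le> \<delta> / 2 * sz k" using U(2) \<delta> by (intro mult_left_mono) (auto simp del: of_nat_mult)
        finally show ?thesis .
      qed
      also have "(1 + \<delta>1) * sz k + \<delta> / 2 * sz k \<le> (1 + \<delta>) * sz k"
      proof -
        have "(1 + \<delta>1 + \<delta> / 2) * sz k \<le> (1 + \<delta>) * sz k" using \<delta>1(3) by (intro mult_right_mono) auto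
        then show ?thesis by (simp add: algebra_simps)
      qed
      finally have cost: "(\<Sum>(g, v)\<in>E. \<Upsilon> g) \<le> (1 + \<delta>) * sz k" by simp
      define B where "B = B0 \<union> (unfaithful k Z \<union> touch k A B0)"
      have fB0: "finite B0" by (rule finite_subset[OF B0(1) finite_V])
      have "real (card B) \<le> real (card B0) + (real (card (unfaithful k Z)) + real (card (touch k A B0)))"
      proof -
        have "card B \<le> card B0 + (card (unfaithful k Z) + card (touch k A B0))" unfolding B_def
          by (rule order_trans[OF card_Un_le add_left_mono[OF card_Un_le]])
        then show ?thesis by simp
      qed
      also have "\<dots> \<le> \<delta>1 * sz k + (\<delta> / 2 * sz k + real (card A) * \<delta>1 * sz k)"
        by (intro add_mono B0(2) unf card_touch_le[OF Ac fB0 B0(2)])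
      also have "\<dots> = ((1 + real (card A)) * \<delta>1) * sz k + \<delta> / 2 * sz k" by (simp add: algebra_simps)
      also have "\<dots> = \<delta> * sz k" unfolding \<delta>1(2) by simp
      finally have cB: "real (card B) \<le> \<delta> * sz k" .
      have BV: "B \<subseteq> V k" using B0(1) unfaithful_subset touch_subset unfolding B_def by simp
      have EV: "E \<subseteq> (R0 \<union> S \<union> T) \<times> V k"
      proof -
        have "E1 \<subseteq> S \<times> V k"
        proof
          fix p assume "p \<in> E1"
          then obtain v where v: "v \<in> U" "v \<notin> B0" "p = pick v" by (auto simp: E1_def U'_def)
          then have "v \<in> V k - B0" using U(1) by auto
          then show "p \<in> S \<times> V k" using pick W v(3) by (metis mem_Times_iff subsetD)
        qed
        moreover have "E2 \<subseteq> T \<times> V k" using U(1) by (auto simp: E2_def)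
        moreover have "E3 \<subseteq> S \<times> V k"
        proof
          fix p assume "p \<in> E3"
          then obtain t v where tv': "t \<in> T" "v \<in> U" "\<sigma> k t v \<notin> B0" "p = pick (\<sigma> k t v)" by (auto simp: E3_def)
          then have "\<sigma> k t v \<in> V k - B0" using tv by simp
          then show "p \<in> S \<times> V k" using pick W tv'(4) by (metis mem_Times_iff subsetD)
        qed
        ultimately show ?thesis using E0(1) unfolding E_def by blast
      qed
      have connected: "(w, \<sigma> k t w) \<in> link (\<sigma> k) E ^^ (C0 + 1 + 1 + 1 + C0)"
        if w: "w \<in> W" "w \<notin> B" "t \<in> T" "\<sigma> k t w \<in> W" for w t
      proof -
        have wV: "w \<in> V k" using w W by auto
        have wB: "w \<notin> B0" "w \<notin> unfaithful k Z" "w \<notin> touch k A B0" using w(2) by (auto simp: B_def)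
        have away: "\<sigma> k a w \<notin> B0" if "a \<in> A" for a using wB(3) wV that by (auto simp: touch_def)
        have fw: "faithful_at k Z w" by (rule faithfulI[OF wV wB(2)])
        obtain v x where v: "v \<in> U" "x \<in> P" "w = \<sigma> k x v" "v = \<sigma> k (inv x) w"
          using net[OF wV wB(2)] unfolding P_def[symmetric] by blast
        have xc: "x \<in> carrier G" "t \<in> carrier G" using v(2) Pc w(3) Tc by auto
        have vV: "v \<in> V k" using v(1) U(1) by auto
        have "inv x \<in> A" using v(2) by (auto simp: A_def)
        then have vB: "v \<in> V k - B0" using away vV v(4) by auto
        obtain s w1 where sw: "pick v = (s, w1)" by (cases "pick v")
        have s: "s \<in> S" "w1 \<in> W" "v = \<sigma> k s w1" using pick vB sw by force+
        have sc: "s \<in> carrier G" using s(1) Sc by auto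
        have zs: "s \<in> Z" "inv s \<otimes> inv x \<in> Z" "inv s \<otimes> inv x \<in> T0" "inv x \<in> Z" "t \<in> Z"
        proof -
          show "s \<in> Z" using s(1) by (simp add: Z_def)
          have "(\<lambda>(s, x). inv s \<otimes> inv x) (s, x) \<in> T0" unfolding T0_def
            by (rule UnI1, rule imageI) (simp add: s(1) v(2))
          then show "inv s \<otimes> inv x \<in> T0" by simp
          then show "inv s \<otimes> inv x \<in> Z" by (simp add: Z_def)
          show "inv x \<in> Z" using \<open>inv x \<in> A\<close> by (simp add: Z_def)
          show "t \<in> Z" using w(3) by (simp add: Z_def A_def)
        qed
        have "\<sigma> k s (\<sigma> k (inv s \<otimes> inv x) w) = \<sigma> k (s \<otimes> (inv s \<otimes> inv x)) w"
          by (rule faithful_mult[OF fw zs(1,2)])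
        also have "s \<otimes> (inv s \<otimes> inv x) = inv x" using sc xc by simp
        also have "\<sigma> k (inv x) w = \<sigma> k s w1" using v(4) s(3) by simp
        finally have w1: "\<sigma> k (inv s \<otimes> inv x) w = w1" using \<sigma>_inj[OF sc] by simp
        have p1: "(w, w1) \<in> link (\<sigma> k) E ^^ C0"
        proof -
          have "(w, \<sigma> k (inv s \<otimes> inv x) w) \<in> link (\<sigma> k) E0 ^^ C0"
            using path[rule_format, OF _ zs(3), of w] w(1) wB(1) w1 s(2) by simp
          then show ?thesis unfolding w1 by (rule link_pow_mono) (auto simp: E_def)
        qed
        have "(s, w1) \<in> E1" unfolding E1_def using vB v(1) by (intro image_eqI[of _ _ v]) (auto simp: U'_def sw)
        then have "(s, w1) \<in> E" by (simp add: E_def)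
        then have p2: "(w1, v) \<in> link (\<sigma> k) E ^^ 1" unfolding s(3) using link_edge by simp
        have "(t, v) \<in> E" using w(3) v(1) by (auto simp: E_def E2_def)
        then have p3: "(v, \<sigma> k t v) \<in> link (\<sigma> k) E ^^ 1" using link_edge by simp
        have tx: "t \<otimes> inv x \<in> A" "t \<otimes> inv x \<in> Z"
        proof -
          have "(\<lambda>(t, x). t \<otimes> inv x) (t, x) \<in> A" unfolding A_def
            by (rule UnI1, rule UnI2, rule imageI) (simp add: w(3) v(2))
          then show "t \<otimes> inv x \<in> A" by simp
          then show "t \<otimes> inv x \<in> Z" by (simp add: Z_def)
        qed
        have tv_eq: "\<sigma> k t v = \<sigma> k (t \<otimes> inv x) w" using faithful_mult[OF fw zs(5,4)] v(4) by simp
        have tvB: "\<sigma> k t v \<in> V k - B0" using tv[OF w(3) v(1)] away[OF tx(1)] tv_eq by simp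
        obtain s' w2 where sw': "pick (\<sigma> k t v) = (s', w2)" by (cases "pick (\<sigma> k t v)")
        have s': "s' \<in> S" "w2 \<in> W" "\<sigma> k t v = \<sigma> k s' w2" using pick[rule_format, OF tvB] sw' by auto
        have sc': "s' \<in> carrier G" using s'(1) Sc by auto
        have "(s', w2) \<in> E3" unfolding E3_def
          by (rule image_eqI[of _ _ "(t, v)"]) (use sw' w(3) v(1) tvB in auto)
        then have "(s', w2) \<in> E" by (simp add: E_def)
        then have p4: "(\<sigma> k t v, w2) \<in> link (\<sigma> k) E ^^ 1" unfolding s'(3) using link_edge' by simp
        let ?t0 = "inv s' \<otimes> (t \<otimes> inv x \<otimes> inv t)" and ?t1 = "inv s' \<otimes> (t \<otimes> inv x)"
        have z0: "?t0 \<in> T0" "?t0 \<in> Z" "?t1 \<in> Z" "s' \<in> Z"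
        proof -
          have "(\<lambda>(s, t, x). inv s \<otimes> (t \<otimes> inv x \<otimes> inv t)) (s', t, x) \<in> T0" unfolding T0_def
            by (rule UnI2, rule imageI) (simp add: s'(1) w(3) v(2))
          then show "?t0 \<in> T0" by simp
          then show "?t0 \<in> Z" by (simp add: Z_def)
          have "(\<lambda>(s, t, x). inv s \<otimes> (t \<otimes> inv x)) (s', t, x) \<in> Z" unfolding Z_def
            by (rule UnI2, rule imageI) (simp add: s'(1) w(3) v(2))
          then show "?t1 \<in> Z" by simp
          show "s' \<in> Z" using s'(1) by (simp add: Z_def)
        qed
        have "\<sigma> k ?t0 (\<sigma> k t w) = \<sigma> k (?t0 \<otimes> t) w" by (rule faithful_mult[OF fw z0(2) zs(5)])
        also have "?t0 \<otimes> t = ?t1" using sc' xc by (simp add: m_assoc)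
        finally have e1: "\<sigma> k ?t0 (\<sigma> k t w) = \<sigma> k ?t1 w" .
        have "\<sigma> k s' (\<sigma> k ?t1 w) = \<sigma> k (s' \<otimes> ?t1) w" by (rule faithful_mult[OF fw z0(4,3)])
        also have "s' \<otimes> ?t1 = t \<otimes> inv x" using sc' xc by (simp add: m_assoc)
        also have "\<sigma> k (t \<otimes> inv x) w = \<sigma> k s' w2" using tv_eq s'(3) by simp
        finally have w2: "\<sigma> k ?t0 (\<sigma> k t w) = w2" using \<sigma>_inj[OF sc'] e1 by simp
        have "t \<in> A" using w(3) by (simp add: A_def)
        then have "\<sigma> k t w \<notin> B0" by (rule away)
        then have "(\<sigma> k t w, w2) \<in> link (\<sigma> k) E0 ^^ C0"
          using path[rule_format, OF _ z0(1), of "\<sigma> k t w"] w(4) w2 s'(2) by simp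
        then have "(\<sigma> k t w, w2) \<in> link (\<sigma> k) E ^^ C0" by (rule link_pow_mono) (auto simp: E_def)
        then have p5: "(w2, \<sigma> k t w) \<in> link (\<sigma> k) E ^^ C0" by (rule link_pow_sym)
        show ?thesis
          by (rule relpow_trans[OF relpow_trans[OF relpow_trans[OF relpow_trans[OF p1 p2] p3] p4] p5])
      qed
      have "\<forall>v\<in>V k - B. \<exists>s\<in>S. \<exists>w\<in>W. v = \<sigma> k s w" using cov by (simp add: B_def)
      moreover have "\<forall>w\<in>W - B. \<forall>t\<in>T. \<sigma> k t w \<in> W \<longrightarrow> (w, \<sigma> k t w) \<in> link (\<sigma> k) E ^^ (C0 + 1 + 1 + 1 + C0)"
        using connected by simp
      ultimately show ?case using W EV BV cB cost by (intro exI[of _ W] exI[of _ E] exI[of _ B]) simp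
    qed
  qed
qed

text \<open>For fixed \<open>S\<close> the property tests one finite subset of \<open>L\<close> at a
  time, so it passes to limit stages.\<close>

lemma sparsely_connected_union:
  assumes "\<And>T. finite T \<Longrightarrow> T \<subseteq> L \<Longrightarrow> \<exists>L'. T \<subseteq> L' \<and> sparsely_connected \<Upsilon> S L'"
  shows "sparsely_connected \<Upsilon> S L"
  unfolding sparsely_connected_def
proof (intro allI impI)
  fix T \<delta> assume T: "finite T \<and> T \<subseteq> L \<and> (0 :: real) < \<delta>"
  then obtain L' where "T \<subseteq> L'" "sparsely_connected \<Upsilon> S L'" using assms by blast
  then show "\<exists>C R. finite R \<and> R \<subseteq> carrier G \<and>
           (\<forall>\<^sub>F k in sequentially. \<exists>W E B. W \<subseteq> V k \<and> E \<subseteq> R \<times> V k \<and> B \<subseteq> V k \<and>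
              real (card B) \<le> \<delta> * sz k \<and> (\<Sum>(g, v)\<in>E. \<Upsilon> g) \<le> (1 + \<delta>) * sz k \<and>
              (\<forall>v\<in>V k - B. \<exists>s\<in>S. \<exists>w\<in>W. v = \<sigma> k s w) \<and>
              (\<forall>w\<in>W - B. \<forall>t\<in>T. \<sigma> k t w \<in> W \<longrightarrow> (w, \<sigma> k t w) \<in> link (\<sigma> k) E ^^ C))"
    unfolding sparsely_connected_def using T by (elim allE[of _ T]) (elim allE[of _ \<delta>], simp)
qed

text \<open>Transfinite induction along the chain. \<open>S\<close> is the same at all stages, and
  since \<delta> is quantified inside the property a normal step does not enlarge the budget; hence
  nothing accumulates, even over infinitely many steps.\<close>

lemma sparsely_connected_w_normal:
  assumes wn: "w_normal N G" and N: "infinite N" and S: "finite S" "S \<subseteq> N"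
    and conn: "sparsely_connected \<Upsilon> S N" and \<Upsilon>: "\<And>g. 0 \<le> \<Upsilon> g"
  shows "sparsely_connected \<Upsilon> S (carrier G)"
proof -
  obtain r :: "nat rel" and z c and H :: "nat \<Rightarrow> 'a set" where r: "Well_order r" and zc: "z \<in> Field r" "c \<in> Field r"
    and least: "\<forall>a\<in>Field r. (z, a) \<in> r \<and> (a, c) \<in> r" and sub: "\<forall>a\<in>Field r. subgroup (H a) G"
    and Hz: "H z = N" and Hc: "H c = carrier G" and mono: "\<forall>a b. (a, b) \<in> r \<longrightarrow> H a \<subseteq> H b"
    and succ: "\<forall>a\<in>Field r - {c}. H a \<lhd> G\<lparr>carrier := H (wo_rel.suc r {a})\<rparr>"
    and lim: "\<forall>a\<in>Field r - {z}. (\<forall>b\<in>Field r - {c}. a \<noteq> wo_rel.suc r {b}) \<longrightarrow> H a = (\<Union>b\<in>underS r a. H b)"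
    using wn unfolding w_normal_def by (elim exE conjE) (rule that, assumption+)
  interpret wo: wo_rel r by (simp add: wo_rel_def r)
  have HN: "S \<subseteq> H a" "infinite (H a)" if "a \<in> Field r" for a
  proof -
    have "N \<subseteq> H a" using mono least that Hz by auto
    then show "S \<subseteq> H a" "infinite (H a)" using S N infinite_super by auto
  qed
  have "sparsely_connected \<Upsilon> S (H a)" if "a \<in> Field r" for a
    using that
  proof (induction a rule: wo.well_order_induct)
    fix a assume IH: "\<forall>b. b \<noteq> a \<and> (b, a) \<in> r \<longrightarrow> b \<in> Field r \<longrightarrow> sparsely_connected \<Upsilon> S (H b)" and a: "a \<in> Field r"
    consider "a = z" | b where "b \<in> Field r - {c}" "a = wo.suc {b}"
      | "a \<noteq> z" "\<forall>b\<in>Field r - {c}. a \<noteq> wo.suc {b}" by blast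
    then show "sparsely_connected \<Upsilon> S (H a)"
    proof cases
      case 1
      then show ?thesis using conn Hz by simp
    next
      case 2
      have bc: "(b, c) \<in> r" "b \<noteq> c" "b \<in> Field r" using 2 least by auto
      \<comment> \<open>As \<open>c\<close> lies strictly above \<open>b\<close>, the successor of
        \<open>b\<close> is a genuine one.\<close>
      then have "c \<in> AboveS r {b}" using zc by (auto simp: AboveS_def)
      then have ne: "AboveS r {b} \<noteq> {}" by blast
      have ba: "(b, a) \<in> r" "b \<noteq> a"
        using wo.suc_greater[of "{b}" b] ne bc(3) 2(2) by auto
      have IHb: "sparsely_connected \<Upsilon> S (H b)" using IH ba bc(3) by blast
      have nrm: "H b \<lhd> G\<lparr>carrier := H a\<rparr>" using succ 2 by blast
      have sa: "subgroup (H a) G" "subgroup (H b) G" using sub a bc by auto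
      have "t \<otimes> x \<otimes> inv t \<in> H b" if "t \<in> H a" "x \<in> H b" for t x
        using normal.inv_op_closed2[OF nrm, of t x] that m_inv_consistent[OF sa(1) that(1)] by simp
      then show ?thesis
        by (rule sparsely_connected_normal_extension[OF sa(2) HN(2)[OF bc(3)] S(1) HN(1)[OF bc(3)]
              subgroup.subset[OF sa(1)] _ IHb \<Upsilon>])
    next
      case 3
      then have Ha: "H a = (\<Union>b\<in>underS r a. H b)" using lim a by blast
      show ?thesis
      proof (rule sparsely_connected_union)
        fix T assume T: "finite T" "T \<subseteq> H a"
        have "\<exists>b\<in>underS r a. T \<subseteq> H b" using T
        proof (induction T)
          case empty
          have "z \<in> underS r a" using least a 3 by (auto simp: underS_def)
          then show ?case by blast
        next
          case (insert x T)
          then obtain b b' where b: "b \<in> underS r a" "T \<subseteq> H b" "b' \<in> underS r a" "x \<in> H b'"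
            unfolding Ha by blast
          have "b \<in> Field r" "b' \<in> Field r" using b by (auto simp: underS_def Field_def)
          then have "(b, b') \<in> r \<or> (b', b) \<in> r" using wo.TOTALS by blast
          then have "H b \<subseteq> H b' \<or> H b' \<subseteq> H b" using mono by blast
          then show ?case
          proof
            assume "H b \<subseteq> H b'"
            then show ?case using b by blast
          next
            assume "H b' \<subseteq> H b"
            then show ?case using b by blast
          qed
        qed
        then obtain b where b: "b \<in> underS r a" "T \<subseteq> H b" by blast
        then have "b \<noteq> a \<and> (b, a) \<in> r" "b \<in> Field r" by (auto simp: underS_def Field_def)
        then show "\<exists>L'. T \<subseteq> L' \<and> sparsely_connected \<Upsilon> S L'" using IH b(2) by blast
      qed
    qed
  qed
  then show ?thesis using zc(2) Hc by metis
qed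

end

section \<open>Direct products\<close>

text \<open>An internal direct product, presented by its two projections as endomorphisms of
  \<open>G\<close>, so that the factors are subgroups of \<open>G\<close> and one approximation
  serves for both.\<close>

locale sofic_direct_product = sofic_sequence +
  fixes pa pb :: "'a \<Rightarrow> 'a"
  assumes pa_closed [simp]: "g \<in> carrier G \<Longrightarrow> pa g \<in> carrier G"
    and pb_closed [simp]: "g \<in> carrier G \<Longrightarrow> pb g \<in> carrier G"
    and pa_mult: "g \<in> carrier G \<Longrightarrow> h \<in> carrier G \<Longrightarrow> pa (g \<otimes> h) = pa g \<otimes> pa h"
    and pb_mult: "g \<in> carrier G \<Longrightarrow> h \<in> carrier G \<Longrightarrow> pb (g \<otimes> h) = pb g \<otimes> pb h"
    and pa_pa [simp]: "g \<in> carrier G \<Longrightarrow> pa (pa g) = pa g"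
    and pb_pb [simp]: "g \<in> carrier G \<Longrightarrow> pb (pb g) = pb g"
    and pa_pb [simp]: "g \<in> carrier G \<Longrightarrow> pa (pb g) = \<one>"
    and pb_pa [simp]: "g \<in> carrier G \<Longrightarrow> pb (pa g) = \<one>"
    and pa_pb_eqI: "g \<in> carrier G \<Longrightarrow> h \<in> carrier G \<Longrightarrow> pa g = pa h \<Longrightarrow> pb g = pb h \<Longrightarrow> g = h"
begin

text \<open>Along this sequence the two factors act by exactly commuting permutations.\<close>

definition prod_seq :: "'a sofic_seq" where
  "prod_seq k = (prod_encode ` (V k \<times> V k),
     \<lambda>g m. if m \<in> prod_encode ` (V k \<times> V k)
       then (case prod_decode m of (x, y) \<Rightarrow> prod_encode (\<sigma> k (pa g) x, \<sigma> k (pb g) y)) else m)"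

lemma enc_in [simp]: "prod_encode p \<in> prod_encode ` A \<longleftrightarrow> p \<in> A"
  using inj_prod_encode by (auto dest: injD)

lemma prod_act [simp]:
  "x \<in> V k \<Longrightarrow> y \<in> V k \<Longrightarrow> snd (prod_seq k) g (prod_encode (x, y)) = prod_encode (\<sigma> k (pa g) x, \<sigma> k (pb g) y)"
  by (simp add: prod_seq_def)

lemma prod_V: "fst (prod_seq k) = prod_encode ` (V k \<times> V k)"
  by (simp add: prod_seq_def)

lemma card_enc: "card (prod_encode ` A) = card A"
  by (rule card_image) (rule inj_on_subset[OF inj_prod_encode subset_UNIV])

lemma card_prod_V: "real (card (fst (prod_seq k))) = sz k * sz k"
  by (simp add: prod_V card_enc card_cartesian_product)

lemma prod_seq_permutes: "g \<in> carrier G \<Longrightarrow> snd (prod_seq k) g permutes fst (prod_seq k)"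
proof (rule bij_imp_permutes)
  assume g: "g \<in> carrier G"
  let ?f = "snd (prod_seq k) g" and ?V = "fst (prod_seq k)"
  have inj: "inj_on ?f ?V"
  proof (rule inj_onI)
    fix m m' assume "m \<in> ?V" "m' \<in> ?V" "?f m = ?f m'"
    then show "m = m'" using g by (auto simp: prod_V \<sigma>_inj)
  qed
  have fin: "finite ?V" by (simp add: prod_V)
  have "?f ` ?V \<subseteq> ?V" using g by (auto simp: prod_V)
  then have "?f ` ?V = ?V" by (rule card_subset_eq[OF fin]) (rule card_image[OF inj])
  then show "bij_betw ?f ?V ?V" using inj by (simp add: bij_betw_def)
  show "?f m = m" if "m \<notin> ?V" for m using that by (auto simp: prod_seq_def)
qed

text \<open>A failure of multiplicativity shows in one of two coordinates, hence the tolerance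
  \<delta>/2. Distinct elements differ in one of the projections, and that coordinate alone
  separates them.\<close>

lemma sofic_prod_seq: "sofic_approximation_sequence G prod_seq"
  unfolding sofic_approximation_sequence_def
proof (intro conjI allI impI)
  fix k
  show "sofic_approximation G (fst (prod_seq k)) (snd (prod_seq k))"
    unfolding sofic_approximation_def using prod_seq_permutes by (simp add: prod_V)
next
  fix F and \<delta> :: real assume F: "finite F \<and> F \<subseteq> carrier G \<and> 0 < \<delta>"
  let ?F = "pa ` F \<union> pb ` F"
  have "\<forall>\<^sub>F k in sequentially. good_approximation G ?F (\<delta> / 2) (V k) (\<sigma> k)"
  proof -
    have "finite ?F \<and> ?F \<subseteq> carrier G \<and> 0 < \<delta> / 2" using F by (auto dest: subsetD)
    then show ?thesis using sofic unfolding sofic_approximation_sequence_def by blast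
  qed
  then show "\<forall>\<^sub>F k in sequentially. good_approximation G F \<delta> (fst (prod_seq k)) (snd (prod_seq k))"
  proof eventually_elim
    case (elim k)
    have sz2: "0 < sz k * sz k" by (intro mult_pos_pos sz_pos)
    have h1: "real (card {v \<in> V k. \<sigma> k (s \<otimes> t) v \<noteq> (\<sigma> k s \<circ> \<sigma> k t) v}) \<le> \<delta> / 2 * sz k" if "s \<in> ?F" "t \<in> ?F" for s t
    proof -
      have "hamming_dist (V k) (\<sigma> k (s \<otimes> t)) (\<sigma> k s \<circ> \<sigma> k t) \<le> \<delta> / 2"
        using elim that unfolding good_approximation_def by blast
      then show ?thesis unfolding hamming_dist_def using sz_pos[of k] by (simp add: divide_le_eq)
    qed
    have h2: "real (card {v \<in> V k. \<sigma> k s v = \<sigma> k t v}) \<le> \<delta> / 2 * sz k" if "s \<in> ?F" "t \<in> ?F" "s \<noteq> t" for s t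
    proof -
      have "hamming_dist (V k) (\<sigma> k s) (\<sigma> k t) \<ge> 1 - \<delta> / 2"
        using elim that unfolding good_approximation_def by blast
      then have "(1 - \<delta> / 2) * sz k \<le> real (card {v \<in> V k. \<sigma> k s v \<noteq> \<sigma> k t v})"
        unfolding hamming_dist_def using sz_pos[of k] by (simp add: le_divide_eq)
      moreover have "{v \<in> V k. \<sigma> k s v \<noteq> \<sigma> k t v} = V k - {v \<in> V k. \<sigma> k s v = \<sigma> k t v}" by auto
      then have "real (card {v \<in> V k. \<sigma> k s v \<noteq> \<sigma> k t v}) = sz k - real (card {v \<in> V k. \<sigma> k s v = \<sigma> k t v})"
        by (simp add: card_Diff_subset of_nat_diff card_mono)
      ultimately show ?thesis by (simp add: algebra_simps)
    qed
    show ?case unfolding good_approximation_def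
    proof (intro conjI ballI impI)
      fix s t assume st: "s \<in> F" "t \<in> F"
      have c: "s \<in> carrier G" "t \<in> carrier G" using st F by auto
      let ?X = "{v \<in> V k. \<sigma> k (pa s \<otimes> pa t) v \<noteq> (\<sigma> k (pa s) \<circ> \<sigma> k (pa t)) v}"
      let ?Y = "{v \<in> V k. \<sigma> k (pb s \<otimes> pb t) v \<noteq> (\<sigma> k (pb s) \<circ> \<sigma> k (pb t)) v}"
      let ?B = "{m \<in> fst (prod_seq k). snd (prod_seq k) (s \<otimes> t) m \<noteq> (snd (prod_seq k) s \<circ> snd (prod_seq k) t) m}"
      have "?B \<subseteq> prod_encode ` (?X \<times> V k \<union> V k \<times> ?Y)"
        using c by (auto simp: prod_V pa_mult pb_mult)
      then have "card ?B \<le> card (prod_encode ` (?X \<times> V k \<union> V k \<times> ?Y))" by (rule card_mono[rotated]) simp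
      also have "\<dots> \<le> card ?X * card (V k) + card (V k) * card ?Y"
        unfolding card_enc by (rule order_trans[OF card_Un_le]) (simp add: card_cartesian_product)
      finally have "real (card ?B) \<le> real (card ?X) * sz k + sz k * real (card ?Y)"
        unfolding of_nat_mult[symmetric] of_nat_add[symmetric] of_nat_le_iff .
      also have "\<dots> \<le> (\<delta> / 2 * sz k) * sz k + sz k * (\<delta> / 2 * sz k)"
        using st by (intro add_mono mult_right_mono mult_left_mono h1) auto
      finally have "real (card ?B) \<le> \<delta> * (sz k * sz k)" by (simp add: algebra_simps)
      then show "hamming_dist (fst (prod_seq k)) (snd (prod_seq k) (s \<otimes> t)) (snd (prod_seq k) s \<circ> snd (prod_seq k) t) \<le> \<delta>"
        unfolding hamming_dist_def card_prod_V using sz2 by (simp add: divide_le_eq)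
    next
      fix s t assume st: "s \<in> F" "t \<in> F" "s \<noteq> t"
      have c: "s \<in> carrier G" "t \<in> carrier G" using st F by auto
      let ?A = "{m \<in> fst (prod_seq k). snd (prod_seq k) s m = snd (prod_seq k) t m}"
      let ?N = "{m \<in> fst (prod_seq k). snd (prod_seq k) s m \<noteq> snd (prod_seq k) t m}"
      have "real (card ?A) \<le> \<delta> / 2 * (sz k * sz k)"
      proof (cases "pa s = pa t")
        case False
        let ?X = "{v \<in> V k. \<sigma> k (pa s) v = \<sigma> k (pa t) v}"
        have "?A \<subseteq> prod_encode ` (?X \<times> V k)" by (auto simp: prod_V)
        then have "card ?A \<le> card (prod_encode ` (?X \<times> V k))" by (rule card_mono[rotated]) simp
        then have "real (card ?A) \<le> real (card ?X) * sz k"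
          unfolding card_enc card_cartesian_product of_nat_mult[symmetric] of_nat_le_iff .
        also have "\<dots> \<le> (\<delta> / 2 * sz k) * sz k" using st False by (intro mult_right_mono h2) auto
        finally show ?thesis by simp
      next
        case True
        then have False': "pb s \<noteq> pb t" using pa_pb_eqI c st by blast
        let ?X = "{v \<in> V k. \<sigma> k (pb s) v = \<sigma> k (pb t) v}"
        have "?A \<subseteq> prod_encode ` (V k \<times> ?X)" by (auto simp: prod_V)
        then have "card ?A \<le> card (prod_encode ` (V k \<times> ?X))" by (rule card_mono[rotated]) simp
        then have "real (card ?A) \<le> sz k * real (card ?X)"
          unfolding card_enc card_cartesian_product of_nat_mult[symmetric] of_nat_le_iff .
        also have "\<dots> \<le> sz k * (\<delta> / 2 * sz k)" using st False' by (intro mult_left_mono h2) auto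
        finally show ?thesis by (simp add: mult_ac)
      qed
      moreover have "?N = fst (prod_seq k) - ?A" by auto
      then have "real (card ?N) = sz k * sz k - real (card ?A)"
        by (simp add: card_Diff_subset of_nat_diff card_mono prod_V card_prod_V[unfolded prod_V])
      moreover have "\<delta> / 2 * (sz k * sz k) \<le> \<delta> * (sz k * sz k)" using F by (intro mult_right_mono) auto
      ultimately have "(1 - \<delta>) * (sz k * sz k) \<le> real (card ?N)" by (simp add: algebra_simps)
      then show "1 - \<delta> \<le> hamming_dist (fst (prod_seq k)) (snd (prod_seq k) s) (snd (prod_seq k) t)"
        unfolding hamming_dist_def card_prod_V using sz2 by (simp add: le_divide_eq)
    qed
  qed
qed

lemma subgroup_pa: "subgroup (pa ` carrier G) G" and subgroup_pb: "subgroup (pb ` carrier G) G"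
proof -
  have "group_hom G G pa" "group_hom G G pb"
    by (unfold_locales, auto simp: hom_def pa_mult pb_mult)
  then show "subgroup (pa ` carrier G) G" "subgroup (pb ` carrier G) G"
    using group_hom.img_is_subgroup by auto
qed

lemma in_pa: "a \<in> pa ` carrier G \<Longrightarrow> a \<in> carrier G \<and> pa a = a \<and> pb a = \<one>"
  and in_pb: "b \<in> pb ` carrier G \<Longrightarrow> b \<in> carrier G \<and> pb b = b \<and> pa b = \<one>"
  by auto

text \<open>In a row where all edges for \<open>Q\<close> are recorded, words in \<open>Q\<close>
  can be followed freely.\<close>

lemma horizontal_path:
  assumes Q: "Q \<subseteq> pa ` carrier G" and x: "x \<in> V k" "faithful_at k Z x" and Z: "Q \<subseteq> Z" "word_ball Q j \<subseteq> Z"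
    and y: "y \<in> V k" "\<sigma> k \<one> y = y" and E: "\<And>q x'. q \<in> Q \<Longrightarrow> x' \<in> V k \<Longrightarrow> (q, prod_encode (x', y)) \<in> E"
    and p: "p \<in> word_ball Q j"
  shows "(prod_encode (x, y), prod_encode (\<sigma> k p x, y)) \<in> link (snd (prod_seq k)) E ^^ j"
proof -
  have Qc: "Q \<subseteq> carrier G" using Q in_pa by blast
  obtain w where w: "set w \<subseteq> Q" "length w \<le> j" "p = wprod w" using p by (rule word_ballE)
  have "(prod_encode (x, y), prod_encode (\<sigma> k (wprod w) x, y)) \<in> link (snd (prod_seq k)) E ^^ length w"
    using w(1,2)
  proof (induction w)
    case Nil
    have "\<one> \<in> Z" using one_in_word_ball Z(2) by blast
    then show ?case using faithful_one[OF x(2)] by simp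
  next
    case (Cons q w)
    have q: "q \<in> Q" "set w \<subseteq> Q" "length w \<le> j" using Cons.prems by auto
    have qa: "q \<in> carrier G" "pa q = q" "pb q = \<one>" using q(1) Q in_pa by blast+
    have "wprod w \<in> word_ball Q j" by (rule word_ballI[OF q(2,3)])
    then have eq: "\<sigma> k q (\<sigma> k (wprod w) x) = \<sigma> k (wprod (q # w)) x"
      using faithful_mult[OF x(2), of q "wprod w"] Z q(1) by auto
    have x': "\<sigma> k (wprod w) x \<in> V k" using x(1) wprod_closed[OF subset_trans[OF q(2) Qc]] by simp
    have "(prod_encode (\<sigma> k (wprod w) x, y), snd (prod_seq k) q (prod_encode (\<sigma> k (wprod w) x, y))) \<in> link (snd (prod_seq k)) E"
      by (rule link_edge[OF E[OF q(1) x']])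
    then have "(prod_encode (\<sigma> k (wprod w) x, y), prod_encode (\<sigma> k (wprod (q # w)) x, y)) \<in> link (snd (prod_seq k)) E"
      using x' y qa eq by simp
    with Cons.IH[OF q(2,3)] show ?case
      by (simp del: wprod_Cons) (rule relcompI)
  qed
  then show ?thesis unfolding w(3) by (rule link_pow_le[OF _ w(2)])
qed

text \<open>Edges for \<open>b\<close> are recorded only on a sparse set of columns. Go along the
  row of y to such a column, apply \<open>b\<close> there, and return along the row of the
  translate; as the factors commute exactly, the return ends at the original first
  coordinate.\<close>

lemma vertical_path:
  assumes Q: "Q \<subseteq> pa ` carrier G" "m_inv G ` Q \<subseteq> Q" and x: "x \<in> V k" "faithful_at k Z x" and Z: "Q \<subseteq> Z" "word_ball Q j \<subseteq> Z"
    and y: "y \<in> W" "\<sigma> k \<one> y = y" "\<sigma> k b y \<in> W" "\<sigma> k \<one> (\<sigma> k b y) = \<sigma> k b y" "W \<subseteq> V k"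
    and E1: "\<And>q x' y. q \<in> Q \<Longrightarrow> x' \<in> V k \<Longrightarrow> y \<in> W \<Longrightarrow> (q, prod_encode (x', y)) \<in> E"
    and u: "p \<in> word_ball Q j" "\<sigma> k p x \<in> U" and b: "b \<in> pb ` carrier G"
    and E2: "\<And>u. u \<in> U \<Longrightarrow> (b, prod_encode (u, y)) \<in> E"
  shows "(prod_encode (x, y), prod_encode (x, \<sigma> k b y)) \<in> link (snd (prod_seq k)) E ^^ (j + 1 + j)"
proof -
  have yV: "y \<in> V k" "\<sigma> k b y \<in> V k" using y by auto
  have pc: "p \<in> carrier G" using u(1) word_ball_closed[of Q j] Q in_pa by blast
  have uV: "\<sigma> k p x \<in> V k" using pc x by simp
  have one: "\<sigma> k \<one> (\<sigma> k p x) = \<sigma> k p x"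
    using faithful_mult[OF x(2), of \<one> p] one_in_word_ball[of Q j] u(1) Z pc by auto
  have 1: "(prod_encode (x, y), prod_encode (\<sigma> k p x, y)) \<in> link (snd (prod_seq k)) E ^^ j"
    by (rule horizontal_path[OF Q(1) x Z yV(1) y(2) E1[OF _ _ y(1)] u(1)])
  have "(prod_encode (x, \<sigma> k b y), prod_encode (\<sigma> k p x, \<sigma> k b y)) \<in> link (snd (prod_seq k)) E ^^ j"
    by (rule horizontal_path[OF Q(1) x Z yV(2) y(4) E1[OF _ _ y(3)] u(1)])
  then have 3: "(prod_encode (\<sigma> k p x, \<sigma> k b y), prod_encode (x, \<sigma> k b y)) \<in> link (snd (prod_seq k)) E ^^ j"
    by (rule link_pow_sym)
  have "(prod_encode (\<sigma> k p x, y), snd (prod_seq k) b (prod_encode (\<sigma> k p x, y))) \<in> link (snd (prod_seq k)) E"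
    by (rule link_edge[OF E2[OF u(2)]])
  then have 2: "(prod_encode (\<sigma> k p x, y), prod_encode (\<sigma> k p x, \<sigma> k b y)) \<in> link (snd (prod_seq k)) E ^^ 1"
    using uV yV in_pb[OF b] one by simp
  show ?thesis by (rule relpow_trans[OF relpow_trans[OF 1 2] 3])
qed

text \<open>Base points are all points in the rows over a net WB of the second factor, so that
  \<open>S\<close> lies in the second factor. The rows carry all edges for \<open>Q\<close>, which
  fills the budget |V|. Infinite factors permit two sparser nets at small extra cost: columns UA,
  which words in \<open>Q\<close> of bounded length reach from almost every point, and rows UB. A
  move by t goes vertically to a row of UB, there by \<open>pa t\<close>, then vertically to its
  target.\<close>

lemma product_sparsely_connected:
  assumes Q: "finite Q" "Q \<subseteq> pa ` carrier G" "m_inv G ` Q \<subseteq> Q" "infinite (generate G Q)"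
    and infB: "infinite (pb ` carrier G)" and \<Upsilon>: "\<And>g. 0 \<le> \<Upsilon> g"
  shows "\<exists>S. finite S \<and> S \<subseteq> carrier G \<and> sofic_sequence.sparsely_connected G prod_seq \<Upsilon> S (carrier G)"
proof -
  interpret P: sofic_sequence G prod_seq
    by unfold_locales (rule countable_carrier, rule sofic_prod_seq)
  let ?s = "\<lambda>k. snd (prod_seq k)"
  have Qc: "Q \<subseteq> carrier G" using Q(2) in_pa by blast
  have Bc: "pb ` carrier G \<subseteq> carrier G" by auto
  have \<Upsilon>sum: "0 \<le> sum \<Upsilon> A" for A using \<Upsilon> by (simp add: sum_nonneg)
  have \<Upsilon>le: "\<Upsilon> g \<le> sum \<Upsilon> A" if "finite A" "g \<in> A" for g A using that \<Upsilon> by (intro member_le_sum) auto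
  have ex_net: "\<exists>D. finite D \<and> D \<noteq> {} \<and> D \<subseteq> C \<and> K \<le> real (card D)" if "infinite C" for C :: "'a set" and K :: real
  proof -
    obtain D where "D \<subseteq> C" "finite D" "card D = nat \<lceil>K\<rceil> + 1" using infinite_arbitrarily_large[OF \<open>infinite C\<close>] by blast
    then show ?thesis using real_nat_ceiling_ge[of K] by (intro exI[of _ D]) auto
  qed
  define diff where "diff D = (\<lambda>(d, d'). inv d \<otimes> d') ` (D \<times> D)" for D
  have diff: "finite (diff D)" "diff D \<subseteq> C" if "finite D" "D \<subseteq> C" "subgroup C G" for C D
  proof -
    show "finite (diff D)" using that(1) by (simp add: diff_def)
    show "diff D \<subseteq> C" unfolding diff_def
      using subgroup.m_closed[OF that(3)] subgroup.m_inv_closed[OF that(3)] subsetD[OF that(2)] by auto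
  qed
  obtain D1 where D1: "finite D1" "D1 \<noteq> {}" "D1 \<subseteq> pb ` carrier G" "sum \<Upsilon> Q + 1 \<le> real (card D1)"
    using ex_net[OF infB, of "sum \<Upsilon> Q + 1"] by blast
  define S where "S = diff D1"
  have S: "finite S" "S \<subseteq> pb ` carrier G" using diff[OF D1(1,3) subgroup_pb] by (auto simp: S_def)
  have "P.sparsely_connected \<Upsilon> S (carrier G)"
    unfolding P.sparsely_connected_def
  proof (intro allI impI)
    fix T \<delta> assume T\<delta>: "finite T \<and> T \<subseteq> carrier G \<and> (0 :: real) < \<delta>"
    then have T: "finite T" "T \<subseteq> carrier G" and \<delta>: "0 < \<delta>" by auto
    define TA where "TA = pa ` T"
    define TB where "TB = pb ` T"
    have TA: "finite TA" "TA \<subseteq> pa ` carrier G" and TB: "finite TB" "TB \<subseteq> pb ` carrier G"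
      using T by (auto simp: TA_def TB_def)
    obtain D2 where D2: "finite D2" "D2 \<noteq> {}" "D2 \<subseteq> pb ` carrier G" "2 * sum \<Upsilon> TA / \<delta> \<le> real (card D2)"
      using ex_net[OF infB, of "2 * sum \<Upsilon> TA / \<delta>"] by blast
    define P2 where "P2 = diff D2"
    have P2: "finite P2" "P2 \<subseteq> pb ` carrier G" using diff[OF D2(1,3) subgroup_pb] by (auto simp: P2_def)
    \<comment> \<open>Vertical moves from y to the net row u = b^-1 y, and from u to the target row,
      which is \<open>pb t \<otimes> b\<close> applied to u.\<close>
    define B2 where "B2 = m_inv G ` P2 \<union> (\<lambda>(t, b). t \<otimes> b) ` (TB \<times> P2)"
    have B2: "finite B2" "B2 \<subseteq> pb ` carrier G"
    proof -
      show "finite B2" using P2 TB by (simp add: B2_def)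
      show "B2 \<subseteq> pb ` carrier G" unfolding B2_def
        using subgroup.m_closed[OF subgroup_pb] subgroup.m_inv_closed[OF subgroup_pb] subsetD[OF P2(2)] subsetD[OF TB(2)] by auto
    qed
    obtain D3 where D3: "finite D3" "D3 \<noteq> {}" "D3 \<subseteq> generate G Q" "2 * sum \<Upsilon> B2 / \<delta> \<le> real (card D3)"
      using ex_net[OF Q(4), of "2 * sum \<Upsilon> B2 / \<delta>"] by blast
    define P3 where "P3 = diff D3"
    have P3: "finite P3" "P3 \<subseteq> generate G Q"
      using diff[OF D3(1,3) generate_is_subgroup[OF Qc]] by (auto simp: P3_def)
    have "\<exists>j. A \<subseteq> word_ball Q j" if "finite A" "A \<subseteq> generate G Q" for A
      using that
    proof (induction A)
      case (insert a A)
      then obtain j where j: "A \<subseteq> word_ball Q j" by auto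
      obtain i where "a \<in> word_ball Q i" using insert.prems by (auto simp: generate_eq_word_balls[OF Qc Q(3)])
      then have "insert a A \<subseteq> word_ball Q (max i j)"
        using j word_ball_mono[of i "max i j" Q] word_ball_mono[of j "max i j" Q] by auto
      then show ?case by blast
    qed simp
    then obtain j where "P3 \<subseteq> word_ball Q j" using P3 by blast
    then have j: "inv p \<in> word_ball Q j" if "p \<in> P3" for p using that word_ball_inv[OF Qc Q(3)] by blast
    have sc: "S \<subseteq> carrier G" "TA \<subseteq> carrier G" "TB \<subseteq> carrier G" "P2 \<subseteq> carrier G" "B2 \<subseteq> carrier G"
      "P3 \<subseteq> carrier G" "D1 \<subseteq> carrier G" "D2 \<subseteq> carrier G" "D3 \<subseteq> carrier G"
    proof -
      have "generate G Q \<subseteq> carrier G" by (rule generate_incl[OF Qc])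
      then show "P3 \<subseteq> carrier G" "D3 \<subseteq> carrier G" using P3(2) D3(3) by (auto dest: subsetD)
      show "TA \<subseteq> carrier G" using TA(2) in_pa by blast
      show "S \<subseteq> carrier G" "TB \<subseteq> carrier G" "P2 \<subseteq> carrier G" "B2 \<subseteq> carrier G" "D1 \<subseteq> carrier G" "D2 \<subseteq> carrier G"
        by (rule subset_trans[OF S(2) Bc], rule subset_trans[OF TB(2) Bc], rule subset_trans[OF P2(2) Bc],
            rule subset_trans[OF B2(2) Bc], rule subset_trans[OF D1(3) Bc], rule subset_trans[OF D2(3) Bc])
    qed
    define Z where "Z = insert \<one> (D1 \<union> S \<union> D2 \<union> P2 \<union> B2 \<union> D3 \<union> P3 \<union> m_inv G ` P3 \<union> TA \<union> TB \<union> Q \<union> word_ball Q j)"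
    have Z: "finite Z" "Z \<subseteq> carrier G"
    proof -
      show "finite Z" unfolding Z_def using D1 S D2 P2 B2 D3 P3 TA TB Q finite_word_ball[OF Q(1)] by simp
      have "m_inv G ` P3 \<subseteq> carrier G" using sc(6) by auto
      then show "Z \<subseteq> carrier G" unfolding Z_def using sc Qc word_ball_closed[OF Qc] by simp
    qed
    \<comment> \<open>The exceptional set takes one share for each coordinate and |TA| shares for
      preimages in the first.\<close>
    define \<theta> where "\<theta> = \<delta> / (2 + real (card TA))"
    have \<theta>: "0 < \<theta>" "(2 + real (card TA)) * \<theta> = \<delta>"
    proof -
      have a: "0 < 2 + real (card TA)" by linarith
      show "0 < \<theta>" unfolding \<theta>_def using \<delta> a by simp
      show "(2 + real (card TA)) * \<theta> = \<delta>" unfolding \<theta>_def using a by simp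
    qed
    define C where "C = (j + 1 + j) + 1 + (j + 1 + j)"
    show "\<exists>C R. finite R \<and> R \<subseteq> carrier G \<and>
           (\<forall>\<^sub>F k in sequentially. \<exists>W E B. W \<subseteq> P.V k \<and> E \<subseteq> R \<times> P.V k \<and> B \<subseteq> P.V k \<and>
              real (card B) \<le> \<delta> * P.sz k \<and> (\<Sum>(g, v)\<in>E. \<Upsilon> g) \<le> (1 + \<delta>) * P.sz k \<and>
              (\<forall>v\<in>P.V k - B. \<exists>s\<in>S. \<exists>w\<in>W. v = ?s k s w) \<and>
              (\<forall>w\<in>W - B. \<forall>t\<in>T. ?s k t w \<in> W \<longrightarrow> (w, ?s k t w) \<in> link (?s k) E ^^ C))"
    proof (rule exI[of _ C], rule exI[of _ "Q \<union> B2 \<union> TA"], intro conjI)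
      show "finite (Q \<union> B2 \<union> TA)" using Q B2 TA by simp
      show "Q \<union> B2 \<union> TA \<subseteq> carrier G" using Qc sc by simp
      show "\<forall>\<^sub>F k in sequentially. \<exists>W E B. W \<subseteq> P.V k \<and> E \<subseteq> (Q \<union> B2 \<union> TA) \<times> P.V k \<and> B \<subseteq> P.V k \<and>
              real (card B) \<le> \<delta> * P.sz k \<and> (\<Sum>(g, v)\<in>E. \<Upsilon> g) \<le> (1 + \<delta>) * P.sz k \<and>
              (\<forall>v\<in>P.V k - B. \<exists>s\<in>S. \<exists>w\<in>W. v = ?s k s w) \<and>
              (\<forall>w\<in>W - B. \<forall>t\<in>T. ?s k t w \<in> W \<longrightarrow> (w, ?s k t w) \<in> link (?s k) E ^^ C)"
        using eventually_unfaithful_small[OF Z \<theta>(1)]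
      proof eventually_elim
        case (elim k)
        have DZ: "D1 \<union> (\<lambda>(d, d'). inv d \<otimes> d') ` (D1 \<times> D1) \<subseteq> Z" "D2 \<union> (\<lambda>(d, d'). inv d \<otimes> d') ` (D2 \<times> D2) \<subseteq> Z"
          "D3 \<union> (\<lambda>(d, d'). inv d \<otimes> d') ` (D3 \<times> D3) \<subseteq> Z"
          unfolding Z_def S_def P2_def P3_def diff_def by (simp_all only: Un_subset_iff) auto
        obtain WB where WB: "WB \<subseteq> V k" "card WB * card D1 \<le> card (V k)"
          and WBnet: "\<And>w. w \<in> V k \<Longrightarrow> w \<notin> unfaithful k Z \<Longrightarrow> \<exists>u\<in>WB. \<exists>x\<in>S. w = \<sigma> k x u \<and> u = \<sigma> k (inv x) w"
          using ex_separated_net[OF D1(1,2) sc(7) subset_refl DZ(1)] unfolding S_def diff_def by metis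
        obtain UB where UB: "UB \<subseteq> WB" "card UB * card D2 \<le> card (V k)"
          and UBnet: "\<And>w. w \<in> WB \<Longrightarrow> w \<notin> unfaithful k Z \<Longrightarrow> \<exists>u\<in>UB. \<exists>x\<in>P2. w = \<sigma> k x u \<and> u = \<sigma> k (inv x) w"
          using ex_separated_net[OF D2(1,2) sc(8) WB(1) DZ(2)] unfolding P2_def diff_def by metis
        obtain UA where UA: "UA \<subseteq> V k" "card UA * card D3 \<le> card (V k)"
          and UAnet: "\<And>w. w \<in> V k \<Longrightarrow> w \<notin> unfaithful k Z \<Longrightarrow> \<exists>u\<in>UA. \<exists>x\<in>P3. w = \<sigma> k x u \<and> u = \<sigma> k (inv x) w"
          using ex_separated_net[OF D3(1,2) sc(9) subset_refl DZ(3)] unfolding P3_def diff_def by metis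
        have UBV: "UB \<subseteq> V k" by (rule subset_trans[OF UB(1) WB(1)])
        have fin: "finite WB" "finite UB" "finite UA"
          by (rule finite_subset[OF WB(1) finite_V], rule finite_subset[OF UBV finite_V], rule finite_subset[OF UA(1) finite_V])
        define W where "W = prod_encode ` (V k \<times> WB)"
        \<comment> \<open>Of the three edge sets only this one is not sparse beyond the first net;
          \<open>D1\<close> was chosen to outweigh the total weight of \<open>Q\<close>.\<close>
        define E1 where "E1 = Q \<times> prod_encode ` (V k \<times> WB)"
        define E2 where "E2 = B2 \<times> prod_encode ` (UA \<times> V k)"
        define E3 where "E3 = TA \<times> prod_encode ` (V k \<times> UB)"
        define E where "E = E1 \<union> (E2 \<union> E3)"
        have fE: "finite E1" "finite E2" "finite E3" using Q B2 TA fin by (auto simp: E1_def E2_def E3_def)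
        have prod_cost: "(\<Sum>(g, v)\<in>A \<times> prod_encode ` X. \<Upsilon> g) = real (card X) * sum \<Upsilon> A" for A X
        proof -
          have "(\<Sum>(g, v)\<in>A \<times> prod_encode ` X. \<Upsilon> g) = (\<Sum>g\<in>A. \<Sum>v\<in>prod_encode ` X. \<Upsilon> g)"
            by (rule sum.cartesian_product[symmetric])
          then show ?thesis by (simp add: card_enc sum_distrib_left)
        qed
        have small: "sz k * real (card U) * c \<le> \<delta> / 2 * (sz k * sz k)"
          if "card U * card D \<le> card (V k)" "2 * c / \<delta> \<le> real (card D)" "0 \<le> c" for U :: "nat set" and D :: "'a set" and c
        proof -
          have "c \<le> \<delta> / 2 * real (card D)" using that(2) \<delta> by (simp add: field_simps)
          then have "real (card U) * c \<le> real (card U) * (\<delta> / 2 * real (card D))" by (intro mult_left_mono) auto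
          also have "\<dots> = \<delta> / 2 * real (card U * card D)" by simp
          also have "\<dots> \<le> \<delta> / 2 * sz k" using that(1) \<delta> by (intro mult_left_mono) (auto simp del: of_nat_mult)
          finally have "sz k * (real (card U) * c) \<le> sz k * (\<delta> / 2 * sz k)" by (intro mult_left_mono) auto
          then show ?thesis by (simp add: mult_ac)
        qed
        have c1: "(\<Sum>(g, v)\<in>E1. \<Upsilon> g) \<le> sz k * sz k"
        proof -
          have "real (card WB) * sum \<Upsilon> Q \<le> real (card WB) * real (card D1)"
            using D1(4) by (intro mult_left_mono) auto
          also have "\<dots> \<le> sz k" using WB(2) unfolding of_nat_mult[symmetric] of_nat_le_iff .
          finally have "sz k * (real (card WB) * sum \<Upsilon> Q) \<le> sz k * sz k" by (intro mult_left_mono) auto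
          then show ?thesis unfolding E1_def prod_cost by (simp add: card_cartesian_product mult_ac)
        qed
        have c2: "(\<Sum>(g, v)\<in>E2. \<Upsilon> g) \<le> \<delta> / 2 * (sz k * sz k)"
          unfolding E2_def prod_cost using small[OF UA(2) D3(4) \<Upsilon>sum] by (simp add: card_cartesian_product mult_ac)
        have c3: "(\<Sum>(g, v)\<in>E3. \<Upsilon> g) \<le> \<delta> / 2 * (sz k * sz k)"
          unfolding E3_def prod_cost using small[OF UB(2) D2(4) \<Upsilon>sum] by (simp add: card_cartesian_product mult_ac)
        have "(\<Sum>(g, v)\<in>E. \<Upsilon> g) \<le> (\<Sum>(g, v)\<in>E1. \<Upsilon> g) + ((\<Sum>(g, v)\<in>E2. \<Upsilon> g) + (\<Sum>(g, v)\<in>E3. \<Upsilon> g))"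
          unfolding E_def using fE \<Upsilon> by (intro order_trans[OF sum_edge_Un_le] add_left_mono) auto
        also have "\<dots> \<le> sz k * sz k + (\<delta> / 2 * (sz k * sz k) + \<delta> / 2 * (sz k * sz k))"
          by (intro add_mono c1 c2 c3)
        finally have cost: "(\<Sum>(g, v)\<in>E. \<Upsilon> g) \<le> (1 + \<delta>) * P.sz k" unfolding card_prod_V by (simp add: algebra_simps)
        define X where "X = unfaithful k Z \<union> touch k TA (unfaithful k Z)"
        have XV: "X \<subseteq> V k" using unfaithful_subset touch_subset by (simp add: X_def)
        have cX: "real (card X) \<le> \<theta> * sz k + real (card TA) * \<theta> * sz k"
        proof -
          have "real (card X) \<le> real (card (unfaithful k Z)) + real (card (touch k TA (unfaithful k Z)))"
            unfolding X_def using card_Un_le[of "unfaithful k Z" "touch k TA (unfaithful k Z)"] by linarith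
          also have "\<dots> \<le> \<theta> * sz k + real (card TA) * \<theta> * sz k"
            by (intro add_mono elim card_touch_le[OF TA(1) sc(2) _ elim] finite_unfaithful)
          finally show ?thesis .
        qed
        define B where "B = prod_encode ` (X \<times> V k \<union> V k \<times> unfaithful k Z)"
        have "card B \<le> card X * card (V k) + card (V k) * card (unfaithful k Z)"
          unfolding B_def card_enc by (rule order_trans[OF card_Un_le]) (simp add: card_cartesian_product)
        then have "real (card B) \<le> real (card X) * sz k + sz k * real (card (unfaithful k Z))"
          unfolding of_nat_mult[symmetric] of_nat_add[symmetric] of_nat_le_iff .
        also have "\<dots> \<le> (\<theta> * sz k + real (card TA) * \<theta> * sz k) * sz k + sz k * (\<theta> * sz k)"
          using cX elim by (intro add_mono mult_right_mono mult_left_mono) auto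
        also have "\<dots> = ((2 + real (card TA)) * \<theta>) * (sz k * sz k)" by (simp add: algebra_simps)
        finally have cB: "real (card B) \<le> \<delta> * P.sz k" unfolding \<theta>(2) card_prod_V .
        have BV: "B \<subseteq> P.V k" unfolding B_def prod_V using XV unfaithful_subset by (intro image_mono) auto
        have WV: "W \<subseteq> P.V k" unfolding W_def prod_V using WB by (intro image_mono) auto
        have EV: "E \<subseteq> (Q \<union> B2 \<union> TA) \<times> P.V k"
          unfolding E_def E1_def E2_def E3_def prod_V using WB(1) UA(1) UBV by auto
        have onex: "\<sigma> k \<one> x = x" if "x \<in> V k" "x \<notin> unfaithful k Z" for x
          by (rule faithful_one[OF faithfulI[OF that]]) (simp add: Z_def)
        have cov: "\<exists>s\<in>S. \<exists>w\<in>W. v = ?s k s w" if v: "v \<in> P.V k - B" for v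
        proof -
          obtain x y where xy: "v = prod_encode (x, y)" "x \<in> V k" "y \<in> V k" using v by (auto simp: prod_V)
          have nb: "x \<notin> unfaithful k Z" "y \<notin> unfaithful k Z" using v xy by (auto simp: B_def X_def)
          obtain u s where us: "u \<in> WB" "s \<in> S" "y = \<sigma> k s u" using WBnet[OF xy(3) nb(2)] by blast
          have "u \<in> V k" using us(1) WB(1) by blast
          then have "?s k s (prod_encode (x, u)) = v"
            using xy us in_pb[OF subsetD[OF S(2) us(2)]] onex[OF xy(2) nb(1)] by simp
          then show ?thesis using us xy by (intro bexI[of _ s] bexI[of _ "prod_encode (x, u)"]) (auto simp: W_def)
        qed
        have connected: "(w, ?s k t w) \<in> link (?s k) E ^^ C"
          if w: "w \<in> W" "w \<notin> B" "t \<in> T" "?s k t w \<in> W" for w t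
        proof -
          obtain x y where xy: "w = prod_encode (x, y)" "x \<in> V k" "y \<in> WB" using w(1) by (auto simp: W_def)
          have yV: "y \<in> V k" using xy(3) WB(1) by blast
          have tc: "t \<in> carrier G" using w(3) T(2) by blast
          have ta: "pa t \<in> TA" "pb t \<in> TB" "pa t \<in> carrier G" "pb t \<in> carrier G"
            using w(3) tc by (auto simp: TA_def TB_def)
          have nb: "x \<notin> unfaithful k Z" "y \<notin> unfaithful k Z" "\<sigma> k (pa t) x \<notin> unfaithful k Z"
            using w(2) xy yV ta(1) by (auto simp: B_def X_def touch_def)
          have x2V: "\<sigma> k (pa t) x \<in> V k" using xy(2) ta(3) by simp
          have fy: "faithful_at k Z y" by (rule faithfulI[OF yV nb(2)])
          have tw: "?s k t w = prod_encode (\<sigma> k (pa t) x, \<sigma> k (pb t) y)" using xy yV by simp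
          then have tyW: "\<sigma> k (pb t) y \<in> WB" using w(4) by (auto simp: W_def)
          obtain u b where ub: "u \<in> UB" "b \<in> P2" "y = \<sigma> k b u" "u = \<sigma> k (inv b) y" using UBnet[OF xy(3) nb(2)] by blast
          have uW: "u \<in> WB" "u \<in> V k" using ub(1) UB(1) UBV by auto
          have bc: "b \<in> carrier G" using ub(2) sc(4) by blast
          have bB: "inv b \<in> B2" "pb t \<otimes> b \<in> B2"
          proof -
            show "inv b \<in> B2" using ub(2) by (simp add: B2_def)
            have "(\<lambda>(t, b). t \<otimes> b) (pb t, b) \<in> B2" unfolding B2_def
              by (rule UnI2, rule imageI) (simp add: ta(2) ub(2))
            then show "pb t \<otimes> b \<in> B2" by simp
          qed
          have zz: "\<one> \<in> Z" "inv b \<in> Z" "pb t \<otimes> b \<in> Z" "pb t \<in> Z" using bB ta by (auto simp: Z_def)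
          have one_u: "\<sigma> k \<one> u = u" using faithful_mult[OF fy zz(1,2)] ub(4) bc by simp
          have one_ty: "\<sigma> k \<one> (\<sigma> k (pb t) y) = \<sigma> k (pb t) y" using faithful_mult[OF fy zz(1,4)] ta by simp
          have "pb t \<otimes> b \<otimes> inv b = pb t" using bc ta by (simp add: m_assoc)
          then have ty: "\<sigma> k (pb t \<otimes> b) u = \<sigma> k (pb t) y" using faithful_mult[OF fy zz(3,2)] ub(4) by simp
          have ZQ: "Q \<subseteq> Z" "word_ball Q j \<subseteq> Z" by (auto simp: Z_def)
          have E1in: "(q, prod_encode (x', y')) \<in> E" if "q \<in> Q" "x' \<in> V k" "y' \<in> WB" for q x' y'
            using that by (simp add: E_def E1_def)
          have E2in: "(b', prod_encode (u', y')) \<in> E" if "b' \<in> B2" "u' \<in> UA" "y' \<in> V k" for b' u' y'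
            using that by (simp add: E_def E2_def)
          obtain ua p where ua: "ua \<in> UA" "p \<in> P3" "ua = \<sigma> k (inv p) x" using UAnet[OF xy(2) nb(1)] by blast
          obtain ua' p' where ua': "ua' \<in> UA" "p' \<in> P3" "ua' = \<sigma> k (inv p') (\<sigma> k (pa t) x)"
            using UAnet[OF x2V nb(3)] by blast
          have v1: "(prod_encode (x, y), prod_encode (x, \<sigma> k (inv b) y)) \<in> link (?s k) E ^^ (j + 1 + j)"
          proof (rule vertical_path[OF Q(2,3) xy(2) faithfulI[OF xy(2) nb(1)] ZQ xy(3) onex[OF yV nb(2)] _ _ WB(1) E1in j[OF ua(2)]])
            show "\<sigma> k (inv b) y \<in> WB" using uW ub(4) by simp
            show "\<sigma> k \<one> (\<sigma> k (inv b) y) = \<sigma> k (inv b) y" using one_u ub(4) by simp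
            show "\<sigma> k (inv p) x \<in> UA" using ua by simp
            show "inv b \<in> pb ` carrier G" using bB(1) B2(2) by blast
            show "(inv b, prod_encode (u', y)) \<in> E" if "u' \<in> UA" for u' by (rule E2in[OF bB(1) that yV])
          qed
          have "(pa t, prod_encode (x, u)) \<in> E" using ta(1) xy(2) ub(1) by (simp add: E_def E3_def)
          then have "(prod_encode (x, u), ?s k (pa t) (prod_encode (x, u))) \<in> link (?s k) E" by (rule link_edge)
          then have v2: "(prod_encode (x, u), prod_encode (\<sigma> k (pa t) x, u)) \<in> link (?s k) E ^^ 1"
            using xy(2) uW(2) tc one_u by simp
          have v3: "(prod_encode (\<sigma> k (pa t) x, u), prod_encode (\<sigma> k (pa t) x, \<sigma> k (pb t \<otimes> b) u)) \<in> link (?s k) E ^^ (j + 1 + j)"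
          proof (rule vertical_path[OF Q(2,3) x2V faithfulI[OF x2V nb(3)] ZQ uW(1) one_u _ _ WB(1) E1in j[OF ua'(2)]])
            show "\<sigma> k (pb t \<otimes> b) u \<in> WB" using ty tyW by simp
            show "\<sigma> k \<one> (\<sigma> k (pb t \<otimes> b) u) = \<sigma> k (pb t \<otimes> b) u" using ty one_ty by simp
            show "\<sigma> k (inv p') (\<sigma> k (pa t) x) \<in> UA" using ua' by simp
            show "pb t \<otimes> b \<in> pb ` carrier G" using bB(2) B2(2) by blast
            show "(pb t \<otimes> b, prod_encode (u', u)) \<in> E" if "u' \<in> UA" for u' by (rule E2in[OF bB(2) that uW(2)])
          qed
          have v1': "(w, prod_encode (x, u)) \<in> link (?s k) E ^^ (j + 1 + j)" using v1 ub(4) xy(1) by simp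
          have v3': "(prod_encode (\<sigma> k (pa t) x, u), ?s k t w) \<in> link (?s k) E ^^ (j + 1 + j)"
            using v3 unfolding tw ty .
          show ?thesis unfolding C_def by (rule relpow_trans[OF relpow_trans[OF v1' v2] v3'])
        qed
        have "\<forall>v\<in>P.V k - B. \<exists>s\<in>S. \<exists>w\<in>W. v = ?s k s w" using cov by simp
        moreover have "\<forall>w\<in>W - B. \<forall>t\<in>T. ?s k t w \<in> W \<longrightarrow> (w, ?s k t w) \<in> link (?s k) E ^^ C"
          using connected by simp
        ultimately show ?case using WV EV BV cB cost by (intro exI[of _ W] exI[of _ E] exI[of _ B]) simp
      qed
    qed
  qed
  then show ?thesis using S(1) subset_trans[OF S(2) Bc] by blast
qed

end

section \<open>Maps into compact spaces\<close>

lemma compatible_metric_space: "compatible_metric X d \<Longrightarrow> Metric_space (topspace X) d"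
  by (simp add: compatible_metric_def)

lemma compact_uniformly_continuous:
  assumes X: "compact_space X" "compatible_metric X dX" and Y: "compatible_metric Y dY"
    and f: "continuous_map X Y f" and e: "0 < (e :: real)"
  obtains \<delta> where "0 < \<delta>" "\<And>x x'. x \<in> topspace X \<Longrightarrow> x' \<in> topspace X \<Longrightarrow> dX x x' < \<delta> \<Longrightarrow> dY (f x) (f x') < e"
proof -
  interpret MX: Metric_space "topspace X" dX using X by (simp add: compatible_metric_def)
  interpret MY: Metric_space "topspace Y" dY using Y by (simp add: compatible_metric_def)
  let ?m1 = "metric (topspace X, dX)" and ?m2 = "metric (topspace Y, dY)"
  have tX: "mtopology_of ?m1 = X" and tY: "mtopology_of ?m2 = Y"
    using X(2) Y by (simp_all add: compatible_metric_def mtopology_of_def)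
  have "uniformly_continuous_map ?m1 ?m2 f"
    using continuous_eq_uniformly_continuous_map[of ?m1 ?m2 f] f X(1) unfolding tX tY by simp
  then have "\<exists>\<delta>>0. \<forall>x\<in>topspace X. \<forall>y\<in>topspace X. dX y x < \<delta> \<longrightarrow> dY (f y) (f x) < e"
    using e by (simp add: uniformly_continuous_map_def)
  then show thesis using that by blast
qed

lemma compact_locally_constant:
  assumes X: "compact_space X" "compatible_metric X d" and f: "continuous_map X (discrete_topology A) f"
  obtains \<delta> where "0 < (\<delta> :: real)" "\<And>x x'. x \<in> topspace X \<Longrightarrow> x' \<in> topspace X \<Longrightarrow> d x x' < \<delta> \<Longrightarrow> f x = f x'"
proof -
  interpret disc: discrete_metric A .
  have "compatible_metric (discrete_topology A) disc.dd"
    by (simp add: compatible_metric_def disc.disc.Metric_space_axioms disc.mtopology_discrete_metric)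
  then obtain \<delta> where "0 < \<delta>" "\<And>x x'. x \<in> topspace X \<Longrightarrow> x' \<in> topspace X \<Longrightarrow> d x x' < \<delta> \<Longrightarrow> disc.dd (f x) (f x') < 1"
    using compact_uniformly_continuous[OF X _ f, of disc.dd 1] by auto
  note near = this
  show thesis
  proof (rule that[OF near(1)], rule ccontr)
    fix x x' assume "x \<in> topspace X" "x' \<in> topspace X" "d x x' < \<delta>" "f x \<noteq> f x'"
    then show False using near(2)[of x x'] by (simp add: disc.dd_def)
  qed
qed

lemma compact_discrete_image_finite:
  assumes "compact_space X" "continuous_map X (discrete_topology A) f"
  shows "finite (f ` topspace X)" "f ` topspace X \<subseteq> A"
proof -
  have "compactin (discrete_topology A) (f ` topspace X)"
    using assms image_compactin by (auto simp: compact_space_def)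
  then show "finite (f ` topspace X)" "f ` topspace X \<subseteq> A" by (simp_all add: compactin_discrete_topology)
qed

text \<open>The cell of a point is named by the centre of a ball of radius e/2 that contains
  it.\<close>

lemma compact_finite_cells:
  assumes X: "compact_space X" "compatible_metric X d" and e: "0 < (e :: real)"
  obtains c :: "'x \<Rightarrow> 'x" where "finite (c ` topspace X)"
    "\<And>x x'. x \<in> topspace X \<Longrightarrow> x' \<in> topspace X \<Longrightarrow> c x = c x' \<Longrightarrow> d x x' < e"
proof -
  interpret M: Metric_space "topspace X" d using X by (simp add: compatible_metric_def)
  have "compactin M.mtopology (topspace X)" using X by (simp add: compatible_metric_def compact_space_def)
  then have "M.mtotally_bounded (topspace X)" by (rule M.compactin_imp_mtotally_bounded)
  then obtain K where K: "finite K" "K \<subseteq> topspace X" "topspace X \<subseteq> (\<Union>k\<in>K. M.mball k (e / 2))"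
    using e half_gt_zero[OF e] unfolding M.mtotally_bounded_def by (elim allE[of _ "e / 2"]) auto
  define c where "c x = (SOME k. k \<in> K \<and> x \<in> M.mball k (e / 2))" for x
  have c: "c x \<in> K \<and> x \<in> M.mball (c x) (e / 2)" if "x \<in> topspace X" for x
    unfolding c_def by (rule someI_ex) (use K(3) that in blast)
  show thesis
  proof (rule that[of c])
    show "finite (c ` topspace X)" by (rule finite_subset[OF _ K(1)]) (use c in blast)
    fix x x' assume x: "x \<in> topspace X" "x' \<in> topspace X" "c x = c x'"
    then have "d (c x) x < e / 2" "d (c x) x' < e / 2" using c[OF x(1)] c[OF x(2)] by auto
    moreover have "d x x' \<le> d x (c x) + d (c x) x'" using M.triangle x K(2) c[OF x(1)] by blast
    ultimately show "d x x' < e" by (simp add: M.commute)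
  qed
qed

lemma compact_bounded_dist:
  assumes X: "compact_space X" "compatible_metric X d"
  obtains D where "0 < (D :: real)" "\<And>x x'. x \<in> topspace X \<Longrightarrow> x' \<in> topspace X \<Longrightarrow> d x x' \<le> D"
proof -
  interpret M: Metric_space "topspace X" d using X by (simp add: compatible_metric_def)
  have "compactin M.mtopology (topspace X)" using X by (simp add: compatible_metric_def compact_space_def)
  then have "M.mbounded (topspace X)" by (rule M.compactin_imp_mbounded)
  then show thesis using that unfolding M.mbounded_alt_pos by blast
qed

section \<open>Separated sets of maps and their numbers\<close>

definition separated :: "real \<Rightarrow> ('w \<Rightarrow> 'w \<Rightarrow> real) \<Rightarrow> 'w set \<Rightarrow> bool" where
  "separated \<epsilon> \<rho> W \<longleftrightarrow> (\<forall>x\<in>W. \<forall>y\<in>W. x \<noteq> y \<longrightarrow> \<rho> x y \<ge> \<epsilon>)"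

lemma dist_inf_geE:
  assumes "finite V" "V \<noteq> {}" "\<epsilon> \<le> dist_inf V d \<phi> \<psi>"
  obtains v where "v \<in> V" "\<epsilon> \<le> d (\<phi> v) (\<psi> v)"
  using assms by (auto simp: dist_inf_def Max_ge_iff)

lemma dist_inf_geI:
  assumes "finite V" "v \<in> V" "\<epsilon> \<le> d (\<phi> v) (\<psi> v)"
  shows "\<epsilon> \<le> dist_inf V d \<phi> \<psi>"
  unfolding dist_inf_def using assms by (intro order_trans[OF assms(3) Max_ge]) auto

lemma separated_maps_bounded:
  assumes X: "compact_space X" "compatible_metric X d" and \<epsilon>: "0 < \<epsilon>" and V: "finite V" "V \<noteq> {}"
  obtains b where "\<And>W. W \<subseteq> V \<rightarrow>\<^sub>E topspace X \<Longrightarrow> separated \<epsilon> (dist_inf V d) W \<Longrightarrow> finite W \<and> card W \<le> b"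
proof -
  obtain c :: "'a \<Rightarrow> 'a" where c: "finite (c ` topspace X)"
    "\<And>x x'. x \<in> topspace X \<Longrightarrow> x' \<in> topspace X \<Longrightarrow> c x = c x' \<Longrightarrow> d x x' < \<epsilon>"
    using compact_finite_cells[OF X \<epsilon>] by blast
  let ?P = "V \<rightarrow>\<^sub>E c ` topspace X"
  have fP: "finite ?P" using V c by (intro finite_PiE) auto
  show thesis
  proof (rule that[of "card ?P"])
    fix W assume W: "W \<subseteq> V \<rightarrow>\<^sub>E topspace X" "separated \<epsilon> (dist_inf V d) W"
    have inj: "inj_on (\<lambda>\<phi>. \<lambda>v\<in>V. c (\<phi> v)) W"
    proof (rule inj_onI, rule ccontr)
      fix \<phi> \<psi> assume *: "\<phi> \<in> W" "\<psi> \<in> W" "(\<lambda>v\<in>V. c (\<phi> v)) = (\<lambda>v\<in>V. c (\<psi> v))" "\<phi> \<noteq> \<psi>"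
      then have "\<epsilon> \<le> dist_inf V d \<phi> \<psi>" using W(2) by (simp add: separated_def)
      then obtain v where v: "v \<in> V" "\<epsilon> \<le> d (\<phi> v) (\<psi> v)" by (rule dist_inf_geE[OF V])
      have "c (\<phi> v) = c (\<psi> v)" using fun_cong[OF *(3), of v] v(1) by simp
      moreover have "\<phi> v \<in> topspace X" "\<psi> v \<in> topspace X" using * W(1) v(1) by (auto simp: PiE_iff)
      ultimately show False using c(2) v(2) by (meson not_le)
    qed
    have img: "(\<lambda>\<phi>. \<lambda>v\<in>V. c (\<phi> v)) ` W \<subseteq> ?P" using W(1) by (auto simp: PiE_iff)
    show "finite W \<and> card W \<le> card ?P"
      using inj_on_finite[OF inj img fP] card_inj_on_le[OF inj img fP] by simp
  qed
qed

text \<open>Total boundedness bounds the cardinalities in the definition, so that \<open>Max\<close>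
  is attained and is an upper bound.\<close>

lemma separation_number_facts:
  assumes X: "compact_space X" "compatible_metric X d" and \<epsilon>: "0 < \<epsilon>" and V: "finite V" "V \<noteq> {}"
    and \<Omega>: "\<Omega> \<subseteq> V \<rightarrow>\<^sub>E topspace X"
  shows "\<exists>W\<subseteq>\<Omega>. finite W \<and> separated \<epsilon> (dist_inf V d) W \<and> card W = separation_number \<epsilon> \<Omega> (dist_inf V d)"
    and "W \<subseteq> \<Omega> \<Longrightarrow> separated \<epsilon> (dist_inf V d) W \<Longrightarrow> card W \<le> separation_number \<epsilon> \<Omega> (dist_inf V d)"
proof -
  obtain b where b: "\<And>W. W \<subseteq> V \<rightarrow>\<^sub>E topspace X \<Longrightarrow> separated \<epsilon> (dist_inf V d) W \<Longrightarrow> finite W \<and> card W \<le> b"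
    using separated_maps_bounded[OF X \<epsilon> V] by blast
  let ?C = "{card W |W. W \<subseteq> \<Omega> \<and> finite W \<and> (\<forall>x\<in>W. \<forall>y\<in>W. x \<noteq> y \<longrightarrow> dist_inf V d x y \<ge> \<epsilon>)}"
  have num: "separation_number \<epsilon> \<Omega> (dist_inf V d) = Max ?C" by (simp add: separation_number_def)
  have fin: "finite ?C"
  proof (rule finite_subset)
    show "?C \<subseteq> {..b}"
    proof
      fix m assume "m \<in> ?C"
      then obtain W where "W \<subseteq> \<Omega>" "separated \<epsilon> (dist_inf V d) W" "m = card W" by (auto simp: separated_def)
      then show "m \<in> {..b}" using b[of W] \<Omega> by auto
    qed
  qed simp
  have "card {} \<in> ?C" by (rule CollectI, rule exI[of _ "{}"]) simp
  then have ne: "?C \<noteq> {}" by blast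
  have "Max ?C \<in> ?C" by (rule Max_in[OF fin ne])
  then obtain W' where W': "Max ?C = card W'" "W' \<subseteq> \<Omega>" "finite W'"
    "\<forall>x\<in>W'. \<forall>y\<in>W'. x \<noteq> y \<longrightarrow> dist_inf V d x y \<ge> \<epsilon>"
    unfolding mem_Collect_eq by (elim exE conjE)
  have "separated \<epsilon> (dist_inf V d) W'" using W'(4) by (simp only: separated_def)
  then show "\<exists>W\<subseteq>\<Omega>. finite W \<and> separated \<epsilon> (dist_inf V d) W \<and> card W = separation_number \<epsilon> \<Omega> (dist_inf V d)"
    using W'(1-3) num by (intro exI[of _ W']) simp
  assume W: "W \<subseteq> \<Omega>" "separated \<epsilon> (dist_inf V d) W"
  then have "finite W" using b[of W] \<Omega> by blast
  then have "card W \<in> ?C" using W unfolding separated_def by blast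
  then show "card W \<le> separation_number \<epsilon> \<Omega> (dist_inf V d)" unfolding num by (rule Max_ge[OF fin])
qed

lemma separation_number_mono:
  assumes X: "compact_space X" "compatible_metric X d" and \<epsilon>: "0 < \<epsilon>" and V: "finite V" "V \<noteq> {}"
    and \<Omega>: "\<Omega> \<subseteq> \<Omega>'" "\<Omega>' \<subseteq> V \<rightarrow>\<^sub>E topspace X"
  shows "separation_number \<epsilon> \<Omega> (dist_inf V d) \<le> separation_number \<epsilon> \<Omega>' (dist_inf V d)"
proof -
  obtain W where W: "W \<subseteq> \<Omega>" "separated \<epsilon> (dist_inf V d) W" "card W = separation_number \<epsilon> \<Omega> (dist_inf V d)"
    using separation_number_facts(1)[OF X \<epsilon> V subset_trans[OF \<Omega>]] by blast
  then show ?thesis using separation_number_facts(2)[OF X \<epsilon> V \<Omega>(2), of W] \<Omega>(1) by auto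
qed

lemma sofic_maps_subset: "sofic_maps X d \<alpha> F \<delta> V \<sigma> \<subseteq> V \<rightarrow>\<^sub>E topspace X"
  by (auto simp: sofic_maps_def)

lemma sofic_maps_mono: "F' \<subseteq> F \<Longrightarrow> \<delta> \<le> \<delta>' \<Longrightarrow> sofic_maps X d \<alpha> F \<delta> V \<sigma> \<subseteq> sofic_maps X d \<alpha> F' \<delta>' V \<sigma>"
  by (auto simp: sofic_maps_def intro: order_trans)

text \<open>Chebyshev's inequality.\<close>

lemma card_far_le:
  assumes V: "finite V" "V \<noteq> {}" and d2: "dist_2 V d \<phi> \<psi> \<le> \<delta>" and \<rho>: "0 < \<rho>"
  shows "real (card {v \<in> V. \<rho> \<le> d (\<phi> v) (\<psi> v)}) \<le> (\<delta> / \<rho>)\<^sup>2 * real (card V)"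
proof -
  let ?S = "\<Sum>v\<in>V. (d (\<phi> v) (\<psi> v))\<^sup>2" and ?B = "{v \<in> V. \<rho> \<le> d (\<phi> v) (\<psi> v)}"
  have n: "0 < real (card V)" using V by (simp add: card_gt_0_iff)
  have S0: "0 \<le> ?S" by (intro sum_nonneg) simp
  have "1 / real (card V) * ?S = (dist_2 V d \<phi> \<psi>)\<^sup>2" using n S0 by (simp add: dist_2_def)
  also have "\<dots> \<le> \<delta>\<^sup>2" using d2 n S0 by (intro power_mono) (simp_all add: dist_2_def)
  finally have S: "?S \<le> \<delta>\<^sup>2 * real (card V)" using n by (simp add: field_simps)
  have "real (card ?B) * \<rho>\<^sup>2 = (\<Sum>v\<in>?B. \<rho>\<^sup>2)" by simp
  also have "\<dots> \<le> (\<Sum>v\<in>?B. (d (\<phi> v) (\<psi> v))\<^sup>2)" using \<rho> by (intro sum_mono power_mono) auto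
  also have "\<dots> \<le> ?S" using V by (intro sum_mono2) auto
  finally have "real (card ?B) * \<rho>\<^sup>2 \<le> \<delta>\<^sup>2 * real (card V)" using S by linarith
  then have "real (card ?B) \<le> \<delta>\<^sup>2 * real (card V) / \<rho>\<^sup>2" using \<rho> by (simp add: le_divide_eq)
  then show ?thesis by (simp add: power_divide)
qed

lemma dist_2_le:
  assumes V: "finite V" "V \<noteq> {}" and B: "B \<subseteq> V" "real (card B) \<le> \<theta> * real (card V)"
    and near: "\<And>v. v \<in> V - B \<Longrightarrow> 0 \<le> d (\<phi> v) (\<psi> v) \<and> d (\<phi> v) (\<psi> v) \<le> a"
    and far: "\<And>v. v \<in> B \<Longrightarrow> 0 \<le> d (\<phi> v) (\<psi> v) \<and> d (\<phi> v) (\<psi> v) \<le> D"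
    and le: "a\<^sup>2 + \<theta> * D\<^sup>2 \<le> \<delta>\<^sup>2" and \<delta>: "0 \<le> \<delta>"
  shows "dist_2 V d \<phi> \<psi> \<le> \<delta>"
proof -
  have n: "0 < real (card V)" using V by (simp add: card_gt_0_iff)
  have fB: "finite B" by (rule finite_subset[OF B(1) V(1)])
  have "(\<Sum>v\<in>V. (d (\<phi> v) (\<psi> v))\<^sup>2) = (\<Sum>v\<in>V - B. (d (\<phi> v) (\<psi> v))\<^sup>2) + (\<Sum>v\<in>B. (d (\<phi> v) (\<psi> v))\<^sup>2)"
    by (rule sum.subset_diff[OF B(1) V(1)])
  also have "\<dots> \<le> (\<Sum>v\<in>V - B. a\<^sup>2) + (\<Sum>v\<in>B. D\<^sup>2)"
    using near far by (intro add_mono sum_mono power_mono) auto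
  also have "\<dots> = real (card (V - B)) * a\<^sup>2 + real (card B) * D\<^sup>2" by simp
  also have "\<dots> \<le> real (card V) * a\<^sup>2 + \<theta> * real (card V) * D\<^sup>2"
    using B(2) card_mono[OF V(1), of "V - B"] by (intro add_mono mult_right_mono) auto
  also have "\<dots> = real (card V) * (a\<^sup>2 + \<theta> * D\<^sup>2)" by (simp add: algebra_simps)
  also have "\<dots> \<le> real (card V) * \<delta>\<^sup>2" using le by (intro mult_left_mono) auto
  finally have "1 / real (card V) * (\<Sum>v\<in>V. (d (\<phi> v) (\<psi> v))\<^sup>2) \<le> \<delta>\<^sup>2" using n by (simp add: field_simps)
  then have "dist_2 V d \<phi> \<psi> \<le> sqrt (\<delta>\<^sup>2)" unfolding dist_2_def by (rule real_sqrt_le_mono)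
  then show ?thesis using \<delta> by simp
qed

text \<open>With \<open>x = \<tau> / J\<close>, each partial map with small domain \<open>A\<close> contributes \<open>x ^ card A\<close> to the
  expansion of \<open>(1 + J * x) ^ card V\<close>.\<close>

lemma few_small_partial_maps:
  fixes \<tau> :: real
  assumes K: "finite K" and \<tau>: "0 < \<tau>"
  obtains \<eta> where "0 < \<eta>" "\<And>V :: 'v set. finite V \<Longrightarrow>
    finite (SIGMA A:{A. A \<subseteq> V \<and> real (card A) \<le> \<eta> * real (card V)}. A \<rightarrow>\<^sub>E K) \<and>
    real (card (SIGMA A:{A. A \<subseteq> V \<and> real (card A) \<le> \<eta> * real (card V)}. A \<rightarrow>\<^sub>E K)) \<le> exp (\<tau> * real (card V))"
proof -
  define J where "J = real (card K) + 1"
  \<comment> \<open>One half of \<tau> goes into J x and the other into \<eta>; the bound 1/2 makes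
    ln (1/x) positive.\<close>
  define x where "x = min (\<tau> / (2 * J)) (1 / 2)"
  have J: "0 < J" by (simp add: J_def)
  have x: "0 < x" "x < 1" "J * x \<le> \<tau> / 2"
  proof -
    show "0 < x" using \<tau> J by (simp add: x_def)
    show "x < 1" by (simp add: x_def)
    have "J * x \<le> J * (\<tau> / (2 * J))" using J by (intro mult_left_mono) (auto simp: x_def)
    then show "J * x \<le> \<tau> / 2" using J by simp
  qed
  \<comment> \<open>Chosen so that x ^ (\<eta> n) = exp (- \<tau> n / 2); domains with at most
    \<eta> n points contribute at least this much each to the expansion.\<close>
  define \<eta> where "\<eta> = \<tau> / (2 * ln (1 / x))"
  have lnx: "0 < ln (1 / x)" using x by simp
  have \<eta>: "0 < \<eta>" using \<tau> lnx by (simp add: \<eta>_def)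
  have \<eta>x: "\<eta> * ln (1 / x) = \<tau> / 2" using lnx by (simp add: \<eta>_def)
  show thesis
  proof (rule that[OF \<eta>])
    fix V :: "'v set" assume V: "finite V"
    let ?\<A> = "{A. A \<subseteq> V \<and> real (card A) \<le> \<eta> * real (card V)}"
    let ?P = "SIGMA A:?\<A>. A \<rightarrow>\<^sub>E K"
    have f\<A>: "finite ?\<A>" using V by (intro finite_subset[of ?\<A> "Pow V"]) auto
    have fA: "finite A" if "A \<in> ?\<A>" for A using that V finite_subset by auto
    have fP: "finite ?P" 
      by (rule finite_SigmaI[OF f\<A>], rule finite_PiE[OF fA]) (auto simp: K)
    have card_fun: "real (card (A \<rightarrow>\<^sub>E K)) \<le> J ^ card A" if "A \<in> ?\<A>" for A
      using fA[OF that] K by (simp add: card_PiE J_def power_mono)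
    have xn: "x powr (\<eta> * real (card V)) * J ^ card A \<le> (J * x) ^ card A" if "A \<in> ?\<A>" for A
    proof -
      have "x powr (\<eta> * real (card V)) \<le> x powr real (card A)"
        using that x by (intro powr_mono') auto
      also have "\<dots> = x ^ card A" using x by (simp add: powr_realpow)
      finally have "x powr (\<eta> * real (card V)) * J ^ card A \<le> x ^ card A * J ^ card A"
        using J by (intro mult_right_mono) auto
      then show ?thesis by (simp add: power_mult_distrib mult.commute)
    qed
    have "x powr (\<eta> * real (card V)) * real (card ?P) = (\<Sum>A\<in>?\<A>. x powr (\<eta> * real (card V)) * real (card (A \<rightarrow>\<^sub>E K)))"

    proof -
      have "card ?P = (\<Sum>A\<in>?\<A>. card (A \<rightarrow>\<^sub>E K))"
      proof (rule card_SigmaI[OF f\<A>], rule ballI)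
        fix A assume "A \<in> ?\<A>"
        then show "finite (A \<rightarrow>\<^sub>E K)" by (rule finite_PiE[OF fA]) (simp add: K)
      qed
      then show ?thesis by (simp only: of_nat_sum sum_distrib_left)
    qed
    also have "\<dots> \<le> (\<Sum>A\<in>?\<A>. (J * x) ^ card A)"
    proof (rule sum_mono)
      fix A assume A: "A \<in> ?\<A>"
      have "x powr (\<eta> * real (card V)) * real (card (A \<rightarrow>\<^sub>E K)) \<le> x powr (\<eta> * real (card V)) * J ^ card A"
        by (intro mult_left_mono card_fun[OF A]) simp
      then show "x powr (\<eta> * real (card V)) * real (card (A \<rightarrow>\<^sub>E K)) \<le> (J * x) ^ card A" using xn[OF A] by linarith
    qed
    also have "\<dots> \<le> (\<Sum>A\<in>Pow V. (J * x) ^ card A)" using V J x by (intro sum_mono2) auto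
    also have "\<dots> = (\<Prod>v\<in>V. 1 + J * x)"
    proof -
      have "(\<Prod>v\<in>V. J * x + 1) = (\<Sum>A\<in>Pow V. (\<Prod>v\<in>A. J * x) * (\<Prod>v\<in>V - A. 1))" by (rule prod_add[OF V])
      then show ?thesis by (simp add: add.commute)
    qed
    also have "\<dots> = (1 + J * x) ^ card V" by simp
    also have "\<dots> \<le> exp (J * x) ^ card V" using J x by (intro power_mono) (auto intro: exp_ge_add_one_self)
    also have "\<dots> = exp (real (card V) * (J * x))" by (simp add: exp_of_nat_mult)
    also have "\<dots> \<le> exp (real (card V) * (\<tau> / 2))" using mult_left_mono[OF x(3), of "real (card V)"] by simp
    finally have main: "x powr (\<eta> * real (card V)) * real (card ?P) \<le> exp (real (card V) * (\<tau> / 2))" .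
    have "x powr (\<eta> * real (card V)) = exp (- (real (card V) * (\<tau> / 2)))"
    proof -
      have "\<eta> * real (card V) * ln x = - (real (card V) * (\<eta> * ln (1 / x)))" using x by (simp add: ln_div)
      then show ?thesis using x unfolding \<eta>x by (simp add: powr_def mult.assoc)
    qed
    then have "exp (- (real (card V) * (\<tau> / 2))) * real (card ?P) \<le> exp (real (card V) * (\<tau> / 2))" using main by simp
    then have "exp (real (card V) * (\<tau> / 2)) * (exp (- (real (card V) * (\<tau> / 2))) * real (card ?P)) \<le> exp (real (card V) * (\<tau> / 2)) * exp (real (card V) * (\<tau> / 2))"
      by (intro mult_left_mono) auto
    then have "real (card ?P) \<le> exp (real (card V) * (\<tau> / 2)) * exp (real (card V) * (\<tau> / 2))"
      by (simp add: mult.assoc[symmetric] exp_minus)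
    also have "\<dots> = exp (\<tau> * real (card V))" unfolding exp_add[symmetric] by (simp add: algebra_simps)
    finally have "real (card ?P) \<le> exp (\<tau> * real (card V))" .
    then show "finite ?P \<and> real (card ?P) \<le> exp (\<tau> * real (card V))" using fP by simp
  qed
qed

section \<open>Continuous orbit equivalence\<close>

text \<open>Continuity into a discrete space without naming the codomain, so that functions can be
  combined by any operation.\<close>

definition locally_constant :: "'y topology \<Rightarrow> ('y \<Rightarrow> 'c) \<Rightarrow> bool" where
  "locally_constant Y f \<longleftrightarrow> (\<forall>a. openin Y {y \<in> topspace Y. f y = a})"

lemma locally_constant_discrete:
  assumes "continuous_map Y (discrete_topology A) f"
  shows "locally_constant Y f"
  unfolding locally_constant_def
proof
  fix a
  have "f y \<in> A" if "y \<in> topspace Y" for y using continuous_map_image_subset_topspace[OF assms] that by auto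
  then have "{y \<in> topspace Y. f y = a} = {y \<in> topspace Y. f y \<in> A \<inter> {a}}" by auto
  then show "openin Y {y \<in> topspace Y. f y = a}"
    using openin_continuous_map_preimage[OF assms, of "A \<inter> {a}"] by simp
qed

lemma locally_constant_compose:
  assumes "locally_constant Z f" "continuous_map Y Z h"
  shows "locally_constant Y (\<lambda>y. f (h y))"
  unfolding locally_constant_def
proof
  fix a
  have eq: "{y \<in> topspace Y. f (h y) = a} = {y \<in> topspace Y. h y \<in> {z \<in> topspace Z. f z = a}}"
    using continuous_map_image_subset_topspace[OF assms(2)] by auto
  show "openin Y {y \<in> topspace Y. f (h y) = a}"
    unfolding eq by (rule openin_continuous_map_preimage[OF assms(2)]) (use assms(1) in \<open>simp add: locally_constant_def\<close>)
qed

lemma locally_constant_pair: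
  assumes "locally_constant Y f" "locally_constant Y g"
  shows "locally_constant Y (\<lambda>y. F (f y) (g y))"
  unfolding locally_constant_def
proof
  fix a
  have "{y \<in> topspace Y. F (f y) (g y) = a} =
    \<Union>{U. \<exists>b c. F b c = a \<and> U = {y \<in> topspace Y. f y = b} \<inter> {y \<in> topspace Y. g y = c}}" by auto
  also have "openin Y \<dots>" using assms by (intro openin_Union) (auto simp: locally_constant_def)
  finally show "openin Y {y \<in> topspace Y. F (f y) (g y) = a}" .
qed

text \<open>The set where \<open>f\<close> and \<open>g\<close> differ is open. If nonempty it
  contains a point z with trivial stabilizer, and there (f z)^-1 (g z) fixes z.\<close>

lemma topologically_free_eq:
  assumes H: "group H" and act: "continuous_action H Y \<beta>" and free: "topologically_free H Y \<beta>"
    and lc: "locally_constant Y f" "locally_constant Y g"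
    and fg: "\<And>y. y \<in> topspace Y \<Longrightarrow> f y \<in> carrier H" "\<And>y. y \<in> topspace Y \<Longrightarrow> g y \<in> carrier H"
    and eq: "\<And>y. y \<in> topspace Y \<Longrightarrow> \<beta> (f y) y = \<beta> (g y) y" and y: "y \<in> topspace Y"
  shows "f y = g y"
proof (rule ccontr)
  assume neq: "f y \<noteq> g y"
  interpret H: group H by (rule H)
  interpret group_action H "topspace Y" \<beta> using act by (simp add: continuous_action_def)
  let ?U = "{y \<in> topspace Y. (f y \<noteq> g y) = True}" and ?D = "{y \<in> topspace Y. \<forall>s\<in>carrier H - {\<one>\<^bsub>H\<^esub>}. \<beta> s y \<noteq> y}"
  have "locally_constant Y (\<lambda>y. f y \<noteq> g y)" by (rule locally_constant_pair[OF lc])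
  then have U: "openin Y ?U" unfolding locally_constant_def by blast
  have cl: "y \<in> Y closure_of ?D" using free y by (simp add: topologically_free_def)
  have yU: "y \<in> ?U" using y neq by simp
  obtain z where z: "z \<in> ?D" "z \<in> ?U"
    using iffD1[OF in_closure_of cl, THEN conjunct2, rule_format, of ?U, OF conjI[OF yU U]] by (elim exE conjE)
  then have zc: "z \<in> topspace Y" "f z \<in> carrier H" "g z \<in> carrier H" using fg by auto
  let ?s = "inv\<^bsub>H\<^esub> (f z) \<otimes>\<^bsub>H\<^esub> g z"
  have "\<beta> ?s z = \<beta> (inv\<^bsub>H\<^esub> (f z)) (\<beta> (f z) z)" using zc eq[OF zc(1)] composition_rule[of z "inv\<^bsub>H\<^esub> (f z)" "g z"] by simp
  also have "\<dots> = z" using zc orbit_sym_aux[of "f z" z] by simp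
  finally have "?s = \<one>\<^bsub>H\<^esub>" using z(1) zc by auto
  then have "f z \<otimes>\<^bsub>H\<^esub> ?s = f z" using zc by simp
  then have "f z = g z" using zc by simp
  then show False using z by simp
qed

text \<open>The cocycle identities and \<open>\<kappa>_lam\<close> are the form in which topological
  freeness reaches the transfer of maps. The locale is one-sided: maps go from \<open>X\<close> to
  \<open>Y\<close>, and only the identity recovering t from \<open>lam\<close> is included.\<close>

locale coe = sofic_sequence + H: group H for H :: "('b, 'n) monoid_scheme" +
  fixes X :: "'x topology" and Y :: "'y topology" and dX :: "'x \<Rightarrow> 'x \<Rightarrow> real" and dY :: "'y \<Rightarrow> 'y \<Rightarrow> real"
    and \<alpha> :: "'a \<Rightarrow> 'x \<Rightarrow> 'x" and \<beta> :: "'b \<Rightarrow> 'y \<Rightarrow> 'y"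
    and \<Phi> :: "'x \<Rightarrow> 'y" and \<Psi> :: "'y \<Rightarrow> 'x" and \<kappa> :: "'a \<Rightarrow> 'x \<Rightarrow> 'b" and lam :: "'b \<Rightarrow> 'y \<Rightarrow> 'a"
  assumes X: "compact_space X" "compatible_metric X dX" and Y: "compact_space Y" "compatible_metric Y dY"
    and \<alpha>_cont: "g \<in> carrier G \<Longrightarrow> continuous_map X X (\<alpha> g)"
    and \<alpha>_one: "x \<in> topspace X \<Longrightarrow> \<alpha> \<one> x = x"
    and \<beta>_cont: "t \<in> carrier H \<Longrightarrow> continuous_map Y Y (\<beta> t)"
    and \<beta>_mult: "s \<in> carrier H \<Longrightarrow> t \<in> carrier H \<Longrightarrow> y \<in> topspace Y \<Longrightarrow> \<beta> (s \<otimes>\<^bsub>H\<^esub> t) y = \<beta> s (\<beta> t y)"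
    and \<beta>_one: "y \<in> topspace Y \<Longrightarrow> \<beta> \<one>\<^bsub>H\<^esub> y = y"
    and \<Phi>_cont: "continuous_map X Y \<Phi>" and \<Psi>_cont: "continuous_map Y X \<Psi>"
    and \<Psi>\<Phi> [simp]: "x \<in> topspace X \<Longrightarrow> \<Psi> (\<Phi> x) = x" and \<Phi>\<Psi> [simp]: "y \<in> topspace Y \<Longrightarrow> \<Phi> (\<Psi> y) = y"
    and \<kappa>_cont: "g \<in> carrier G \<Longrightarrow> continuous_map X (discrete_topology (carrier H)) (\<kappa> g)"
    and lam_cont: "t \<in> carrier H \<Longrightarrow> continuous_map Y (discrete_topology (carrier G)) (lam t)"
    and \<Phi>_equivariant: "g \<in> carrier G \<Longrightarrow> x \<in> topspace X \<Longrightarrow> \<Phi> (\<alpha> g x) = \<beta> (\<kappa> g x) (\<Phi> x)"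
    and \<Psi>_equivariant: "t \<in> carrier H \<Longrightarrow> y \<in> topspace Y \<Longrightarrow> \<Psi> (\<beta> t y) = \<alpha> (lam t y) (\<Psi> y)"
    and \<kappa>_cocycle: "g \<in> carrier G \<Longrightarrow> h \<in> carrier G \<Longrightarrow> x \<in> topspace X \<Longrightarrow> \<kappa> (g \<otimes> h) x = \<kappa> g (\<alpha> h x) \<otimes>\<^bsub>H\<^esub> \<kappa> h x"
    and lam_cocycle: "s \<in> carrier H \<Longrightarrow> t \<in> carrier H \<Longrightarrow> y \<in> topspace Y \<Longrightarrow> lam (s \<otimes>\<^bsub>H\<^esub> t) y = lam s (\<beta> t y) \<otimes> lam t y"
    and \<kappa>_lam: "t \<in> carrier H \<Longrightarrow> y \<in> topspace Y \<Longrightarrow> \<kappa> (lam t y) (\<Psi> y) = t"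
begin

lemma \<alpha>_in [simp]: "g \<in> carrier G \<Longrightarrow> x \<in> topspace X \<Longrightarrow> \<alpha> g x \<in> topspace X"
  using continuous_map_image_subset_topspace[OF \<alpha>_cont] by blast

lemma \<beta>_in [simp]: "t \<in> carrier H \<Longrightarrow> y \<in> topspace Y \<Longrightarrow> \<beta> t y \<in> topspace Y"
  using continuous_map_image_subset_topspace[OF \<beta>_cont] by blast

lemma \<Phi>_in [simp]: "x \<in> topspace X \<Longrightarrow> \<Phi> x \<in> topspace Y"
  using continuous_map_image_subset_topspace[OF \<Phi>_cont] by blast

lemma \<kappa>_in [simp]: "g \<in> carrier G \<Longrightarrow> x \<in> topspace X \<Longrightarrow> \<kappa> g x \<in> carrier H"
  using continuous_map_image_subset_topspace[OF \<kappa>_cont] by auto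

lemma lam_in [simp]: "t \<in> carrier H \<Longrightarrow> y \<in> topspace Y \<Longrightarrow> lam t y \<in> carrier G"
  using continuous_map_image_subset_topspace[OF lam_cont] by auto

lemma \<kappa>_one [simp]:
  assumes "x \<in> topspace X"
  shows "\<kappa> \<one> x = \<one>\<^bsub>H\<^esub>"
proof -
  have "\<kappa> \<one> x \<otimes>\<^bsub>H\<^esub> \<kappa> \<one> x = \<kappa> \<one> x"
    using \<kappa>_cocycle[of \<one> \<one> x] assms by (simp add: \<alpha>_one)
  then show ?thesis by (rule iffD1[OF H.l_cancel_one, rotated -1]) (use assms in simp_all)
qed

lemma lam_one: "y \<in> topspace Y \<Longrightarrow> lam \<one>\<^bsub>H\<^esub> y = \<one>"
proof -
  assume y: "y \<in> topspace Y"
  have "lam \<one>\<^bsub>H\<^esub> y \<otimes> lam \<one>\<^bsub>H\<^esub> y = lam \<one>\<^bsub>H\<^esub> y"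
    using lam_cocycle[of "\<one>\<^bsub>H\<^esub>" "\<one>\<^bsub>H\<^esub>" y] y by (simp add: \<beta>_one)
  then show ?thesis by (rule iffD1[OF l_cancel_one, rotated -1]) (use y in simp_all)
qed

lemma dX_nonneg [simp]: "0 \<le> dX x x'" and dY_nonneg [simp]: "0 \<le> dY y y'"
  using compatible_metric_space[OF X(2)] compatible_metric_space[OF Y(2)] by (simp_all add: Metric_space_def)

lemma dX_sym: "dX x x' = dX x' x"
  using compatible_metric_space[OF X(2)] by (simp add: Metric_space_def)

lemma dX_triangle: "x \<in> topspace X \<Longrightarrow> y \<in> topspace X \<Longrightarrow> z \<in> topspace X \<Longrightarrow> dX x z \<le> dX x y + dX y z"
  using compatible_metric_space[OF X(2)] by (simp add: Metric_space_def)

lemma \<Phi>_lam: "t \<in> carrier H \<Longrightarrow> x \<in> topspace X \<Longrightarrow> \<Phi> (\<alpha> (lam t (\<Phi> x)) x) = \<beta> t (\<Phi> x)"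
  using \<Psi>_equivariant[of t "\<Phi> x"] \<Phi>\<Psi>[of "\<beta> t (\<Phi> x)"] by simp

lemma lam_inj: "s \<in> carrier H \<Longrightarrow> t \<in> carrier H \<Longrightarrow> y \<in> topspace Y \<Longrightarrow> lam s y = lam t y \<Longrightarrow> s = t"
  by (metis \<kappa>_lam)

end

section \<open>Two finite tools: extending an injection to a permutation, and the pigeonhole
  principle\<close>

lemma ex_permutation_extending:
  assumes V: "finite V" and A: "A \<subseteq> V" and f: "inj_on f A" "f ` A \<subseteq> V"
  obtains p where "p permutes V" "\<And>v. v \<in> A \<Longrightarrow> p v = f v"
proof -
  have fA: "finite A" by (rule finite_subset[OF A V])
  have "card (V - A) = card (V - f ` A)"
    using A f(2) fA V card_image[OF f(1)] by (simp add: card_Diff_subset)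
  then obtain h where h: "bij_betw h (V - A) (V - f ` A)"
    using finite_same_card_bij[of "V - A" "V - f ` A"] V by auto
  define p where "p v = (if v \<in> A then f v else if v \<in> V then h v else v)" for v
  have "bij_betw p V V"
  proof -
    have "bij_betw p A (f ` A)" using f(1) by (simp add: bij_betw_def p_def inj_on_def)
    moreover have "bij_betw p (V - A) (V - f ` A)"
      using h by (subst bij_betw_cong[of _ _ h]) (auto simp: p_def)
    ultimately have "bij_betw p (A \<union> (V - A)) (f ` A \<union> (V - f ` A))" by (rule bij_betw_combine) auto
    moreover have "A \<union> (V - A) = V" "f ` A \<union> (V - f ` A) = V" using A f(2) by auto
    ultimately show ?thesis by simp
  qed
  then have "p permutes V" by (rule bij_imp_permutes) (use A in \<open>auto simp: p_def\<close>)
  then show thesis by (rule that) (simp add: p_def)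
qed

lemma ex_large_fibre:
  assumes S: "finite S" "S \<noteq> {}" and f: "f ` S \<subseteq> T" "finite T"
  obtains t where "t \<in> T" "{x \<in> S. f x = t} \<noteq> {}" "card S \<le> card T * card {x \<in> S. f x = t}"
proof -
  define m where "m = Max ((\<lambda>t. card {x \<in> S. f x = t}) ` T)"
  have T: "T \<noteq> {}" using S f by auto
  have "m \<in> (\<lambda>t. card {x \<in> S. f x = t}) ` T" unfolding m_def using f T by (intro Max_in) auto
  then obtain t where t: "t \<in> T" "m = card {x \<in> S. f x = t}" by auto
  have "S = (\<Union>t\<in>T. {x \<in> S. f x = t})" using f by auto
  then have "card S \<le> (\<Sum>t\<in>T. card {x \<in> S. f x = t})" using card_UN_le[OF f(2), of "\<lambda>t. {x \<in> S. f x = t}"] by simp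
  also have "\<dots> \<le> (\<Sum>t\<in>T. m)"
  proof (rule sum_mono)
    fix t assume "t \<in> T"
    then show "card {x \<in> S. f x = t} \<le> m" unfolding m_def using f(2) by (intro Max_ge finite_imageI imageI)
  qed
  finally have *: "card S \<le> card T * m" by simp
  moreover have "card S \<noteq> 0" using S by simp
  ultimately have "m \<noteq> 0" by (metis le_zero_eq mult_0_right)
  then have "{x \<in> S. f x = t} \<noteq> {}" using t(2) by (metis card.empty)
  then show thesis using that[OF t(1)] * t(2) by simp
qed

section \<open>The group elements and exceptional points that a finite subset of \<open>H\<close>
  brings in\<close>

context coe
begin

text \<open>Products are included because the approximation of \<open>H\<close> is compared with its
  own products on \<open>L\<close>.\<close>

definition doubled :: "'b set \<Rightarrow> 'b set" where
  "doubled L = L \<union> (\<lambda>(s, t). s \<otimes>\<^bsub>H\<^esub> t) ` (L \<times> L)"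

text \<open>All elements of \<open>G\<close> by which the approximation of \<open>H\<close> can move
  a point; inverses serve to show that these moves are injective.\<close>

definition moves :: "'b set \<Rightarrow> 'a set" where
  "moves L = (\<Union>t\<in>doubled L \<union> m_inv H ` doubled L. lam t ` topspace Y)"

text \<open>If a point over the base point w via s is moved by r to a point over w' via s', then w'
  is the translate of w by s'^-1 r s.\<close>

definition returns :: "'a set \<Rightarrow> 'b set \<Rightarrow> 'a set" where
  "returns S L = (\<lambda>(s', r, s). inv s' \<otimes> (r \<otimes> s)) ` (S \<times> moves L \<times> S)"

lemma doubled_closed: "L \<subseteq> carrier H \<Longrightarrow> doubled L \<subseteq> carrier H"
  by (auto simp: doubled_def)

lemma finite_doubled: "finite L \<Longrightarrow> finite (doubled L)"
  by (simp add: doubled_def)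

lemma moves_closed: "L \<subseteq> carrier H \<Longrightarrow> moves L \<subseteq> carrier G"
  using doubled_closed[of L] by (auto simp: moves_def)

lemma finite_moves:
  assumes "finite L" "L \<subseteq> carrier H"
  shows "finite (moves L)"
  unfolding moves_def
proof (rule finite_UN_I)
  show "finite (doubled L \<union> m_inv H ` doubled L)" using finite_doubled[OF assms(1)] by simp
  fix t assume "t \<in> doubled L \<union> m_inv H ` doubled L"
  then have "t \<in> carrier H" using doubled_closed[OF assms(2)] by auto
  then show "finite (lam t ` topspace Y)" by (rule compact_discrete_image_finite(1)[OF Y(1) lam_cont])
qed

lemma returns_closed: "L \<subseteq> carrier H \<Longrightarrow> S \<subseteq> carrier G \<Longrightarrow> returns S L \<subseteq> carrier G"
  using moves_closed[of L] by (auto simp: returns_def subset_iff)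

lemma finite_returns: "finite L \<Longrightarrow> L \<subseteq> carrier H \<Longrightarrow> finite S \<Longrightarrow> finite (returns S L)"
  using finite_moves[of L] by (simp add: returns_def)

definition defect :: "nat \<Rightarrow> 'a set \<Rightarrow> real \<Rightarrow> (nat \<Rightarrow> 'x) \<Rightarrow> nat set" where
  "defect k F \<rho> \<phi> = {v \<in> V k. \<exists>g\<in>F. \<rho> \<le> dX (\<phi> (\<sigma> k g v)) (\<alpha> g (\<phi> v))}"

lemma card_defect_le:
  assumes F: "finite F" and \<phi>: "\<phi> \<in> sofic_maps X dX \<alpha> F \<delta> (V k) (\<sigma> k)"
    and \<delta>: "\<delta>\<^sup>2 * (real (card F) + 1) \<le> \<theta> * \<rho>\<^sup>2" and \<rho>: "0 < \<rho>"
  shows "real (card (defect k F \<rho> \<phi>)) \<le> \<theta> * sz k"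
proof -
  let ?D = "\<lambda>g. {v \<in> V k. \<rho> \<le> dX ((\<phi> \<circ> \<sigma> k g) v) ((\<alpha> g \<circ> \<phi>) v)}"
  have D: "real (card (?D g)) \<le> (\<delta> / \<rho>)\<^sup>2 * sz k" if "g \<in> F" for g
    by (rule card_far_le[of "V k" dX "\<phi> \<circ> \<sigma> k g" "\<alpha> g \<circ> \<phi>" \<delta> \<rho>]) (use \<rho> that \<phi> in \<open>simp_all add: sofic_maps_def\<close>)
  have eq: "defect k F \<rho> \<phi> = (\<Union>g\<in>F. ?D g)" by (auto simp: defect_def)
  have "card (defect k F \<rho> \<phi>) \<le> (\<Sum>g\<in>F. card (?D g))" unfolding eq by (rule card_UN_le[OF F])
  then have "real (card (defect k F \<rho> \<phi>)) \<le> (\<Sum>g\<in>F. real (card (?D g)))" unfolding of_nat_sum[symmetric] of_nat_le_iff .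
  also have "\<dots> \<le> (\<Sum>g\<in>F. (\<delta> / \<rho>)\<^sup>2 * sz k)" by (rule sum_mono[OF D])
  also have "\<dots> = (real (card F) * (\<delta> / \<rho>)\<^sup>2) * sz k" by simp
  also have "\<dots> \<le> \<theta> * sz k"
  proof (rule mult_right_mono)
    have "real (card F) * \<delta>\<^sup>2 \<le> \<delta>\<^sup>2 * (real (card F) + 1)" by (simp add: algebra_simps)
    then have "real (card F) * \<delta>\<^sup>2 \<le> \<theta> * \<rho>\<^sup>2" using \<delta> by linarith
    then show "real (card F) * (\<delta> / \<rho>)\<^sup>2 \<le> \<theta>" using \<rho> by (simp add: power_divide divide_le_eq)
  qed simp
  finally show ?thesis .
qed

end

text \<open>A single model with the data that sparse connectivity provides for it. \<open>F\<close>
  contains all elements that occur in the computations, and \<rho> is a distance below which the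
  relevant cocycle values do not change.\<close>

locale coe_step = coe G \<Sigma> H X Y dX dY \<alpha> \<beta> \<Phi> \<Psi> \<kappa> lam
  for G :: "('a, 'm) monoid_scheme" (structure) and \<Sigma> and H :: "('b, 'n) monoid_scheme"
    and X :: "'x topology" and Y :: "'y topology" and dX dY \<alpha> \<beta> \<Phi> \<Psi> \<kappa> lam +
  fixes k C :: nat and S F R :: "'a set" and L :: "'b set" and \<rho> :: real and W B :: "nat set" and E :: "('a \<times> nat) set"
  assumes S: "S \<subseteq> carrier G" "\<one> \<in> S" "finite S" and L: "L \<subseteq> carrier H" "finite L"
    and F: "F \<subseteq> carrier G" "word_ball (R \<union> m_inv G ` R) C \<subseteq> F" "R \<union> m_inv G ` R \<subseteq> F"
      "S \<subseteq> F" "returns S L \<subseteq> F" "moves L \<subseteq> F" "m_inv G ` moves L \<subseteq> F"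
    and R: "R \<subseteq> carrier G"
    and \<rho>\<kappa>: "\<And>g x x'. g \<in> F \<Longrightarrow> x \<in> topspace X \<Longrightarrow> x' \<in> topspace X \<Longrightarrow> dX x x' < \<rho> \<Longrightarrow> \<kappa> g x = \<kappa> g x'"
    and \<rho>lam: "\<And>t x x'. t \<in> doubled L \<union> m_inv H ` doubled L \<Longrightarrow> x \<in> topspace X \<Longrightarrow> x' \<in> topspace X \<Longrightarrow>
      dX x x' < \<rho> \<Longrightarrow> lam t (\<Phi> x) = lam t (\<Phi> x')"
    and W: "W \<subseteq> V k" and E: "E \<subseteq> R \<times> V k" and B: "B \<subseteq> V k"
    and cover: "\<And>v. v \<in> V k - B \<Longrightarrow> \<exists>s\<in>S. \<exists>w\<in>W. v = \<sigma> k s w"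
    and linked: "\<And>w t. w \<in> W - B \<Longrightarrow> t \<in> returns S L \<Longrightarrow> \<sigma> k t w \<in> W \<Longrightarrow> (w, \<sigma> k t w) \<in> link (\<sigma> k) E ^^ C"
begin

lemma one_F: "\<one> \<in> F"
  using F(4) S(2) by blast

lemma F_carrier: "g \<in> F \<Longrightarrow> g \<in> carrier G"
  using F(1) by blast

definition N :: "(nat \<Rightarrow> 'x) \<Rightarrow> nat set" where
  "N \<phi> = unfaithful k F \<union> defect k F \<rho> \<phi> \<union> B"

text \<open>Enlarged by \<open>S\<close> so that a point outside has its base point outside
  \<open>A\<close>.\<close>

definition halo :: "nat set \<Rightarrow> nat set" where
  "halo A = A \<union> (\<Union>s\<in>S. \<sigma> k s ` A)"

lemma N_subset: "N \<phi> \<subseteq> V k"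
  using B by (auto simp: N_def unfaithful_def defect_def)

lemma halo_subset: "A \<subseteq> V k \<Longrightarrow> halo A \<subseteq> V k"
  using S(1) by (auto simp: halo_def subset_iff)

lemma card_halo_le:
  assumes "finite A"
  shows "card (halo A) \<le> (1 + card S) * card A"
proof -
  have "card (halo A) \<le> card A + card (\<Union>s\<in>S. \<sigma> k s ` A)" unfolding halo_def by (rule card_Un_le)
  also have "card (\<Union>s\<in>S. \<sigma> k s ` A) \<le> (\<Sum>s\<in>S. card (\<sigma> k s ` A))" by (rule card_UN_le[OF S(3)])
  also have "\<dots> \<le> (\<Sum>s\<in>S. card A)" by (rule sum_mono) (rule card_image_le[OF assms])
  finally show ?thesis by simp
qed

lemma faithful_off_N: "v \<in> V k \<Longrightarrow> v \<notin> N \<phi> \<Longrightarrow> faithful_at k F v"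
  by (rule faithfulI) (simp_all add: N_def)

lemma near_off_N: "v \<in> V k \<Longrightarrow> v \<notin> N \<phi> \<Longrightarrow> g \<in> F \<Longrightarrow> dX (\<phi> (\<sigma> k g v)) (\<alpha> g (\<phi> v)) < \<rho>"
  by (auto simp: N_def defect_def not_le)

lemma map_in: "\<phi> \<in> V k \<rightarrow>\<^sub>E topspace X \<Longrightarrow> v \<in> V k \<Longrightarrow> \<phi> v \<in> topspace X"
  by (rule PiE_mem)

text \<open>There \<phi> is equivariant up to \<rho>, and the cocycle does not distinguish points
  this close.\<close>

lemma \<kappa>_off_N:
  assumes "\<phi> \<in> V k \<rightarrow>\<^sub>E topspace X" "v \<in> V k" "v \<notin> N \<phi>" "g \<in> F" "h \<in> F"
  shows "\<kappa> h (\<alpha> g (\<phi> v)) = \<kappa> h (\<phi> (\<sigma> k g v))"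
proof (rule \<rho>\<kappa>[OF assms(5), symmetric])
  show "\<phi> (\<sigma> k g v) \<in> topspace X" "\<alpha> g (\<phi> v) \<in> topspace X"
    using map_in[OF assms(1)] assms(2) F_carrier[OF assms(4)] by simp_all
qed (rule near_off_N[OF assms(2-4)])

definition agree :: "(nat \<Rightarrow> 'x) \<Rightarrow> (nat \<Rightarrow> 'x) \<Rightarrow> bool" where
  "agree \<phi> \<phi>\<^sub>0 \<longleftrightarrow> (\<forall>(g, v)\<in>E. \<kappa> g (\<phi> v) = \<kappa> g (\<phi>\<^sub>0 v))"

lemma agreeD: "agree \<phi> \<phi>\<^sub>0 \<Longrightarrow> (g, v) \<in> E \<Longrightarrow> \<kappa> g (\<phi> v) = \<kappa> g (\<phi>\<^sub>0 v)"
  unfolding agree_def by blast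

text \<open>The cocycle of the composite move at w is the product of the values read along the path,
  and each of these is either recorded on \<open>E\<close> or the inverse of a recorded one. Only w
  has to be unexceptional, because the intermediate points are translates of w by elements of
  \<open>F\<close>.\<close>

lemma path_agree:
  assumes \<phi>: "\<phi> \<in> V k \<rightarrow>\<^sub>E topspace X" "\<phi>\<^sub>0 \<in> V k \<rightarrow>\<^sub>E topspace X" "agree \<phi> \<phi>\<^sub>0"
    and w: "w \<in> V k" "w \<notin> N \<phi>" "w \<notin> N \<phi>\<^sub>0"
  shows "i \<le> C \<Longrightarrow> (w, v) \<in> link (\<sigma> k) E ^^ i \<Longrightarrow>
    \<exists>p\<in>word_ball (R \<union> m_inv G ` R) i. v = \<sigma> k p w \<and> \<kappa> p (\<phi> w) = \<kappa> p (\<phi>\<^sub>0 w)"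
proof (induction i arbitrary: v)
  let ?Q = "R \<union> m_inv G ` R"
  have Q: "?Q \<subseteq> carrier G" using R by auto
  have fw: "faithful_at k F w" by (rule faithful_off_N[OF w(1,2)])
  have x: "\<phi> w \<in> topspace X" "\<phi>\<^sub>0 w \<in> topspace X" using map_in[OF \<phi>(1) w(1)] map_in[OF \<phi>(2) w(1)] .
  {
    case 0
    then have "v = \<sigma> k \<one> w" using faithful_one[OF fw one_F] by simp
    then show ?case using x by (intro bexI[OF _ one_in_word_ball]) simp
  next
    case (Suc i)
    have ball: "word_ball ?Q j \<subseteq> F" if "j \<le> C" for j using word_ball_mono[OF that] F(2) by (rule subset_trans)
    obtain u where u: "(w, u) \<in> link (\<sigma> k) E ^^ i" "(u, v) \<in> link (\<sigma> k) E" using Suc.prems(2) by auto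
    obtain p where p: "p \<in> word_ball ?Q i" "u = \<sigma> k p w" "\<kappa> p (\<phi> w) = \<kappa> p (\<phi>\<^sub>0 w)"
      using Suc.IH[OF Suc_leD[OF Suc.prems(1)] u(1)] by (elim bexE conjE)
    have pF: "p \<in> F" using ball[of i] p(1) Suc.prems(1) by auto
    have pc: "p \<in> carrier G" by (rule F_carrier[OF pF])
    have Suc_ball: "q \<otimes> p \<in> word_ball ?Q (Suc i)" if "q \<in> ?Q" for q
      using word_ball_mult[OF Q generator_in_word_ball[OF Q that] p(1)] by simp
    consider "v = u" | g where "(g, u) \<in> E" "v = \<sigma> k g u" | g where "(g, v) \<in> E" "u = \<sigma> k g v"
      using u(2) by (auto simp: link_def edge_rel_def)
    then show ?case
    proof cases
      case 1
      have "p \<in> word_ball ?Q (Suc i)" by (rule subsetD[OF word_ball_mono p(1)]) simp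
      then show ?thesis using p(2,3) 1 by (intro bexI[of _ p]) simp_all
    next
      case 2
      have gQ: "g \<in> ?Q" and gF: "g \<in> F" using 2(1) E F(3) by auto
      have gc: "g \<in> carrier G" by (rule F_carrier[OF gF])
      have "v = \<sigma> k (g \<otimes> p) w" using faithful_mult[OF fw gF pF] 2(2) p(2) by simp
      moreover have "\<kappa> (g \<otimes> p) (\<phi> w) = \<kappa> (g \<otimes> p) (\<phi>\<^sub>0 w)"
        using \<kappa>_cocycle[OF gc pc x(1)] \<kappa>_cocycle[OF gc pc x(2)] \<kappa>_off_N[OF \<phi>(1) w(1,2) pF gF]
          \<kappa>_off_N[OF \<phi>(2) w(1,3) pF gF] agreeD[OF \<phi>(3) 2(1)] p(2,3) by simp
      ultimately show ?thesis by (intro bexI[OF _ Suc_ball[OF gQ]] conjI)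
    next
      \<comment> \<open>An edge traversed backwards: the recorded value is a left factor of the
        value at \<open>p\<close> and can be cancelled.\<close>
      case 3
      have gR: "g \<in> R" "v \<in> V k" using 3(1) E by auto
      have gQ: "inv g \<in> ?Q" and gF: "g \<in> F" using gR F(3) by auto
      have gc: "g \<in> carrier G" by (rule F_carrier[OF gF])
      let ?q = "inv g \<otimes> p"
      have qb: "?q \<in> word_ball ?Q (Suc i)" by (rule Suc_ball[OF gQ])
      have qF: "?q \<in> F" by (rule subsetD[OF ball[OF Suc.prems(1)] qb])
      have qc: "?q \<in> carrier G" by (rule F_carrier[OF qF])
      have gq: "g \<otimes> ?q = p" using gc pc by simp
      have "\<sigma> k g (\<sigma> k ?q w) = \<sigma> k g v" using faithful_mult[OF fw gF qF] 3(2) p(2) by (simp only: gq)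
      then have v: "v = \<sigma> k ?q w" using \<sigma>_inj[OF gc] by simp
      have e: "\<kappa> g (\<alpha> ?q (\<phi> w)) = \<kappa> g (\<alpha> ?q (\<phi>\<^sub>0 w))"
        unfolding \<kappa>_off_N[OF \<phi>(1) w(1,2) qF gF] \<kappa>_off_N[OF \<phi>(2) w(1,3) qF gF] v[symmetric]
        by (rule agreeD[OF \<phi>(3) 3(1)])
      have e2: "\<kappa> g (\<alpha> ?q (\<phi> w)) \<otimes>\<^bsub>H\<^esub> \<kappa> ?q (\<phi> w) = \<kappa> g (\<alpha> ?q (\<phi> w)) \<otimes>\<^bsub>H\<^esub> \<kappa> ?q (\<phi>\<^sub>0 w)"
        using \<kappa>_cocycle[OF gc qc x(1)] \<kappa>_cocycle[OF gc qc x(2)] p(3) unfolding gq e by simp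
      have c: "\<kappa> g (\<alpha> ?q (\<phi> w)) \<in> carrier H" "\<kappa> ?q (\<phi> w) \<in> carrier H" "\<kappa> ?q (\<phi>\<^sub>0 w) \<in> carrier H"
        using \<kappa>_in[OF gc \<alpha>_in[OF qc x(1)]] \<kappa>_in[OF qc x(1)] \<kappa>_in[OF qc x(2)] .
      have "\<kappa> ?q (\<phi> w) = \<kappa> ?q (\<phi>\<^sub>0 w)"
        using H.inv_solve_left'[OF c(2) c(1) H.m_closed[OF c(1,3)]] e2 c
        by (metis H.mult_inv_cancel(2))
      then show ?thesis using v by (intro bexI[OF _ qb] conjI)
    qed
  }
qed

text \<open>The connecting path realizes some word with the same endpoint, and faithfulness at w
  identifies this word with \<open>g\<close>.\<close>

lemma return_agree:
  assumes \<phi>: "\<phi> \<in> V k \<rightarrow>\<^sub>E topspace X" "\<phi>\<^sub>0 \<in> V k \<rightarrow>\<^sub>E topspace X" "agree \<phi> \<phi>\<^sub>0"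
    and w: "w \<in> W" "w \<notin> N \<phi>" "w \<notin> N \<phi>\<^sub>0" and g: "g \<in> returns S L" "\<sigma> k g w \<in> W"
  shows "\<kappa> g (\<phi> w) = \<kappa> g (\<phi>\<^sub>0 w)"
proof -
  have wV: "w \<in> V k" using w(1) W by blast
  have "w \<in> W - B" using w(1,2) by (simp add: N_def)
  then obtain p where p: "p \<in> word_ball (R \<union> m_inv G ` R) C" "\<sigma> k g w = \<sigma> k p w" "\<kappa> p (\<phi> w) = \<kappa> p (\<phi>\<^sub>0 w)"
    using path_agree[OF \<phi> wV w(2,3) order_refl linked[OF _ g]] by blast
  have "g = p" by (rule faithful_inj[OF faithful_off_N[OF wV w(2)] _ _ p(2)]) (use p(1) g(1) F in blast)+
  then show ?thesis using p(3) by simp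
qed

text \<open>Base points represent themselves, which makes \<open>transfer\<close> equal to \<Phi>
  \<circ> \<phi> on unexceptional ones. Points that are not covered get the default with the unit,
  so that the first component always lies in \<open>S\<close>.\<close>

definition pick :: "nat \<Rightarrow> 'a \<times> nat" where
  "pick u = (if (u \<in> W \<and> \<sigma> k \<one> u = u) \<or> \<not> (\<exists>s\<in>S. \<exists>w\<in>W. u = \<sigma> k s w) then (\<one>, u)
     else (SOME q. fst q \<in> S \<and> snd q \<in> W \<and> u = \<sigma> k (fst q) (snd q)))"

lemma pick_some:
  assumes "\<not> ((u \<in> W \<and> \<sigma> k \<one> u = u) \<or> \<not> (\<exists>s\<in>S. \<exists>w\<in>W. u = \<sigma> k s w))"
  shows "fst (pick u) \<in> S \<and> snd (pick u) \<in> W \<and> u = \<sigma> k (fst (pick u)) (snd (pick u))"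
proof -
  obtain s w where "s \<in> S" "w \<in> W" "u = \<sigma> k s w" using assms by blast
  then have ex: "\<exists>q. fst q \<in> S \<and> snd q \<in> W \<and> u = \<sigma> k (fst q) (snd q)" by (intro exI[of _ "(s, w)"]) simp
  have p: "pick u = (SOME q. fst q \<in> S \<and> snd q \<in> W \<and> u = \<sigma> k (fst q) (snd q))" using assms by (simp only: pick_def if_False)
  show ?thesis unfolding p by (rule someI_ex[OF ex])
qed

lemma pick_in:
  assumes "u \<in> V k"
  shows "fst (pick u) \<in> S" "snd (pick u) \<in> V k"
proof -
  have "fst (pick u) \<in> S \<and> snd (pick u) \<in> V k"
  proof (cases "(u \<in> W \<and> \<sigma> k \<one> u = u) \<or> \<not> (\<exists>s\<in>S. \<exists>w\<in>W. u = \<sigma> k s w)")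
    case True
    then have "pick u = (\<one>, u)" by (simp only: pick_def if_True)
    then show ?thesis using S(2) assms by simp
  qed (use pick_some[of u] W in blast)
  then show "fst (pick u) \<in> S" "snd (pick u) \<in> V k" by simp_all
qed

lemma pick_covered:
  assumes "u \<in> V k" "u \<notin> B"
  shows "snd (pick u) \<in> W" "u = \<sigma> k (fst (pick u)) (snd (pick u))"
proof -
  have "snd (pick u) \<in> W \<and> u = \<sigma> k (fst (pick u)) (snd (pick u))"
  proof (cases "u \<in> W \<and> \<sigma> k \<one> u = u")
    case True
    then have "pick u = (\<one>, u)" by (simp add: pick_def)
    then show ?thesis using True by simp
  next
    case False
    then show ?thesis using pick_some[of u] cover[of u] assms by blast
  qed
  then show "snd (pick u) \<in> W" "u = \<sigma> k (fst (pick u)) (snd (pick u))" by (rule conjunct1, rule conjunct2)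
qed

lemma pick_W: "w \<in> W \<Longrightarrow> \<sigma> k \<one> w = w \<Longrightarrow> pick w = (\<one>, w)"
  by (simp add: pick_def)

lemma pick_off_halo:
  assumes "u \<in> V k" "u \<notin> halo A" "B \<subseteq> A"
  shows "snd (pick u) \<notin> A"
proof
  assume "snd (pick u) \<in> A"
  then have "\<sigma> k (fst (pick u)) (snd (pick u)) \<in> halo A"
    using pick_in(1)[OF assms(1)] by (auto simp: halo_def)
  moreover have "u \<notin> B" using assms(2,3) by (auto simp: halo_def)
  ultimately show False using pick_covered(2)[OF assms(1)] assms(2) by simp
qed

text \<open>The element \<open>t\<close> moves \<open>v\<close> as the element \<open>lam t\<close> of \<open>G\<close> read off at \<open>v\<close>; as \<open>lam\<close> is a cocycle and
  injective in \<open>t\<close>, this is almost multiplicative and almost free.\<close>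

definition jump :: "(nat \<Rightarrow> 'x) \<Rightarrow> 'b \<Rightarrow> nat \<Rightarrow> nat" where
  "jump \<phi>\<^sub>0 t v = \<sigma> k (lam t (\<Phi> (\<phi>\<^sub>0 v))) v"

lemma lam_moves: "t \<in> doubled L \<union> m_inv H ` doubled L \<Longrightarrow> y \<in> topspace Y \<Longrightarrow> lam t y \<in> moves L"
  unfolding moves_def by blast

lemma doubled_H: "t \<in> doubled L \<union> m_inv H ` doubled L \<Longrightarrow> t \<in> carrier H"
  using doubled_closed[OF L(1)] by auto

text \<open>By local constancy \<open>lam\<close> may be evaluated at the exact translate of
  \<open>\<phi>\<^sub>0 v\<close>, whose image under \<Phi> is the translate by t.\<close>

lemma jump_lam:
  assumes \<phi>: "\<phi>\<^sub>0 \<in> V k \<rightarrow>\<^sub>E topspace X" and v: "v \<in> V k" "v \<notin> N \<phi>\<^sub>0"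
    and t: "t \<in> doubled L \<union> m_inv H ` doubled L" "t' \<in> doubled L \<union> m_inv H ` doubled L"
  shows "lam t' (\<Phi> (\<phi>\<^sub>0 (jump \<phi>\<^sub>0 t v))) = lam t' (\<beta> t (\<Phi> (\<phi>\<^sub>0 v)))"
proof -
  have x: "\<phi>\<^sub>0 v \<in> topspace X" by (rule map_in[OF \<phi> v(1)])
  let ?r = "lam t (\<Phi> (\<phi>\<^sub>0 v))"
  have r: "?r \<in> F" using lam_moves[OF t(1) \<Phi>_in[OF x]] F(6) by blast
  have "lam t' (\<Phi> (\<phi>\<^sub>0 (\<sigma> k ?r v))) = lam t' (\<Phi> (\<alpha> ?r (\<phi>\<^sub>0 v)))"
    by (rule \<rho>lam[OF t(2) _ _ near_off_N[OF v r]]) (use map_in[OF \<phi>] v(1) x F_carrier[OF r] in simp_all)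
  then show ?thesis unfolding jump_def \<Phi>_lam[OF doubled_H[OF t(1)] x] .
qed

lemma jump_mult:
  assumes \<phi>: "\<phi>\<^sub>0 \<in> V k \<rightarrow>\<^sub>E topspace X" and v: "v \<in> V k" "v \<notin> N \<phi>\<^sub>0"
    and t: "t \<in> doubled L \<union> m_inv H ` doubled L" "t' \<in> doubled L \<union> m_inv H ` doubled L"
  shows "jump \<phi>\<^sub>0 t' (jump \<phi>\<^sub>0 t v) = \<sigma> k (lam (t' \<otimes>\<^bsub>H\<^esub> t) (\<Phi> (\<phi>\<^sub>0 v))) v"
proof -
  have y: "\<Phi> (\<phi>\<^sub>0 v) \<in> topspace Y" by (rule \<Phi>_in[OF map_in[OF \<phi> v(1)]])
  have r: "lam t (\<Phi> (\<phi>\<^sub>0 v)) \<in> F" "lam t' (\<beta> t (\<Phi> (\<phi>\<^sub>0 v))) \<in> F"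
    using lam_moves[OF t(1) y] lam_moves[OF t(2) \<beta>_in[OF doubled_H[OF t(1)] y]] F(6) by blast+
  have "jump \<phi>\<^sub>0 t' (jump \<phi>\<^sub>0 t v) = \<sigma> k (lam t' (\<beta> t (\<Phi> (\<phi>\<^sub>0 v)))) (\<sigma> k (lam t (\<Phi> (\<phi>\<^sub>0 v))) v)"
    using jump_lam[OF \<phi> v t] by (simp only: jump_def)
  also have "\<dots> = \<sigma> k (lam (t' \<otimes>\<^bsub>H\<^esub> t) (\<Phi> (\<phi>\<^sub>0 v))) v"
    unfolding faithful_mult[OF faithful_off_N[OF v] r(2,1)] lam_cocycle[OF doubled_H[OF t(2)] doubled_H[OF t(1)] y] ..
  finally show ?thesis .
qed

text \<open>Off the exceptional set the jump of t is undone by the jump of its inverse, so it is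
  injective there and extends arbitrarily.\<close>

lemma jump_permutation:
  assumes \<phi>: "\<phi>\<^sub>0 \<in> V k \<rightarrow>\<^sub>E topspace X" and t: "t \<in> doubled L"
  obtains p where "p permutes V k" "\<And>v. v \<in> V k - N \<phi>\<^sub>0 \<Longrightarrow> p v = jump \<phi>\<^sub>0 t v"
proof -
  have tt: "t \<in> doubled L \<union> m_inv H ` doubled L" "inv\<^bsub>H\<^esub> t \<in> doubled L \<union> m_inv H ` doubled L" using t by auto
  have tH: "t \<in> carrier H" by (rule doubled_H[OF tt(1)])
  have undo: "jump \<phi>\<^sub>0 (inv\<^bsub>H\<^esub> t) (jump \<phi>\<^sub>0 t v) = v" if v: "v \<in> V k - N \<phi>\<^sub>0" for v
  proof -
    have vV: "v \<in> V k" "v \<notin> N \<phi>\<^sub>0" using v by auto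
    have "jump \<phi>\<^sub>0 (inv\<^bsub>H\<^esub> t) (jump \<phi>\<^sub>0 t v) = \<sigma> k \<one> v"
      using jump_mult[OF \<phi> vV tt] tH lam_one[OF \<Phi>_in[OF map_in[OF \<phi> vV(1)]]] by simp
    then show ?thesis using faithful_one[OF faithful_off_N[OF vV] one_F] by simp
  qed
  have inj: "inj_on (jump \<phi>\<^sub>0 t) (V k - N \<phi>\<^sub>0)" by (rule inj_on_inverseI[of _ "jump \<phi>\<^sub>0 (inv\<^bsub>H\<^esub> t)"]) (rule undo)
  have im: "jump \<phi>\<^sub>0 t ` (V k - N \<phi>\<^sub>0) \<subseteq> V k"
  proof (rule image_subsetI)
    fix v assume "v \<in> V k - N \<phi>\<^sub>0"
    then have v: "v \<in> V k" by simp
    show "jump \<phi>\<^sub>0 t v \<in> V k" unfolding jump_def \<sigma>_in[OF lam_in[OF tH \<Phi>_in[OF map_in[OF \<phi> v]]]] by (rule v)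
  qed
  show thesis by (rule ex_permutation_extending[OF finite_V Diff_subset inj im]) (rule that)
qed

text \<open>Every element of \<open>H\<close> must be sent to a permutation; goodness on
  \<open>L\<close> depends only on \<open>doubled L\<close>, so the identity serves
  elsewhere.\<close>

definition induced :: "(nat \<Rightarrow> 'x) \<Rightarrow> 'b \<Rightarrow> nat \<Rightarrow> nat" where
  "induced \<phi>\<^sub>0 t = (if t \<in> doubled L
     then SOME p. p permutes V k \<and> (\<forall>v\<in>V k - N \<phi>\<^sub>0. p v = jump \<phi>\<^sub>0 t v) else id)"

lemma induced_facts:
  assumes \<phi>: "\<phi>\<^sub>0 \<in> V k \<rightarrow>\<^sub>E topspace X"
  shows "induced \<phi>\<^sub>0 t permutes V k" "t \<in> doubled L \<Longrightarrow> v \<in> V k \<Longrightarrow> v \<notin> N \<phi>\<^sub>0 \<Longrightarrow> induced \<phi>\<^sub>0 t v = jump \<phi>\<^sub>0 t v"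
proof -
  have *: "induced \<phi>\<^sub>0 t permutes V k \<and> (\<forall>v\<in>V k - N \<phi>\<^sub>0. induced \<phi>\<^sub>0 t v = jump \<phi>\<^sub>0 t v)" if t: "t \<in> doubled L"
  proof -
    obtain p where "p permutes V k" "\<And>v. v \<in> V k - N \<phi>\<^sub>0 \<Longrightarrow> p v = jump \<phi>\<^sub>0 t v" by (rule jump_permutation[OF \<phi> t]) (rule that)
    then have "\<exists>p. p permutes V k \<and> (\<forall>v\<in>V k - N \<phi>\<^sub>0. p v = jump \<phi>\<^sub>0 t v)" by (intro exI[of _ p] conjI ballI)
    then have ex: "\<exists>p. p permutes V k \<and> (\<forall>v\<in>V k - N \<phi>\<^sub>0. p v = jump \<phi>\<^sub>0 t v)" .
    have "induced \<phi>\<^sub>0 t = (SOME p. p permutes V k \<and> (\<forall>v\<in>V k - N \<phi>\<^sub>0. p v = jump \<phi>\<^sub>0 t v))"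
      using t by (simp add: induced_def)
    then show ?thesis by (simp only:) (rule someI_ex[OF ex])
  qed
  show "induced \<phi>\<^sub>0 t permutes V k"
  proof (cases "t \<in> doubled L")
    case False
    then show ?thesis by (simp add: induced_def permutes_id)
  qed (use * in blast)
  show "t \<in> doubled L \<Longrightarrow> v \<in> V k \<Longrightarrow> v \<notin> N \<phi>\<^sub>0 \<Longrightarrow> induced \<phi>\<^sub>0 t v = jump \<phi>\<^sub>0 t v" using * by blast
qed

lemma induced_sofic: "\<phi>\<^sub>0 \<in> V k \<rightarrow>\<^sub>E topspace X \<Longrightarrow> sofic_approximation H (V k) (induced \<phi>\<^sub>0)"
  by (simp add: sofic_approximation_def induced_facts)

text \<open>Multiplicativity can fail only where v or its jump is exceptional. Distinct elements of
  \<open>L\<close> give distinct values of \<open>lam\<close>, and a faithful point is moved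
  differently by these.\<close>

lemma induced_good:
  assumes \<phi>: "\<phi>\<^sub>0 \<in> V k \<rightarrow>\<^sub>E topspace X"
    and small: "real ((1 + card (moves L)) * card (N \<phi>\<^sub>0)) \<le> \<delta> * sz k"
  shows "good_approximation H L \<delta> (V k) (induced \<phi>\<^sub>0)"
proof -
  let ?bad = "N \<phi>\<^sub>0 \<union> touch k (moves L) (N \<phi>\<^sub>0)"
  have fN: "finite (N \<phi>\<^sub>0)" by (rule finite_subset[OF N_subset finite_V])
  have bV: "?bad \<subseteq> V k" using N_subset touch_subset by blast
  have "card ?bad \<le> card (N \<phi>\<^sub>0) + card (moves L) * card (N \<phi>\<^sub>0)"
    using card_Un_le[of "N \<phi>\<^sub>0" "touch k (moves L) (N \<phi>\<^sub>0)"]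
      card_touch[OF finite_moves[OF L(2,1)] moves_closed[OF L(1)] fN, of k] by linarith
  then have "real (card ?bad) \<le> real ((1 + card (moves L)) * card (N \<phi>\<^sub>0))" unfolding of_nat_le_iff by simp
  then have bad: "real (card ?bad) \<le> \<delta> * sz k" using small by linarith
  have dbl: "t \<in> doubled L" if "t \<in> L" for t using that by (simp add: doubled_def)
  have mult: "hamming_dist (V k) (induced \<phi>\<^sub>0 (s \<otimes>\<^bsub>H\<^esub> t)) (induced \<phi>\<^sub>0 s \<circ> induced \<phi>\<^sub>0 t) \<le> \<delta>" if st: "s \<in> L" "t \<in> L" for s t
  proof -
    have std: "s \<otimes>\<^bsub>H\<^esub> t \<in> doubled L" using st by (auto simp: doubled_def)
    have "{v \<in> V k. induced \<phi>\<^sub>0 (s \<otimes>\<^bsub>H\<^esub> t) v \<noteq> (induced \<phi>\<^sub>0 s \<circ> induced \<phi>\<^sub>0 t) v} \<subseteq> ?bad"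
    proof (rule subsetI, rule ccontr)
      fix v assume v: "v \<in> {v \<in> V k. induced \<phi>\<^sub>0 (s \<otimes>\<^bsub>H\<^esub> t) v \<noteq> (induced \<phi>\<^sub>0 s \<circ> induced \<phi>\<^sub>0 t) v}" "v \<notin> ?bad"
      then have vV: "v \<in> V k" "v \<notin> N \<phi>\<^sub>0" by auto
      have y: "\<Phi> (\<phi>\<^sub>0 v) \<in> topspace Y" by (rule \<Phi>_in[OF map_in[OF \<phi> vV(1)]])
      have m: "lam t (\<Phi> (\<phi>\<^sub>0 v)) \<in> moves L" by (rule lam_moves[OF UnI1[OF dbl[OF st(2)]] y])
      have jV: "jump \<phi>\<^sub>0 t v \<in> V k" unfolding jump_def using vV(1) m moves_closed[OF L(1)] by auto
      have jN: "jump \<phi>\<^sub>0 t v \<notin> N \<phi>\<^sub>0" using v(2) m vV(1) by (auto simp: jump_def touch_def)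
      have "(induced \<phi>\<^sub>0 s \<circ> induced \<phi>\<^sub>0 t) v = jump \<phi>\<^sub>0 s (jump \<phi>\<^sub>0 t v)"
        using induced_facts(2)[OF \<phi> dbl[OF st(2)] vV] induced_facts(2)[OF \<phi> dbl[OF st(1)] jV jN] by simp
      also have "\<dots> = jump \<phi>\<^sub>0 (s \<otimes>\<^bsub>H\<^esub> t) v"
        using jump_mult[OF \<phi> vV UnI1[OF dbl[OF st(2)]] UnI1[OF dbl[OF st(1)]]] by (simp only: jump_def)
      also have "\<dots> = induced \<phi>\<^sub>0 (s \<otimes>\<^bsub>H\<^esub> t) v" by (rule induced_facts(2)[OF \<phi> std vV, symmetric])
      finally show False using v(1) by simp
    qed
    then have "card {v \<in> V k. induced \<phi>\<^sub>0 (s \<otimes>\<^bsub>H\<^esub> t) v \<noteq> (induced \<phi>\<^sub>0 s \<circ> induced \<phi>\<^sub>0 t) v} \<le> card ?bad"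
      by (rule card_mono[rotated]) (simp add: fN)
    then have "real (card {v \<in> V k. induced \<phi>\<^sub>0 (s \<otimes>\<^bsub>H\<^esub> t) v \<noteq> (induced \<phi>\<^sub>0 s \<circ> induced \<phi>\<^sub>0 t) v}) \<le> \<delta> * sz k"
      using bad by linarith
    then show ?thesis by (simp add: hamming_dist_def divide_le_eq)
  qed
  have inj: "1 - \<delta> \<le> hamming_dist (V k) (induced \<phi>\<^sub>0 s) (induced \<phi>\<^sub>0 t)" if st: "s \<in> L" "t \<in> L" "s \<noteq> t" for s t
  proof -
    let ?D = "{v \<in> V k. induced \<phi>\<^sub>0 s v \<noteq> induced \<phi>\<^sub>0 t v}"
    have "V k \<subseteq> ?D \<union> ?bad"
    proof (rule subsetI, rule ccontr)
      fix v assume v: "v \<in> V k" "v \<notin> ?D \<union> ?bad"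
      then have vN: "v \<notin> N \<phi>\<^sub>0" and e: "induced \<phi>\<^sub>0 s v = induced \<phi>\<^sub>0 t v" by auto
      have y: "\<Phi> (\<phi>\<^sub>0 v) \<in> topspace Y" by (rule \<Phi>_in[OF map_in[OF \<phi> v(1)]])
      have r: "lam s (\<Phi> (\<phi>\<^sub>0 v)) \<in> F" "lam t (\<Phi> (\<phi>\<^sub>0 v)) \<in> F"
        using lam_moves[OF UnI1[OF dbl[OF st(1)]] y] lam_moves[OF UnI1[OF dbl[OF st(2)]] y] F(6) by blast+
      have "jump \<phi>\<^sub>0 s v = jump \<phi>\<^sub>0 t v"
        using e induced_facts(2)[OF \<phi> dbl[OF st(1)] v(1) vN] induced_facts(2)[OF \<phi> dbl[OF st(2)] v(1) vN] by simp
      then have "lam s (\<Phi> (\<phi>\<^sub>0 v)) = lam t (\<Phi> (\<phi>\<^sub>0 v))" unfolding jump_def by (rule faithful_inj[OF faithful_off_N[OF v(1) vN] r])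
      then have "s = t" by (rule lam_inj[rotated 3]) (use st L(1) y in blast)+
      then show False using st(3) by simp
    qed
    then have "card (V k) \<le> card (?D \<union> ?bad)" by (rule card_mono[rotated]) (simp add: fN)
    also have "\<dots> \<le> card ?D + card ?bad" by (rule card_Un_le)
    finally have "sz k \<le> real (card ?D) + real (card ?bad)" unfolding of_nat_add[symmetric] of_nat_le_iff .
    then have "(1 - \<delta>) * sz k \<le> real (card ?D)" using bad by (simp add: algebra_simps)
    then show ?thesis by (simp add: hamming_dist_def le_divide_eq)
  qed
  show ?thesis unfolding good_approximation_def using mult inj by blast
qed

end

section \<open>Transferred maps over the induced approximation\<close>

context coe_step
begin

text \<open>The map \<open>\<phi>\<close> is rebuilt over \<open>Y\<close> from its values at base points only, using the cocycle of the
  reference map \<open>\<phi>\<^sub>0\<close> to reach the other points. If the cocycles of \<open>\<phi>\<close> and \<open>\<phi>\<^sub>0\<close> agree along the edges,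
  they agree along all return paths between base points, whence the result is approximately
  equivariant for the single sofic approximation \<open>induced \<phi>\<^sub>0\<close>.\<close>

definition transfer :: "(nat \<Rightarrow> 'x) \<Rightarrow> (nat \<Rightarrow> 'x) \<Rightarrow> nat \<Rightarrow> 'y" where
  "transfer \<phi>\<^sub>0 \<phi> = (\<lambda>u\<in>V k. \<beta> (\<kappa> (fst (pick u)) (\<phi>\<^sub>0 (snd (pick u)))) (\<Phi> (\<phi> (snd (pick u)))))"

lemma pick_carrier: "u \<in> V k \<Longrightarrow> fst (pick u) \<in> carrier G"
  using pick_in(1) S(1) by blast

lemma transfer_in:
  assumes "\<phi> \<in> V k \<rightarrow>\<^sub>E topspace X" "\<phi>\<^sub>0 \<in> V k \<rightarrow>\<^sub>E topspace X"
  shows "transfer \<phi>\<^sub>0 \<phi> \<in> V k \<rightarrow>\<^sub>E topspace Y"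
  unfolding transfer_def
proof (rule restrict_PiE[THEN iffD2], rule funcsetI)
  fix u assume u: "u \<in> V k"
  show "\<beta> (\<kappa> (fst (pick u)) (\<phi>\<^sub>0 (snd (pick u)))) (\<Phi> (\<phi> (snd (pick u)))) \<in> topspace Y"
    by (intro \<beta>_in \<kappa>_in \<Phi>_in pick_carrier[OF u] map_in[OF assms(1)] map_in[OF assms(2)] pick_in(2)[OF u])
qed

lemma transfer_W:
  assumes \<phi>: "\<phi> \<in> V k \<rightarrow>\<^sub>E topspace X" "\<phi>\<^sub>0 \<in> V k \<rightarrow>\<^sub>E topspace X" and w: "w \<in> W" "w \<notin> N \<phi>"
  shows "transfer \<phi>\<^sub>0 \<phi> w = \<Phi> (\<phi> w)"
proof -
  have wV: "w \<in> V k" using w(1) W by blast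
  have "pick w = (\<one>, w)" by (rule pick_W[OF w(1) faithful_one[OF faithful_off_N[OF wV w(2)] one_F]])
  then show ?thesis using wV \<beta>_one[OF \<Phi>_in[OF map_in[OF \<phi>(1) wV]]] map_in[OF \<phi>(2) wV] by (simp add: transfer_def)
qed

text \<open>Let v lie over w via s, u = r v over w' via s', g = s'^-1 r s and
  \<open>h = \<kappa> s' (\<phi>\<^sub>0 w')\<close>. The cocycle identity for
  \<open>\<phi>\<^sub>0\<close> gives \<open>h \<kappa> g (\<phi>\<^sub>0 w) = t \<kappa> s
  (\<phi>\<^sub>0 w)\<close>. Agreement replaces \<open>\<kappa> g (\<phi>\<^sub>0 w)\<close> by
  \<open>\<kappa> g (\<phi> w)\<close>, so the translate by t of the transferred map at v is h
  applied to \<Phi> (g \<phi>(w)), while at u it is h applied to \<Phi> (\<phi>(g w)). These are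
  close by equivariance of \<phi> at w.\<close>

lemma transfer_near:
  assumes \<phi>: "\<phi> \<in> V k \<rightarrow>\<^sub>E topspace X" "\<phi>\<^sub>0 \<in> V k \<rightarrow>\<^sub>E topspace X" "agree \<phi> \<phi>\<^sub>0"
    and \<rho>\<beta>: "\<And>s z x x'. s \<in> S \<Longrightarrow> z \<in> topspace X \<Longrightarrow> x \<in> topspace X \<Longrightarrow> x' \<in> topspace X \<Longrightarrow> dX x x' < \<rho> \<Longrightarrow>
      dY (\<beta> (\<kappa> s z) (\<Phi> x)) (\<beta> (\<kappa> s z) (\<Phi> x')) < \<epsilon>"
    and t: "t \<in> L" and v: "v \<in> V k" "v \<notin> halo (N \<phi> \<union> N \<phi>\<^sub>0)" "v \<notin> touch k (moves L) (halo (N \<phi> \<union> N \<phi>\<^sub>0))"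
  shows "dY (transfer \<phi>\<^sub>0 \<phi> (induced \<phi>\<^sub>0 t v)) (\<beta> t (transfer \<phi>\<^sub>0 \<phi> v)) < \<epsilon>"
proof -
  let ?A = "N \<phi> \<union> N \<phi>\<^sub>0"
  have BA: "B \<subseteq> ?A" by (auto simp: N_def)
  have A_halo: "?A \<subseteq> halo ?A" by (auto simp: halo_def)
  have td: "t \<in> doubled L" using t by (simp add: doubled_def)
  have tH: "t \<in> carrier H" using t L(1) by blast
  have vB: "v \<notin> B" and vN: "v \<notin> N \<phi>\<^sub>0" using v(2) BA A_halo by blast+
  have x0: "\<phi>\<^sub>0 v \<in> topspace X" by (rule map_in[OF \<phi>(2) v(1)])
  define r where "r = lam t (\<Phi> (\<phi>\<^sub>0 v))"
  have rm: "r \<in> moves L" unfolding r_def by (rule lam_moves[OF UnI1[OF td] \<Phi>_in[OF x0]])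
  then have rF: "r \<in> F" using F(6) by blast
  have rc: "r \<in> carrier G" by (rule F_carrier[OF rF])
  define u where "u = \<sigma> k r v"
  have ind: "induced \<phi>\<^sub>0 t v = u" using induced_facts(2)[OF \<phi>(2) td v(1) vN] by (simp add: jump_def r_def u_def)
  have uV: "u \<in> V k" using v(1) rc by (simp add: u_def)
  have uh: "u \<notin> halo ?A" using v(1,3) rm by (auto simp: touch_def u_def)
  have uB: "u \<notin> B" using uh BA A_halo by blast
  define s w where "s = fst (pick v)" and "w = snd (pick v)"
  define s' w' where "s' = fst (pick u)" and "w' = snd (pick u)"
  have s: "s \<in> S" "s' \<in> S" using pick_in(1)[OF v(1)] pick_in(1)[OF uV] by (simp_all add: s_def s'_def)
  have sF: "s \<in> F" "s' \<in> F" using s F(4) by blast+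
  have sc: "s \<in> carrier G" "s' \<in> carrier G" using s S(1) by blast+
  have w: "w \<in> W" "w' \<in> W" "v = \<sigma> k s w" "u = \<sigma> k s' w'"
    unfolding s_def w_def s'_def w'_def using pick_covered[OF v(1) vB] pick_covered[OF uV uB] by blast+
  have wV: "w \<in> V k" "w' \<in> V k" using w(1,2) W by blast+
  have wN: "w \<notin> N \<phi>" "w \<notin> N \<phi>\<^sub>0"
    using pick_off_halo[OF v(1,2) BA] by (simp_all add: w_def)
  have x: "\<phi> w \<in> topspace X" "\<phi>\<^sub>0 w \<in> topspace X" "\<phi> w' \<in> topspace X" "\<phi>\<^sub>0 w' \<in> topspace X"
    using map_in[OF \<phi>(1)] map_in[OF \<phi>(2)] wV by blast+
  define g where "g = inv s' \<otimes> (r \<otimes> s)"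
  have gr: "g \<in> returns S L" unfolding g_def returns_def by (rule image_eqI[of _ _ "(s', r, s)"]) (simp_all add: s rm)
  have gF: "g \<in> F" using gr F(5) by blast
  have gc: "g \<in> carrier G" by (rule F_carrier[OF gF])
  have sg: "s' \<otimes> g = r \<otimes> s" using sc rc by (simp add: g_def)
  have fw: "faithful_at k F w" by (rule faithful_off_N[OF wV(1) wN(1)])
  have "\<sigma> k s' w' = \<sigma> k s' (\<sigma> k g w)"
    using faithful_mult[OF fw sF(2) gF] faithful_mult[OF fw rF sF(1)] w(3,4) sg by (simp add: u_def)
  then have w': "w' = \<sigma> k g w" using \<sigma>_inj[OF sc(2)] by simp
  have \<kappa>g: "\<kappa> g (\<phi> w) = \<kappa> g (\<phi>\<^sub>0 w)" by (rule return_agree[OF \<phi> w(1) wN gr]) (use w(2) w' in simp)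
  define h where "h = \<kappa> s' (\<phi>\<^sub>0 w')"
  have hc: "h \<in> carrier H" unfolding h_def by (rule \<kappa>_in[OF sc(2) x(4)])
  have "h = \<kappa> s' (\<alpha> g (\<phi>\<^sub>0 w))" unfolding h_def w' by (rule \<kappa>_off_N[OF \<phi>(2) wV(1) wN(2) gF sF(2), symmetric])
  then have "h \<otimes>\<^bsub>H\<^esub> \<kappa> g (\<phi>\<^sub>0 w) = \<kappa> (r \<otimes> s) (\<phi>\<^sub>0 w)" using \<kappa>_cocycle[OF sc(2) gc x(2)] sg by simp
  also have "\<dots> = \<kappa> r (\<phi>\<^sub>0 v) \<otimes>\<^bsub>H\<^esub> \<kappa> s (\<phi>\<^sub>0 w)"
    using \<kappa>_cocycle[OF rc sc(1) x(2)] \<kappa>_off_N[OF \<phi>(2) wV(1) wN(2) sF(1) rF] w(3) by simp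
  also have "\<kappa> r (\<phi>\<^sub>0 v) = t" using \<kappa>_lam[OF tH \<Phi>_in[OF x0]] \<Psi>\<Phi>[OF x0] by (simp add: r_def)
  finally have hg: "h \<otimes>\<^bsub>H\<^esub> \<kappa> g (\<phi> w) = t \<otimes>\<^bsub>H\<^esub> \<kappa> s (\<phi>\<^sub>0 w)" unfolding \<kappa>g .
  have \<kappa>c: "\<kappa> g (\<phi> w) \<in> carrier H" "\<kappa> s (\<phi>\<^sub>0 w) \<in> carrier H" using \<kappa>_in[OF gc x(1)] \<kappa>_in[OF sc(1) x(2)] .
  have y: "\<Phi> (\<phi> w) \<in> topspace Y" by (rule \<Phi>_in[OF x(1)])
  have "\<beta> h (\<Phi> (\<alpha> g (\<phi> w))) = \<beta> (h \<otimes>\<^bsub>H\<^esub> \<kappa> g (\<phi> w)) (\<Phi> (\<phi> w))"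
    using \<Phi>_equivariant[OF gc x(1)] \<beta>_mult[OF hc \<kappa>c(1) y] by simp
  also have "\<dots> = \<beta> t (transfer \<phi>\<^sub>0 \<phi> v)"
    unfolding hg using \<beta>_mult[OF tH \<kappa>c(2) y] v(1) by (simp add: transfer_def s_def w_def)
  finally have tv: "\<beta> h (\<Phi> (\<alpha> g (\<phi> w))) = \<beta> t (transfer \<phi>\<^sub>0 \<phi> v)" .
  have tu: "transfer \<phi>\<^sub>0 \<phi> u = \<beta> h (\<Phi> (\<phi> w'))" using uV by (simp add: transfer_def h_def s'_def w'_def)
  have "dX (\<phi> w') (\<alpha> g (\<phi> w)) < \<rho>" unfolding w' by (rule near_off_N[OF wV(1) wN(1) gF])
  then have "dY (\<beta> h (\<Phi> (\<phi> w'))) (\<beta> h (\<Phi> (\<alpha> g (\<phi> w)))) < \<epsilon>"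
    unfolding h_def by (rule \<rho>\<beta>[OF s(2) x(4) x(3) \<alpha>_in[OF gc x(1)]])
  then show ?thesis unfolding ind tu tv .
qed

text \<open>The error is below \<delta>/2 except on the halo and its preimages under moves, where it
  is at most the diameter bound \<open>D\<close>; the condition on \<theta> controls the mean
  square.\<close>

lemma transfer_sofic_map:
  assumes \<phi>: "\<phi> \<in> V k \<rightarrow>\<^sub>E topspace X" "\<phi>\<^sub>0 \<in> V k \<rightarrow>\<^sub>E topspace X" "agree \<phi> \<phi>\<^sub>0"
    and \<rho>\<beta>: "\<And>s z x x'. s \<in> S \<Longrightarrow> z \<in> topspace X \<Longrightarrow> x \<in> topspace X \<Longrightarrow> x' \<in> topspace X \<Longrightarrow> dX x x' < \<rho> \<Longrightarrow>
      dY (\<beta> (\<kappa> s z) (\<Phi> x)) (\<beta> (\<kappa> s z) (\<Phi> x')) < \<delta> / 2"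
    and D: "\<And>y y'. y \<in> topspace Y \<Longrightarrow> y' \<in> topspace Y \<Longrightarrow> dY y y' \<le> D"
    and \<delta>: "0 < \<delta>" and \<theta>: "2 * \<theta> * D\<^sup>2 \<le> \<delta>\<^sup>2"
    and small: "real ((1 + card (moves L)) * ((1 + card S) * (card (N \<phi>) + card (N \<phi>\<^sub>0)))) \<le> \<theta> * sz k"
  shows "transfer \<phi>\<^sub>0 \<phi> \<in> sofic_maps Y dY \<beta> L \<delta> (V k) (induced \<phi>\<^sub>0)"
proof -
  let ?A = "N \<phi> \<union> N \<phi>\<^sub>0"
  let ?bad = "halo ?A \<union> touch k (moves L) (halo ?A)"
  have AV: "?A \<subseteq> V k" using N_subset by blast
  have hV: "halo ?A \<subseteq> V k" by (rule halo_subset[OF AV])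
  have fA: "finite ?A" by (rule finite_subset[OF AV finite_V])
  have fh: "finite (halo ?A)" by (rule finite_subset[OF hV finite_V])
  have bV: "?bad \<subseteq> V k" using hV touch_subset by blast
  have h: "card (halo ?A) \<le> (1 + card S) * (card (N \<phi>) + card (N \<phi>\<^sub>0))"
    using card_halo_le[OF fA] mult_le_mono2[OF card_Un_le[of "N \<phi>" "N \<phi>\<^sub>0"], of "1 + card S"] by (rule order_trans)
  have "card ?bad \<le> (1 + card (moves L)) * card (halo ?A)"
    using card_Un_le[of "halo ?A" "touch k (moves L) (halo ?A)"]
      card_touch[OF finite_moves[OF L(2,1)] moves_closed[OF L(1)] fh, of k] by simp
  also have "\<dots> \<le> (1 + card (moves L)) * ((1 + card S) * (card (N \<phi>) + card (N \<phi>\<^sub>0)))" by (rule mult_le_mono2[OF h])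
  finally have "real (card ?bad) \<le> real ((1 + card (moves L)) * ((1 + card S) * (card (N \<phi>) + card (N \<phi>\<^sub>0))))"
    unfolding of_nat_le_iff .
  then have bad: "real (card ?bad) \<le> \<theta> * sz k" using small by linarith
  have tr: "transfer \<phi>\<^sub>0 \<phi> \<in> V k \<rightarrow>\<^sub>E topspace Y" by (rule transfer_in[OF \<phi>(1,2)])
  have "dist_2 (V k) dY (transfer \<phi>\<^sub>0 \<phi> \<circ> induced \<phi>\<^sub>0 t) (\<beta> t \<circ> transfer \<phi>\<^sub>0 \<phi>) \<le> \<delta>" if t: "t \<in> L" for t
  proof (rule dist_2_le[where B = ?bad and \<theta> = \<theta> and a = "\<delta> / 2" and D = D])
    have tH: "t \<in> carrier H" using t L(1) by blast
    fix v
    {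
      assume v: "v \<in> V k - ?bad"
      have "dY (transfer \<phi>\<^sub>0 \<phi> (induced \<phi>\<^sub>0 t v)) (\<beta> t (transfer \<phi>\<^sub>0 \<phi> v)) < \<delta> / 2"
        by (rule transfer_near[OF \<phi> \<rho>\<beta> t]) (use v in auto)
      then show "0 \<le> dY ((transfer \<phi>\<^sub>0 \<phi> \<circ> induced \<phi>\<^sub>0 t) v) ((\<beta> t \<circ> transfer \<phi>\<^sub>0 \<phi>) v) \<and>
        dY ((transfer \<phi>\<^sub>0 \<phi> \<circ> induced \<phi>\<^sub>0 t) v) ((\<beta> t \<circ> transfer \<phi>\<^sub>0 \<phi>) v) \<le> \<delta> / 2" by simp
    }
    assume "v \<in> ?bad"
    then have v: "v \<in> V k" using bV by blast
    have iv: "induced \<phi>\<^sub>0 t v \<in> V k" using permutes_in_image[OF induced_facts(1)[OF \<phi>(2)], of t v] v by simp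
    have "dY (transfer \<phi>\<^sub>0 \<phi> (induced \<phi>\<^sub>0 t v)) (\<beta> t (transfer \<phi>\<^sub>0 \<phi> v)) \<le> D"
      by (rule D[OF PiE_mem[OF tr iv] \<beta>_in[OF tH PiE_mem[OF tr v]]])
    then show "0 \<le> dY ((transfer \<phi>\<^sub>0 \<phi> \<circ> induced \<phi>\<^sub>0 t) v) ((\<beta> t \<circ> transfer \<phi>\<^sub>0 \<phi>) v) \<and>
      dY ((transfer \<phi>\<^sub>0 \<phi> \<circ> induced \<phi>\<^sub>0 t) v) ((\<beta> t \<circ> transfer \<phi>\<^sub>0 \<phi>) v) \<le> D" by simp
  next
    show "(\<delta> / 2)\<^sup>2 + \<theta> * D\<^sup>2 \<le> \<delta>\<^sup>2"
    proof -
      have "(\<delta> / 2)\<^sup>2 \<le> \<delta>\<^sup>2 / 2" by (simp add: power2_eq_square)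
      then show ?thesis using \<theta> by linarith
    qed
  qed (use bV bad \<delta> in simp_all)
  then show ?thesis using tr by (simp add: sofic_maps_def)
qed

text \<open>Separation at v is pulled back to its base point, where the transferred maps are \<Phi>
  \<circ> \<phi> and \<Phi> \<circ> \<psi>. Two thirds of \<epsilon> are spent on the equivariance
  errors, and \<epsilon>' depends on the action of \<open>S\<close> only.\<close>

lemma transfer_separated:
  assumes \<phi>: "\<phi> \<in> V k \<rightarrow>\<^sub>E topspace X" "\<phi>\<^sub>0 \<in> V k \<rightarrow>\<^sub>E topspace X" "\<psi> \<in> V k \<rightarrow>\<^sub>E topspace X"
    and far: "\<epsilon> \<le> dX (\<phi> v) (\<psi> v)" and v: "v \<in> V k" "v \<notin> halo (N \<phi>)" "v \<notin> halo (N \<psi>)"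
    and \<rho>: "\<rho> \<le> \<epsilon> / 3"
    and unif: "\<And>s x x'. s \<in> S \<Longrightarrow> x \<in> topspace X \<Longrightarrow> x' \<in> topspace X \<Longrightarrow> dY (\<Phi> x) (\<Phi> x') < \<epsilon>' \<Longrightarrow> dX (\<alpha> s x) (\<alpha> s x') < \<epsilon> / 3"
  shows "\<epsilon>' \<le> dist_inf (V k) dY (transfer \<phi>\<^sub>0 \<phi>) (transfer \<phi>\<^sub>0 \<psi>)"
proof -
  have BN: "B \<subseteq> N \<phi>" "B \<subseteq> N \<psi>" by (auto simp: N_def)
  have vB: "v \<notin> B" using v(2) BN(1) by (auto simp: halo_def)
  define s w where "s = fst (pick v)" and "w = snd (pick v)"
  have s: "s \<in> S" "s \<in> F" "s \<in> carrier G" using pick_in(1)[OF v(1)] F(4) S(1) by (auto simp: s_def)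
  have w: "w \<in> W" "v = \<sigma> k s w" unfolding s_def w_def by (rule pick_covered[OF v(1) vB])+
  have wN: "w \<notin> N \<phi>" "w \<notin> N \<psi>"
    unfolding w_def by (rule pick_off_halo[OF v(1,2) BN(1)], rule pick_off_halo[OF v(1,3) BN(2)])
  have wV: "w \<in> V k" using w(1) W by blast
  have x: "\<phi> w \<in> topspace X" "\<psi> w \<in> topspace X" "\<phi> v \<in> topspace X" "\<psi> v \<in> topspace X"
    using map_in[OF \<phi>(1)] map_in[OF \<phi>(3)] wV v(1) by blast+
  note ax = \<alpha>_in[OF s(3) x(1)] \<alpha>_in[OF s(3) x(2)]
  have near: "dX (\<phi> v) (\<alpha> s (\<phi> w)) < \<rho>" "dX (\<psi> v) (\<alpha> s (\<psi> w)) < \<rho>"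
    using near_off_N[OF wV wN(1) s(2)] near_off_N[OF wV wN(2) s(2)] unfolding w(2) .
  have "dX (\<phi> v) (\<psi> v) \<le> dX (\<phi> v) (\<alpha> s (\<phi> w)) + (dX (\<alpha> s (\<phi> w)) (\<alpha> s (\<psi> w)) + dX (\<alpha> s (\<psi> w)) (\<psi> v))"
    using dX_triangle[OF x(3) ax(1) x(4)] dX_triangle[OF ax x(4)] by linarith
  then have "\<epsilon> / 3 \<le> dX (\<alpha> s (\<phi> w)) (\<alpha> s (\<psi> w))" using near far \<rho> dX_sym[of "\<psi> v" "\<alpha> s (\<psi> w)"] by linarith
  then have "\<epsilon>' \<le> dY (\<Phi> (\<phi> w)) (\<Phi> (\<psi> w))" using unif[OF s(1) x(1,2)] by (rule_tac ccontr) linarith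
  then have "\<epsilon>' \<le> dY (transfer \<phi>\<^sub>0 \<phi> w) (transfer \<phi>\<^sub>0 \<psi> w)"
    unfolding transfer_W[OF \<phi>(1,2) w(1) wN(1)] transfer_W[OF \<phi>(3,2) w(1) wN(2)] .
  then show ?thesis by (rule dist_inf_geI[OF finite_V wV])
qed

end

text \<open>Each map is coded by its cocycle values on \<open>E\<close>, its halo, and the cells of
  its values on the halo; each of the two records has at most exp (\<tau> |V| / 2) possibilities.
  Within a largest fibre the first record makes all maps agree with one reference map. The second
  forces two maps to be \<epsilon> apart at a point off their common halo, where
  \<open>transfer_separated\<close> applies.\<close>

lemma (in coe_step) transfer_count:
  fixes \<tau> \<theta> \<theta>' \<eta> :: real and c :: "'x \<Rightarrow> 'x"
  assumes \<Omega>: "finite \<Omega>" "\<Omega> \<noteq> {}" "\<Omega> \<subseteq> V k \<rightarrow>\<^sub>E topspace X" "separated \<epsilon> (dist_inf (V k) dX) \<Omega>"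
    and small: "\<And>\<phi>. \<phi> \<in> \<Omega> \<Longrightarrow> real (card (N \<phi>)) \<le> \<theta> * sz k"
    and \<theta>: "real (1 + card S) * \<theta> \<le> \<eta>" "real (1 + card (moves L)) * (real (1 + card S) * (2 * \<theta>)) \<le> \<theta>'" "0 \<le> \<theta>"
    and c: "finite (c ` topspace X)" "\<And>x x'. x \<in> topspace X \<Longrightarrow> x' \<in> topspace X \<Longrightarrow> c x = c x' \<Longrightarrow> dX x x' < \<epsilon>"
    and cells: "finite (SIGMA A:{A. A \<subseteq> V k \<and> real (card A) \<le> \<eta> * sz k}. A \<rightarrow>\<^sub>E c ` topspace X)"
      "real (card (SIGMA A:{A. A \<subseteq> V k \<and> real (card A) \<le> \<eta> * sz k}. A \<rightarrow>\<^sub>E c ` topspace X)) \<le> exp (\<tau> / 2 * sz k)"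
    and R: "finite R" and records: "(\<Sum>(g, v)\<in>E. ln (real (card (\<kappa> g ` topspace X)))) \<le> \<tau> / 2 * sz k"
    and \<rho>\<beta>: "\<And>s z x x'. s \<in> S \<Longrightarrow> z \<in> topspace X \<Longrightarrow> x \<in> topspace X \<Longrightarrow> x' \<in> topspace X \<Longrightarrow> dX x x' < \<rho> \<Longrightarrow>
      dY (\<beta> (\<kappa> s z) (\<Phi> x)) (\<beta> (\<kappa> s z) (\<Phi> x')) < \<delta> / 2"
    and D: "\<And>y y'. y \<in> topspace Y \<Longrightarrow> y' \<in> topspace Y \<Longrightarrow> dY y y' \<le> D"
    and \<delta>: "0 < \<delta>" "2 * \<theta>' * D\<^sup>2 \<le> \<delta>\<^sup>2" "\<theta>' \<le> \<delta>"
    and \<rho>: "\<rho> \<le> \<epsilon> / 3" and \<epsilon>': "0 < \<epsilon>'"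
    and unif: "\<And>s x x'. s \<in> S \<Longrightarrow> x \<in> topspace X \<Longrightarrow> x' \<in> topspace X \<Longrightarrow> dY (\<Phi> x) (\<Phi> x') < \<epsilon>' \<Longrightarrow> dX (\<alpha> s x) (\<alpha> s x') < \<epsilon> / 3"
  shows "\<exists>\<sigma>'. sofic_approximation H (V k) \<sigma>' \<and> good_approximation H L \<delta> (V k) \<sigma>' \<and>
    real (card \<Omega>) \<le> exp (\<tau> * sz k) *
      real (separation_number \<epsilon>' (sofic_maps Y dY \<beta> L \<delta> (V k) \<sigma>') (dist_inf (V k) dY))"
proof -
  let ?A = "\<lambda>\<phi>. halo (N \<phi>)"
  let ?rec = "\<lambda>\<phi>. \<lambda>(g, v)\<in>E. \<kappa> g (\<phi> v)"
  let ?code = "\<lambda>\<phi>. (?rec \<phi>, (?A \<phi>, \<lambda>v\<in>?A \<phi>. c (\<phi> v)))"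
  let ?P = "PiE E (\<lambda>(g, v). \<kappa> g ` topspace X)"
  let ?Q = "SIGMA A:{A. A \<subseteq> V k \<and> real (card A) \<le> \<eta> * sz k}. A \<rightarrow>\<^sub>E c ` topspace X"
  have \<Omega>V: "\<phi> \<in> V k \<rightarrow>\<^sub>E topspace X" if "\<phi> \<in> \<Omega>" for \<phi> using \<Omega>(3) that by blast
  have fE: "finite E" by (rule finite_subset[OF E]) (simp add: R)
  have gE: "g \<in> carrier G" "v \<in> V k" if "(g, v) \<in> E" for g v using that E coe_step.R[OF coe_step_axioms] by blast+
  obtain \<phi>1 where \<phi>1: "\<phi>1 \<in> \<Omega>" using \<Omega>(2) by blast
  obtain v1 where v1: "v1 \<in> V k" using V_nonempty by blast
  have X0: "topspace X \<noteq> {}" using map_in[OF \<Omega>V[OF \<phi>1] v1] by blast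
  have \<kappa>fin: "finite (\<kappa> g ` topspace X)" if "g \<in> carrier G" for g
    by (rule compact_discrete_image_finite(1)[OF X(1) \<kappa>_cont[OF that]])
  have \<kappa>pos: "0 < real (card (\<kappa> g ` topspace X))" if "g \<in> carrier G" for g
    using \<kappa>fin[OF that] X0 by (simp add: card_gt_0_iff)
  have fP: "finite ?P" by (rule finite_PiE[OF fE]) (use gE \<kappa>fin in auto)
  have "real (card ?P) = (\<Prod>p\<in>E. real (card ((\<lambda>(g, v). \<kappa> g ` topspace X) p)))"
    unfolding card_PiE[OF fE] of_nat_prod ..
  also have "\<dots> = (\<Prod>p\<in>E. exp (ln (real (card (\<kappa> (fst p) ` topspace X)))))"
    by (rule prod.cong) (use gE \<kappa>pos in auto)
  also have "\<dots> = exp (\<Sum>p\<in>E. ln (real (card (\<kappa> (fst p) ` topspace X))))" by (rule exp_sum[OF fE, symmetric])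
  also have "\<dots> \<le> exp (\<tau> / 2 * sz k)" using records by (simp add: case_prod_unfold)
  finally have cP: "real (card ?P) \<le> exp (\<tau> / 2 * sz k)" .
  have img: "?code ` \<Omega> \<subseteq> ?P \<times> ?Q"
  proof (rule image_subsetI)
    fix \<phi> assume \<phi>: "\<phi> \<in> \<Omega>"
    have "?rec \<phi> \<in> ?P"
    proof (rule PiE_I)
      fix p assume p: "p \<in> E"
      obtain g v where gv: "p = (g, v)" by (cases p)
      have "\<phi> v \<in> topspace X" using map_in[OF \<Omega>V[OF \<phi>]] gE(2) p unfolding gv by blast
      then show "?rec \<phi> p \<in> (case p of (g, v) \<Rightarrow> \<kappa> g ` topspace X)" using p unfolding gv by simp
    qed simp
    moreover have "real (card (?A \<phi>)) \<le> \<eta> * sz k"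
    proof -
      have "card (?A \<phi>) \<le> (1 + card S) * card (N \<phi>)" by (rule card_halo_le[OF finite_subset[OF N_subset finite_V]])
      then have "real (card (?A \<phi>)) \<le> real (1 + card S) * real (card (N \<phi>))" unfolding of_nat_mult[symmetric] of_nat_le_iff .
      also have "\<dots> \<le> real (1 + card S) * (\<theta> * sz k)" by (rule mult_left_mono[OF small[OF \<phi>]]) simp
      also have "\<dots> = (real (1 + card S) * \<theta>) * sz k" by simp
      also have "\<dots> \<le> \<eta> * sz k" by (rule mult_right_mono[OF \<theta>(1)]) simp
      finally show ?thesis .
    qed
    moreover have AV: "?A \<phi> \<subseteq> V k" by (rule halo_subset[OF N_subset])
    moreover have "(\<lambda>v\<in>?A \<phi>. c (\<phi> v)) \<in> ?A \<phi> \<rightarrow>\<^sub>E c ` topspace X"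
    proof (rule restrict_PiE[THEN iffD2], rule funcsetI, rule imageI)
      fix v assume "v \<in> ?A \<phi>"
      then show "\<phi> v \<in> topspace X" using map_in[OF \<Omega>V[OF \<phi>]] AV by blast
    qed
    ultimately show "?code \<phi> \<in> ?P \<times> ?Q" by (intro SigmaI CollectI conjI)
  qed
  obtain t where t: "t \<in> ?P \<times> ?Q" "{\<phi> \<in> \<Omega>. ?code \<phi> = t} \<noteq> {}"
    "card \<Omega> \<le> card (?P \<times> ?Q) * card {\<phi> \<in> \<Omega>. ?code \<phi> = t}"
    by (rule ex_large_fibre[OF \<Omega>(1,2) img finite_cartesian_product[OF fP cells(1)]])
  define K where "K = {\<phi> \<in> \<Omega>. ?code \<phi> = t}"
  have K: "\<phi> \<in> \<Omega>" "?code \<phi> = t" if "\<phi> \<in> K" for \<phi> using that by (simp_all add: K_def)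
  obtain \<phi>0 where \<phi>0: "\<phi>0 \<in> K" using t(2) by (auto simp: K_def)
  have \<phi>0V: "\<phi>0 \<in> V k \<rightarrow>\<^sub>E topspace X" by (rule \<Omega>V[OF K(1)[OF \<phi>0]])
  have agr: "agree \<phi> \<phi>0" if "\<phi> \<in> K" for \<phi>
    unfolding agree_def
  proof (clarify)
    fix g v assume e: "(g, v) \<in> E"
    have "?rec \<phi> = ?rec \<phi>0" using K(2)[OF that] K(2)[OF \<phi>0] by (metis (no_types) Pair_inject)
    from fun_cong[OF this, of "(g, v)"] show "\<kappa> g (\<phi> v) = \<kappa> g (\<phi>0 v)" using e by simp
  qed
  let ?tr = "transfer \<phi>0" and ?\<sigma> = "induced \<phi>0"
  let ?M = "sofic_maps Y dY \<beta> L \<delta> (V k) ?\<sigma>"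
  have big: "real ((1 + card (moves L)) * ((1 + card S) * (card (N \<phi>) + card (N \<phi>0)))) \<le> \<theta>' * sz k" if "\<phi> \<in> \<Omega>" for \<phi>
  proof -
    have "real ((1 + card (moves L)) * ((1 + card S) * (card (N \<phi>) + card (N \<phi>0)))) =
      real (1 + card (moves L)) * (real (1 + card S) * (real (card (N \<phi>)) + real (card (N \<phi>0))))" by (simp only: of_nat_mult of_nat_add)
    also have "\<dots> \<le> real (1 + card (moves L)) * (real (1 + card S) * (2 * \<theta> * sz k))"
      using small[OF that] small[OF K(1)[OF \<phi>0]] by (intro mult_left_mono) linarith+
    also have "\<dots> = (real (1 + card (moves L)) * (real (1 + card S) * (2 * \<theta>))) * sz k" by simp
    also have "\<dots> \<le> \<theta>' * sz k" by (rule mult_right_mono[OF \<theta>(2)]) simp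
    finally show ?thesis .
  qed
  have good: "good_approximation H L \<delta> (V k) ?\<sigma>"
  proof (rule induced_good[OF \<phi>0V])
    have "(1 + card (moves L)) * card (N \<phi>0) \<le> (1 + card (moves L)) * ((1 + card S) * (card (N \<phi>0) + card (N \<phi>0)))"
      by (intro mult_le_mono2) simp
    then have "real ((1 + card (moves L)) * card (N \<phi>0)) \<le> real ((1 + card (moves L)) * ((1 + card S) * (card (N \<phi>0) + card (N \<phi>0))))"
      unfolding of_nat_le_iff .
    also have "\<dots> \<le> \<theta>' * sz k" by (rule big[OF K(1)[OF \<phi>0]])
    also have "\<dots> \<le> \<delta> * sz k" by (rule mult_right_mono[OF \<delta>(3)]) simp
    finally show "real ((1 + card (moves L)) * card (N \<phi>0)) \<le> \<delta> * sz k" .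
  qed
  have trM: "?tr ` K \<subseteq> ?M"
  proof (rule image_subsetI)
    fix \<phi> assume "\<phi> \<in> K"
    then show "?tr \<phi> \<in> ?M"
      by (intro transfer_sofic_map[OF \<Omega>V[OF K(1)] \<phi>0V agr \<rho>\<beta> D \<delta>(1,2) big[OF K(1)]])
  qed
  have sep: "\<epsilon>' \<le> dist_inf (V k) dY (?tr \<phi>) (?tr \<psi>)" if *: "\<phi> \<in> K" "\<psi> \<in> K" "\<phi> \<noteq> \<psi>" for \<phi> \<psi>
  proof -
    have "\<epsilon> \<le> dist_inf (V k) dX \<phi> \<psi>" using \<Omega>(4) * K(1) by (simp add: separated_def)
    then obtain v where v: "v \<in> V k" "\<epsilon> \<le> dX (\<phi> v) (\<psi> v)" by (rule dist_inf_geE[OF finite_V V_nonempty])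
    have code: "?code \<phi> = ?code \<psi>" using K(2)[OF *(1)] K(2)[OF *(2)] by (rule trans_sym)
    have A: "?A \<phi> = ?A \<psi>" using code by simp
    have cc: "(\<lambda>v\<in>?A \<phi>. c (\<phi> v)) = (\<lambda>v\<in>?A \<psi>. c (\<psi> v))" using code unfolding prod.inject by (elim conjE)
    have "v \<notin> ?A \<phi>"
    proof
      assume "v \<in> ?A \<phi>"
      then have "c (\<phi> v) = c (\<psi> v)" using fun_cong[OF cc, of v] A by simp
      then have "dX (\<phi> v) (\<psi> v) < \<epsilon>" by (rule c(2)[OF map_in[OF \<Omega>V[OF K(1)[OF *(1)]] v(1)] map_in[OF \<Omega>V[OF K(1)[OF *(2)]] v(1)]])
      then show False using v(2) by simp
    qed
    then show ?thesis
      by (intro transfer_separated[OF \<Omega>V[OF K(1)[OF *(1)]] \<phi>0V \<Omega>V[OF K(1)[OF *(2)]] v(2,1) _ _ \<rho> unif]) (use A in simp_all)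
  qed
  have inj: "inj_on ?tr K"
  proof (rule inj_onI, rule ccontr)
    fix \<phi> \<psi> assume *: "\<phi> \<in> K" "\<psi> \<in> K" "?tr \<phi> = ?tr \<psi>" "\<phi> \<noteq> \<psi>"
    have "\<epsilon>' \<le> dist_inf (V k) dY (?tr \<phi>) (?tr \<psi>)" by (rule sep[OF *(1,2,4)])
    then obtain v where v: "v \<in> V k" "\<epsilon>' \<le> dY (?tr \<phi> v) (?tr \<psi> v)" by (rule dist_inf_geE[OF finite_V V_nonempty])
    have "?tr \<psi> v \<in> topspace Y" by (rule PiE_mem[OF transfer_in[OF \<Omega>V[OF K(1)[OF *(2)]] \<phi>0V] v(1)])
    then have "dY (?tr \<psi> v) (?tr \<psi> v) = 0"
      using Metric_space.mdist_zero[OF compatible_metric_space[OF Y(2)]] by blast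
    then show False using v(2) *(3) \<epsilon>' by simp
  qed
  have "separated \<epsilon>' (dist_inf (V k) dY) (?tr ` K)"
    unfolding separated_def
  proof (intro ballI impI)
    fix a b assume ab: "a \<in> ?tr ` K" "b \<in> ?tr ` K" "a \<noteq> b"
    then obtain \<phi> \<psi> where "\<phi> \<in> K" "a = ?tr \<phi>" "\<psi> \<in> K" "b = ?tr \<psi>" by blast
    then show "\<epsilon>' \<le> dist_inf (V k) dY a b" using sep ab(3) by metis
  qed
  then have "card (?tr ` K) \<le> separation_number \<epsilon>' ?M (dist_inf (V k) dY)"
    by (rule separation_number_facts(2)[OF Y \<epsilon>' finite_V V_nonempty sofic_maps_subset trM])
  then have cK: "card K \<le> separation_number \<epsilon>' ?M (dist_inf (V k) dY)" unfolding card_image[OF inj] .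
  have "card \<Omega> \<le> card (?P \<times> ?Q) * card K" using t(3) unfolding K_def .
  then have "real (card \<Omega>) \<le> real (card (?P \<times> ?Q)) * real (card K)" unfolding of_nat_mult[symmetric] of_nat_le_iff .
  also have "real (card (?P \<times> ?Q)) = real (card ?P) * real (card ?Q)" by (simp only: card_cartesian_product of_nat_mult)
  also have "real (card ?P) * real (card ?Q) * real (card K) \<le>
    exp (\<tau> / 2 * sz k) * exp (\<tau> / 2 * sz k) * real (separation_number \<epsilon>' ?M (dist_inf (V k) dY))"
    using cP cells(2) cK by (intro mult_mono) simp_all
  also have "exp (\<tau> / 2 * sz k) * exp (\<tau> / 2 * sz k) = exp (\<tau> * sz k)" unfolding exp_add[symmetric] by (simp add: algebra_simps)
  finally show ?thesis using good induced_sofic[OF \<phi>0V] by (intro exI[of _ ?\<sigma>] conjI)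
qed

lemma common_positive_bound:
  assumes "finite I" "\<And>i. i \<in> I \<Longrightarrow> \<exists>e>0::real. P i e"
    and mono: "\<And>i e e'. P i e \<Longrightarrow> e' \<le> e \<Longrightarrow> P i e'"
  shows "\<exists>e>0. \<forall>i\<in>I. P i e"
  using assms(1,2)
proof (induction I)
  case empty
  show ?case by (intro exI[of _ 1]) simp
next
  case (insert i I)
  obtain a where a: "a > 0" "\<forall>i\<in>I. P i a" using insert.IH insert.prems by (metis insertCI)
  obtain b where b: "b > 0" "P i b" using insert.prems[of i] by blast
  show ?case
  proof (intro exI[of _ "min a b"] conjI ballI)
    fix j assume j: "j \<in> insert i I"
    show "P j (min a b)"
    proof (cases "j = i")
      case True
      then show ?thesis using mono[OF b(2), of "min a b"] by simp
    next
      case False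
      then have "P j a" using a(2) j by blast
      then show ?thesis by (rule mono) simp
    qed
  qed (use a b in simp)
qed

section \<open>Choice of the constants, uniformly along the sequence\<close>

context coe
begin

definition sepX :: "real \<Rightarrow> 'a set \<Rightarrow> real \<Rightarrow> nat \<Rightarrow> nat" where
  "sepX \<epsilon> F \<delta> k = separation_number \<epsilon> (sofic_maps X dX \<alpha> F \<delta> (V k) (\<sigma> k)) (dist_inf (V k) dX)"

definition sepY :: "real \<Rightarrow> 'b set \<Rightarrow> real \<Rightarrow> nat \<Rightarrow> ('b \<Rightarrow> nat \<Rightarrow> nat) \<Rightarrow> nat" where
  "sepY \<epsilon> L \<delta> k \<sigma>' = separation_number \<epsilon> (sofic_maps Y dY \<beta> L \<delta> (V k) \<sigma>') (dist_inf (V k) dY)"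

text \<open>Here \<open>S\<close> and \<epsilon>' are given before \<open>L\<close> and \<delta>.
  Then \<open>T\<close> is the set of return moves for \<open>L\<close>, connectivity supplies
  \<open>C\<close> and \<open>R\<close>, these determine \<open>F\<close>, and \<open>F\<close>
  determines \<rho> and \<delta>'.\<close>

lemma transfer_maps:
  assumes S: "finite S" "S \<subseteq> carrier G"
    and sc: "sparsely_connected (\<lambda>g. 4 / \<tau> * ln (max 1 (real (card (\<kappa> g ` topspace X))))) S (carrier G)"
    and \<epsilon>: "0 < \<epsilon>" and \<tau>: "0 < \<tau>" and \<epsilon>': "0 < \<epsilon>'"
    and unif: "\<And>s x x'. s \<in> insert \<one> S \<Longrightarrow> x \<in> topspace X \<Longrightarrow> x' \<in> topspace X \<Longrightarrow>
      dY (\<Phi> x) (\<Phi> x') < \<epsilon>' \<Longrightarrow> dX (\<alpha> s x) (\<alpha> s x') < \<epsilon> / 3"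
    and L: "finite L" "L \<subseteq> carrier H" and \<delta>: "0 < \<delta>"
  shows "\<exists>F \<delta>'. finite F \<and> F \<subseteq> carrier G \<and> 0 < \<delta>' \<and>
    (\<forall>\<^sub>F k in sequentially. 0 < sepX \<epsilon> F \<delta>' k \<longrightarrow>
      (\<exists>\<sigma>'. sofic_approximation H (V k) \<sigma>' \<and> good_approximation H L \<delta> (V k) \<sigma>' \<and>
        real (sepX \<epsilon> F \<delta>' k) \<le> exp (\<tau> * sz k) * real (sepY \<epsilon>' L \<delta> k \<sigma>')))"
proof -
  let ?S = "insert \<one> S"
  have S1: "finite ?S" "?S \<subseteq> carrier G" using S by auto
  let ?T = "returns ?S L"
  have T: "finite ?T" "?T \<subseteq> carrier G" by (rule finite_returns[OF L S1(1)], rule returns_closed[OF L(2) S1(2)])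
  obtain D where D: "0 < D" "\<And>y y'. y \<in> topspace Y \<Longrightarrow> y' \<in> topspace Y \<Longrightarrow> dY y y' \<le> D"
    using compact_bounded_dist[OF Y] by blast
  obtain c :: "'x \<Rightarrow> 'x" where c: "finite (c ` topspace X)"
    "\<And>x x'. x \<in> topspace X \<Longrightarrow> x' \<in> topspace X \<Longrightarrow> c x = c x' \<Longrightarrow> dX x x' < \<epsilon>"
    using compact_finite_cells[OF X \<epsilon>] by blast
  obtain \<eta> where \<eta>: "0 < \<eta>" and cells: "\<And>V :: nat set. finite V \<Longrightarrow>
    finite (SIGMA A:{A. A \<subseteq> V \<and> real (card A) \<le> \<eta> * real (card V)}. A \<rightarrow>\<^sub>E c ` topspace X) \<and>
    real (card (SIGMA A:{A. A \<subseteq> V \<and> real (card A) \<le> \<eta> * real (card V)}. A \<rightarrow>\<^sub>E c ` topspace X)) \<le> exp (\<tau> / 2 * real (card V))"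
    by (rule few_small_partial_maps[OF c(1) half_gt_zero[OF \<tau>]]) (rule that)
  \<comment> \<open>The admissible fraction of exceptional points: \<delta> for goodness of the
    approximation, the other term for the mean square error.\<close>
  define \<theta>' where "\<theta>' = min \<delta> (\<delta>\<^sup>2 / (2 * D\<^sup>2))"
  have \<theta>': "0 < \<theta>'" "\<theta>' \<le> \<delta>" "2 * \<theta>' * D\<^sup>2 \<le> \<delta>\<^sup>2"
  proof -
    show "0 < \<theta>'" "\<theta>' \<le> \<delta>" using \<delta> D(1) by (simp_all add: \<theta>'_def)
    have "\<theta>' * (2 * D\<^sup>2) \<le> \<delta>\<^sup>2 / (2 * D\<^sup>2) * (2 * D\<^sup>2)" by (rule mult_right_mono) (simp_all add: \<theta>'_def)
    then show "2 * \<theta>' * D\<^sup>2 \<le> \<delta>\<^sup>2" using D(1) by (simp add: mult_ac)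
  qed
  define m s where "m = real (1 + card (moves L))" and "s = real (1 + card ?S)"
  have ms: "1 \<le> m" "1 \<le> s" by (simp_all add: m_def s_def)
  \<comment> \<open>An exceptional set is a union of three sets of size \<theta> |V|, there are two
    maps, and passing to the halo and to preimages under moves multiplies by s and m; hence 6 m
    s.\<close>
  define \<theta> where "\<theta> = min \<theta>' \<eta> / (6 * m * s)"
  have \<theta>: "0 < \<theta>" "s * (3 * \<theta>) \<le> \<eta>" "m * (s * (2 * (3 * \<theta>))) \<le> \<theta>'"
  proof -
    show pos: "0 < \<theta>" using \<theta>'(1) \<eta> ms by (simp add: \<theta>_def)
    have e: "m * (s * (2 * (3 * \<theta>))) = min \<theta>' \<eta>" using ms by (simp add: \<theta>_def)
    then show "m * (s * (2 * (3 * \<theta>))) \<le> \<theta>'" by simp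
    have "0 \<le> s * (3 * \<theta>)" using pos ms by simp
    then have "s * (3 * \<theta>) \<le> m * (s * (3 * \<theta>))" using mult_right_mono[OF ms(1), of "s * (3 * \<theta>)"] by simp
    also have "m * (s * (3 * \<theta>)) \<le> \<eta>"
    proof -
      have "0 \<le> m * (s * (3 * \<theta>))" using pos ms by simp
      moreover have "2 * (m * (s * (3 * \<theta>))) = min \<theta>' \<eta>" unfolding e[symmetric] by simp
      moreover have "min \<theta>' \<eta> \<le> \<eta>" by simp
      ultimately show ?thesis by linarith
    qed
    finally show "s * (3 * \<theta>) \<le> \<eta>" .
  qed
  define \<delta>sc where "\<delta>sc = min \<theta> 1"
  have \<delta>sc: "0 < \<delta>sc" "\<delta>sc \<le> \<theta>" "\<delta>sc \<le> 1" using \<theta>(1) by (simp_all add: \<delta>sc_def)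
  \<comment> \<open>A cost of at most 2 |V| for these weights bounds the logarithm of the number of
    records by \<tau> |V| / 2. The maximum with 1 keeps the weight nonnegative where
    \<open>card\<close> is 0.\<close>
  let ?\<Upsilon> = "\<lambda>g. 4 / \<tau> * ln (max 1 (real (card (\<kappa> g ` topspace X))))"
  have "\<exists>C R. finite R \<and> R \<subseteq> carrier G \<and>
    (\<forall>\<^sub>F k in sequentially. \<exists>W E B. W \<subseteq> V k \<and> E \<subseteq> R \<times> V k \<and> B \<subseteq> V k \<and>
      real (card B) \<le> \<delta>sc * sz k \<and> (\<Sum>(g, v)\<in>E. ?\<Upsilon> g) \<le> (1 + \<delta>sc) * sz k \<and>
      (\<forall>v\<in>V k - B. \<exists>s\<in>S. \<exists>w\<in>W. v = \<sigma> k s w) \<and>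
      (\<forall>w\<in>W - B. \<forall>t\<in>?T. \<sigma> k t w \<in> W \<longrightarrow> (w, \<sigma> k t w) \<in> link (\<sigma> k) E ^^ C))"
    using sc[unfolded sparsely_connected_def, rule_format, of ?T \<delta>sc] T \<delta>sc(1) by blast
  then obtain C R where R: "finite R" "R \<subseteq> carrier G" and scR: "\<forall>\<^sub>F k in sequentially. \<exists>W E B. W \<subseteq> V k \<and> E \<subseteq> R \<times> V k \<and> B \<subseteq> V k \<and>
      real (card B) \<le> \<delta>sc * sz k \<and> (\<Sum>(g, v)\<in>E. ?\<Upsilon> g) \<le> (1 + \<delta>sc) * sz k \<and>
      (\<forall>v\<in>V k - B. \<exists>s\<in>S. \<exists>w\<in>W. v = \<sigma> k s w) \<and>
      (\<forall>w\<in>W - B. \<forall>t\<in>?T. \<sigma> k t w \<in> W \<longrightarrow> (w, \<sigma> k t w) \<in> link (\<sigma> k) E ^^ C)"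
    by (elim exE conjE)
  define Q where "Q = R \<union> m_inv G ` R"
  have Q: "finite Q" "Q \<subseteq> carrier G" using R by (auto simp: Q_def)
  define F where "F = word_ball Q C \<union> Q \<union> ?S \<union> ?T \<union> moves L \<union> m_inv G ` moves L"
  have mL: "finite (moves L)" "moves L \<subseteq> carrier G" by (rule finite_moves[OF L], rule moves_closed[OF L(2)])
  have F: "finite F" unfolding F_def using finite_word_ball[OF Q(1)] Q(1) S1(1) T(1) mL(1) by simp
  have Fc: "F \<subseteq> carrier G" unfolding F_def using word_ball_closed[OF Q(2)] Q(2) S1(2) T(2) mL(2) by auto
  define I where "I = doubled L \<union> m_inv H ` doubled L"
  have I: "finite I" "I \<subseteq> carrier H" using finite_doubled[OF L(1)] doubled_closed[OF L(2)] by (auto simp: I_def)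
  let ?K = "\<Union>s\<in>?S. \<kappa> s ` topspace X"
  have K: "finite ?K" "?K \<subseteq> carrier H"
  proof -
    show "finite ?K" by (rule finite_UN_I[OF S1(1)]) (use compact_discrete_image_finite(1)[OF X(1) \<kappa>_cont] S1(2) in blast)
    show "?K \<subseteq> carrier H" using S1(2) by auto
  qed
  let ?P1 = "\<lambda>g e. \<forall>x\<in>topspace X. \<forall>x'\<in>topspace X. dX x x' < e \<longrightarrow> \<kappa> g x = \<kappa> g x'"
  let ?P2 = "\<lambda>t e. \<forall>x\<in>topspace X. \<forall>x'\<in>topspace X. dX x x' < e \<longrightarrow> lam t (\<Phi> x) = lam t (\<Phi> x')"
  let ?P3 = "\<lambda>h e. \<forall>x\<in>topspace X. \<forall>x'\<in>topspace X. dX x x' < e \<longrightarrow> dY (\<beta> h (\<Phi> x)) (\<beta> h (\<Phi> x')) < \<delta> / 2"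
  have "\<exists>e>0. \<forall>g\<in>F. ?P1 g e"
  proof (rule common_positive_bound[OF F])
    fix g assume "g \<in> F"
    then have "g \<in> carrier G" using Fc by blast
    then show "\<exists>e>0. ?P1 g e" using compact_locally_constant[OF X \<kappa>_cont] by metis
  qed (meson less_le_trans)
  then obtain e1 where e1: "0 < e1" "\<forall>g\<in>F. ?P1 g e1" by blast
  have "\<exists>e>0. \<forall>t\<in>I. ?P2 t e"
  proof (rule common_positive_bound[OF I(1)])
    fix t assume "t \<in> I"
    then have "t \<in> carrier H" using I(2) by blast
    then have "continuous_map X (discrete_topology (carrier G)) (lam t \<circ> \<Phi>)"
      by (rule continuous_map_compose[OF \<Phi>_cont lam_cont])
    from compact_locally_constant[OF X this] show "\<exists>e>0. ?P2 t e" unfolding o_apply by metis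
  qed (meson less_le_trans)
  then obtain e2 where e2: "0 < e2" "\<forall>t\<in>I. ?P2 t e2" by blast
  have "\<exists>e>0. \<forall>h\<in>?K. ?P3 h e"
  proof (rule common_positive_bound[OF K(1)])
    fix h assume "h \<in> ?K"
    then have "h \<in> carrier H" using K(2) by blast
    then have "continuous_map X Y (\<beta> h \<circ> \<Phi>)"
      by (rule continuous_map_compose[OF \<Phi>_cont \<beta>_cont])
    from compact_uniformly_continuous[OF X Y(2) this half_gt_zero[OF \<delta>]] show "\<exists>e>0. ?P3 h e" unfolding o_apply by metis
  qed (meson less_le_trans)
  then obtain e3 where e3: "0 < e3" "\<forall>h\<in>?K. ?P3 h e3" by blast
  define \<rho> where "\<rho> = min (min e1 e2) (min e3 (\<epsilon> / 3))"
  have \<rho>: "0 < \<rho>" "\<rho> \<le> e1" "\<rho> \<le> e2" "\<rho> \<le> e3" "\<rho> \<le> \<epsilon> / 3" using e1 e2 e3 \<epsilon> by (auto simp: \<rho>_def)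
  \<comment> \<open>Solves the condition of \<open>card_defect_le\<close>, the Chebyshev bound over
    all elements of \<open>F\<close>.\<close>
  define \<delta>' where "\<delta>' = \<rho> * sqrt (\<theta> / (real (card F) + 1))"
  have \<delta>': "0 < \<delta>'" using \<rho>(1) \<theta>(1) by (simp add: \<delta>'_def)
  have "\<delta>'\<^sup>2 = \<rho>\<^sup>2 * (\<theta> / (real (card F) + 1))" using \<theta>(1) by (simp add: \<delta>'_def power_mult_distrib)
  then have \<delta>'2: "\<delta>'\<^sup>2 * (real (card F) + 1) \<le> \<theta> * \<rho>\<^sup>2" by (simp add: field_simps)
  have ev: "\<forall>\<^sub>F k in sequentially. 0 < sepX \<epsilon> F \<delta>' k \<longrightarrow>
      (\<exists>\<sigma>'. sofic_approximation H (V k) \<sigma>' \<and> good_approximation H L \<delta> (V k) \<sigma>' \<and>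
        real (sepX \<epsilon> F \<delta>' k) \<le> exp (\<tau> * sz k) * real (sepY \<epsilon>' L \<delta> k \<sigma>'))"
    using scR eventually_unfaithful_small[OF F Fc \<theta>(1)]
  proof eventually_elim
    case (elim k)
    obtain W E B where W: "W \<subseteq> V k" and E: "E \<subseteq> R \<times> V k" and B: "B \<subseteq> V k" "real (card B) \<le> \<delta>sc * sz k"
      and sumE: "(\<Sum>(g, v)\<in>E. ?\<Upsilon> g) \<le> (1 + \<delta>sc) * sz k"
      and cover: "\<forall>v\<in>V k - B. \<exists>s\<in>S. \<exists>w\<in>W. v = \<sigma> k s w"
      and linked: "\<forall>w\<in>W - B. \<forall>t\<in>?T. \<sigma> k t w \<in> W \<longrightarrow> (w, \<sigma> k t w) \<in> link (\<sigma> k) E ^^ C"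
      using elim(1) by (elim exE conjE)
    interpret step: coe_step G \<Sigma> H X Y dX dY \<alpha> \<beta> \<Phi> \<Psi> \<kappa> lam k C ?S F R L \<rho> W B E
    proof unfold_locales
      show "\<kappa> g x = \<kappa> g x'" if "g \<in> F" "x \<in> topspace X" "x' \<in> topspace X" "dX x x' < \<rho>" for g x x'
        using e1(2) that \<rho>(2) by (meson less_le_trans)
      show "lam t (\<Phi> x) = lam t (\<Phi> x')"
        if "t \<in> doubled L \<union> m_inv H ` doubled L" "x \<in> topspace X" "x' \<in> topspace X" "dX x x' < \<rho>" for t x x'
        using e2(2)[folded I_def] that[folded I_def] \<rho>(3) by (meson less_le_trans)
      show "\<exists>s\<in>?S. \<exists>w\<in>W. v = \<sigma> k s w" if "v \<in> V k - B" for v using cover that by blast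
      show "(w, \<sigma> k t w) \<in> link (\<sigma> k) E ^^ C" if "w \<in> W - B" "t \<in> ?T" "\<sigma> k t w \<in> W" for w t using linked that by blast
    qed (use S1 L Fc R W E B in \<open>auto simp: F_def Q_def\<close>)
    show ?case
    proof
      assume pos: "0 < sepX \<epsilon> F \<delta>' k"
      have "\<exists>\<Omega>\<subseteq>sofic_maps X dX \<alpha> F \<delta>' (V k) (\<sigma> k). finite \<Omega> \<and> separated \<epsilon> (dist_inf (V k) dX) \<Omega> \<and> card \<Omega> = sepX \<epsilon> F \<delta>' k"
        unfolding sepX_def by (rule separation_number_facts(1)[OF X \<epsilon> finite_V V_nonempty sofic_maps_subset])
      then obtain \<Omega> where \<Omega>: "\<Omega> \<subseteq> sofic_maps X dX \<alpha> F \<delta>' (V k) (\<sigma> k)" "finite \<Omega>"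
        "separated \<epsilon> (dist_inf (V k) dX) \<Omega>" "card \<Omega> = sepX \<epsilon> F \<delta>' k" by (elim exE conjE)
      have \<Omega>0: "\<Omega> \<noteq> {}" using pos \<Omega>(4) by auto
      have small: "real (card (step.N \<phi>)) \<le> 3 * \<theta> * sz k" if "\<phi> \<in> \<Omega>" for \<phi>
      proof -
        have "real (card (step.N \<phi>)) \<le> real (card (unfaithful k F) + card (defect k F \<rho> \<phi>) + card B)"
          unfolding of_nat_le_iff step.N_def
          by (rule order_trans[OF card_Un_le]) (use card_Un_le[of "unfaithful k F" "defect k F \<rho> \<phi>"] in simp)
        moreover have "real (card (defect k F \<rho> \<phi>)) \<le> \<theta> * sz k"
          by (rule card_defect_le[OF F _ \<delta>'2 \<rho>(1)]) (use that \<Omega>(1) in blast)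
        moreover have "real (card B) \<le> \<theta> * sz k"
          by (rule order_trans[OF B(2) mult_right_mono[OF \<delta>sc(2)]]) simp
        ultimately show ?thesis using elim(2) by simp
      qed
      have records: "(\<Sum>(g, v)\<in>E. ln (real (card (\<kappa> g ` topspace X)))) \<le> \<tau> / 2 * sz k"
      proof -
        have "(\<Sum>(g, v)\<in>E. ln (real (card (\<kappa> g ` topspace X)))) \<le> (\<Sum>(g, v)\<in>E. \<tau> / 4 * ?\<Upsilon> g)"
        proof (rule sum_mono, clarify)
          fix g v
          have "ln (real n) \<le> ln (max 1 (real n))" for n :: nat by (cases "n = 0") (simp_all add: max_def)
          then show "ln (real (card (\<kappa> g ` topspace X))) \<le> \<tau> / 4 * ?\<Upsilon> g" using \<tau> by simp
        qed
        also have "\<dots> = \<tau> / 4 * (\<Sum>(g, v)\<in>E. ?\<Upsilon> g)" by (simp add: sum_distrib_left case_prod_unfold)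
        also have "\<dots> \<le> \<tau> / 4 * ((1 + \<delta>sc) * sz k)" by (rule mult_left_mono[OF sumE]) (use \<tau> in simp)
        also have "\<dots> \<le> \<tau> / 4 * (2 * sz k)" using \<delta>sc(3) \<tau> by (intro mult_left_mono mult_right_mono) simp_all
        finally show ?thesis by simp
      qed
      have \<theta>m: "real (1 + card (moves L)) * (real (1 + card ?S) * (2 * (3 * \<theta>))) \<le> \<theta>'" "real (1 + card ?S) * (3 * \<theta>) \<le> \<eta>"
        using \<theta>(3,2) unfolding m_def s_def .
      have \<rho>\<beta>: "dY (\<beta> (\<kappa> q z) (\<Phi> x)) (\<beta> (\<kappa> q z) (\<Phi> x')) < \<delta> / 2"
        if "q \<in> ?S" "z \<in> topspace X" "x \<in> topspace X" "x' \<in> topspace X" "dX x x' < \<rho>" for q z x x'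
      proof -
        have "\<kappa> q z \<in> ?K" using that(1,2) by blast
        from bspec[OF e3(2) this] show ?thesis using that \<rho>(4) by (meson less_le_trans)
      qed
      have \<Omega>E: "\<Omega> \<subseteq> V k \<rightarrow>\<^sub>E topspace X" by (rule subset_trans[OF \<Omega>(1) sofic_maps_subset])
      have "0 \<le> 3 * \<theta>" using \<theta>(1) by simp
      note cnt = step.transfer_count[OF \<Omega>(2) \<Omega>0 \<Omega>E \<Omega>(3) small \<theta>m(2,1) this c
        conjunct1[OF cells[OF finite_V]] conjunct2[OF cells[OF finite_V]] R(1) records \<rho>\<beta> D(2) \<delta> \<theta>'(3,2) \<rho>(5) \<epsilon>' unif]
      show "\<exists>\<sigma>'. sofic_approximation H (V k) \<sigma>' \<and> good_approximation H L \<delta> (V k) \<sigma>' \<and>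
        real (sepX \<epsilon> F \<delta>' k) \<le> exp (\<tau> * sz k) * real (sepY \<epsilon>' L \<delta> k \<sigma>')"
        using cnt unfolding sepY_def \<Omega>(4) by blast
    qed
  qed
  show ?thesis using F Fc \<delta>' ev by (intro exI conjI)
qed

text \<open>\<open>S\<close> comes from weights that depend only on \<kappa> and \<tau>, so the
  modulus of continuity \<epsilon>' taken from \<open>S\<close> is the same for all \<open>L\<close>
  and \<delta>.\<close>

lemma ex_transfer:
  assumes sc: "\<And>\<Upsilon> :: 'a \<Rightarrow> real. (\<And>g. 0 \<le> \<Upsilon> g) \<Longrightarrow> \<exists>S. finite S \<and> S \<subseteq> carrier G \<and> sparsely_connected \<Upsilon> S (carrier G)"
    and \<epsilon>: "0 < \<epsilon>" and \<tau>: "0 < \<tau>"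
  shows "\<exists>\<epsilon>'>0. \<forall>L \<delta>. finite L \<and> L \<subseteq> carrier H \<and> 0 < \<delta> \<longrightarrow> (\<exists>F \<delta>'. finite F \<and> F \<subseteq> carrier G \<and> 0 < \<delta>' \<and>
    (\<forall>\<^sub>F k in sequentially. 0 < sepX \<epsilon> F \<delta>' k \<longrightarrow>
      (\<exists>\<sigma>'. sofic_approximation H (V k) \<sigma>' \<and> good_approximation H L \<delta> (V k) \<sigma>' \<and>
        real (sepX \<epsilon> F \<delta>' k) \<le> exp (\<tau> * sz k) * real (sepY \<epsilon>' L \<delta> k \<sigma>'))))"
proof -
  let ?\<Upsilon> = "\<lambda>g. 4 / \<tau> * ln (max 1 (real (card (\<kappa> g ` topspace X))))"
  have "0 \<le> ?\<Upsilon> g" for g using \<tau> by simp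
  then obtain S where S: "finite S" "S \<subseteq> carrier G" "sparsely_connected ?\<Upsilon> S (carrier G)" using sc[of ?\<Upsilon>] by blast
  let ?P = "\<lambda>s e. \<forall>y\<in>topspace Y. \<forall>y'\<in>topspace Y. dY y y' < e \<longrightarrow> dX (\<alpha> s (\<Psi> y)) (\<alpha> s (\<Psi> y')) < \<epsilon> / 3"
  have "\<exists>e>0. \<forall>s\<in>insert \<one> S. ?P s e"
  proof (rule common_positive_bound)
    show "finite (insert \<one> S)" using S(1) by simp
    fix s assume "s \<in> insert \<one> S"
    then have "s \<in> carrier G" using S(2) by auto
    then have "continuous_map Y X (\<alpha> s \<circ> \<Psi>)" by (rule continuous_map_compose[OF \<Psi>_cont \<alpha>_cont])
    moreover have "0 < \<epsilon> / 3" using \<epsilon> by simp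
    ultimately show "\<exists>e>0. ?P s e" using compact_uniformly_continuous[OF Y X(2), of "\<alpha> s \<circ> \<Psi>" "\<epsilon> / 3"] unfolding o_apply by metis
  qed (meson less_le_trans)
  then obtain e where e: "0 < e" "\<forall>s\<in>insert \<one> S. ?P s e" by blast
  have unif: "dX (\<alpha> s x) (\<alpha> s x') < \<epsilon> / 3"
    if "s \<in> insert \<one> S" "x \<in> topspace X" "x' \<in> topspace X" "dY (\<Phi> x) (\<Phi> x') < e" for s x x'
    using bspec[OF e(2) that(1), rule_format, OF \<Phi>_in[OF that(2)] \<Phi>_in[OF that(3)] that(4)] that(2,3) by simp
  show ?thesis
  proof (intro exI[of _ e] conjI allI impI)
    show "0 < e" by (rule e(1))
    fix L \<delta> assume "finite L \<and> L \<subseteq> carrier H \<and> 0 < (\<delta> :: real)"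
    then show "\<exists>F \<delta>'. finite F \<and> F \<subseteq> carrier G \<and> 0 < \<delta>' \<and>
    (\<forall>\<^sub>F k in sequentially. 0 < sepX \<epsilon> F \<delta>' k \<longrightarrow>
      (\<exists>\<sigma>'. sofic_approximation H (V k) \<sigma>' \<and> good_approximation H L \<delta> (V k) \<sigma>' \<and>
        real (sepX \<epsilon> F \<delta>' k) \<le> exp (\<tau> * sz k) * real (sepY e L \<delta> k \<sigma>')))"
      by (elim conjE) (rule transfer_maps[OF S \<epsilon> \<tau> e(1) unif])
  qed
qed

end

section \<open>Comparison of entropies\<close>

lemma less_log_card:
  assumes "0 < z" "ereal c < ereal (1 / z) * log_card n"
  shows "0 < n" "exp (c * z) < real n"
proof -
  show n: "0 < n"
  proof (rule ccontr)
    assume "\<not> 0 < n"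
    then show False using assms by (simp add: log_card_def)
  qed
  then have "c < ln (real n) / z" using assms(2) by (simp add: log_card_def)
  then have "c * z < ln (real n)" using assms(1) by (simp add: less_divide_eq)
  then show "exp (c * z) < real n" using n by (metis exp_less_cancel_iff exp_ln of_nat_0_less_iff)
qed

lemma log_card_ge:
  assumes "0 < z" "exp (c * z) \<le> real n"
  shows "ereal c \<le> ereal (1 / z) * log_card n"
proof -
  have n: "0 < real n" using assms(2) exp_gt_zero[of "c * z"] by linarith
  then have "c * z \<le> ln (real n)" using assms(2) by (simp add: ln_ge_iff)
  then have "c \<le> ln (real n) / z" using assms(1) by (simp add: le_divide_eq)
  then show ?thesis using n by (simp add: log_card_def)
qed

lemma good_approximation_mono:
  "good_approximation H L' \<delta>' V \<sigma> \<Longrightarrow> L \<subseteq> L' \<Longrightarrow> \<delta>' \<le> \<delta> \<Longrightarrow> good_approximation H L \<delta> V \<sigma>"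
  unfolding good_approximation_def by (smt (verit) subsetD)

section \<open>Assembling a sofic approximation sequence of \<open>H\<close>\<close>

context coe
begin

lemma frequently_many_maps:
  assumes c: "ereal c < (INF F\<in>{F. finite F \<and> F \<subseteq> carrier G}. INF \<delta>\<in>{0<..}.
        limsup (\<lambda>k. ereal (1 / sz k) * log_card (sepX \<epsilon> F \<delta> k)))"
    and F: "finite F" "F \<subseteq> carrier G" and \<delta>: "0 < \<delta>"
  shows "\<exists>\<^sub>F k in sequentially. ereal c < ereal (1 / sz k) * log_card (sepX \<epsilon> F \<delta> k)"
proof -
  have "(INF F\<in>{F. finite F \<and> F \<subseteq> carrier G}. INF \<delta>\<in>{0<..}.
        limsup (\<lambda>k. ereal (1 / sz k) * log_card (sepX \<epsilon> F \<delta> k))) \<le> (INF \<delta>\<in>{0<..}.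
        limsup (\<lambda>k. ereal (1 / sz k) * log_card (sepX \<epsilon> F \<delta> k)))" by (rule INF_lower) (use F in simp)
  also have "\<dots> \<le> limsup (\<lambda>k. ereal (1 / sz k) * log_card (sepX \<epsilon> F \<delta> k))" by (rule INF_lower) (use \<delta> in simp)
  finally have less: "ereal c < limsup (\<lambda>k. ereal (1 / sz k) * log_card (sepX \<epsilon> F \<delta> k))" using c by (rule less_le_trans[rotated])
  show ?thesis
  proof (rule ccontr)
    assume "\<not> ?thesis"
    then have "\<forall>\<^sub>F k in sequentially. ereal (1 / sz k) * log_card (sepX \<epsilon> F \<delta> k) \<le> ereal c"
      by (simp add: not_frequently not_less)
    then have "limsup (\<lambda>k. ereal (1 / sz k) * log_card (sepX \<epsilon> F \<delta> k)) \<le> ereal c" by (rule Limsup_bounded)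
    then show False using less by simp
  qed
qed

text \<open>For an exhaustion of \<open>H\<close> by finite sets L n with tolerances 1/(n + 1), each
  n borrows one model of \<open>G\<close> carrying many maps and uses the approximation of
  \<open>H\<close> transferred to it. The scale \<epsilon>' does not depend on n, so the lower bound
  survives in the entropy of the resulting sequence.\<close>

lemma entropy_le_max:
  assumes sc: "\<And>\<Upsilon> :: 'a \<Rightarrow> real. (\<And>g. 0 \<le> \<Upsilon> g) \<Longrightarrow> \<exists>S. finite S \<and> S \<subseteq> carrier G \<and> sparsely_connected \<Upsilon> S (carrier G)"
    and H: "countable (carrier H)"
  shows "sofic_entropy G X dX \<alpha> \<Sigma> \<le> max_sofic_entropy H Y dY \<beta>"
proof (rule dense_le)
  fix e assume e: "e < sofic_entropy G X dX \<alpha> \<Sigma>"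
  show "e \<le> max_sofic_entropy H Y dY \<beta>"
  proof (cases e)
    case (real c)
    obtain c1 where c1: "e < ereal c1" "ereal c1 < sofic_entropy G X dX \<alpha> \<Sigma>" using ereal_dense2[OF e] by blast
    \<comment> \<open>The gap below the entropy of \<open>G\<close> absorbs the loss of the
      pigeonhole argument.\<close>
    define \<tau> where "\<tau> = c1 - c"
    have \<tau>: "0 < \<tau>" using c1(1) real by (simp add: \<tau>_def)
    obtain \<epsilon> where \<epsilon>: "0 < \<epsilon>" and many: "ereal c1 < (INF F\<in>{F. finite F \<and> F \<subseteq> carrier G}. INF \<delta>\<in>{0<..}.
        limsup (\<lambda>k. ereal (1 / sz k) * log_card (sepX \<epsilon> F \<delta> k)))"
      using c1(2) unfolding sofic_entropy_def less_SUP_iff sepX_def[symmetric] by auto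
    obtain \<epsilon>' where \<epsilon>': "0 < \<epsilon>'" and tr: "\<And>L \<delta>. finite L \<and> L \<subseteq> carrier H \<and> 0 < \<delta> \<Longrightarrow> \<exists>F \<delta>'. finite F \<and> F \<subseteq> carrier G \<and> 0 < \<delta>' \<and>
    (\<forall>\<^sub>F k in sequentially. 0 < sepX \<epsilon> F \<delta>' k \<longrightarrow>
      (\<exists>\<sigma>'. sofic_approximation H (V k) \<sigma>' \<and> good_approximation H L \<delta> (V k) \<sigma>' \<and>
        real (sepX \<epsilon> F \<delta>' k) \<le> exp (\<tau> * sz k) * real (sepY \<epsilon>' L \<delta> k \<sigma>')))"
      using ex_transfer[OF sc \<epsilon> \<tau>] by blast
    have step: "\<exists>k \<sigma>'. sofic_approximation H (V k) \<sigma>' \<and> good_approximation H L \<delta> (V k) \<sigma>' \<and>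
      exp (c * sz k) \<le> real (sepY \<epsilon>' L \<delta> k \<sigma>')" if L: "finite L" "L \<subseteq> carrier H" "0 < \<delta>" for L \<delta>
    proof -
      obtain F \<delta>' where F: "finite F" "F \<subseteq> carrier G" "0 < \<delta>'" and ev: "\<forall>\<^sub>F k in sequentially. 0 < sepX \<epsilon> F \<delta>' k \<longrightarrow>
        (\<exists>\<sigma>'. sofic_approximation H (V k) \<sigma>' \<and> good_approximation H L \<delta> (V k) \<sigma>' \<and>
          real (sepX \<epsilon> F \<delta>' k) \<le> exp (\<tau> * sz k) * real (sepY \<epsilon>' L \<delta> k \<sigma>'))"
        using tr[OF conjI[OF L(1) conjI[OF L(2,3)]]] by (elim exE conjE)
      \<comment> \<open>An upper limit above \<open>c1\<close> gives arbitrarily late indices with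
        many maps, and late indices admit the transfer.\<close>
      obtain k where k: "ereal c1 < ereal (1 / sz k) * log_card (sepX \<epsilon> F \<delta>' k)"
        "0 < sepX \<epsilon> F \<delta>' k \<longrightarrow>
        (\<exists>\<sigma>'. sofic_approximation H (V k) \<sigma>' \<and> good_approximation H L \<delta> (V k) \<sigma>' \<and>
          real (sepX \<epsilon> F \<delta>' k) \<le> exp (\<tau> * sz k) * real (sepY \<epsilon>' L \<delta> k \<sigma>'))"
        using frequently_ex[OF frequently_eventually_conj[OF frequently_many_maps[OF many F] ev]] by (elim exE conjE)
      note pos = less_log_card[OF sz_pos k(1)]
      obtain \<sigma>' where \<sigma>': "sofic_approximation H (V k) \<sigma>'" "good_approximation H L \<delta> (V k) \<sigma>'"
        "real (sepX \<epsilon> F \<delta>' k) \<le> exp (\<tau> * sz k) * real (sepY \<epsilon>' L \<delta> k \<sigma>')" using mp[OF k(2) pos(1)] by (elim exE conjE)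
      have "c1 * sz k = \<tau> * sz k + c * sz k" by (simp add: \<tau>_def algebra_simps)
      then have "exp (\<tau> * sz k) * exp (c * sz k) = exp (c1 * sz k)" by (simp only: exp_add)
      then have "exp (\<tau> * sz k) * exp (c * sz k) \<le> exp (\<tau> * sz k) * real (sepY \<epsilon>' L \<delta> k \<sigma>')" using pos(2) \<sigma>'(3) by linarith
      then have "exp (c * sz k) \<le> real (sepY \<epsilon>' L \<delta> k \<sigma>')" by (rule mult_left_le_imp_le) simp
      then show ?thesis using \<sigma>'(1,2) by blast
    qed
    define L where "L n = from_nat_into (carrier H) ` {..n :: nat}" for n
    have H0: "carrier H \<noteq> {}" using H.one_closed by blast
    have L: "finite (L n)" "L n \<subseteq> carrier H" for n using from_nat_into[OF H0] by (auto simp: L_def)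
    have dn: "0 < 1 / (real n + 1)" for n by simp
    obtain \<Sigma>' :: "'b sofic_seq" where \<Sigma>': "\<And>n. sofic_approximation H (fst (\<Sigma>' n)) (snd (\<Sigma>' n)) \<and>
      good_approximation H (L n) (1 / (real n + 1)) (fst (\<Sigma>' n)) (snd (\<Sigma>' n)) \<and>
      (\<exists>k. fst (\<Sigma>' n) = V k \<and> exp (c * sz k) \<le> real (sepY \<epsilon>' (L n) (1 / (real n + 1)) k (snd (\<Sigma>' n))))"
    proof -
      have ex: "\<exists>p. sofic_approximation H (fst p) (snd p) \<and>
        good_approximation H (L n) (1 / (real n + 1)) (fst p) (snd p) \<and>
        (\<exists>k. fst p = V k \<and> exp (c * sz k) \<le> real (sepY \<epsilon>' (L n) (1 / (real n + 1)) k (snd p)))" for n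
      proof -
        obtain k \<sigma>' where "sofic_approximation H (V k) \<sigma>'" "good_approximation H (L n) (1 / (real n + 1)) (V k) \<sigma>'"
          "exp (c * sz k) \<le> real (sepY \<epsilon>' (L n) (1 / (real n + 1)) k \<sigma>')" using step[OF L(1)[of n] L(2)[of n] dn[of n]] by (elim exE conjE)
        then show ?thesis by (intro exI[of _ "(V k, \<sigma>')"]) auto
      qed
      have "\<forall>n. \<exists>p. sofic_approximation H (fst p) (snd p) \<and>
        good_approximation H (L n) (1 / (real n + 1)) (fst p) (snd p) \<and>
        (\<exists>k. fst p = V k \<and> exp (c * sz k) \<le> real (sepY \<epsilon>' (L n) (1 / (real n + 1)) k (snd p)))" using ex by (rule allI)
      from choice[OF this] obtain f where "\<forall>n. sofic_approximation H (fst (f n)) (snd (f n)) \<and>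
        good_approximation H (L n) (1 / (real n + 1)) (fst (f n)) (snd (f n)) \<and>
        (\<exists>k. fst (f n) = V k \<and> exp (c * sz k) \<le> real (sepY \<epsilon>' (L n) (1 / (real n + 1)) k (snd (f n))))" by (elim exE)
      then show thesis by (intro that[of f]) (rule spec)
    qed
    have late: "\<forall>\<^sub>F n in sequentially. F \<subseteq> L n \<and> 1 / (real n + 1) \<le> \<delta>" if F: "finite F" "F \<subseteq> carrier H" "0 < \<delta>" for F \<delta>
    proof (rule eventually_conj)
      have "F \<subseteq> from_nat_into (carrier H) ` UNIV" using F(2) range_from_nat_into[OF H0 H] by simp
      then obtain C where C: "finite C" "F = from_nat_into (carrier H) ` C" using finite_subset_image[OF F(1)] by blast
      show "\<forall>\<^sub>F n in sequentially. F \<subseteq> L n"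
        by (rule eventually_sequentiallyI[of "Max (insert 0 C)"]) (use C in \<open>auto simp: L_def\<close>)
      obtain m :: nat where m: "1 / \<delta> \<le> real m" using real_arch_simple by blast
      show "\<forall>\<^sub>F n in sequentially. 1 / (real n + 1) \<le> \<delta>"
      proof (rule eventually_sequentiallyI[of m])
        fix n assume "m \<le> n"
        then have "1 / \<delta> \<le> real n + 1" using m by linarith
        then show "1 / (real n + 1) \<le> \<delta>" using F(3) by (simp add: field_simps)
      qed
    qed
    have sofic': "sofic_approximation_sequence H \<Sigma>'"
      unfolding sofic_approximation_sequence_def
    proof (intro conjI allI impI)
      show "sofic_approximation H (fst (\<Sigma>' k)) (snd (\<Sigma>' k))" for k using \<Sigma>' by blast
      fix F \<delta> assume "finite F \<and> F \<subseteq> carrier H \<and> 0 < (\<delta> :: real)"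
      then have "\<forall>\<^sub>F n in sequentially. F \<subseteq> L n \<and> 1 / (real n + 1) \<le> \<delta>" using late by blast
      then show "\<forall>\<^sub>F k in sequentially. good_approximation H F \<delta> (fst (\<Sigma>' k)) (snd (\<Sigma>' k))"
      proof eventually_elim
        case (elim n)
        then show ?case using \<Sigma>'[of n] good_approximation_mono by blast
      qed
    qed
    have "ereal c \<le> (INF F\<in>{F. finite F \<and> F \<subseteq> carrier H}. INF \<delta>\<in>{0<..}.
        limsup (\<lambda>k. ereal (1 / real (card (fst (\<Sigma>' k)))) *
          log_card (separation_number \<epsilon>'
            (sofic_maps Y dY \<beta> F \<delta> (fst (\<Sigma>' k)) (snd (\<Sigma>' k))) (dist_inf (fst (\<Sigma>' k)) dY))))"
    proof (intro INF_greatest)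
      fix F and \<delta> :: real assume F: "F \<in> {F. finite F \<and> F \<subseteq> carrier H}" and \<delta>: "\<delta> \<in> {0<..}"
      let ?f = "\<lambda>n. ereal (1 / real (card (fst (\<Sigma>' n)))) *
          log_card (separation_number \<epsilon>'
            (sofic_maps Y dY \<beta> F \<delta> (fst (\<Sigma>' n)) (snd (\<Sigma>' n))) (dist_inf (fst (\<Sigma>' n)) dY))"
      have "\<forall>\<^sub>F n in sequentially. F \<subseteq> L n \<and> 1 / (real n + 1) \<le> \<delta>" by (rule late) (use F \<delta> in simp_all)
      then have "\<forall>\<^sub>F n in sequentially. ereal c \<le> ?f n"
      proof eventually_elim
        case (elim n)
        obtain k where k: "fst (\<Sigma>' n) = V k" "exp (c * sz k) \<le> real (sepY \<epsilon>' (L n) (1 / (real n + 1)) k (snd (\<Sigma>' n)))"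
          using \<Sigma>'[of n] by (elim conjE exE)
        have "sepY \<epsilon>' (L n) (1 / (real n + 1)) k (snd (\<Sigma>' n)) \<le> sepY \<epsilon>' F \<delta> k (snd (\<Sigma>' n))"
          unfolding sepY_def
          by (rule separation_number_mono[OF Y \<epsilon>' finite_V V_nonempty sofic_maps_mono sofic_maps_subset]) (use elim in simp_all)
        then have "exp (c * sz k) \<le> real (sepY \<epsilon>' F \<delta> k (snd (\<Sigma>' n)))" using k(2) by linarith
        then show ?case unfolding k(1) sepY_def by (rule log_card_ge[OF sz_pos])
      qed
      then have "ereal c \<le> liminf ?f" by (rule Liminf_bounded)
      also have "\<dots> \<le> limsup ?f" by (rule Liminf_le_Limsup) simp
      finally show "ereal c \<le> limsup ?f" .
    qed
    also have "\<dots> \<le> sofic_entropy H Y dY \<beta> \<Sigma>'" unfolding sofic_entropy_def by (rule SUP_upper) (use \<epsilon>' in simp)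
    also have "\<dots> \<le> max_sofic_entropy H Y dY \<beta>" unfolding max_sofic_entropy_def by (rule SUP_upper) (use sofic' in simp)
    finally show ?thesis using real by simp
  next
    case PInf
    then show ?thesis using e by simp
  next
    case MInf
    then show ?thesis by simp
  qed
qed

end

text \<open>Both sides of each identity required by the locale are locally constant and move every
  point to the same place, so \<open>topologically_free_eq\<close> applies: over \<open>Y\<close>
  for \<kappa>, over \<open>X\<close> for \<open>lam\<close>.\<close>

lemma coe_entropy_le:
  fixes G :: "('a, 'm) monoid_scheme" (structure) and H :: "('b, 'n) monoid_scheme"
    and X :: "'x topology" and Y :: "'y topology"
  assumes G: "sofic_sequence G \<Sigma>" and H: "group H" "countable (carrier H)"
    and X: "compact_space X" "compatible_metric X dX" and Y: "compact_space Y" "compatible_metric Y dY"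
    and \<alpha>: "continuous_action G X \<alpha>" "topologically_free G X \<alpha>"
    and \<beta>: "continuous_action H Y \<beta>" "topologically_free H Y \<beta>"
    and oe: "continuously_orbit_equivalent G X \<alpha> H Y \<beta>"
    and sc: "\<And>\<Upsilon> :: 'a \<Rightarrow> real. (\<And>g. 0 \<le> \<Upsilon> g) \<Longrightarrow>
      \<exists>S. finite S \<and> S \<subseteq> carrier G \<and> sofic_sequence.sparsely_connected G \<Sigma> \<Upsilon> S (carrier G)"
  shows "sofic_entropy G X dX \<alpha> \<Sigma> \<le> max_sofic_entropy H Y dY \<beta>"
proof -
  interpret sofic_sequence G \<Sigma> by (rule G)
  interpret H: group H by (rule H)
  interpret A: group_action G "topspace X" \<alpha> using \<alpha>(1) by (simp add: continuous_action_def)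
  interpret B: group_action H "topspace Y" \<beta> using \<beta>(1) by (simp add: continuous_action_def)
  obtain \<Phi> \<Psi> \<kappa>' l where hom: "homeomorphic_maps X Y \<Phi> \<Psi>"
    and \<kappa>'c: "continuous_map (prod_topology (discrete_topology (carrier G)) X) (discrete_topology (carrier H)) \<kappa>'"
    and lc: "continuous_map (prod_topology (discrete_topology (carrier H)) Y) (discrete_topology (carrier G)) l"
    and \<kappa>'eq: "\<forall>g\<in>carrier G. \<forall>x\<in>topspace X. \<Phi> (\<alpha> g x) = \<beta> (\<kappa>' (g, x)) (\<Phi> x)"
    and leq: "\<forall>t\<in>carrier H. \<forall>y\<in>topspace Y. \<Psi> (\<beta> t y) = \<alpha> (l (t, y)) (\<Psi> y)"
    using oe unfolding continuously_orbit_equivalent_def by (elim exE conjE)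
  define \<kappa> where "\<kappa> g x = \<kappa>' (g, x)" for g x
  define lam where "lam t y = l (t, y)" for t y
  have \<kappa>eq: "\<Phi> (\<alpha> g x) = \<beta> (\<kappa> g x) (\<Phi> x)" if "g \<in> carrier G" "x \<in> topspace X" for g x
    using \<kappa>'eq that by (simp add: \<kappa>_def)
  have lameq: "\<Psi> (\<beta> t y) = \<alpha> (lam t y) (\<Psi> y)" if "t \<in> carrier H" "y \<in> topspace Y" for t y
    using leq that by (simp add: lam_def)
  have \<Phi>c: "continuous_map X Y \<Phi>" and \<Psi>c: "continuous_map Y X \<Psi>"
    and \<Psi>\<Phi>: "\<And>x. x \<in> topspace X \<Longrightarrow> \<Psi> (\<Phi> x) = x" and \<Phi>\<Psi>: "\<And>y. y \<in> topspace Y \<Longrightarrow> \<Phi> (\<Psi> y) = y"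
    using hom by (auto simp: homeomorphic_maps_def)
  have \<alpha>c: "continuous_map X X (\<alpha> g)" if "g \<in> carrier G" for g using \<alpha>(1) that by (simp add: continuous_action_def)
  have \<beta>c: "continuous_map Y Y (\<beta> t)" if "t \<in> carrier H" for t using \<beta>(1) that by (simp add: continuous_action_def)
  have \<kappa>c: "continuous_map X (discrete_topology (carrier H)) (\<kappa> g)" if g: "g \<in> carrier G" for g
  proof -
    have "continuous_map X (prod_topology (discrete_topology (carrier G)) X) (\<lambda>x. (g, x))"
      by (rule continuous_map_pairedI) (use g in simp_all)
    from continuous_map_compose[OF this \<kappa>'c] show ?thesis by (simp add: \<kappa>_def[abs_def] o_def)
  qed
  have lamc: "continuous_map Y (discrete_topology (carrier G)) (lam t)" if t: "t \<in> carrier H" for t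
  proof -
    have "continuous_map Y (prod_topology (discrete_topology (carrier H)) Y) (\<lambda>y. (t, y))"
      by (rule continuous_map_pairedI) (use t in simp_all)
    from continuous_map_compose[OF this lc] show ?thesis by (simp add: lam_def[abs_def] o_def)
  qed
  have \<alpha>in: "\<alpha> g x \<in> topspace X" if "g \<in> carrier G" "x \<in> topspace X" for g x
    using A.element_image[OF that(1,2)] by simp
  have \<beta>in: "\<beta> t y \<in> topspace Y" if "t \<in> carrier H" "y \<in> topspace Y" for t y
    using B.element_image[OF that(1,2)] by simp
  have \<Phi>in: "\<Phi> x \<in> topspace Y" if "x \<in> topspace X" for x using continuous_map_image_subset_topspace[OF \<Phi>c] that by blast
  have \<Psi>in: "\<Psi> y \<in> topspace X" if "y \<in> topspace Y" for y using continuous_map_image_subset_topspace[OF \<Psi>c] that by blast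
  have \<kappa>in: "\<kappa> g x \<in> carrier H" if "g \<in> carrier G" "x \<in> topspace X" for g x
    using continuous_map_image_subset_topspace[OF \<kappa>c[OF that(1)]] that(2) by auto
  have lamin: "lam t y \<in> carrier G" if "t \<in> carrier H" "y \<in> topspace Y" for t y
    using continuous_map_image_subset_topspace[OF lamc[OF that(1)]] that(2) by auto
  note free_H = topologically_free_eq[OF H(1) \<beta>] and free_G = topologically_free_eq[OF is_group \<alpha>]
  have lcy: "locally_constant Y (\<lambda>y. \<kappa> g (\<Psi> y))" if "g \<in> carrier G" for g
    by (rule locally_constant_compose[OF locally_constant_discrete[OF \<kappa>c[OF that]] \<Psi>c])
  have lcx: "locally_constant X (\<lambda>x. lam t (\<Phi> x))" if "t \<in> carrier H" for t
    by (rule locally_constant_compose[OF locally_constant_discrete[OF lamc[OF that]] \<Phi>c])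
  interpret coe G \<Sigma> H X Y dX dY \<alpha> \<beta> \<Phi> \<Psi> \<kappa> lam
  proof unfold_locales
    show "\<alpha> \<one> x = x" if "x \<in> topspace X" for x using A.id_eq_one that by (metis restrict_apply')
    show "\<beta> \<one>\<^bsub>H\<^esub> y = y" if "y \<in> topspace Y" for y using B.id_eq_one that by (metis restrict_apply')
    show "\<beta> (s \<otimes>\<^bsub>H\<^esub> t) y = \<beta> s (\<beta> t y)" if "s \<in> carrier H" "t \<in> carrier H" "y \<in> topspace Y" for s t y
      using B.composition_rule that by blast
    show "\<kappa> (g \<otimes> h) x = \<kappa> g (\<alpha> h x) \<otimes>\<^bsub>H\<^esub> \<kappa> h x" if gh: "g \<in> carrier G" "h \<in> carrier G" and x: "x \<in> topspace X" for g h x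
    proof -
      have "\<kappa> (g \<otimes> h) (\<Psi> (\<Phi> x)) = \<kappa> g (\<alpha> h (\<Psi> (\<Phi> x))) \<otimes>\<^bsub>H\<^esub> \<kappa> h (\<Psi> (\<Phi> x))"
      proof (rule free_H[where f = "\<lambda>y. \<kappa> (g \<otimes> h) (\<Psi> y)" and g = "\<lambda>y. \<kappa> g (\<alpha> h (\<Psi> y)) \<otimes>\<^bsub>H\<^esub> \<kappa> h (\<Psi> y)"])
        show "locally_constant Y (\<lambda>y. \<kappa> (g \<otimes> h) (\<Psi> y))" using lcy gh by simp
        have "locally_constant Y (\<lambda>y. \<kappa> g (\<alpha> h (\<Psi> y)))"
          using locally_constant_compose[OF locally_constant_discrete[OF \<kappa>c[OF gh(1)]] continuous_map_compose[OF \<Psi>c \<alpha>c[OF gh(2)]]]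
          by (simp add: o_def)
        then show "locally_constant Y (\<lambda>y. \<kappa> g (\<alpha> h (\<Psi> y)) \<otimes>\<^bsub>H\<^esub> \<kappa> h (\<Psi> y))"
          by (rule locally_constant_pair[OF _ lcy[OF gh(2)]])
        fix y assume y: "y \<in> topspace Y"
        note p = \<Psi>in[OF y]
        note hp = \<alpha>in[OF gh(2) p]
        show "\<kappa> (g \<otimes> h) (\<Psi> y) \<in> carrier H" "\<kappa> g (\<alpha> h (\<Psi> y)) \<otimes>\<^bsub>H\<^esub> \<kappa> h (\<Psi> y) \<in> carrier H"
          using \<kappa>in gh p hp by simp_all
        have "\<beta> (\<kappa> (g \<otimes> h) (\<Psi> y)) y = \<Phi> (\<alpha> (g \<otimes> h) (\<Psi> y))" using \<kappa>eq[of "g \<otimes> h" "\<Psi> y"] gh p \<Phi>\<Psi>[OF y] by simp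
        also have "\<dots> = \<beta> (\<kappa> g (\<alpha> h (\<Psi> y))) (\<beta> (\<kappa> h (\<Psi> y)) y)"
          using A.composition_rule[OF p gh] \<kappa>eq[OF gh(1) hp] \<kappa>eq[OF gh(2) p] \<Phi>\<Psi>[OF y] by simp
        also have "\<dots> = \<beta> (\<kappa> g (\<alpha> h (\<Psi> y)) \<otimes>\<^bsub>H\<^esub> \<kappa> h (\<Psi> y)) y"
          using B.composition_rule[OF y \<kappa>in[OF gh(1) hp] \<kappa>in[OF gh(2) p]] by simp
        finally show "\<beta> (\<kappa> (g \<otimes> h) (\<Psi> y)) y = \<beta> (\<kappa> g (\<alpha> h (\<Psi> y)) \<otimes>\<^bsub>H\<^esub> \<kappa> h (\<Psi> y)) y" .
      qed (rule \<Phi>in[OF x])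
      then show ?thesis using \<Psi>\<Phi>[OF x] by simp
    qed
    show "lam (s \<otimes>\<^bsub>H\<^esub> t) y = lam s (\<beta> t y) \<otimes> lam t y" if st: "s \<in> carrier H" "t \<in> carrier H" and y: "y \<in> topspace Y" for s t y
    proof -
      have "lam (s \<otimes>\<^bsub>H\<^esub> t) (\<Phi> (\<Psi> y)) = lam s (\<beta> t (\<Phi> (\<Psi> y))) \<otimes> lam t (\<Phi> (\<Psi> y))"
      proof (rule free_G[where f = "\<lambda>x. lam (s \<otimes>\<^bsub>H\<^esub> t) (\<Phi> x)" and g = "\<lambda>x. lam s (\<beta> t (\<Phi> x)) \<otimes> lam t (\<Phi> x)"])
        show "locally_constant X (\<lambda>x. lam (s \<otimes>\<^bsub>H\<^esub> t) (\<Phi> x))" using lcx st by simp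
        have "locally_constant X (\<lambda>x. lam s (\<beta> t (\<Phi> x)))"
          using locally_constant_compose[OF locally_constant_discrete[OF lamc[OF st(1)]] continuous_map_compose[OF \<Phi>c \<beta>c[OF st(2)]]]
          by (simp add: o_def)
        then show "locally_constant X (\<lambda>x. lam s (\<beta> t (\<Phi> x)) \<otimes> lam t (\<Phi> x))"
          by (rule locally_constant_pair[OF _ lcx[OF st(2)]])
        fix x assume x: "x \<in> topspace X"
        note p = \<Phi>in[OF x]
        note hp = \<beta>in[OF st(2) p]
        show "lam (s \<otimes>\<^bsub>H\<^esub> t) (\<Phi> x) \<in> carrier G" "lam s (\<beta> t (\<Phi> x)) \<otimes> lam t (\<Phi> x) \<in> carrier G"
          using lamin st p hp by simp_all
        have "\<alpha> (lam (s \<otimes>\<^bsub>H\<^esub> t) (\<Phi> x)) x = \<Psi> (\<beta> (s \<otimes>\<^bsub>H\<^esub> t) (\<Phi> x))" using lameq[of "s \<otimes>\<^bsub>H\<^esub> t" "\<Phi> x"] st p \<Psi>\<Phi>[OF x] by simp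
        also have "\<dots> = \<alpha> (lam s (\<beta> t (\<Phi> x))) (\<alpha> (lam t (\<Phi> x)) x)"
          using B.composition_rule[OF p st] lameq[OF st(1) hp] lameq[OF st(2) p] \<Psi>\<Phi>[OF x] by simp
        also have "\<dots> = \<alpha> (lam s (\<beta> t (\<Phi> x)) \<otimes> lam t (\<Phi> x)) x"
          using A.composition_rule[OF x lamin[OF st(1) hp] lamin[OF st(2) p]] by simp
        finally show "\<alpha> (lam (s \<otimes>\<^bsub>H\<^esub> t) (\<Phi> x)) x = \<alpha> (lam s (\<beta> t (\<Phi> x)) \<otimes> lam t (\<Phi> x)) x" .
      qed (rule \<Psi>in[OF y])
      then show ?thesis using \<Phi>\<Psi>[OF y] by simp
    qed
    show "\<kappa> (lam t y) (\<Psi> y) = t" if t: "t \<in> carrier H" and y: "y \<in> topspace Y" for t y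
    proof (rule free_H[where f = "\<lambda>y. \<kappa> (lam t y) (\<Psi> y)" and g = "\<lambda>y. t"])
      have "continuous_map Y (prod_topology (discrete_topology (carrier G)) X) (\<lambda>y. (lam t y, \<Psi> y))"
        by (rule continuous_map_pairedI[OF lamc[OF t] \<Psi>c])
      from continuous_map_compose[OF this \<kappa>'c]
      show "locally_constant Y (\<lambda>y. \<kappa> (lam t y) (\<Psi> y))" by (intro locally_constant_discrete) (simp add: \<kappa>_def o_def)
      show "locally_constant Y (\<lambda>y. t)" by (rule locally_constant_discrete[of _ "{t}"]) simp
      fix y assume y: "y \<in> topspace Y"
      show "\<kappa> (lam t y) (\<Psi> y) \<in> carrier H" by (rule \<kappa>in[OF lamin[OF t y] \<Psi>in[OF y]])
      show "\<beta> (\<kappa> (lam t y) (\<Psi> y)) y = \<beta> t y"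
        using \<kappa>eq[OF lamin[OF t y] \<Psi>in[OF y]] lameq[OF t y] \<Phi>\<Psi>[OF y] \<Phi>\<Psi>[OF \<beta>in[OF t y]] by simp
    qed (use t y in simp_all)
  qed (use X Y \<alpha>c \<beta>c \<Phi>c \<Psi>c \<Psi>\<Phi> \<Phi>\<Psi> \<kappa>c lamc \<kappa>eq lameq in simp_all)
  show ?thesis by (rule entropy_le_max[OF sc H(2)])
qed

text \<open>Folner sets and nets come from \<open>N\<close> as a group of its own, while
  connectivity speaks of \<open>N\<close> inside \<open>G\<close>; words, balls and net steps are
  the same in both. \<open>N\<close> is infinite because finite groups are locally finite.\<close>

lemma (in sofic_sequence) amenable_sparsely_connected:
  assumes N: "subgroup N G" "w_normal N G" and am: "amenable_group (G\<lparr>carrier := N\<rparr>)"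
    and nlf: "\<not> locally_finite_group (G\<lparr>carrier := N\<rparr>)" and nvc: "\<not> virtually_cyclic_group (G\<lparr>carrier := N\<rparr>)"
    and \<Upsilon>: "\<And>g. 0 \<le> \<Upsilon> g"
  shows "\<exists>S. finite S \<and> S \<subseteq> carrier G \<and> sparsely_connected \<Upsilon> S (carrier G)"
proof -
  let ?K = "G\<lparr>carrier := N\<rparr>"
  have K: "group ?K" by (rule subgroup.subgroup_is_group[OF N(1) is_group])
  have wprod: "group.wprod ?K = wprod"
    unfolding fun_eq_iff group.wprod_def[OF K] wprod_def by simp
  have ball: "group.word_ball ?K = word_ball"
    unfolding fun_eq_iff group.word_ball_def[OF K] word_ball_def wprod by simp
  have net_rel: "group.net_rel ?K = net_rel"
    unfolding fun_eq_iff group.net_rel_def[OF K] net_rel_def ball by simp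
  obtain Q where Q: "finite Q" "Q \<subseteq> carrier ?K" "m_inv ?K ` Q \<subseteq> Q" "group.sparse_net ?K Q"
    by (rule group.ex_sparse_net[OF K nlf nvc])
  have "infinite N"
  proof
    assume fin: "finite N"
    have "locally_finite_group ?K"
      unfolding locally_finite_group_def
    proof (intro allI impI)
      fix F assume "finite F \<and> F \<subseteq> carrier ?K"
      then have "generate ?K F \<subseteq> N" using group.generate_incl[OF K, of F] by simp
      then show "finite (generate ?K F)" using fin by (rule finite_subset)
    qed
    then show False using nlf by simp
  qed
  moreover have "\<exists>S. finite S \<and> S \<subseteq> N \<and> sparsely_connected \<Upsilon> S N"
  proof (rule folner_sparsely_connected[OF N(1) Q(1)])
    show "Q \<subseteq> N" using Q(2) by simp
    show "\<exists>F. finite F \<and> F \<noteq> {} \<and> F \<subseteq> N \<and> (\<forall>t\<in>T. real (card ((\<lambda>x. t \<otimes> x) ` F - F)) \<le> \<epsilon> * real (card F))"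
      if T: "finite T" "T \<subseteq> N" "0 < \<epsilon>" for T and \<epsilon> :: real
    proof -
      have "T \<subseteq> carrier ?K" using T(2) by simp
      show ?thesis
      proof (rule group.amenable_folner[OF K am T(1) \<open>T \<subseteq> carrier ?K\<close> T(3)])
        fix F assume "finite F" "F \<noteq> {}" "F \<subseteq> carrier ?K"
          "\<And>t. t \<in> T \<Longrightarrow> real (card ((\<lambda>x. t \<otimes>\<^bsub>?K\<^esub> x) ` F - F)) \<le> \<epsilon> * real (card F)"
        then show ?thesis by (intro exI[of _ F]) simp
      qed
    qed
    show "\<exists>S l Y D. finite S \<and> S \<subseteq> N \<and> Y \<subseteq> N \<and> finite D \<and> D \<subseteq> N \<and>
     K * (real l + 1) \<le> real (card D) \<and> inj_on (\<lambda>(d, y). d \<otimes> y) (D \<times> Y) \<and>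
     (\<forall>x\<in>N. \<exists>s\<in>S. \<exists>y\<in>Y. x = s \<otimes> y) \<and>
     (\<forall>M :: nat. \<exists>r. \<forall>y\<in>Y. M \<le> card {y'. (y, y') \<in> net_rel Q l Y ^^ r})" for K :: real
      using spec[OF Q(4)[unfolded group.sparse_net_def[OF K] net_rel], of K] by simp
  qed (rule \<Upsilon>)
  ultimately obtain S where S: "finite S" "S \<subseteq> N" "sparsely_connected \<Upsilon> S N" "infinite N" by blast
  have "sparsely_connected \<Upsilon> S (carrier G)" by (rule sparsely_connected_w_normal[OF N(2) S(4,1,2,3) \<Upsilon>])
  then show ?thesis using S(1,2) subgroup.subset[OF N(1)] by blast
qed

text \<open>The factor that is not locally finite carries the rows along which points are connected;
  the other, being infinite, supplies the sparse nets of rows.\<close>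

lemma (in sofic_sequence) product_ex_sparsely_connected:
  assumes A: "group A" and B: "group B" and iso: "G \<cong> A \<times>\<times> B"
    and nlf: "\<not> locally_finite_group A" and inf: "infinite (carrier B)"
  shows "\<exists>\<Sigma>'. sofic_approximation_sequence G \<Sigma>' \<and> (\<forall>\<Upsilon>. (\<forall>g. 0 \<le> \<Upsilon> g) \<longrightarrow>
    (\<exists>S. finite S \<and> S \<subseteq> carrier G \<and> sofic_sequence.sparsely_connected G \<Sigma>' \<Upsilon> S (carrier G)))"
proof -
  obtain h where h: "h \<in> iso G (A \<times>\<times> B)" using iso unfolding is_iso_def ex_in_conv[symmetric] by (elim exE)
  interpret A: group A by (rule A)
  interpret B: group B by (rule B)
  interpret AB: group "A \<times>\<times> B" by (rule DirProd_group[OF A B])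
  define j where "j = inv_into (carrier G) h"
  have jiso: "j \<in> iso (A \<times>\<times> B) G" unfolding j_def by (rule iso_set_sym[OF h])
  have hbij: "bij_betw h (carrier G) (carrier A \<times> carrier B)" using h by (simp add: iso_def)
  have hj: "h (j p) = p" and jc: "j p \<in> carrier G" if "p \<in> carrier A \<times> carrier B" for p
    using bij_betw_inv_into_right[OF hbij that] bij_betw_inv_into[OF hbij, THEN bij_betwE] that by (auto simp: j_def)
  have jh: "j (h g) = g" and hc: "h g \<in> carrier A \<times> carrier B" if "g \<in> carrier G" for g
    using bij_betw_inv_into_left[OF hbij that] bij_betwE[OF hbij] that by (auto simp: j_def)
  have hm: "h (x \<otimes> y) = h x \<otimes>\<^bsub>A \<times>\<times> B\<^esub> h y" if "x \<in> carrier G" "y \<in> carrier G" for x y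
    using h that by (simp add: iso_def hom_def)
  interpret j: group_hom "A \<times>\<times> B" G j using jiso by unfold_locales (simp add: iso_def)
  have jm: "j (p \<otimes>\<^bsub>A \<times>\<times> B\<^esub> q) = j p \<otimes> j q" if "p \<in> carrier A \<times> carrier B" "q \<in> carrier A \<times> carrier B" for p q
    by (rule j.hom_mult) (use that in simp_all)
  have j1: "j (\<one>\<^bsub>A\<^esub>, \<one>\<^bsub>B\<^esub>) = \<one>" using j.hom_one by simp
  \<comment> \<open>The isomorphism turns the external product into commuting projections of
    \<open>G\<close> itself.\<close>
  define pa pb where "pa g = j (fst (h g), \<one>\<^bsub>B\<^esub>)" and "pb g = j (\<one>\<^bsub>A\<^esub>, snd (h g))" for g
  have f: "fst (h g) \<in> carrier A" "snd (h g) \<in> carrier B" if "g \<in> carrier G" for g using hc[OF that] by auto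
  have hpa: "h (pa g) = (fst (h g), \<one>\<^bsub>B\<^esub>)" and hpb: "h (pb g) = (\<one>\<^bsub>A\<^esub>, snd (h g))" if "g \<in> carrier G" for g
    using f[OF that] by (simp_all add: pa_def pb_def hj)
  interpret sofic_direct_product G \<Sigma> pa pb
  proof unfold_locales
    fix g assume g: "g \<in> carrier G"
    show c: "pa g \<in> carrier G" "pb g \<in> carrier G" using f[OF g] by (simp_all add: pa_def pb_def jc)
    show "pa (pa g) = pa g" "pb (pa g) = \<one>" 
      unfolding pa_def[of "pa g"] pb_def[of "pa g"] hpa[OF g] by (simp_all add: j1 pa_def)
    show "pb (pb g) = pb g" "pa (pb g) = \<one>" 
      unfolding pa_def[of "pb g"] pb_def[of "pb g"] hpb[OF g] by (simp_all add: j1 pb_def)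
    fix h' assume h': "h' \<in> carrier G"
    have e: "h (g \<otimes> h') = (fst (h g) \<otimes>\<^bsub>A\<^esub> fst (h h'), snd (h g) \<otimes>\<^bsub>B\<^esub> snd (h h'))"
      using hm[OF g h'] by (simp add: DirProd_def case_prod_unfold)
    show "pa (g \<otimes> h') = pa g \<otimes> pa h'" "pb (g \<otimes> h') = pb g \<otimes> pb h'"
      using f[OF g] f[OF h'] jm[of "(fst (h g), \<one>\<^bsub>B\<^esub>)" "(fst (h h'), \<one>\<^bsub>B\<^esub>)"]
        jm[of "(\<one>\<^bsub>A\<^esub>, snd (h g))" "(\<one>\<^bsub>A\<^esub>, snd (h h'))"]
      by (simp_all add: pa_def pb_def e)
    assume pe: "pa g = pa h'" "pb g = pb h'"
    have "fst (h g) = fst (h h')" using arg_cong[OF pe(1), of h] unfolding hpa[OF g] hpa[OF h'] by (rule Pair_inject)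
    moreover have "snd (h g) = snd (h h')" using arg_cong[OF pe(2), of h] unfolding hpb[OF g] hpb[OF h'] by (rule Pair_inject)
    ultimately have "j (h g) = j (h h')" by (metis prod_eqI)
    then show "g = h'" unfolding jh[OF g] jh[OF h'] .
  qed
  obtain F where F: "finite F" "F \<subseteq> carrier A" "infinite (generate A F)" using nlf unfolding locally_finite_group_def by blast
  define i where "i a = j (a, \<one>\<^bsub>B\<^esub>)" for a
  have ic: "i a \<in> carrier G" if "a \<in> carrier A" for a using that by (simp add: i_def jc)
  have im: "i (a \<otimes>\<^bsub>A\<^esub> b) = i a \<otimes> i b" if "a \<in> carrier A" "b \<in> carrier A" for a b
    using jm[of "(a, \<one>\<^bsub>B\<^esub>)" "(b, \<one>\<^bsub>B\<^esub>)"] that by (simp add: i_def)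
  have ii: "i (inv\<^bsub>A\<^esub> a) = inv (i a)" if "a \<in> carrier A" for a
    using j.hom_inv[of "(a, \<one>\<^bsub>B\<^esub>)"] that inv_DirProd[OF A B, of a "\<one>\<^bsub>B\<^esub>"] by (simp add: i_def)
  define Q where "Q = i ` (F \<union> m_inv A ` F)"
  have Q: "finite Q" using F(1) by (simp add: Q_def)
  have FA: "F \<union> m_inv A ` F \<subseteq> carrier A" using F(2) by auto
  have Qpa: "Q \<subseteq> pa ` carrier G"
  proof (unfold Q_def, rule image_subsetI)
    fix a assume "a \<in> F \<union> m_inv A ` F"
    then have a: "a \<in> carrier A" using FA by blast
    have "i a = pa (i a)" using a by (simp add: pa_def i_def hj)
    then show "i a \<in> pa ` carrier G" using ic[OF a] by (rule image_eqI)
  qed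
  have Qinv: "m_inv G ` Q \<subseteq> Q"
  proof (rule image_subsetI)
    fix q assume "q \<in> Q"
    then obtain a where a: "a \<in> F \<union> m_inv A ` F" "q = i a" unfolding Q_def by blast
    have "inv\<^bsub>A\<^esub> a \<in> F \<union> m_inv A ` F" using a(1) F(2) by (auto simp: subset_iff)
    then show "inv q \<in> Q" unfolding a(2) Q_def using ii[of a] a(1) FA by (metis image_eqI subsetD)
  qed
  have gen: "i a \<in> generate G Q" if "a \<in> generate A F" for a
    using that
  proof induction
    case one
    then show ?case using j1 by (simp add: i_def generate.one)
  next
    case (incl a)
    then show ?case by (intro generate.incl) (simp add: Q_def)
  next
    case (inv a)
    then show ?case by (intro generate.incl) (simp add: Q_def)
  next
    case (eng a b)
    then show ?case using im A.generate_in_carrier[OF F(2)] by (simp add: generate.eng)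
  qed
  have iinj: "inj_on i (carrier A)"
  proof (rule inj_onI)
    fix a b assume ab: "a \<in> carrier A" "b \<in> carrier A" "i a = i b"
    have hi: "h (i c) = (c, \<one>\<^bsub>B\<^esub>)" if "c \<in> carrier A" for c using that by (simp add: i_def hj)
    show "a = b" using arg_cong[OF ab(3), of h] unfolding hi[OF ab(1)] hi[OF ab(2)] by (rule Pair_inject)
  qed
  have Qgen: "infinite (generate G Q)"
  proof
    assume "finite (generate G Q)"
    then have "finite (i ` generate A F)" by (rule finite_subset[rotated]) (use gen in blast)
    moreover have "inj_on i (generate A F)" by (rule inj_on_subset[OF iinj A.generate_incl[OF F(2)]])
    ultimately show False using F(3) finite_imageD by blast
  qed
  have infB: "infinite (pb ` carrier G)"
  proof
    let ?i = "\<lambda>b. j (\<one>\<^bsub>A\<^esub>, b)"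
    assume fin: "finite (pb ` carrier G)"
    have "?i ` carrier B \<subseteq> pb ` carrier G"
    proof (rule image_subsetI)
      fix b assume b: "b \<in> carrier B"
      have "?i b = pb (?i b)" using b by (simp add: pb_def hj)
      then show "?i b \<in> pb ` carrier G" using b by (intro image_eqI[of _ pb "?i b"]) (simp_all add: jc)
    qed
    then have "finite (?i ` carrier B)" using fin by (rule finite_subset)
    moreover have "inj_on ?i (carrier B)"
    proof (rule inj_onI)
      fix a b assume ab: "a \<in> carrier B" "b \<in> carrier B" "?i a = ?i b"
      have hi: "h (?i c) = (\<one>\<^bsub>A\<^esub>, c)" if "c \<in> carrier B" for c using that by (simp add: hj)
      show "a = b" using arg_cong[OF ab(3), of h] unfolding hi[OF ab(1)] hi[OF ab(2)] by (rule Pair_inject)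
    qed
    ultimately show False using inf finite_imageD by blast
  qed
  show ?thesis
  proof (intro exI[of _ prod_seq] conjI allI impI)
    show "sofic_approximation_sequence G prod_seq" by (rule sofic_prod_seq)
    fix \<Upsilon> :: "'a \<Rightarrow> real" assume "\<forall>g. 0 \<le> \<Upsilon> g"
    then show "\<exists>S. finite S \<and> S \<subseteq> carrier G \<and> sofic_sequence.sparsely_connected G prod_seq \<Upsilon> S (carrier G)"
      by (intro product_sparsely_connected[OF Q Qpa Qinv Qgen infB]) blast
  qed
qed

lemma sofic_sequenceI:
  "group G \<Longrightarrow> countable (carrier G) \<Longrightarrow> sofic_approximation_sequence G \<Sigma> \<Longrightarrow> sofic_sequence G \<Sigma>"
  by (simp add: sofic_sequence_def sofic_sequence_axioms_def)

theorem theorem3: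
  fixes G :: "('a, 'm) monoid_scheme" and H :: "('b, 'n) monoid_scheme"
    and X :: "'x topology" and Y :: "'y topology"
    and dX :: "'x \<Rightarrow> 'x \<Rightarrow> real" and dY :: "'y \<Rightarrow> 'y \<Rightarrow> real"
    and \<alpha> :: "'a \<Rightarrow> 'x \<Rightarrow> 'x" and \<beta> :: "'b \<Rightarrow> 'y \<Rightarrow> 'y"
  assumes "group G" and "countable (carrier G)" and "sofic_group G"
    and "group H" and "countable (carrier H)" and "sofic_group H"
    and "compact_space X" and "compatible_metric X dX"
    and "compact_space Y" and "compatible_metric Y dY"
    and "continuous_action G X \<alpha>" and "topologically_free G X \<alpha>"
    and "continuous_action H Y \<beta>" and "topologically_free H Y \<beta>"
    and "continuously_orbit_equivalent G X \<alpha> H Y \<beta>"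
  shows "((\<exists>N. subgroup N G \<and> w_normal N G \<and> amenable_group (G\<lparr>carrier := N\<rparr>) \<and>
             \<not> locally_finite_group (G\<lparr>carrier := N\<rparr>) \<and>
             \<not> virtually_cyclic_group (G\<lparr>carrier := N\<rparr>)) \<longrightarrow>
            max_sofic_entropy H Y dY \<beta> \<ge> max_sofic_entropy G X dX \<alpha>) \<and>
         ((\<exists>(A :: 'c monoid) (B :: 'd monoid). group A \<and> group B \<and>
             countable (carrier A) \<and> infinite (carrier A) \<and>
             countable (carrier B) \<and> infinite (carrier B) \<and>
             (\<not> locally_finite_group A \<or> \<not> locally_finite_group B) \<and>
             G \<cong> A \<times>\<times> B) \<longrightarrow>
            max_sofic_entropy H Y dY \<beta> \<ge> inf_sofic_entropy G X dX \<alpha>)"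
proof (intro conjI impI, goal_cases)
  case 1
  then obtain N where N: "subgroup N G" "w_normal N G" "amenable_group (G\<lparr>carrier := N\<rparr>)"
      "\<not> locally_finite_group (G\<lparr>carrier := N\<rparr>)" "\<not> virtually_cyclic_group (G\<lparr>carrier := N\<rparr>)"
    by (elim exE conjE)
  show "max_sofic_entropy G X dX \<alpha> \<le> max_sofic_entropy H Y dY \<beta>"
    unfolding max_sofic_entropy_def[of G]
  proof (rule SUP_least)
    fix \<Sigma> assume "\<Sigma> \<in> {\<Sigma>. sofic_approximation_sequence G \<Sigma>}"
    then have \<Sigma>: "sofic_approximation_sequence G \<Sigma>" by simp
    show "sofic_entropy G X dX \<alpha> \<Sigma> \<le> max_sofic_entropy H Y dY \<beta>"
      by (rule coe_entropy_le[OF sofic_sequenceI[OF assms(1,2) \<Sigma>] assms(4,5,7-15)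
        sofic_sequence.amenable_sparsely_connected[OF sofic_sequenceI[OF assms(1,2) \<Sigma>] N]])
  qed
next
  case 2
  then show ?case
  proof (elim exE conjE)
    fix A :: "'c monoid" and B :: "'d monoid"
    assume A: "group A" "infinite (carrier A)" and B: "group B" "infinite (carrier B)"
      and nlf: "\<not> locally_finite_group A \<or> \<not> locally_finite_group B" and iso: "G \<cong> A \<times>\<times> B"
    obtain \<Sigma> where \<Sigma>: "sofic_approximation_sequence G \<Sigma>" using assms(3) unfolding sofic_group_def by (elim exE)
    interpret sofic_sequence G \<Sigma> by (rule sofic_sequenceI[OF assms(1,2) \<Sigma>])
    \<comment> \<open>If it is the second factor that is not locally finite, the factors are
      exchanged.\<close>
    note exA = product_ex_sparsely_connected[OF A(1) B(1) iso _ B(2)]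
      and exB = product_ex_sparsely_connected[OF B(1) A(1) iso_trans[OF iso DirProd_commute_iso] _ A(2)]
    have "\<exists>\<Sigma>'. sofic_approximation_sequence G \<Sigma>' \<and> (\<forall>\<Upsilon>. (\<forall>g. 0 \<le> \<Upsilon> g) \<longrightarrow>
      (\<exists>S. finite S \<and> S \<subseteq> carrier G \<and> sofic_sequence.sparsely_connected G \<Sigma>' \<Upsilon> S (carrier G)))"
      by (rule disjE[OF nlf exA exB])
    then obtain \<Sigma>' where \<Sigma>': "sofic_approximation_sequence G \<Sigma>'" "\<forall>\<Upsilon>. (\<forall>g. 0 \<le> \<Upsilon> g) \<longrightarrow>
      (\<exists>S. finite S \<and> S \<subseteq> carrier G \<and> sofic_sequence.sparsely_connected G \<Sigma>' \<Upsilon> S (carrier G))" by (elim exE conjE)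
    have "inf_sofic_entropy G X dX \<alpha> \<le> sofic_entropy G X dX \<alpha> \<Sigma>'"
      unfolding inf_sofic_entropy_def by (rule INF_lower) (use \<Sigma>'(1) in simp)
    also have "\<dots> \<le> max_sofic_entropy H Y dY \<beta>"
      by (rule coe_entropy_le[OF sofic_sequenceI[OF assms(1,2) \<Sigma>'(1)] assms(4,5,7-15)]) (rule \<Sigma>'(2)[rule_format])
    finally show "inf_sofic_entropy G X dX \<alpha> \<le> max_sofic_entropy H Y dY \<beta>" .
  qed
qed

end
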